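(* Let $S=Z(f)$ be an irreducible semi-stable $(2,2)$-type surface of $\mathbb{P}^1\times\mathbb{P}^2$. Then $S$ is stable if and only if $S$ satisfies both of the following properties: (i) Either $p_2:S\to\mathbb{P}^2$ is a finite map, or there exist some sections $\sigma:\mathbb{P}^1\to S$ of $p_1$ which are contracted by $p_2$ (to a point $P_2\in\mathbb{P}^2$ depending on $\sigma$) and, for all such sections $\sigma$, $\mathrm{Im}(\sigma)$ contains at most $A_1$-type singular points of $S$ and the map $\phi_\sigma:\mathbb{P}^1\to\mathbb{P}(T_{\mathbb{P}^2,P_2})$ is non-constant. (ii) If $P=P_1\times P_2$ is a singular point of $S$ which is not of $A_1$-type, then the fibre of $p_1$ over $P_1$ is reduced.
   Context: Work over $\mathbb{C}$. A $(2,2)$-type surface is an effective divisor $S=Z(f)$ of $\mathbb{P}^1\times\mathbb{P}^2$, where $0\neq f\in V=\mathbb{C}[x_0,x_1]_2\otimes\mathbb{C}[y_0,y_1,y_2]_2$; it is irreducible if $f$ is irreducible. $p_1:S\to\mathbb{P}^1$, $p_2:S\to\mathbb{P}^2$ are the restrictions of the projections; the fibres of $p_1$ are regarded as conics in $\mathbb{P}^2$. $S_{\text{sing}}$ is the singular locus of $S$. Stability: $G=\mathrm{SL}(2,\mathbb{C})\times\mathrm{SL}(3,\mathbb{C})$ acts linearly on $V$. $S=Z(f)$ is semi-stable if $0\notin\overline{G\cdot f}$, and stable (properly stable) if $G\cdot f$ is closed in $V$ and the stabilizer of $f$ is finite. Equivalently (Hilbert–Mumford), $S$ is not semi-stable (resp.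 not stable) iff for some non-trivial one-parameter subgroup $\lambda$ of $G$ one has $\lim_{t\to0}\lambda(t)\cdot f=0$ (resp. $\lim_{t\to0}\lambda(t)\cdot f$ exists). A point $P\in S$ is an $A_n$-type singularity if $\widehat{\mathcal{O}}_{S,P}\cong\mathbb{C}[[x,y,z]]/(x^2+y^2+z^{n+1})$. The map $\phi_\sigma$: $p_2$ is not finite at $P=P_1\times P_2\in S$ exactly when $\mathbb{P}^1\times P_2\subset S$; then $\sigma:\mathbb{P}^1\to\mathbb{P}^1\times P_2\subset S$ is a section of $p_1$ contracted by $p_2$ to $P_2$, and every conic $p_2(p_1^{-1}(Q))$, $Q\in\mathbb{P}^1$, passes through $P_2$. If $\sigma(\mathbb{P}^1)\not\subseteq S_{\text{sing}}$, the generic such conic is smooth at $P_2$, and $\phi_\sigma:\mathbb{P}^1\to\mathbb{P}(T_{\mathbb{P}^2,P_2})\simeq\mathbb{P}^1$ is the morphism extending the map which sends a general $Q$ to the tangent line at $P_2$ of the conic $p_2(p_1^{-1}(Q))$. *)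

theory Defs
  imports
    "HOL-Analysis.Analysis"
    "HOL-Algebra.QuotRing"
    "HOL-Computational_Algebra.Formal_Power_Series"
    "HOL-Library.Poly_Mapping"
begin

section \<open>Polynomials\<close>

type_synonym 'v cpoly = "('v \<Rightarrow>\<^sub>0 nat) \<Rightarrow>\<^sub>0 complex"

definition Const :: "complex \<Rightarrow> 'v cpoly" where
  "Const c = Poly_Mapping.single 0 c"

definition Var :: "'v \<Rightarrow> 'v cpoly" where
  "Var v = Poly_Mapping.single (Poly_Mapping.single v 1) 1"

text \<open>\<open>subst_poly c e f\<close> is the image of \<open>f\<close> under the homomorphism that is \<open>c\<close> on
  constants and sends each variable \<open>v\<close> to \<open>e v\<close>.\<close>

definition subst_poly ::
  "(complex \<Rightarrow> 'r::comm_ring_1) \<Rightarrow> ('v::finite \<Rightarrow> 'r) \<Rightarrow> 'v cpoly \<Rightarrow> 'r" where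
  "subst_poly c e f =
     (\<Sum>m\<in>Poly_Mapping.keys f.
        c (Poly_Mapping.lookup f m) * (\<Prod>v\<in>UNIV. e v ^ Poly_Mapping.lookup m v))"

definition eval :: "'v::finite cpoly \<Rightarrow> complex ^ 'v \<Rightarrow> complex" where
  "eval f a = subst_poly (\<lambda>c. c) (($) a) f"

definition homogeneous :: "nat \<Rightarrow> 'v::finite cpoly \<Rightarrow> bool" where
  "homogeneous d f \<longleftrightarrow>
     (\<forall>m\<in>Poly_Mapping.keys f. (\<Sum>v\<in>UNIV. Poly_Mapping.lookup m v) = d)"

text \<open>The variables \<open>Inl i\<close> are the coordinates \<open>x\<close> on the projective line, the
  variables \<open>Inr j\<close> the coordinates \<open>y\<close> on the projective plane.\<close>

type_synonym xy_poly = "(2 + 3) cpoly"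

text \<open>The space $V$, including 0.\<close>

definition forms22 :: "xy_poly set" where
  "forms22 = {f. \<forall>m\<in>Poly_Mapping.keys f.
     (\<Sum>i\<in>UNIV. Poly_Mapping.lookup m (Inl i)) = 2 \<and>
     (\<Sum>j\<in>UNIV. Poly_Mapping.lookup m (Inr j)) = 2}"

definition eval2 :: "xy_poly \<Rightarrow> complex ^ 2 \<Rightarrow> complex ^ 3 \<Rightarrow> complex" where
  "eval2 f a b = subst_poly (\<lambda>c. c) (case_sum (($) a) (($) b)) f"


section \<open>Stability\<close>

definition SL23 :: "((complex ^ 2 ^ 2) \<times> (complex ^ 3 ^ 3)) set" where
  "SL23 = {g. det (fst g) = 1 \<and> det (snd g) = 1}"

text \<open>The left action $(g \cdot f)(x,y) = f(g_1^{-1}x,\, g_2^{-1}y)$.\<close>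

definition act :: "(complex ^ 2 ^ 2) \<times> (complex ^ 3 ^ 3) \<Rightarrow> xy_poly \<Rightarrow> xy_poly" where
  "act g f = subst_poly Const
     (case_sum (\<lambda>i. \<Sum>k\<in>UNIV. Const (matrix_inv (fst g) $ i $ k) * Var (Inl k))
               (\<lambda>j. \<Sum>k\<in>UNIV. Const (matrix_inv (snd g) $ j $ k) * Var (Inr k))) f"

definition orbit :: "xy_poly \<Rightarrow> xy_poly set" where
  "orbit f = (\<lambda>g. act g f) ` SL23"

text \<open>The space $V$ carries the Euclidean topology, i.e. that of coefficientwise convergence: a
  polynomial is identified with its coefficient function, and $V$ becomes a closed
  finite-dimensional linear subspace of the space of all functions from monomials to the
  complex numbers with the product topology.  (Orbit closures are the same in the Zariski
  topology.)\<close>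

definition git_semistable :: "xy_poly \<Rightarrow> bool" where
  "git_semistable f \<longleftrightarrow> Poly_Mapping.lookup 0 \<notin> closure (Poly_Mapping.lookup ` orbit f)"

definition git_stable :: "xy_poly \<Rightarrow> bool" where
  "git_stable f \<longleftrightarrow> closed (Poly_Mapping.lookup ` orbit f) \<and> finite {g \<in> SL23. act g f = f}"


section \<open>The surface and its projections\<close>

text \<open>Points of a projective space are the one-dimensional linear subspaces.\<close>

definition proj_space :: "(complex ^ 'n) set set" where
  "proj_space = {vec.span {v} | v. v \<noteq> 0}"

definition surface :: "xy_poly \<Rightarrow> ((complex ^ 2) set \<times> (complex ^ 3) set) set" where
  "surface f = {P \<in> proj_space \<times> proj_space. \<forall>a\<in>fst P. \<forall>b\<in>snd P. eval2 f a b = 0}"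

text \<open>As \<open>p\<^sub>2\<close> is projective, it is finite iff all its fibres are finite sets.\<close>

definition p2_finite :: "xy_poly \<Rightarrow> bool" where
  "p2_finite f \<longleftrightarrow> (\<forall>M\<in>proj_space. finite {P \<in> surface f. snd P = M})"

text \<open>\<open>contracted_section f \<sigma> M\<close>: the map \<open>\<sigma>\<close> is a section of \<open>p\<^sub>1\<close> contracted by \<open>p\<^sub>2\<close> to
  the point \<open>M\<close>.  Such a map is \<open>Q \<mapsto> (Q, M)\<close>, hence automatically a morphism.\<close>

definition contracted_section ::
  "xy_poly \<Rightarrow> ((complex ^ 2) set \<Rightarrow> (complex ^ 2) set \<times> (complex ^ 3) set)
    \<Rightarrow> (complex ^ 3) set \<Rightarrow> bool" where
  "contracted_section f \<sigma> M \<longleftrightarrow>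
     (\<forall>Q\<in>proj_space. \<sigma> Q \<in> surface f \<and> fst (\<sigma> Q) = Q \<and> snd (\<sigma> Q) = M)"

text \<open>The equation $f(a,y)$ of the fibre of \<open>p\<^sub>1\<close> over the point spanned by \<open>a\<close>.\<close>

definition fibre_form :: "xy_poly \<Rightarrow> complex ^ 2 \<Rightarrow> 3 cpoly" where
  "fibre_form f a = subst_poly Const (case_sum (\<lambda>i. Const (a $ i)) Var) f"

text \<open>The plane scheme $q = 0$ is reduced iff $\mathbb{C}[y]/(q)$ has no nilpotent elements
  (a principal ideal of $\mathbb{C}[y_0,y_1,y_2]$ is saturated).\<close>

definition p1_fibre_reduced :: "xy_poly \<Rightarrow> (complex ^ 2) set \<Rightarrow> bool" where
  "p1_fibre_reduced f L \<longleftrightarrow>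
     (\<forall>a\<in>L - {0}. \<forall>h n. fibre_form f a dvd h ^ n \<longrightarrow> fibre_form f a dvd h)"


section \<open>Singularities\<close>

text \<open>The ring $\mathbb{C}[[u,v,w]]$, realised as $\mathbb{C}[[u]][[v]][[w]]$.\<close>

type_synonym cfps3 = "complex fps fps fps"

definition const3 :: "complex \<Rightarrow> cfps3" where
  "const3 c = fps_const (fps_const (fps_const c))"

definition fps_u :: cfps3 where "fps_u = fps_const (fps_const fps_X)"
definition fps_v :: cfps3 where "fps_v = fps_const fps_X"
definition fps_w :: cfps3 where "fps_w = fps_X"

text \<open>The coefficient of $u^i v^j w^k$.\<close>

definition coeff3 :: "cfps3 \<Rightarrow> nat \<Rightarrow> nat \<Rightarrow> nat \<Rightarrow> complex" where
  "coeff3 g i j k = fps_nth (fps_nth (fps_nth g k) j) i"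

text \<open>\<open>g\<close> is the equation of \<open>f = 0\<close> in a standard affine chart $x_i = 1$, $y_j = 1$ around
  \<open>P\<close>, expanded in the affine coordinates \<open>u, v, w\<close> translated so that \<open>P\<close> becomes the origin.
  Indices are computed modulo 2 and 3, so that \<open>i + 1\<close>, resp. \<open>j + 1\<close> and \<open>j + 2\<close>, are the
  indices other than \<open>i\<close>, resp. \<open>j\<close>.\<close>

definition local_equation ::
  "xy_poly \<Rightarrow> (complex ^ 2) set \<times> (complex ^ 3) set \<Rightarrow> cfps3 \<Rightarrow> bool" where
  "local_equation f P g \<longleftrightarrow>
     (\<exists>i j. \<exists>a\<in>fst P. \<exists>b\<in>snd P. a $ i = 1 \<and> b $ j = 1 \<and>
        g = subst_poly const3
              (case_sum (\<lambda>k. const3 (a $ k) + (if k = i + 1 then fps_u else 0))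
                        (\<lambda>k. const3 (b $ k) + (if k = j + 1 then fps_v
                                                else if k = j + 2 then fps_w else 0))) f)"

text \<open>Jacobian criterion: the three first-order partial derivatives of a local equation vanish.\<close>

definition sing_locus :: "xy_poly \<Rightarrow> ((complex ^ 2) set \<times> (complex ^ 3) set) set" where
  "sing_locus f = {P \<in> surface f. \<exists>g. local_equation f P g \<and>
     coeff3 g 1 0 0 = 0 \<and> coeff3 g 0 1 0 = 0 \<and> coeff3 g 0 0 1 = 0}"

definition cfps3_ring :: "cfps3 ring" where
  "cfps3_ring = \<lparr>carrier = UNIV, mult = (*), one = 1, zero = 0, add = (+)\<rparr>"

definition hypersurface_ring :: "cfps3 \<Rightarrow> cfps3 set ring" where
  "hypersurface_ring g = cfps3_ring Quot (PIdl\<^bsub>cfps3_ring\<^esub> g)"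

text \<open>Isomorphism of $\mathbb{C}$-algebras.\<close>

definition hypersurface_iso :: "cfps3 \<Rightarrow> cfps3 \<Rightarrow> bool" where
  "hypersurface_iso g g' \<longleftrightarrow>
     (\<exists>h \<in> ring_iso (hypersurface_ring g) (hypersurface_ring g').
        \<forall>c. h (PIdl\<^bsub>cfps3_ring\<^esub> g +>\<^bsub>cfps3_ring\<^esub> const3 c)
              = PIdl\<^bsub>cfps3_ring\<^esub> g' +>\<^bsub>cfps3_ring\<^esub> const3 c)"

text \<open>The completed local ring of the surface at \<open>P\<close> is $\mathbb{C}[[u,v,w]]/(g)$ for a local
  equation \<open>g\<close> at \<open>P\<close>; its isomorphism class does not depend on the chart.\<close>

definition A_type :: "nat \<Rightarrow> xy_poly \<Rightarrow> (complex ^ 2) set \<times> (complex ^ 3) set \<Rightarrow> bool" where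
  "A_type n f P \<longleftrightarrow> P \<in> surface f \<and>
     (\<exists>g. local_equation f P g \<and> hypersurface_iso g (fps_u ^ 2 + fps_v ^ 2 + fps_w ^ (n + 1)))"


section \<open>The tangent direction map along a contracted section\<close>

text \<open>Derivative at \<open>b\<close> of the form \<open>q\<close> in the direction \<open>y\<close>.\<close>

definition dir_deriv :: "3 cpoly \<Rightarrow> complex ^ 3 \<Rightarrow> complex ^ 3 \<Rightarrow> complex" where
  "dir_deriv q b y = deriv (\<lambda>t. eval q (b + t *s y)) 0"

definition smooth_at :: "3 cpoly \<Rightarrow> complex ^ 3 \<Rightarrow> bool" where
  "smooth_at q b \<longleftrightarrow> eval q b = 0 \<and> (\<exists>y. dir_deriv q b y \<noteq> 0)"

definition tangent_line :: "3 cpoly \<Rightarrow> complex ^ 3 \<Rightarrow> (complex ^ 3) set" where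
  "tangent_line q b = {y. dir_deriv q b y = 0}"

text \<open>The tangent space of the projective plane at the line \<open>M\<close> is
  $\mathrm{Hom}(M, \mathbb{C}^3/M)$, so points of its projectivisation are the planes of
  $\mathbb{C}^3$ containing \<open>M\<close>, i.e. the projective lines through the point \<open>M\<close>.
  A morphism from the projective line to it is given by forms of a common degree
  whose values, taken modulo \<open>M\<close>, have no common zero.\<close>

definition pencil_morphism ::
  "(complex ^ 3) set \<Rightarrow> ((complex ^ 2) set \<Rightarrow> (complex ^ 3) set) \<Rightarrow> bool" where
  "pencil_morphism M \<phi> \<longleftrightarrow>
     (\<exists>d. \<exists>v :: 3 \<Rightarrow> 2 cpoly. (\<forall>k. homogeneous d (v k)) \<and>
        (\<forall>a. a \<noteq> 0 \<longrightarrow> (\<chi> k. eval (v k) a) \<notin> M \<and>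
               \<phi> (vec.span {a}) = vec.span (insert (\<chi> k. eval (v k) a) M)))"

text \<open>\<open>\<phi>\<close> is the map \<open>\<phi>\<^sub>\<sigma>\<close> for the section \<open>\<sigma>\<close> contracted to \<open>M\<close>; it is determined by this
  on \<open>proj_space\<close>, and none exists if the image of \<open>\<sigma>\<close> lies in the singular locus.  A general
  point of the projective line is one outside a finite set.\<close>

definition is_phi ::
  "xy_poly \<Rightarrow> (complex ^ 3) set \<Rightarrow> ((complex ^ 2) set \<Rightarrow> (complex ^ 3) set) \<Rightarrow> bool" where
  "is_phi f M \<phi> \<longleftrightarrow> pencil_morphism M \<phi> \<and>
     finite {Q \<in> proj_space. \<not> (\<forall>a\<in>Q - {0}. \<forall>b\<in>M - {0}.
        smooth_at (fibre_form f a) b \<and> \<phi> Q = tangent_line (fibre_form f a) b)}"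

end

theory Submission
  imports Defs "HOL-Computational_Algebra.Fundamental_Theorem_Algebra"
begin

text \<open>Write $f(x,y) = T(x,x,y,y)$ with a symmetric tensor $T$.  The orbit map is controlled by
  Gaussian elimination with complete pivoting, which writes a group element as a diagonal matrix
  between two bounded factors: if no real one-parameter subgroup is destabilising, then the orbit
  map is proper, so the orbit is closed and the stabiliser compact.  An infinite compact stabiliser
  contains power-bounded, hence diagonalisable, elements close to the identity, whose logarithms
  are again destabilising weights.  Conversely, the limit along a destabilising subgroup has an
  infinite stabiliser, and it lies in the orbit if that is closed.

  By completing squares in the power series ring, a singular point is of type $A_1$ iff its Hessian
  is nondegenerate.  With sorted weights $(\rho,-\rho)$ and $(s_0,s_1,s_2)$ in a basis adapted to
  the subgroup, the vanishing coefficients of $f$ then force one of three configurations: a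
  contracted section whose tangent direction is constant or nowhere defined, a contracted section
  through a worse than $A_1$ singularity, or such a point on a non-reduced fibre.  Each of these
  is in turn destabilised by explicit weights.\<close>

section \<open>Polynomials as functions\<close>

text \<open>The weights are real rather than integral because they arise as limits of normalised
  logarithms, which need not be rational; only powers \<open>exp (n * r)\<close> with natural
  \<open>n\<close> are ever applied. With the symmetric tensor, changes of coordinates, tangent
  lines and Hessians are all values of one multilinear form, so each geometric condition becomes the
  vanishing of a few numbers T(a,a',b,b') in an adapted basis. The definition of type A_1 admits
  arbitrary algebra isomorphisms, not only coordinate changes; ruling them out at a degenerate point
  therefore takes an argument inside the quotient rings. Irreducibility acts through one fact: no
  conic f(a,y) vanishes identically. The explicit weights (rho; s0,s1,s2) are chosen so that the
  monomials of positive weight are exactly those known to vanish: (0; 1,0,-1) if the tangent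
  direction is constant or undefined, (1; 2,-1,-1) or (1; 2,0,-2) at a bad point of a contracted
  section, (1; 1,0,-1) at a bad point on a double line.\<close>

locale coeff_hom =
  fixes c :: "complex \<Rightarrow> 'r::comm_ring_1"
  assumes hom_1: "c 1 = 1"
    and hom_add: "c (x + y) = c x + c y"
    and hom_mult: "c (x * y) = c x * c y"
begin

lemma hom_0: "c 0 = 0"
  using hom_add[of 0 0] by simp

lemma hom_minus: "c (- x) = - c x"
  using hom_add[of x "- x"] by (simp add: eq_neg_iff_add_eq_0 add.commute hom_0)

lemma hom_diff: "c (x - y) = c x - c y"
  using hom_add[of x "- y"] by (simp add: hom_minus)

lemmas hom_simps = hom_0 hom_1 hom_add hom_mult hom_minus hom_diff

lemma hom_sum: "c (sum h A) = (\<Sum>i\<in>A. c (h i))"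
  by (induction A rule: infinite_finite_induct) (auto simp: hom_simps)

end

lemma poly_mapping_sum_single:
  "p = (\<Sum>m\<in>Poly_Mapping.keys p. Poly_Mapping.single m (Poly_Mapping.lookup p m))"
  by (rule poly_mapping_eqI) (auto simp: lookup_sum lookup_single when_def in_keys_iff)

section \<open>Substitution as a ring homomorphism\<close>

context coeff_hom
begin

lemma subst_zero [simp]: "subst_poly c e 0 = 0"
  by (simp add: subst_poly_def)

lemma subst_add [simp]: "subst_poly c e (p + q) = subst_poly c e p + subst_poly c e q"
  unfolding subst_poly_def
  by (rule setsum_keys_plus_distrib[where f = "\<lambda>m a. c a * (\<Prod>v\<in>UNIV. e v ^ Poly_Mapping.lookup m v)"])
    (auto simp: algebra_simps hom_simps)

lemma subst_sum: "subst_poly c e (sum h A) = (\<Sum>i\<in>A. subst_poly c e (h i))"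
  by (induction A rule: infinite_finite_induct) auto

lemma subst_single:
  "subst_poly c e (Poly_Mapping.single m a) = c a * (\<Prod>v\<in>UNIV. e v ^ Poly_Mapping.lookup m v)"
  by (cases "a = 0") (auto simp: subst_poly_def hom_0)

lemma subst_mult [simp]: "subst_poly c e (p * q) = subst_poly c e p * subst_poly c e q"
proof -
  have *: "subst_poly c e (Poly_Mapping.single m a * Poly_Mapping.single n b) =
      subst_poly c e (Poly_Mapping.single m a) * subst_poly c e (Poly_Mapping.single n b)" for m n a b
    by (simp add: mult_single subst_single lookup_add power_add prod.distrib algebra_simps hom_mult)
  have "subst_poly c e (p * q) = subst_poly c e
      ((\<Sum>m\<in>Poly_Mapping.keys p. Poly_Mapping.single m (Poly_Mapping.lookup p m)) *
       (\<Sum>m\<in>Poly_Mapping.keys q. Poly_Mapping.single m (Poly_Mapping.lookup q m)))"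
    by (simp flip: poly_mapping_sum_single)
  also have "\<dots> = subst_poly c e
      (\<Sum>m\<in>Poly_Mapping.keys p. Poly_Mapping.single m (Poly_Mapping.lookup p m)) *
     subst_poly c e (\<Sum>m\<in>Poly_Mapping.keys q. Poly_Mapping.single m (Poly_Mapping.lookup q m))"
    by (simp add: sum_product subst_sum *)
  finally show ?thesis
    by (simp flip: poly_mapping_sum_single)
qed

lemma subst_Const [simp]: "subst_poly c e (Const a) = c a"
  by (simp add: Const_def subst_single)

lemma subst_one [simp]: "subst_poly c e 1 = 1"
  using subst_Const[of e 1] by (simp add: Const_def hom_1)

lemma subst_Var [simp]: "subst_poly c e (Var v) = e v"
proof -
  have "(\<Prod>w\<in>UNIV. e w ^ Poly_Mapping.lookup (Poly_Mapping.single v (1::nat)) w) = (\<Prod>w\<in>UNIV. if w = v then e v else 1)"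
    by (intro prod.cong) (auto simp: lookup_single when_def)
  then show ?thesis by (simp add: Var_def subst_single hom_1)
qed

lemma subst_power [simp]: "subst_poly c e (p ^ n) = subst_poly c e p ^ n"
  by (induction n) auto

lemma subst_prod: "subst_poly c e (prod h A) = (\<Prod>i\<in>A. subst_poly c e (h i))"
  by (induction A rule: infinite_finite_induct) auto

lemma subst_minus [simp]: "subst_poly c e (- p) = - subst_poly c e p"
  using subst_add[of e p "- p"] by (simp add: eq_neg_iff_add_eq_0 add.commute del: subst_add)

lemma subst_diff [simp]: "subst_poly c e (p - q) = subst_poly c e p - subst_poly c e q"
  using subst_add[of e p "- q"] by (simp del: subst_add)

end

lemma Const_hom: "coeff_hom Const"
  by standard (auto simp: Const_def single_add mult_single)

lemma id_hom: "coeff_hom (\<lambda>x. x)"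
  by standard auto

interpretation Const: coeff_hom Const by (rule Const_hom)
interpretation id: coeff_hom "\<lambda>x. x" by (rule id_hom)

lemma (in coeff_hom) subst_subst:
  "subst_poly c e (subst_poly Const d p) = subst_poly c (\<lambda>v. subst_poly c e (d v)) p"
  by (simp add: subst_poly_def[of Const] subst_sum subst_prod) (simp add: subst_poly_def)

text \<open>Independence of characters: monomials are multiplicative in \<open>x\<close>. Rescaling
  a coordinate in which \<open>m\<close> and \<open>m0\<close> have different exponents and
  subtracting a multiple of the relation removes \<open>m0\<close>, and the induction hypothesis
  applies to the rest.\<close>

lemma monomial_functions_independent:
  fixes a :: "('v::finite \<Rightarrow>\<^sub>0 nat) \<Rightarrow> complex"
  assumes "finite K" and "\<And>x. (\<Sum>m\<in>K. a m * (\<Prod>v\<in>UNIV. x v ^ Poly_Mapping.lookup m v)) = 0"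
  shows "\<forall>m\<in>K. a m = 0"
  using assms
proof (induction K arbitrary: a rule: finite_induct)
  case (insert m0 K)
  define mf where "mf m x = (\<Prod>v\<in>UNIV. x v ^ Poly_Mapping.lookup m v)" for m :: "'v \<Rightarrow>\<^sub>0 nat" and x :: "'v \<Rightarrow> complex"
  have mf_mult: "mf m (\<lambda>v. x v * y v) = mf m x * mf m y" for m x y
    by (simp add: mf_def power_mult_distrib prod.distrib)
  have rel: "a m0 * mf m0 x + (\<Sum>m\<in>K. a m * mf m x) = 0" for x
  proof -
    have "(\<Sum>m\<in>insert m0 K. a m * mf m x) = 0"
      unfolding mf_def by (rule insert.prems)
    then show ?thesis
      by (simp add: sum.insert[OF insert.hyps(1,2)])
  qed
  have rel': "(\<Sum>m\<in>K. a m * mf m x) = - a m0 * mf m0 x" for x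
    using rel[of x] by (metis add.inverse_inverse add_eq_0_iff minus_mult_left)
  have zero: "a m = 0" if "m \<in> K" for m
  proof -
    have "m \<noteq> m0" using that insert.hyps by auto
    then obtain w where w: "Poly_Mapping.lookup m w \<noteq> Poly_Mapping.lookup m0 w"
      by (auto simp: poly_mapping_eq_iff fun_eq_iff)
    \<comment> \<open>The factor 2 separates exponents, since the powers of 2 are distinct.\<close>
    define y :: "'v \<Rightarrow> complex" where "y = (\<lambda>v. if v = w then 2 else 1)"
    have mfy: "mf n y = 2 ^ Poly_Mapping.lookup n w" for n
    proof -
      have "mf n y = (\<Prod>v\<in>UNIV. if v = w then 2 ^ Poly_Mapping.lookup n w else 1)"
        unfolding mf_def y_def by (intro prod.cong) auto
      then show ?thesis by simp
    qed
    have "(\<Sum>n\<in>K. (a n * (mf n y - mf m0 y)) * mf n x) = 0" for x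
    proof -
      have "(\<Sum>n\<in>K. (a n * (mf n y - mf m0 y)) * mf n x)
        = (\<Sum>n\<in>K. a n * mf n (\<lambda>v. x v * y v)) - mf m0 y * (\<Sum>n\<in>K. a n * mf n x)"
        unfolding mf_mult sum_distrib_left sum_subtractf[symmetric]
        by (intro sum.cong refl) (simp add: algebra_simps)
      also have "\<dots> = - a m0 * mf m0 (\<lambda>v. x v * y v) + mf m0 y * (a m0 * mf m0 x)"
        using rel'[of x] rel'[of "\<lambda>v. x v * y v"] by simp
      also have "\<dots> = 0" by (simp add: mf_mult)
      finally show ?thesis .
    qed
    then have "\<forall>n\<in>K. a n * (mf n y - mf m0 y) = 0"
      using insert.IH[of "\<lambda>n. a n * (mf n y - mf m0 y)"] unfolding mf_def by blast
    then have "a m * (mf m y - mf m0 y) = 0" using that by blast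
    moreover have "mf m y \<noteq> mf m0 y"
    proof
      assume "mf m y = mf m0 y"
      then have "(of_nat (2 ^ Poly_Mapping.lookup m w) :: complex) = of_nat (2 ^ Poly_Mapping.lookup m0 w)"
        by (simp add: mfy)
      then have "(2::nat) ^ Poly_Mapping.lookup m w = 2 ^ Poly_Mapping.lookup m0 w"
        unfolding of_nat_eq_iff .
      then show False using w by simp
    qed
    ultimately show ?thesis by simp
  qed
  moreover have "a m0 = 0"
    using rel[of "\<lambda>_. 1"] zero by (simp add: mf_def)
  ultimately show ?case by auto
qed auto

text \<open>The difference has only zero values, so its coefficients vanish. This is what allows
  later polynomial identities to be checked on values.\<close>

lemma subst_poly_inject:
  fixes p q :: "'v::finite cpoly"
  assumes "\<And>x. subst_poly (\<lambda>c. c) x p = subst_poly (\<lambda>c. c) x q"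
  shows "p = q"
proof -
  have "subst_poly (\<lambda>c. c) x (p - q) = 0" for x
    using assms by simp
  then have "\<forall>m\<in>Poly_Mapping.keys (p - q). Poly_Mapping.lookup (p - q) m = 0"
    using monomial_functions_independent[of "Poly_Mapping.keys (p - q)" "Poly_Mapping.lookup (p - q)"]
    by (simp add: subst_poly_def)
  then have "Poly_Mapping.lookup (p - q) m = 0" for m
    by (meson in_keys_iff)
  then show ?thesis
    by (intro poly_mapping_eqI) (simp add: lookup_minus)
qed

lemma eval_inject:
  assumes "\<And>x. eval p x = eval q x"
  shows "p = q"
proof (rule subst_poly_inject)
  fix x
  show "subst_poly (\<lambda>c. c) x p = subst_poly (\<lambda>c. c) x q"
    using assms[of "vec_lambda x"] by (simp add: eval_def vec_lambda_inverse)
qed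

lemma eval2_inject:
  assumes "\<And>x y. eval2 p x y = eval2 q x y"
  shows "p = q"
proof (rule subst_poly_inject)
  fix x :: "2 + 3 \<Rightarrow> complex"
  have "x = case_sum (($) (\<chi> i. x (Inl i))) (($) (\<chi> j. x (Inr j)))"
    by (auto split: sum.split)
  then show "subst_poly (\<lambda>c. c) x p = subst_poly (\<lambda>c. c) x q"
    using assms[of "\<chi> i. x (Inl i)" "\<chi> j. x (Inr j)"] by (metis eval2_def)
qed

section \<open>Evaluation rules\<close>

lemma eval_simps [simp]:
  "eval (p + q) x = eval p x + eval q x" "eval (p * q) x = eval p x * eval q x"
  "eval (p - q) x = eval p x - eval q x" "eval (p ^ n) x = eval p x ^ n"
  "eval (Const a) x = a" "eval (Var v) x = x $ v" "eval 0 x = 0" "eval 1 x = 1"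
  by (simp_all add: eval_def)

lemma eval_sum: "eval (sum h A) x = (\<Sum>i\<in>A. eval (h i) x)"
  by (simp add: eval_def id.subst_sum)

lemma eval2_simps [simp]:
  "eval2 (p + q) x y = eval2 p x y + eval2 q x y" "eval2 (p * q) x y = eval2 p x y * eval2 q x y"
  "eval2 (Const a) x y = a" "eval2 (Var (Inl i)) x y = x $ i" "eval2 (Var (Inr j)) x y = y $ j"
  "eval2 0 x y = 0" "eval2 1 x y = 1"
  by (simp_all add: eval2_def)

lemma eval2_sum: "eval2 (sum h A) x y = (\<Sum>i\<in>A. eval2 (h i) x y)"
  by (simp add: eval2_def id.subst_sum)

lemma eval2_act:
  "eval2 (act g f) x y = eval2 f (matrix_inv (fst g) *v x) (matrix_inv (snd g) *v y)"
proof -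
  have *: "(\<lambda>v. subst_poly (\<lambda>c. c) (case_sum (($) x) (($) y))
      (case v of Inl i \<Rightarrow> \<Sum>k\<in>UNIV. Const (matrix_inv (fst g) $ i $ k) * Var (Inl k)
       | Inr j \<Rightarrow> \<Sum>k\<in>UNIV. Const (matrix_inv (snd g) $ j $ k) * Var (Inr k)))
    = case_sum (($) (matrix_inv (fst g) *v x)) (($) (matrix_inv (snd g) *v y))"
    by (auto simp: fun_eq_iff id.subst_sum matrix_vector_mult_def split: sum.split)
  show ?thesis
    by (simp add: eval2_def act_def id.subst_subst *)
qed

lemma eval_fibre_form: "eval (fibre_form f a) y = eval2 f a y"
proof -
  have "(\<lambda>v. subst_poly (\<lambda>c. c) (($) y) (case v of Inl i \<Rightarrow> Const (a $ i) | Inr j \<Rightarrow> Var j))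
    = case_sum (($) a) (($) y)"
    by (auto simp: fun_eq_iff split: sum.split)
  then show ?thesis
    by (simp add: eval_def eval2_def fibre_form_def id.subst_subst)
qed


section \<open>Symmetric tensors\<close>

type_synonym tensor = "complex ^ 3 ^ 3 ^ 2 ^ 2"

text \<open>The coefficient map and the arguments are generic on purpose: with \<open>Const\<close>
  and variables this is the polynomial, with the identity a multilinear form on vectors, with
  \<open>const3\<close> and power series the local expansion.\<close>

definition gform :: "(complex \<Rightarrow> 'r::comm_ring_1) \<Rightarrow> tensor \<Rightarrow> (2 \<Rightarrow> 'r) \<Rightarrow> (2 \<Rightarrow> 'r) \<Rightarrow> (3 \<Rightarrow> 'r) \<Rightarrow> (3 \<Rightarrow> 'r) \<Rightarrow> 'r"
  where "gform c T x x' y y' =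
    (\<Sum>i\<in>UNIV. \<Sum>i'\<in>UNIV. \<Sum>j\<in>UNIV. \<Sum>j'\<in>UNIV. c (T $ i $ i' $ j $ j') * x i * x' i' * y j * y' j')"

abbreviation mform :: "tensor \<Rightarrow> complex ^ 2 \<Rightarrow> complex ^ 2 \<Rightarrow> complex ^ 3 \<Rightarrow> complex ^ 3 \<Rightarrow> complex"
  where "mform T x x' y y' \<equiv> gform (\<lambda>c. c) T (($) x) (($) x') (($) y) (($) y')"

definition sym_tensor :: "tensor \<Rightarrow> bool" where
  "sym_tensor T \<longleftrightarrow> (\<forall>i i' j j'. T $ i $ i' $ j $ j' = T $ i' $ i $ j $ j' \<and> T $ i $ i' $ j $ j' = T $ i $ i' $ j' $ j)"

definition poly_of :: "tensor \<Rightarrow> xy_poly" where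
  "poly_of T = gform Const T (Var \<circ> Inl) (Var \<circ> Inl) (Var \<circ> Inr) (Var \<circ> Inr)"

definition mon :: "2 \<Rightarrow> 2 \<Rightarrow> 3 \<Rightarrow> 3 \<Rightarrow> (2 + 3) \<Rightarrow>\<^sub>0 nat" where
  "mon i i' j j' = Poly_Mapping.single (Inl i) 1 + Poly_Mapping.single (Inl i') 1
     + Poly_Mapping.single (Inr j) 1 + Poly_Mapping.single (Inr j') 1"

definition mons :: "((2 + 3) \<Rightarrow>\<^sub>0 nat) set" where
  "mons = {m. (\<Sum>i\<in>UNIV. Poly_Mapping.lookup m (Inl i)) = 2 \<and> (\<Sum>j\<in>UNIV. Poly_Mapping.lookup m (Inr j)) = 2}"

lemma forms22_iff: "f \<in> forms22 \<longleftrightarrow> Poly_Mapping.keys f \<subseteq> mons"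
  by (auto simp: forms22_def mons_def)

lemma gform_add:
  "gform c T (\<lambda>i. x i + z i) x' y y' = gform c T x x' y y' + gform c T z x' y y'"
  "gform c T x (\<lambda>i. x' i + z i) y y' = gform c T x x' y y' + gform c T x z y y'"
  "gform c T x x' (\<lambda>i. y i + z' i) y' = gform c T x x' y y' + gform c T x x' z' y'"
  "gform c T x x' y (\<lambda>i. y' i + z' i) = gform c T x x' y y' + gform c T x x' y z'"
  by (simp_all add: gform_def algebra_simps sum.distrib)

lemma gform_scale:
  "gform c T (\<lambda>i. r * x i) x' y y' = r * gform c T x x' y y'"
  "gform c T x (\<lambda>i. r * x' i) y y' = r * gform c T x x' y y'"
  "gform c T x x' (\<lambda>i. r * y i) y' = r * gform c T x x' y y'"
  "gform c T x x' y (\<lambda>i. r * y' i) = r * gform c T x x' y y'"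
  by (simp_all add: gform_def algebra_simps sum_distrib_left)

lemma gform_zero [simp]:
  "gform c T (\<lambda>i. 0) x' y y' = 0" "gform c T x (\<lambda>i. 0) y y' = 0"
  "gform c T x x' (\<lambda>i. 0) y' = 0" "gform c T x x' y (\<lambda>i. 0) = 0"
  by (simp_all add: gform_def)

lemma (in coeff_hom) gform_hom:
  "gform c T (\<lambda>i. c (x i)) (\<lambda>i. c (x' i)) (\<lambda>j. c (y j)) (\<lambda>j. c (y' j)) = c (gform (\<lambda>c. c) T x x' y y')"
  by (simp add: gform_def hom_sum hom_mult)

lemma gform_commute:
  assumes "sym_tensor T"
  shows "gform c T x x' y y' = gform c T x' x y y'" "gform c T x x' y y' = gform c T x x' y' y"
proof -
  show "gform c T x x' y y' = gform c T x' x y y'"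
    unfolding gform_def
    apply (rule trans[OF sum.swap])
    apply (intro sum.cong refl)
    using assms by (simp add: sym_tensor_def algebra_simps)
  have "(\<Sum>j\<in>UNIV. \<Sum>j'\<in>UNIV. c (T $ i $ i' $ j $ j') * x i * x' i' * y j * y' j')
     = (\<Sum>j\<in>UNIV. \<Sum>j'\<in>UNIV. c (T $ i $ i' $ j $ j') * x i * x' i' * y' j * y j')" for i i'
    apply (rule trans[OF sum.swap])
    apply (intro sum.cong refl)
    using assms by (simp add: sym_tensor_def algebra_simps)
  then show "gform c T x x' y y' = gform c T x x' y' y"
    by (simp add: gform_def)
qed

lemma nth_add: "($) (x + y) = (\<lambda>i. x $ i + y $ i)"
  by auto

lemma nth_scale: "($) (r *s x) = (\<lambda>i. r * x $ i)"
  by auto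

lemma mform_add:
  "mform T (x + z) x' y y' = mform T x x' y y' + mform T z x' y y'"
  "mform T x (x' + z) y y' = mform T x x' y y' + mform T x z y y'"
  "mform T x x' (y + w) y' = mform T x x' y y' + mform T x x' w y'"
  "mform T x x' y (y' + w) = mform T x x' y y' + mform T x x' y w"
  unfolding nth_add by (rule gform_add)+

lemma mform_scale:
  "mform T (r *s x) x' y y' = r * mform T x x' y y'"
  "mform T x (r *s x') y y' = r * mform T x x' y y'"
  "mform T x x' (r *s y) y' = r * mform T x x' y y'"
  "mform T x x' y (r *s y') = r * mform T x x' y y'"
  unfolding nth_scale by (rule gform_scale)+

lemma mform_0 [simp]:
  "mform T 0 x' y y' = 0" "mform T x 0 y y' = 0" "mform T x x' 0 y' = 0" "mform T x x' y 0 = 0"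
  by (simp_all add: gform_def)

lemma mform_sum:
  "mform T (sum h A) x' y y' = (\<Sum>k\<in>A. mform T (h k) x' y y')"
  "mform T x (sum h A) y y' = (\<Sum>k\<in>A. mform T x (h k) y y')"
  "mform T x x' (sum g B) y' = (\<Sum>k\<in>B. mform T x x' (g k) y')"
  "mform T x x' y (sum g B) = (\<Sum>k\<in>B. mform T x x' y (g k))"
proof -
  note [simp del] = sum_component vector_add_component
  show "mform T (sum h A) x' y y' = (\<Sum>k\<in>A. mform T (h k) x' y y')"
    by (induction A rule: infinite_finite_induct) (simp_all add: mform_add)
  show "mform T x (sum h A) y y' = (\<Sum>k\<in>A. mform T x (h k) y y')"
    by (induction A rule: infinite_finite_induct) (simp_all add: mform_add)
  show "mform T x x' (sum g B) y' = (\<Sum>k\<in>B. mform T x x' (g k) y')"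
    by (induction B rule: infinite_finite_induct) (simp_all add: mform_add)
  show "mform T x x' y (sum g B) = (\<Sum>k\<in>B. mform T x x' y (g k))"
    by (induction B rule: infinite_finite_induct) (simp_all add: mform_add)
qed

lemma mform_axis: "mform T (axis i 1) (axis i' 1) (axis j 1) (axis j' 1) = T $ i $ i' $ j $ j'"
proof -
  have "mform T (axis i 1) (axis i' 1) (axis j 1) (axis j' 1) =
    (\<Sum>k\<in>UNIV. \<Sum>k'\<in>UNIV. \<Sum>l\<in>UNIV. \<Sum>l'\<in>UNIV. if l' = j' then (if l = j then (if k' = i' then (if k = i then T $ k $ k' $ l $ l' else 0) else 0) else 0) else 0)"
    unfolding gform_def by (intro sum.cong refl) (auto simp: axis_def)
  then show ?thesis by simp
qed

lemma eval2_poly_of: "eval2 (poly_of T) x y = mform T x x y y"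
  by (simp add: poly_of_def gform_def eval2_sum)

lemma (in coeff_hom) subst_poly_of:
  "subst_poly c e (poly_of T) = gform c T (e \<circ> Inl) (e \<circ> Inl) (e \<circ> Inr) (e \<circ> Inr)"
  by (simp add: poly_of_def gform_def subst_sum)

section \<open>Monomials of bidegree (2,2)\<close>

lemma poly_of_eq_sum_single:
  "poly_of T = (\<Sum>i\<in>UNIV. \<Sum>i'\<in>UNIV. \<Sum>j\<in>UNIV. \<Sum>j'\<in>UNIV. Poly_Mapping.single (mon i i' j j') (T $ i $ i' $ j $ j'))"
  by (simp add: poly_of_def gform_def mon_def Const_def Var_def mult_single)

lemma lookup_poly_of:
  "Poly_Mapping.lookup (poly_of T) m = (\<Sum>i\<in>UNIV. \<Sum>i'\<in>UNIV. \<Sum>j\<in>UNIV. \<Sum>j'\<in>UNIV. if mon i i' j j' = m then T $ i $ i' $ j $ j' else 0)"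
  by (simp add: poly_of_eq_sum_single lookup_sum lookup_single when_def)

lemma mon_in_mons: "mon i i' j j' \<in> mons"
  by (simp add: mons_def mon_def lookup_add lookup_single when_def sum.distrib)

text \<open>Lowering a positive value by one, twice, exhausts the total; the two indices may
  coincide.\<close>

lemma sum_eq_2_split:
  fixes n :: "'a::finite \<Rightarrow> nat"
  assumes "sum n UNIV = 2"
  shows "\<exists>i i'. \<forall>k. n k = (if k = i then 1 else 0) + (if k = i' then 1 else 0)"
proof -
  have ex: "\<exists>i. m i > 0" if "sum m UNIV \<noteq> 0" for m :: "'a \<Rightarrow> nat"
    using that by (metis gr0I sum.neutral)
  have dec: "sum (m(i := m i - 1)) UNIV = sum m UNIV - 1" if "m i > 0" for m :: "'a \<Rightarrow> nat" and i
    using that by (simp add: sum.remove[of UNIV i])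
  obtain i where i: "n i > 0" using ex[of n] assms by auto
  define n' where "n' = n(i := n i - 1)"
  have s': "sum n' UNIV = 1" using dec[of n i] i assms by (simp add: n'_def)
  then obtain i' where i': "n' i' > 0" using ex[of n'] by auto
  have "sum (n'(i' := n' i' - 1)) UNIV = 0" using dec[of n' i'] i' s' by simp
  then have "(n'(i' := n' i' - 1)) k = 0" for k by simp
  then have "n k = (if k = i then 1 else 0) + (if k = i' then 1 else 0)" for k
    using i i' by (force simp: n'_def split: if_splits)
  then show ?thesis by blast
qed

lemma mons_eq_mon: "m \<in> mons \<Longrightarrow> \<exists>i i' j j'. m = mon i i' j j'"
proof -
  assume "m \<in> mons"
  then obtain i i' j j' where
    "\<And>k. Poly_Mapping.lookup m (Inl k) = (if k = i then 1 else 0) + (if k = i' then 1 else 0)"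
    "\<And>k. Poly_Mapping.lookup m (Inr k) = (if k = j then 1 else 0) + (if k = j' then 1 else 0)"
    unfolding mons_def
    using sum_eq_2_split[of "\<lambda>i. Poly_Mapping.lookup m (Inl i)"] sum_eq_2_split[of "\<lambda>i. Poly_Mapping.lookup m (Inr i)"]
    by blast
  then have "Poly_Mapping.lookup m v = Poly_Mapping.lookup (mon i i' j j') v" for v
    by (cases v) (simp_all add: mon_def lookup_add lookup_single when_def)
  then show ?thesis using poly_mapping_eqI by blast
qed

lemma finite_mons: "finite mons"
proof (rule finite_subset)
  show "mons \<subseteq> (\<lambda>(i, i', j, j'). mon i i' j j') ` UNIV"
  proof
    fix m assume "m \<in> mons"
    then obtain i i' j j' where "m = mon i i' j j'" using mons_eq_mon by blast
    then show "m \<in> (\<lambda>(i, i', j, j'). mon i i' j j') ` UNIV"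
      by (intro image_eqI[of _ _ "(i, i', j, j')"]) auto
  qed
qed simp

lemma poly_of_in_forms22: "poly_of T \<in> forms22"
  unfolding forms22_iff
proof
  fix m assume "m \<in> Poly_Mapping.keys (poly_of T)"
  then have "Poly_Mapping.lookup (poly_of T) m \<noteq> 0" by (simp add: in_keys_iff)
  then have "\<exists>i i' j j'. mon i i' j j' = m"
    unfolding lookup_poly_of by (rule contrapos_np) simp
  then show "m \<in> mons" using mon_in_mons by blast
qed

text \<open>Polarisation in both groups of variables, with a factor 4 for each. It takes a function
  instead of a tensor, so that it can also be fed with coefficient sums that need not come from a
  form.\<close>

definition tens :: "(complex ^ 2 \<Rightarrow> complex ^ 3 \<Rightarrow> complex) \<Rightarrow> tensor" where
  "tens F = (\<chi> i i' j j'.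
     (F (axis i 1 + axis i' 1) (axis j 1 + axis j' 1) - F (axis i 1 + axis i' 1) (axis j 1 - axis j' 1)
      - F (axis i 1 - axis i' 1) (axis j 1 + axis j' 1) + F (axis i 1 - axis i' 1) (axis j 1 - axis j' 1)) / 16)"

lemma mform_diff:
  "mform T (x - z) x' y y' = mform T x x' y y' - mform T z x' y y'"
  "mform T x (x' - z) y y' = mform T x x' y y' - mform T x z y y'"
  "mform T x x' (y - w) y' = mform T x x' y y' - mform T x x' w y'"
  "mform T x x' y (y' - w) = mform T x x' y y' - mform T x x' y w"
proof -
  note [simp del] = vector_add_component vector_minus_component
  show "mform T (x - z) x' y y' = mform T x x' y y' - mform T z x' y y'"
    by (simp add: eq_diff_eq flip: mform_add(1))
  show "mform T x (x' - z) y y' = mform T x x' y y' - mform T x z y y'"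
    by (simp add: eq_diff_eq flip: mform_add(2))
  show "mform T x x' (y - w) y' = mform T x x' y y' - mform T x x' w y'"
    by (simp add: eq_diff_eq flip: mform_add(3))
  show "mform T x x' y (y' - w) = mform T x x' y y' - mform T x x' y w"
    by (simp add: eq_diff_eq flip: mform_add(4))
qed

lemma mform_polarization:
  assumes "sym_tensor T"
  shows "16 * mform T x x' y y' = mform T (x + x') (x + x') (y + y') (y + y') - mform T (x + x') (x + x') (y - y') (y - y')
    - mform T (x - x') (x - x') (y + y') (y + y') + mform T (x - x') (x - x') (y - y') (y - y')"
  by (simp add: mform_add mform_diff gform_commute(1)[OF assms, of _ "($) x'" "($) x"]
      gform_commute(2)[OF assms, of _ _ _ "($) y'" "($) y"])

lemma tens_mform:
  assumes "sym_tensor T"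
  shows "tens (\<lambda>x y. mform T x x y y) = T"
proof -
  have "tens (\<lambda>x y. mform T x x y y) $ i $ i' $ j $ j' = T $ i $ i' $ j $ j'" for i i' j j'
    using mform_polarization[OF assms, of "axis i 1" "axis i' 1" "axis j 1" "axis j' 1"]
    by (simp add: tens_def mform_axis mult.commute)
  then show ?thesis by (simp add: vec_eq_iff)
qed

lemma poly_of_inject:
  assumes "sym_tensor T" "sym_tensor T'" "poly_of T = poly_of T'"
  shows "T = T'"
proof -
  have "T = tens (eval2 (poly_of T))"
    unfolding eval2_poly_of[abs_def] by (rule tens_mform[OF assms(1), symmetric])
  also have "\<dots> = tens (eval2 (poly_of T'))"
    by (simp only: assms(3))
  also have "\<dots> = T'"
    unfolding eval2_poly_of[abs_def] by (rule tens_mform[OF assms(2)])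
  finally show ?thesis .
qed

lemma poly_of_add: "poly_of (T + T') = poly_of T + poly_of T'"
  by (simp add: poly_of_def gform_def algebra_simps sum.distrib Const.hom_add)

text \<open>It suffices to treat a single monomial, because symmetric tensors are closed under
  addition.\<close>

lemma forms22_eq_poly_of:
  assumes "f \<in> forms22"
  shows "\<exists>T. sym_tensor T \<and> f = poly_of T"
proof -
  have single: "\<exists>T. sym_tensor T \<and> Poly_Mapping.single (mon i i' j j') a = poly_of T" for i i' j j' a
  proof -
    \<comment> \<open>\<open>D\<close> has at most one nonzero entry. Averaging it over the two
      transpositions gives a symmetric tensor with the same values T(x,x,y,y).\<close>
    define D :: tensor where "D = (\<chi> k k' l l'. (if k = i \<and> k' = i' then 1 else 0) * (if l = j \<and> l' = j' then a else 0))"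
    define T :: tensor where "T = (\<chi> k k' l l'. (D $ k $ k' $ l $ l' + D $ k' $ k $ l $ l' + D $ k $ k' $ l' $ l + D $ k' $ k $ l' $ l) / 4)"
    have "sym_tensor T" by (simp add: sym_tensor_def T_def algebra_simps)
    moreover have D: "mform D x x' y y' = a * x $ i * x' $ i' * y $ j * y' $ j'" for x x' y y'
    proof -
      have "mform D x x' y y' = (\<Sum>k\<in>UNIV. \<Sum>k'\<in>UNIV. \<Sum>l\<in>UNIV. \<Sum>l'\<in>UNIV. if l' = j' then (if l = j then (if k' = i' then (if k = i then a * x $ k * x' $ k' * y $ l * y' $ l' else 0) else 0) else 0) else 0)"
        unfolding gform_def D_def by (intro sum.cong refl) auto
      then show ?thesis by simp
    qed
    have four: "4 * mform T x x' y y' = mform D x x' y y' + mform D x' x y y' + mform D x x' y' y + mform D x' x y' y" for x x' y y'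
    proof -
      have 1: "mform D x' x y y' = (\<Sum>k\<in>UNIV. \<Sum>k'\<in>UNIV. \<Sum>l\<in>UNIV. \<Sum>l'\<in>UNIV. D $ k' $ k $ l $ l' * x $ k * x' $ k' * y $ l * y' $ l')" for x x' y y'
        unfolding gform_def by (rule trans[OF sum.swap], simp add: algebra_simps)
      have 2: "mform D x x' y' y = (\<Sum>k\<in>UNIV. \<Sum>k'\<in>UNIV. \<Sum>l\<in>UNIV. \<Sum>l'\<in>UNIV. D $ k $ k' $ l' $ l * x $ k * x' $ k' * y $ l * y' $ l')" for x x' y y'
        unfolding gform_def by (rule sum.cong[OF refl], rule sum.cong[OF refl], rule trans[OF sum.swap]) (simp add: algebra_simps)
      have 3: "mform D x' x y' y = (\<Sum>k\<in>UNIV. \<Sum>k'\<in>UNIV. \<Sum>l\<in>UNIV. \<Sum>l'\<in>UNIV. D $ k' $ k $ l' $ l * x $ k * x' $ k' * y $ l * y' $ l')"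
        unfolding 1[of x' x y' y] by (rule sum.cong[OF refl], rule sum.cong[OF refl], rule trans[OF sum.swap]) (simp add: algebra_simps)
      have 4: "mform D x x' y y' = (\<Sum>k\<in>UNIV. \<Sum>k'\<in>UNIV. \<Sum>l\<in>UNIV. \<Sum>l'\<in>UNIV. D $ k $ k' $ l $ l' * x $ k * x' $ k' * y $ l * y' $ l')"
        by (simp add: gform_def)
      show ?thesis
        unfolding 1[of x' x y y'] 2[of x x' y' y] 3 4 unfolding gform_def T_def sum_distrib_left sum.distrib[symmetric]
        by (intro sum.cong refl) (simp add: algebra_simps)
    qed
    have TD: "mform T x x y y = a * x $ i * x $ i' * y $ j * y $ j'" for x y
      using four[of x x y y] by (simp add: D algebra_simps)
    have "eval2 (Poly_Mapping.single (mon i i' j j') a) x y = eval2 (poly_of T) x y" for x y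
    proof -
      have "Poly_Mapping.single (mon i i' j j') a = Const a * Var (Inl i) * Var (Inl i') * Var (Inr j) * Var (Inr j')"
        by (simp add: Const_def Var_def mult_single mon_def)
      then show ?thesis
        by (simp add: eval2_poly_of TD)
    qed
    then have "Poly_Mapping.single (mon i i' j j') a = poly_of T"
      by (rule eval2_inject)
    ultimately show ?thesis by blast
  qed
  have "\<exists>T. sym_tensor T \<and> (\<Sum>m\<in>K. Poly_Mapping.single m (Poly_Mapping.lookup f m)) = poly_of T"
    if "finite K" "K \<subseteq> mons" for K
    using that
  proof (induction K rule: finite_induct)
    case empty
    have "sym_tensor 0" "poly_of 0 = 0" by (auto simp: sym_tensor_def poly_of_def gform_def Const.hom_0)
    then show ?case by auto
  next
    case (insert m K)
    obtain T where T: "sym_tensor T" "(\<Sum>m\<in>K. Poly_Mapping.single m (Poly_Mapping.lookup f m)) = poly_of T"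
      using insert.IH insert.prems by (meson insert_subset)
    have "m \<in> mons" using insert.prems by simp
    then obtain i i' j j' where m: "m = mon i i' j j'" using mons_eq_mon by blast
    obtain T' where T': "sym_tensor T'" "Poly_Mapping.single m (Poly_Mapping.lookup f m) = poly_of T'"
      using single[of i i' j j' "Poly_Mapping.lookup f m"] unfolding m by metis
    have "sym_tensor (T' + T)" using T T' by (auto simp: sym_tensor_def)
    then show ?case using insert.hyps T T' by (intro exI[of _ "T' + T"]) (simp add: poly_of_add)
  qed
  from this[of "Poly_Mapping.keys f"] assms show ?thesis
    by (simp add: forms22_iff flip: poly_mapping_sum_single)
qed

section \<open>Complex matrices\<close>

definition diagm :: "('n \<Rightarrow> complex) \<Rightarrow> complex ^ 'n ^ 'n" where
  "diagm d = (\<chi> i j. if i = j then d i else 0)"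

text \<open>The bounded factors of the decomposition \<open>a ** diagm d ** b\<close>; they take the
  place of the unitary matrices in a Cartan decomposition. The determinant is only required to have
  norm 1, because pivoting permutes rows and columns.\<close>

definition unit_bounded :: "(complex ^ 'n ^ 'n) set" where
  "unit_bounded = {a. (\<forall>i j. norm (a $ i $ j) \<le> 1) \<and> norm (det a) = 1}"

lemma det_diagm: "det (diagm d) = (\<Prod>i\<in>UNIV. d i)"
  by (subst det_diagonal) (auto simp: diagm_def)

lemma diagm_mult_nth: "(a ** diagm d) $ i $ j = a $ i $ j * d j"
proof -
  have "(\<Sum>k\<in>UNIV. a $ i $ k * (if k = j then d k else 0)) = (\<Sum>k\<in>UNIV. if k = j then a $ i $ j * d j else 0)"
    by (intro sum.cong) auto
  then show ?thesis by (simp add: matrix_matrix_mult_def diagm_def)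
qed

lemma column_diagm: "column k (diagm d) = d k *s axis k 1"
  by (auto simp: vec_eq_iff column_def diagm_def axis_def)

lemma mult_diagm_mult_nth: "(a ** diagm d ** b) $ i $ j = (\<Sum>k\<in>UNIV. a $ i $ k * d k * b $ k $ j)"
  by (subst matrix_matrix_mult_def) (simp add: diagm_mult_nth)

lemma diagm_1: "diagm (\<lambda>i. 1) = mat 1"
  by (auto simp: vec_eq_iff diagm_def mat_def)

text \<open>One elimination step. A pivot of maximal norm keeps all multipliers in the unit disc,
  and subtracting the rank one matrix \<open>c i * d * r j\<close> clears the row and the column of
  the pivot.\<close>

lemma pivot:
  fixes h :: "'a::finite \<Rightarrow> 'b::finite \<Rightarrow> complex"
  assumes "I \<noteq> {}" "J \<noteq> {}" and supp: "\<And>i j. h i j \<noteq> 0 \<Longrightarrow> i \<in> I \<and> j \<in> J"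
  obtains i0 j0 c r d where "i0 \<in> I" "j0 \<in> J" "\<And>i. norm (c i :: complex) \<le> 1" "\<And>j. norm (r j :: complex) \<le> 1"
    "c i0 = 1" "r j0 = 1" "\<And>i. c i \<noteq> 0 \<Longrightarrow> i \<in> I" "\<And>j. r j \<noteq> 0 \<Longrightarrow> j \<in> J"
    "\<And>i j. h i j - c i * d * r j \<noteq> 0 \<Longrightarrow> i \<in> I - {i0} \<and> j \<in> J - {j0}"
proof -
  define M where "M = (\<lambda>(i, j). norm (h i j)) ` (I \<times> J)"
  have "finite M" "M \<noteq> {}" unfolding M_def using assms(1,2) by auto
  then have "Max M \<in> M" by (rule Max_in)
  then obtain i0 j0 where ij: "i0 \<in> I" "j0 \<in> J" "Max M = norm (h i0 j0)"
    unfolding M_def by auto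
  have max: "norm (h i j) \<le> norm (h i0 j0)" for i j
  proof (cases "h i j = 0")
    case False
    then have "norm (h i j) \<in> M" unfolding M_def using supp[of i j] by force
    then show ?thesis using \<open>finite M\<close> ij(3) by (metis Max_ge)
  qed simp
  define d where "d = h i0 j0"
  \<comment> \<open>If \<open>d\<close> is 0, then all of \<open>h\<close> is 0, and division by
    zero makes the other multipliers 0.\<close>
  define c where "c i = (if i = i0 then 1 else h i j0 / d)" for i
  define r where "r j = (if j = j0 then 1 else h i0 j / d)" for j
  have z: "h i j = 0" if "d = 0" for i j
    using max[of i j] that by (simp add: d_def)
  have "norm (c i) \<le> 1" for i
    using max[of i j0] by (auto simp: c_def d_def norm_divide divide_le_eq_1)
  moreover have "norm (r j) \<le> 1" for j
    using max[of i0 j] by (auto simp: r_def d_def norm_divide divide_le_eq_1)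
  moreover have "i \<in> I" if "c i \<noteq> 0" for i
    using that supp[of i j0] ij by (auto simp: c_def split: if_splits)
  moreover have "j \<in> J" if "r j \<noteq> 0" for j
    using that supp[of i0 j] ij by (auto simp: r_def split: if_splits)
  moreover have "i \<in> I - {i0} \<and> j \<in> J - {j0}" if nz: "h i j - c i * d * r j \<noteq> 0" for i j
  proof -
    from nz have d0: "d \<noteq> 0" using z[of i j] by auto
    have "i \<noteq> i0" "j \<noteq> j0" using nz d0 by (auto simp: c_def r_def d_def split: if_splits)
    moreover have "i \<in> I"
    proof (rule ccontr)
      assume "i \<notin> I"
      then have "h i j = 0" "h i j0 = 0" using supp[of i j] supp[of i j0] by auto
      then show False using nz \<open>i \<noteq> i0\<close> by (simp add: c_def)
    qed
    moreover have "j \<in> J"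
    proof (rule ccontr)
      assume "j \<notin> J"
      then have "h i j = 0" "h i0 j = 0" using supp[of i j] supp[of i0 j] by auto
      then show False using nz \<open>j \<noteq> j0\<close> by (simp add: r_def)
    qed
    ultimately show "i \<in> I - {i0} \<and> j \<in> J - {j0}" by auto
  qed
  moreover have "c i0 = 1" "r j0 = 1" by (auto simp: c_def r_def)
  ultimately show ?thesis using ij that[of i0 j0 c r d] by blast
qed

text \<open>With the rows sorted by pivots the multiplier matrix is unit triangular, so the
  determinant is the sign of a permutation.\<close>

lemma norm_det_triangular2:
  fixes a :: "complex ^ 2 ^ 2"
  assumes "i0 \<noteq> i1" "a $ i0 $ 1 = 1" "a $ i0 $ 2 = 0" "a $ i1 $ 2 = 1"
  shows "norm (det a) = 1"
  using exhaust_2[of i0] exhaust_2[of i1] assms by (auto simp: det_2)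

lemma norm_det_triangular3:
  fixes a :: "complex ^ 3 ^ 3"
  assumes "i0 \<noteq> i1" "i0 \<noteq> i2" "i1 \<noteq> i2" "a $ i0 $ 1 = 1" "a $ i0 $ 2 = 0" "a $ i0 $ 3 = 0"
    "a $ i1 $ 2 = 1" "a $ i1 $ 3 = 0" "a $ i2 $ 3 = 1"
  shows "norm (det a) = 1"
proof -
  have cases: "(i0 = 1 \<and> i1 = 2 \<and> i2 = 3) \<or> (i0 = 1 \<and> i1 = 3 \<and> i2 = 2) \<or> (i0 = 2 \<and> i1 = 1 \<and> i2 = 3) \<or>
    (i0 = 2 \<and> i1 = 3 \<and> i2 = 1) \<or> (i0 = 3 \<and> i1 = 1 \<and> i2 = 2) \<or> (i0 = 3 \<and> i1 = 2 \<and> i2 = 1)"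
    using exhaust_3[of i0] exhaust_3[of i1] exhaust_3[of i2] assms(1-3) by (elim disjE) simp_all
  note a = assms(4-)
  have "det a = 1 \<or> det a = - 1"
    using cases
  proof (elim disjE conjE)
    assume e: "i0 = 1" "i1 = 2" "i2 = 3"
    show ?thesis using a unfolding e det_3 by simp
  next
    assume e: "i0 = 1" "i1 = 3" "i2 = 2"
    show ?thesis using a unfolding e det_3 by simp
  next
    assume e: "i0 = 2" "i1 = 1" "i2 = 3"
    show ?thesis using a unfolding e det_3 by simp
  next
    assume e: "i0 = 2" "i1 = 3" "i2 = 1"
    show ?thesis using a unfolding e det_3 by simp
  next
    assume e: "i0 = 3" "i1 = 1" "i2 = 2"
    show ?thesis using a unfolding e det_3 by simp
  next
    assume e: "i0 = 3" "i1 = 2" "i2 = 1"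
    show ?thesis using a unfolding e det_3 by simp
  qed
  then show ?thesis by auto
qed

text \<open>Gaussian elimination with complete pivoting.\<close>

lemma bounded_factorization2:
  fixes g :: "complex ^ 2 ^ 2"
  shows "\<exists>a\<in>unit_bounded. \<exists>b\<in>unit_bounded. \<exists>d. g = a ** diagm d ** b"
proof -
  define I where "I = (UNIV :: 2 set)"
  have neI: "I \<noteq> {}" by (simp add: I_def)
  have base: "\<And>i j. g $ i $ j \<noteq> 0 \<Longrightarrow> i \<in> I \<and> j \<in> I" by (simp add: I_def)
  show ?thesis
  proof (rule pivot[of I I "\<lambda>i j. g $ i $ j"])
    show "I \<noteq> {}" "I \<noteq> {}" by (rule neI)+
    show "\<And>i j. g $ i $ j \<noteq> 0 \<Longrightarrow> i \<in> I \<and> j \<in> I" by (rule base)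
    fix i0 j0 c0 r0 d0
    assume 0: "i0 \<in> I" "j0 \<in> I" "\<And>i. norm (c0 i) \<le> 1" "\<And>j. norm (r0 j) \<le> 1" "c0 i0 = 1" "r0 j0 = 1"
      "\<And>i. c0 i \<noteq> 0 \<Longrightarrow> i \<in> I" "\<And>j. r0 j \<noteq> 0 \<Longrightarrow> j \<in> I"
      "\<And>i j. g $ i $ j - c0 i * d0 * r0 j \<noteq> 0 \<Longrightarrow> i \<in> I - {i0} \<and> j \<in> I - {j0}"
  have ne: "I - {i::2} \<noteq> {}" for i
    using exhaust_2[of i] by (auto simp: UNIV_2 I_def)
  show ?thesis
  proof (rule pivot[of "I - {i0}" "I - {j0}" "\<lambda>i j. g $ i $ j - c0 i * d0 * r0 j"])
    show "I - {i0} \<noteq> {}" "I - {j0} \<noteq> {}" by (rule ne)+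
    show "\<And>i j. g $ i $ j - c0 i * d0 * r0 j \<noteq> 0 \<Longrightarrow> i \<in> I - {i0} \<and> j \<in> I - {j0}" by (rule 0(9))
    fix i1 j1 c1 r1 d1
    assume 1: "i1 \<in> I - {i0}" "j1 \<in> I - {j0}" "\<And>i. norm (c1 i) \<le> 1" "\<And>j. norm (r1 j) \<le> 1" "c1 i1 = 1" "r1 j1 = 1"
    "\<And>i. c1 i \<noteq> 0 \<Longrightarrow> i \<in> I - {i0}" "\<And>j. r1 j \<noteq> 0 \<Longrightarrow> j \<in> I - {j0}"
    "\<And>i j. g $ i $ j - c0 i * d0 * r0 j - c1 i * d1 * r1 j \<noteq> 0 \<Longrightarrow> i \<in> I - {i0} - {i1} \<and> j \<in> I - {j0} - {j1}"
  have "I - {i0} - {i1} = {}"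
    using exhaust_2[of i0] exhaust_2[of i1] 1(1) by (auto simp: UNIV_2 I_def)
  then have g: "g $ i $ j = c0 i * d0 * r0 j + c1 i * d1 * r1 j" for i j
    using 1(9)[of i j] by (auto simp: algebra_simps)
  define a :: "complex ^ 2 ^ 2" where "a = (\<chi> i k. if k = 1 then c0 i else c1 i)"
  define b :: "complex ^ 2 ^ 2" where "b = (\<chi> k j. if k = 1 then r0 j else r1 j)"
  have "norm (det a) = 1"
    using 1(1) 1(7)[of i0] by (intro norm_det_triangular2[of i0 i1]) (auto simp: a_def 0 1)
  moreover have "norm (det (transpose b)) = 1"
    using 1(2) 1(8)[of j0] by (intro norm_det_triangular2[of j0 j1]) (auto simp: b_def transpose_def 0 1)
  ultimately have "a \<in> unit_bounded" "b \<in> unit_bounded"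
    using 0 1 by (auto simp: unit_bounded_def a_def b_def det_transpose)
  moreover have "g = a ** diagm (\<lambda>k. if k = 1 then d0 else d1) ** b"
    unfolding vec_eq_iff mult_diagm_mult_nth by (auto simp: sum_2 a_def b_def g)
  ultimately show ?thesis by blast
  qed
  qed
qed

lemma bounded_factorization3:
  fixes g :: "complex ^ 3 ^ 3"
  shows "\<exists>a\<in>unit_bounded. \<exists>b\<in>unit_bounded. \<exists>d. g = a ** diagm d ** b"
proof -
  define I where "I = (UNIV :: 3 set)"
  have neI: "I \<noteq> {}" by (simp add: I_def)
  have base: "\<And>i j. g $ i $ j \<noteq> 0 \<Longrightarrow> i \<in> I \<and> j \<in> I" by (simp add: I_def)
  show ?thesis
  proof (rule pivot[of I I "\<lambda>i j. g $ i $ j"])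
    show "I \<noteq> {}" "I \<noteq> {}" by (rule neI)+
    show "\<And>i j. g $ i $ j \<noteq> 0 \<Longrightarrow> i \<in> I \<and> j \<in> I" by (rule base)
    fix i0 j0 c0 r0 d0
    assume 0: "i0 \<in> I" "j0 \<in> I" "\<And>i. norm (c0 i) \<le> 1" "\<And>j. norm (r0 j) \<le> 1" "c0 i0 = 1" "r0 j0 = 1"
      "\<And>i. c0 i \<noteq> 0 \<Longrightarrow> i \<in> I" "\<And>j. r0 j \<noteq> 0 \<Longrightarrow> j \<in> I"
      "\<And>i j. g $ i $ j - c0 i * d0 * r0 j \<noteq> 0 \<Longrightarrow> i \<in> I - {i0} \<and> j \<in> I - {j0}"
  have ne: "I - {i::3} \<noteq> {}" for i
    using exhaust_3[of i] by (auto simp: UNIV_3 I_def)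
  show ?thesis
  proof (rule pivot[of "I - {i0}" "I - {j0}" "\<lambda>i j. g $ i $ j - c0 i * d0 * r0 j"])
    show "I - {i0} \<noteq> {}" "I - {j0} \<noteq> {}" by (rule ne)+
    show "\<And>i j. g $ i $ j - c0 i * d0 * r0 j \<noteq> 0 \<Longrightarrow> i \<in> I - {i0} \<and> j \<in> I - {j0}" by (rule 0(9))
    fix i1 j1 c1 r1 d1
    assume 1: "i1 \<in> I - {i0}" "j1 \<in> I - {j0}" "\<And>i. norm (c1 i) \<le> 1" "\<And>j. norm (r1 j) \<le> 1" "c1 i1 = 1" "r1 j1 = 1"
    "\<And>i. c1 i \<noteq> 0 \<Longrightarrow> i \<in> I - {i0}" "\<And>j. r1 j \<noteq> 0 \<Longrightarrow> j \<in> I - {j0}"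
    "\<And>i j. g $ i $ j - c0 i * d0 * r0 j - c1 i * d1 * r1 j \<noteq> 0 \<Longrightarrow> i \<in> I - {i0} - {i1} \<and> j \<in> I - {j0} - {j1}"
  have ne2: "I - {i::3} - {i'} \<noteq> {}" for i i'
  proof
    assume "I - {i} - {i'} = {}"
    then have "I \<subseteq> {i, i'}" by blast
    then have "card I \<le> card {i, i'}" by (intro card_mono) auto
    also have "\<dots> \<le> 2" by (simp add: card_insert_if)
    finally show False by (simp add: I_def)
  qed
  show ?thesis
  proof (rule pivot[of "I - {i0} - {i1}" "I - {j0} - {j1}" "\<lambda>i j. g $ i $ j - c0 i * d0 * r0 j - c1 i * d1 * r1 j"])
    show "I - {i0} - {i1} \<noteq> {}" "I - {j0} - {j1} \<noteq> {}" by (rule ne2)+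
    show "\<And>i j. g $ i $ j - c0 i * d0 * r0 j - c1 i * d1 * r1 j \<noteq> 0 \<Longrightarrow> i \<in> I - {i0} - {i1} \<and> j \<in> I - {j0} - {j1}" by (rule 1(9))
    fix i2 j2 c2 r2 d2
    assume 2: "i2 \<in> I - {i0} - {i1}" "j2 \<in> I - {j0} - {j1}" "\<And>i. norm (c2 i) \<le> 1" "\<And>j. norm (r2 j) \<le> 1" "c2 i2 = 1" "r2 j2 = 1"
    "\<And>i. c2 i \<noteq> 0 \<Longrightarrow> i \<in> I - {i0} - {i1}" "\<And>j. r2 j \<noteq> 0 \<Longrightarrow> j \<in> I - {j0} - {j1}"
    "\<And>i j. g $ i $ j - c0 i * d0 * r0 j - c1 i * d1 * r1 j - c2 i * d2 * r2 j \<noteq> 0 \<Longrightarrow> i \<in> I - {i0} - {i1} - {i2} \<and> j \<in> I - {j0} - {j1} - {j2}"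
  have "I - {i0} - {i1} - {i2} = {}"
  proof -
    have "card {i0, i1, i2} = card I" using 1(1) 2(1) by (auto simp: I_def card_insert_if)
    then have "{i0, i1, i2} = I" by (intro card_subset_eq) (auto simp: I_def)
    then show ?thesis by blast
  qed
  then have g: "g $ i $ j = c0 i * d0 * r0 j + c1 i * d1 * r1 j + c2 i * d2 * r2 j" for i j
    using 2(9)[of i j] by (auto simp: algebra_simps)
  \<comment> \<open>The multiplier columns form \<open>a\<close>, the multiplier rows form
    \<open>b\<close>, and the pivots form the diagonal matrix.\<close>
  define a :: "complex ^ 3 ^ 3" where "a = (\<chi> i k. if k = 1 then c0 i else if k = 2 then c1 i else c2 i)"
  define b :: "complex ^ 3 ^ 3" where "b = (\<chi> k j. if k = 1 then r0 j else if k = 2 then r1 j else r2 j)"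
  have "norm (det a) = 1"
    using 1(1) 1(7)[of i0] 2(1) 2(7)[of i0] 2(7)[of i1] by (intro norm_det_triangular3[of i0 i1 i2]) (auto simp: a_def 0 1 2)
  moreover have "norm (det (transpose b)) = 1"
    using 1(2) 1(8)[of j0] 2(2) 2(8)[of j0] 2(8)[of j1] by (intro norm_det_triangular3[of j0 j1 j2]) (auto simp: b_def transpose_def 0 1 2)
  ultimately have "a \<in> unit_bounded" "b \<in> unit_bounded"
    using 0 1 2 by (auto simp: unit_bounded_def a_def b_def det_transpose)
  moreover have "g = a ** diagm (\<lambda>k. if k = 1 then d0 else if k = 2 then d1 else d2) ** b"
    unfolding vec_eq_iff mult_diagm_mult_nth by (auto simp: sum_3 a_def b_def g)
  ultimately show ?thesis by blast
  qed
  qed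
  qed
qed

section \<open>Bounds for determinants and inverses\<close>

lemma norm_det_le:
  fixes a :: "complex ^ 'n ^ 'n"
  assumes "\<And>i j. norm (a $ i $ j) \<le> 1"
  shows "norm (det a) \<le> fact CARD('n)"
proof -
  have "norm (det a) \<le> (\<Sum>p\<in>{p. p permutes (UNIV::'n set)}. norm (of_int (sign p) * (\<Prod>i\<in>UNIV. a $ i $ p i)))"
    unfolding det_def by (rule norm_sum)
  also have "\<dots> \<le> (\<Sum>p\<in>{p. p permutes (UNIV::'n set)}. 1)"
  proof (rule sum_mono)
    fix p :: "'n \<Rightarrow> 'n"
    have "norm (of_int (sign p) :: complex) = 1" by (auto simp: sign_def)
    moreover have "norm (\<Prod>i\<in>UNIV. a $ i $ p i) \<le> 1"
      unfolding prod_norm[symmetric] by (rule prod_le_1) (use assms in auto)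
    ultimately show "norm (of_int (sign p) * (\<Prod>i\<in>UNIV. a $ i $ p i)) \<le> 1"
      by (simp add: norm_mult)
  qed
  also have "\<dots> = fact CARD('n)"
    by (simp add: card_permutations)
  finally show ?thesis .
qed

text \<open>Cramer's rule: each entry of the inverse is a determinant with entries of norm at most
  1, divided by a number of norm 1.\<close>

lemma unit_bounded_inverse:
  fixes a :: "complex ^ 'n ^ 'n"
  assumes "a \<in> unit_bounded"
  shows "\<exists>b. a ** b = mat 1 \<and> b ** a = mat 1 \<and> (\<forall>i j. norm (b $ i $ j) \<le> fact CARD('n))"
proof -
  have det: "norm (det a) = 1" "det a \<noteq> 0" using assms by (auto simp: unit_bounded_def)
  define b :: "complex ^ 'n ^ 'n" where
    "b = (\<chi> k j. det (\<chi> i l. if l = k then (axis j 1 :: complex ^ 'n) $ i else a $ i $ l) / det a)"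
  have col: "a *v column j b = axis j 1" for j
    unfolding cramer[OF det(2)] by (simp add: vec_eq_iff b_def column_def)
  have "a ** b = mat 1"
  proof -
    have "(a ** b) $ i $ j = (a *v column j b) $ i" for i j
      by (simp add: matrix_matrix_mult_def matrix_vector_mult_def column_def)
    then show ?thesis by (simp add: vec_eq_iff col axis_def mat_def)
  qed
  moreover have "norm (b $ k $ j) \<le> fact CARD('n)" for k j
  proof -
    have "norm (det (\<chi> i l. if l = k then (axis j 1 :: complex ^ 'n) $ i else a $ i $ l)) \<le> fact CARD('n)"
      using assms by (intro norm_det_le) (auto simp: unit_bounded_def axis_def)
    then show ?thesis by (simp add: b_def norm_divide det(1))
  qed
  ultimately show ?thesis using matrix_left_right_inverse by blast
qed

lemma mat_inverse_exists:
  fixes a :: "complex ^ 'n ^ 'n"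
  assumes "det a \<noteq> 0"
  shows "\<exists>b. a ** b = mat 1 \<and> b ** a = mat 1 \<and> det a * det b = 1"
proof -
  obtain b where b: "a ** b = mat 1" "b ** a = mat 1"
    using assms invertible_det_nz invertible_def by blast
  then have "det a * det b = 1" by (metis det_I det_mul)
  then show ?thesis using b by blast
qed


subsection \<open>Diagonalisation of power-bounded matrices\<close>

primrec mpow :: "nat \<Rightarrow> complex ^ 'n ^ 'n \<Rightarrow> complex ^ 'n ^ 'n" where
  "mpow 0 h = mat 1"
| "mpow (Suc k) h = h ** mpow k h"

definition power_bounded :: "complex ^ 'n ^ 'n \<Rightarrow> bool" where
  "power_bounded h \<longleftrightarrow> (\<exists>C. \<forall>k w. norm (mpow k h *v w) \<le> C * norm w)"

lemma mpow_Suc_vec: "mpow (Suc k) h *v w = h *v (mpow k h *v w)"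
  by (simp add: matrix_vector_mul_assoc)

lemma scalar_vec_norm: "norm (c *s (v :: complex ^ 'n)) = norm c * norm v"
  by (simp add: norm_vec_def norm_mult L2_set_right_distrib)

lemma mpow_eigen:
  assumes "h *v e = m *s e"
  shows "mpow k h *v e = m ^ k *s e"
proof (induction k)
  case (Suc k)
  then show ?case
    by (simp add: mpow_Suc_vec assms vector_scalar_commute vector_smult_assoc mult.commute del: mpow.simps)
qed simp

lemma power_unbounded:
  fixes x :: real
  assumes "x \<ge> 0" "\<And>k. x ^ k \<le> C"
  shows "x \<le> 1"
proof (rule ccontr)
  assume "\<not> x \<le> 1"
  then obtain n where "C < x ^ n" using real_arch_pow[of x C] by auto
  then show False using assms(2)[of n] by simp
qed

lemma eigenvalue_norm_le_1:
  assumes "power_bounded h" "h *v e = m *s e" "e \<noteq> 0"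
  shows "norm m \<le> 1"
proof -
  obtain C where C: "\<And>k w. norm (mpow k h *v w) \<le> C * norm w"
    using assms(1) unfolding power_bounded_def by blast
  have "norm m ^ k * norm e \<le> C * norm e" for k
    using C[of k e] unfolding mpow_eigen[OF assms(2)] scalar_vec_norm norm_power .
  then have "norm m ^ k \<le> C" for k using assms(3) by simp
  then show ?thesis by (intro power_unbounded) auto
qed

text \<open>The inverse is power-bounded too and has the reciprocal eigenvalue.\<close>

lemma eigenvalue_norm_eq_1:
  assumes "power_bounded h" "power_bounded h'" "h' ** h = mat 1" "h *v e = m *s e" "e \<noteq> 0"
  shows "norm m = 1"
proof -
  have e: "e = m *s (h' *v e)"
    using arg_cong[OF assms(4), of "\<lambda>v. h' *v v"] assms(3)
    by (simp add: matrix_vector_mul_assoc vector_scalar_commute)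
  then have m: "m \<noteq> 0" using assms(5) by auto
  have "inverse m *s e = inverse m *s (m *s (h' *v e))" using e by simp
  then have "h' *v e = inverse m *s e"
    using m by (simp add: vector_smult_assoc)
  then have "norm (inverse m) \<le> 1" using eigenvalue_norm_le_1[OF assms(2)] assms(5) by blast
  moreover have "norm m \<le> 1" using eigenvalue_norm_le_1[OF assms(1,4,5)] .
  ultimately show ?thesis using m by (simp add: norm_inverse inverse_le_1_iff)
qed

text \<open>The k-th power of a Jordan block of size 2 has a term that grows linearly in k, since
  the eigenvalue has norm 1.\<close>

lemma generalized_eigenvector:
  assumes "power_bounded h" "power_bounded h'" "h' ** h = mat 1"
    and w: "h *v w = m *s w + e" and e: "h *v e = m *s e"
  shows "e = 0"
proof (rule ccontr)
  assume "e \<noteq> 0"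
  then have m: "norm m = 1" using eigenvalue_norm_eq_1[OF assms(1-3) e] by blast
  obtain C where C: "\<And>k w. norm (mpow k h *v w) \<le> C * norm w"
    using assms(1) unfolding power_bounded_def by blast
  \<comment> \<open>The extra factor \<open>m\<close> avoids the exponent k - 1 in h^k w = m^k w + k
    m^(k-1) e.\<close>
  have pow: "m *s (mpow k h *v w) = m ^ Suc k *s w + (of_nat k * m ^ k) *s e" for k
  proof (induction k)
    case (Suc k)
    have "m *s (mpow (Suc k) h *v w) = h *v (m *s (mpow k h *v w))"
      by (simp only: mpow_Suc_vec vector_scalar_commute)
    also have "\<dots> = m ^ Suc k *s (h *v w) + (of_nat k * m ^ k) *s (h *v e)"
      unfolding Suc.IH by (simp only: matrix_vector_right_distrib vector_scalar_commute)
    also have "\<dots> = m ^ Suc (Suc k) *s w + (of_nat (Suc k) * m ^ Suc k) *s e"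
      unfolding w e by (simp add: vec_eq_iff algebra_simps)
    finally show ?case .
  qed simp
  have "real k * norm e \<le> C * norm w + norm w" for k
  proof -
    have "(of_nat k * m ^ k) *s e = m *s (mpow k h *v w) - m ^ Suc k *s w"
      unfolding pow by simp
    then have "norm ((of_nat k * m ^ k) *s e) \<le> norm (m *s (mpow k h *v w)) + norm (m ^ Suc k *s w)"
      by (metis norm_triangle_ineq4)
    then show ?thesis
      using C[of k w] by (simp add: scalar_vec_norm norm_mult norm_power m)
  qed
  then have "real k \<le> (C * norm w + norm w) / norm e" for k
    using \<open>e \<noteq> 0\<close> by (simp add: field_simps)
  then show False using reals_Archimedean2 by (metis not_le)
qed

text \<open>The vector p(h) w, computed by Horner's scheme.\<close>

definition papp :: "complex ^ 'n ^ 'n \<Rightarrow> complex ^ 'n \<Rightarrow> complex poly \<Rightarrow> complex ^ 'n" where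
  "papp h w p = fold_coeffs (\<lambda>a v. a *s w + h *v v) p 0"

lemma papp_0 [simp]: "papp h w 0 = 0"
  by (simp add: papp_def)

lemma papp_pCons: "papp h w (pCons a p) = a *s w + h *v papp h w p"
  by (cases "p = 0"; cases "a = 0") (auto simp: papp_def)

lemma papp_add: "papp h w (p + q) = papp h w p + papp h w q"
  by (induction p q rule: poly_induct2)
    (simp_all add: papp_pCons matrix_vector_right_distrib vec.scale_left_distrib)

lemma papp_smult: "papp h w (smult c p) = c *s papp h w p"
  by (induction p) (simp_all add: papp_pCons vector_scalar_commute vec.scale_right_distrib vector_smult_assoc)

text \<open>Otherwise the vectors h^i w would be independent for all i and exceed the dimension. A
  vector in the span of its predecessors would give a relation whose polynomial has leading
  coefficient 1, hence a nonzero one.\<close>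

lemma papp_dependence: "\<exists>p. p \<noteq> 0 \<and> papp h w p = 0"
proof (rule ccontr)
  assume no: "\<nexists>p. p \<noteq> 0 \<and> papp h w p = 0"
  define b where "b i = papp h w (monom 1 i)" for i
  have span: "\<exists>q. (q = 0 \<or> degree q < k) \<and> v = papp h w q" if "v \<in> vec.span (b ` {..<k})" for v k
  proof -
    have "vec.subspace {papp h w q | q. q = 0 \<or> degree q < k}"
    proof (rule vec.subspaceI)
      show "0 \<in> {papp h w q | q. q = 0 \<or> degree q < k}"
        by (auto intro!: exI[of _ 0])
      show "x + y \<in> {papp h w q | q. q = 0 \<or> degree q < k}" if xy: "x \<in> {papp h w q | q. q = 0 \<or> degree q < k}"
        "y \<in> {papp h w q | q. q = 0 \<or> degree q < k}" for x y
      proof -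
        obtain p q where "x = papp h w p" "p = 0 \<or> degree p < k" "y = papp h w q" "q = 0 \<or> degree q < k"
          using xy by blast
        then have "x + y = papp h w (p + q)" "p + q = 0 \<or> degree (p + q) < k"
          by (auto simp: papp_add intro: degree_add_less)
        then show ?thesis by blast
      qed
      show "c *s x \<in> {papp h w q | q. q = 0 \<or> degree q < k}" if x: "x \<in> {papp h w q | q. q = 0 \<or> degree q < k}" for c x
      proof -
        obtain p where "x = papp h w p" "p = 0 \<or> degree p < k" using x by blast
        then have "c *s x = papp h w (smult c p)" "smult c p = 0 \<or> degree (smult c p) < k"
          by (auto simp: papp_smult)
        then show ?thesis by blast
      qed
    qed
    moreover have "b ` {..<k} \<subseteq> {papp h w q | q. q = 0 \<or> degree q < k}"
      by (auto simp: b_def degree_monom_eq)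
    ultimately have "v \<in> {papp h w q | q. q = 0 \<or> degree q < k}"
      using that vec.span_minimal[of "b ` {..<k}" "{papp h w q | q. q = 0 \<or> degree q < k}"] by blast
    then show ?thesis by blast
  qed
  have "vec.independent (b ` {..<k}) \<and> card (b ` {..<k}) = k" for k
  proof (induction k)
    case (Suc k)
    have "b k \<notin> vec.span (b ` {..<k})"
    proof
      assume "b k \<in> vec.span (b ` {..<k})"
      from span[OF this] obtain q where q: "q = 0 \<or> degree q < k" "b k = papp h w q"
        by blast
      have "papp h w (monom 1 k + smult (- 1) q) = 0"
        unfolding papp_add papp_smult q(2)[unfolded b_def] by (simp add: vec_eq_iff)
      then have "monom 1 k + smult (- 1) q = 0" using no by blast
      then have "coeff (monom 1 k + smult (- 1) q) k = 0" by simp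
      then show False using q(1) by (auto simp: coeff_eq_0)
    qed
    moreover from this have "b k \<notin> b ` {..<k}" using vec.span_base[of "b k" "b ` {..<k}"] by blast
    ultimately show ?case
      using Suc by (auto simp: lessThan_Suc vec.independent_insert)
  qed (simp add: vec.independent_empty)
  from this[of "Suc CARD('a)"] have "Suc CARD('a) \<le> vec.dim (UNIV :: (complex ^ 'a) set)"
    using vec.independent_card_le_dim[of "b ` {..<Suc CARD('a)}" UNIV] by (metis subset_UNIV)
  then show False unfolding vec_dim_card by simp
qed

text \<open>For \<open>w\<close> outside the span of the eigenvectors, take \<open>p\<close> of
  least degree with p(h) w in the span and split off a root m. Then q(h) w is outside the span while
  (h - m) q(h) w is inside. Corrected by a vector of the span, q(h) w becomes a generalised
  eigenvector for m, hence an eigenvector.\<close>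

lemma power_bounded_span:
  fixes h :: "complex ^ 'n ^ 'n"
  assumes "power_bounded h" "power_bounded h'" "h' ** h = mat 1"
  shows "vec.span {v. \<exists>m. h *v v = m *s v} = UNIV"
proof (rule ccontr)
  define E where "E = {v. \<exists>m. h *v v = m *s v}"
  assume "vec.span {v. \<exists>m. h *v v = m *s v} \<noteq> UNIV"
  then obtain w where w: "w \<notin> vec.span E" by (auto simp: E_def)
  define D where "D = {d. \<exists>p. p \<noteq> 0 \<and> papp h w p \<in> vec.span E \<and> degree p = d}"
  have "D \<noteq> {}"
    using papp_dependence[of h w] vec.span_zero[of E] by (force simp: D_def)
  then have dD: "\<exists>d. d \<in> D" by blast
  define d where "d = (LEAST d. d \<in> D)"
  have d: "d \<in> D" "\<And>d'. d' \<in> D \<Longrightarrow> d \<le> d'"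
    unfolding d_def using LeastI_ex[OF dD] by (auto intro: Least_le)
  then obtain p where p: "p \<noteq> 0" "papp h w p \<in> vec.span E" "degree p = d" by (auto simp: D_def)
  have "degree p \<noteq> 0"
  proof
    assume "degree p = 0"
    then obtain c where c: "p = [:c:]" by (rule degree_eq_zeroE)
    then have "c *s w \<in> vec.span E" "c \<noteq> 0" using p by (auto simp: papp_pCons)
    then have "inverse c *s (c *s w) \<in> vec.span E" using vec.span_scale by blast
    then show False using w \<open>c \<noteq> 0\<close> by (simp add: vector_smult_assoc)
  qed
  then have "\<not> constant (poly p)" by (simp add: constant_degree)
  then obtain m where "poly p m = 0" using fundamental_theorem_of_algebra by blast
  then have "[:- m, 1:] dvd p" by (simp add: poly_eq_0_iff_dvd)
  then obtain q where q: "p = [:- m, 1:] * q" by (rule dvdE)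
  have "q \<noteq> 0" using p(1) q by auto
  moreover have "degree q < degree p" using q \<open>q \<noteq> 0\<close> by (simp add: degree_mult_eq del: mult_pCons_left)
  ultimately have w': "papp h w q \<notin> vec.span E"
    using d p(3) by (force simp: D_def)
  have eq: "papp h w p = h *v papp h w q + (- m) *s papp h w q"
  proof -
    have "p = pCons 0 q + smult (- m) q" by (simp add: q)
    then show ?thesis by (simp only: papp_add papp_smult papp_pCons) simp
  qed
  \<comment> \<open>Every vector of the span is an m-eigenvector plus the image under h - m of a
    vector of the span.\<close>
  have split: "\<exists>u\<in>vec.span E. \<exists>e'. h *v e' = m *s e' \<and> v = e' + (h *v u - m *s u)" if "v \<in> vec.span E" for v
    using that
  proof (induction rule: vec.span_induct_alt)
    case base
    show ?case by (intro bexI[of _ 0] exI[of _ 0]) (auto simp: vec.span_zero)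
  next
    case (step c x y)
    obtain n where n: "h *v x = n *s x" using step(1) by (auto simp: E_def)
    obtain u e' where u: "u \<in> vec.span E" "h *v e' = m *s e'" "y = e' + (h *v u - m *s u)"
      using step(2) by blast
    have x: "x \<in> vec.span E" using step(1) by (rule vec.span_base)
    show ?case
    proof (cases "n = m")
      case True
      show ?thesis
        by (intro bexI[of _ u] exI[of _ "c *s x + e'"])
          (simp_all add: u n True matrix_vector_right_distrib vector_scalar_commute vec_eq_iff algebra_simps)
    next
      case False
      show ?thesis
      \<comment> \<open>On an n-eigenvector h - m is multiplication by the nonzero number n -
        m.\<close>
      proof (intro bexI[of _ "u + (c / (n - m)) *s x"] exI[of _ e'] conjI)
        have "c / (n - m) * n = c + c / (n - m) * m" using False by (simp add: field_simps)
        then have "(c / (n - m)) *s (n *s x) = c *s x + (c / (n - m) * m) *s x"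
          by (simp only: vector_smult_assoc vec.scale_left_distrib)
        then show "c *s x + y = e' + (h *v (u + (c / (n - m)) *s x) - m *s (u + (c / (n - m)) *s x))"
          by (simp add: u(3) n matrix_vector_right_distrib vector_scalar_commute vec.scale_right_distrib vector_smult_assoc mult.commute)
        show "u + (c / (n - m)) *s x \<in> vec.span E" using u(1) x by (intro vec.span_add vec.span_scale)
      qed (rule u(2))
    qed
  qed
  obtain u e' where u: "u \<in> vec.span E" "h *v e' = m *s e'" "papp h w p = e' + (h *v u - m *s u)"
    using split[OF p(2)] by blast
  define z where "z = papp h w q - u"
  have "h *v z = m *s z + e'"
    using eq u(3) unfolding z_def by (simp add: matrix_vector_mult_diff_distrib vec_eq_iff algebra_simps)
  then have "e' = 0" using generalized_eigenvector[OF assms _ u(2)] by blast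
  then have "z \<in> vec.span E"
    using \<open>h *v z = m *s z + e'\<close> by (intro vec.span_base) (auto simp: E_def)
  then have "z + u \<in> vec.span E" using u(1) by (rule vec.span_add)
  then show False using w' by (simp add: z_def)
qed

lemma power_bounded_diagonalisable:
  fixes h :: "complex ^ 'n ^ 'n"
  assumes "power_bounded h" "power_bounded h'" "h' ** h = mat 1"
  shows "\<exists>P d. det P \<noteq> 0 \<and> h ** P = P ** diagm d"
proof -
  define E where "E = {v. \<exists>m. h *v v = m *s v}"
  have E: "vec.span E = UNIV" using power_bounded_span[OF assms] by (simp add: E_def)
  obtain B where B: "B \<subseteq> E" "vec.independent B" "E \<subseteq> vec.span B"
    using vec.maximal_independent_subset by blast
  have spanB: "vec.span B = UNIV"
    using E B(3) by (metis vec.span_mono vec.span_span top.extremum_uniqueI)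
  have "finite B" using B(2) by (rule vec.finiteI_independent)
  have "card B = CARD('n)"
    using vec.dim_eq_card[of B UNIV] B(2) spanB vec_dim_card by (metis vec.span_UNIV)
  then obtain f where f: "bij_betw f (UNIV :: 'n set) B"
    using finite_same_card_bij[of "UNIV :: 'n set" B] \<open>finite B\<close> by auto
  define P :: "complex ^ 'n ^ 'n" where "P = (\<chi> i j. f j $ i)"
  have col: "column j P = f j" for j by (simp add: column_def P_def vec_eq_iff)
  have "columns P = B" using f by (auto simp: columns_def col bij_betw_def)
  then have "\<exists>Q. P ** Q = mat 1" using spanB matrix_right_invertible_span_columns by blast
  then have "det P \<noteq> 0" by (metis invertible_right_inverse invertible_det_nz)
  have "f j \<in> E" for j using f B(1) by (auto simp: bij_betw_def)
  then have "\<forall>j. \<exists>m. h *v f j = m *s f j" by (simp add: E_def)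
  then obtain d where d: "\<And>j. h *v f j = d j *s f j" using choice[of "\<lambda>j m. h *v f j = m *s f j"] by blast
  have "(h ** P) $ i $ j = (P ** diagm d) $ i $ j" for i j
  proof -
    have "(h ** P) $ i $ j = (h *v f j) $ i"
      by (simp add: matrix_matrix_mult_def matrix_vector_mult_def P_def)
    also have "\<dots> = (P ** diagm d) $ i $ j"
      unfolding d diagm_mult_nth by (simp add: P_def)
    finally show ?thesis .
  qed
  then have "h ** P = P ** diagm d" by (simp add: vec_eq_iff)
  then show ?thesis using \<open>det P \<noteq> 0\<close> by blast
qed

section \<open>The Hilbert-Mumford criterion for real weights\<close>

text \<open>The substitution f(p x, q y) without inverses: a right action that makes sense for
  singular matrices too. Over determinant 1 it has the same orbits as \<open>act\<close>, because
  inversion permutes the group.\<close>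

definition tact :: "tensor \<Rightarrow> complex ^ 2 ^ 2 \<Rightarrow> complex ^ 3 ^ 3 \<Rightarrow> tensor" where
  "tact T p q = (\<chi> i i' j j'. mform T (column i p) (column i' p) (column j q) (column j' q))"

definition torbit :: "tensor \<Rightarrow> tensor set" where
  "torbit T = {tact T p q | p q. det p = 1 \<and> det q = 1}"

definition tstab :: "tensor \<Rightarrow> ((complex ^ 2 ^ 2) \<times> (complex ^ 3 ^ 3)) set" where
  "tstab T = {(p, q). det p = 1 \<and> det q = 1 \<and> tact T p q = T}"

text \<open>After a change of coordinates all monomials have nonpositive weight for some non-trivial
  real one-parameter subgroup of the diagonal torus.\<close>

definition destab :: "tensor \<Rightarrow> bool" where
  "destab T \<longleftrightarrow> (\<exists>p q (r :: 2 \<Rightarrow> real) (s :: 3 \<Rightarrow> real). det p \<noteq> 0 \<and> det q \<noteq> 0 \<and>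
     sum r UNIV = 0 \<and> sum s UNIV = 0 \<and> ((\<exists>i. r i \<noteq> 0) \<or> (\<exists>j. s j \<noteq> 0)) \<and>
     (\<forall>i i' j j'. tact T p q $ i $ i' $ j $ j' \<noteq> 0 \<longrightarrow> r i + r i' + s j + s j' \<le> 0))"

lemma mform_tact: "mform (tact T p q) x x' y y' = mform T (p *v x) (p *v x') (q *v y) (q *v y')"
proof -
  have e:
    "mform T (p *v x) x' y y' = (\<Sum>i\<in>UNIV. x $ i * mform T (column i p) x' y y')"
    "mform T x' (p *v x) y y' = (\<Sum>i\<in>UNIV. x $ i * mform T x' (column i p) y y')"
    "mform T x x' (q *v y) y' = (\<Sum>i\<in>UNIV. y $ i * mform T x x' (column i q) y')"
    "mform T x x' y' (q *v y) = (\<Sum>i\<in>UNIV. y $ i * mform T x x' y' (column i q))" for x x' y y'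
    by (simp_all only: matrix_mult_sum mform_sum mform_scale)
  have "mform T (p *v x) (p *v x') (q *v y) (q *v y') =
    (\<Sum>i\<in>UNIV. x $ i * (\<Sum>i'\<in>UNIV. x' $ i' * (\<Sum>j\<in>UNIV. y $ j * (\<Sum>j'\<in>UNIV. y' $ j' * mform T (column i p) (column i' p) (column j q) (column j' q)))))"
    by (subst e(1), rule sum.cong[OF refl], rule arg_cong2[where f = times, OF refl],
        subst e(2), rule sum.cong[OF refl], rule arg_cong2[where f = times, OF refl],
        subst e(3), rule sum.cong[OF refl], rule arg_cong2[where f = times, OF refl], rule e(4))
  also have "\<dots> = mform (tact T p q) x x' y y'"
    unfolding gform_def[of _ "tact T p q"] sum_distrib_left
    by (intro sum.cong refl) (simp add: tact_def algebra_simps)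
  finally show ?thesis by simp
qed

lemma tensor_ext:
  assumes "\<And>x x' y y'. mform T x x' y y' = mform T' x x' y y'"
  shows "T = T'"
  unfolding vec_eq_iff using assms mform_axis by metis

lemma tact_tact: "tact (tact T p q) p' q' = tact T (p ** p') (q ** q')"
  by (rule tensor_ext) (simp only: mform_tact matrix_vector_mul_assoc)

lemma tact_1 [simp]: "tact T (mat 1) (mat 1) = T"
  by (rule tensor_ext) (simp only: mform_tact matrix_vector_mul_lid)

lemma sym_tact:
  assumes "sym_tensor T"
  shows "sym_tensor (tact T p q)"
  unfolding sym_tensor_def tact_def
  by (intro allI conjI; simp only: vec_lambda_beta; rule gform_commute[OF assms])

lemma tact_diagm: "tact T (diagm d) (diagm e) $ i $ i' $ j $ j' = d i * d i' * e j * e j' * T $ i $ i' $ j $ j'"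
  by (simp only: tact_def vec_lambda_beta column_diagm mform_scale mform_axis mult_ac)

lemma tact_nth: "tact T p q $ i $ i' $ j $ j' =
  (\<Sum>k\<in>UNIV. \<Sum>k'\<in>UNIV. \<Sum>l\<in>UNIV. \<Sum>l'\<in>UNIV. T $ k $ k' $ l $ l' * p $ k $ i * p $ k' $ i' * q $ l $ j * q $ l' $ j')"
  by (simp add: tact_def gform_def column_def)

lemma tendsto_tact:
  assumes "(T \<longlongrightarrow> T0) F" "(p \<longlongrightarrow> p0) F" "(q \<longlongrightarrow> q0) F"
  shows "((\<lambda>n. tact (T n) (p n) (q n)) \<longlongrightarrow> tact T0 p0 q0) F"
proof (intro vec_tendstoI)
  fix i i' j j'
  show "((\<lambda>n. tact (T n) (p n) (q n) $ i $ i' $ j $ j') \<longlongrightarrow> tact T0 p0 q0 $ i $ i' $ j $ j') F"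
    unfolding tact_nth by (intro tendsto_sum tendsto_mult tendsto_vec_nth assms)
qed

text \<open>36 is the number of summands: two indices with 2 values and two with 3.\<close>

lemma tact_bound:
  assumes "\<And>i i' j j'. norm (T $ i $ i' $ j $ j') \<le> B" "\<And>i j. norm (p $ i $ j) \<le> M" "\<And>i j. norm (q $ i $ j) \<le> M"
  shows "norm (tact T p q $ i $ i' $ j $ j') \<le> 36 * (B * M * M * M * M)"
proof -
  have M: "0 \<le> M" using assms(2)[of 1 1] norm_ge_zero order_trans by blast
  have B: "0 \<le> B" using assms(1)[of 1 1 1 1] norm_ge_zero order_trans by blast
  have "norm (tact T p q $ i $ i' $ j $ j') \<le> (\<Sum>k\<in>(UNIV::2 set). \<Sum>k'\<in>(UNIV::2 set). \<Sum>l\<in>(UNIV::3 set). \<Sum>l'\<in>(UNIV::3 set). B * M * M * M * M)"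
    unfolding tact_nth
    by (intro sum_norm_le) (auto simp: norm_mult intro!: mult_mono assms M B mult_nonneg_nonneg)
  then show ?thesis by simp
qed

section \<open>Orbits and stabilisers of forms and of tensors\<close>

lemma matrix_inv_unique:
  fixes a :: "complex ^ 'n ^ 'n"
  assumes "a ** b = mat 1" "b ** a = mat 1"
  shows "matrix_inv a = b"
proof -
  have "a ** matrix_inv a = mat 1 \<and> matrix_inv a ** a = mat 1"
    unfolding matrix_inv_def by (rule someI[of _ b]) (use assms in simp)
  then have "matrix_inv a = matrix_inv a ** (a ** b)" "matrix_inv a ** a = mat 1" by (simp_all add: assms)
  then show ?thesis by (simp add: matrix_mul_assoc)
qed

lemma matrix_inv_det_1:
  fixes a :: "complex ^ 'n ^ 'n"
  assumes "det a = 1"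
  shows "a ** matrix_inv a = mat 1" "matrix_inv a ** a = mat 1" "det (matrix_inv a) = 1" "matrix_inv (matrix_inv a) = a"
proof -
  obtain b where b: "a ** b = mat 1" "b ** a = mat 1" "det a * det b = 1"
    using mat_inverse_exists[of a] assms by auto
  have "matrix_inv a = b" "matrix_inv b = a" using matrix_inv_unique b by auto
  then show "a ** matrix_inv a = mat 1" "matrix_inv a ** a = mat 1" "det (matrix_inv a) = 1" "matrix_inv (matrix_inv a) = a"
    using b assms by auto
qed

lemma act_poly_of: "act g (poly_of T) = poly_of (tact T (matrix_inv (fst g)) (matrix_inv (snd g)))"
  by (rule eval2_inject) (simp only: eval2_act eval2_poly_of mform_tact)

lemma orbit_poly_of: "orbit (poly_of T) = poly_of ` torbit T"
proof
  show "orbit (poly_of T) \<subseteq> poly_of ` torbit T"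
  proof
    fix f assume "f \<in> orbit (poly_of T)"
    then obtain g where g: "det (fst g) = 1" "det (snd g) = 1" "f = act g (poly_of T)"
      by (auto simp: orbit_def SL23_def)
    then show "f \<in> poly_of ` torbit T"
      unfolding g(3) act_poly_of torbit_def
      by (intro imageI CollectI exI[of _ "matrix_inv (fst g)"] exI[of _ "matrix_inv (snd g)"]) (simp add: matrix_inv_det_1)
  qed
  show "poly_of ` torbit T \<subseteq> orbit (poly_of T)"
  proof
    fix f assume "f \<in> poly_of ` torbit T"
    then obtain p q where pq: "det p = 1" "det q = 1" "f = poly_of (tact T p q)"
      by (auto simp: torbit_def)
    then have "f = act (matrix_inv p, matrix_inv q) (poly_of T)"
      by (simp add: act_poly_of matrix_inv_det_1)
    moreover have "(matrix_inv p, matrix_inv q) \<in> SL23"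
      using pq by (simp add: SL23_def matrix_inv_det_1)
    ultimately show "f \<in> orbit (poly_of T)" by (auto simp: orbit_def)
  qed
qed

text \<open>Inversion in both factors is an involution that exchanges the two stabilisers.\<close>

lemma finite_stabilizer_iff:
  assumes "sym_tensor T"
  shows "finite {g \<in> SL23. act g (poly_of T) = poly_of T} \<longleftrightarrow> finite (tstab T)"
proof -
  let ?i = "\<lambda>g :: (complex ^ 2 ^ 2) \<times> (complex ^ 3 ^ 3). (matrix_inv (fst g), matrix_inv (snd g))"
  let ?S = "{g \<in> SL23. act g (poly_of T) = poly_of T}"
  have iff: "act g (poly_of T) = poly_of T \<longleftrightarrow> tact T (fst (?i g)) (snd (?i g)) = T" for g
    using poly_of_inject[OF sym_tact[OF assms] assms] by (auto simp: act_poly_of)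
  have 1: "?i g \<in> tstab T" if "g \<in> ?S" for g
    using that iff[of g] by (auto simp: tstab_def SL23_def matrix_inv_det_1)
  have 2: "?i g \<in> ?S" if "g \<in> tstab T" for g
    using that iff[of "?i g"] by (auto simp: tstab_def SL23_def matrix_inv_det_1)
  have 3: "?i (?i g) = g" if "g \<in> ?S \<or> g \<in> tstab T" for g
    using that by (auto simp: tstab_def SL23_def matrix_inv_det_1)
  have "tstab T \<subseteq> ?i ` ?S" using 2 3 by (metis (no_types, lifting) image_eqI subsetI)
  moreover have "?S \<subseteq> ?i ` tstab T" using 1 3 by (metis (no_types, lifting) image_eqI subsetI)
  ultimately show ?thesis by (meson finite_imageI finite_subset)
qed

text \<open>A continuous left inverse of the coefficient map, defined on all coefficient functions
  and not only on those of forms, so that its preimages are closed in the whole product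
  space.\<close>

definition tensor_of_coeffs :: "((2 + 3 \<Rightarrow>\<^sub>0 nat) \<Rightarrow> complex) \<Rightarrow> tensor" where
  "tensor_of_coeffs h = tens (\<lambda>x y. \<Sum>m\<in>mons. h m * (\<Prod>v\<in>UNIV. case_sum (($) x) (($) y) v ^ Poly_Mapping.lookup m v))"

lemma tensor_of_coeffs_lookup:
  assumes "sym_tensor T"
  shows "tensor_of_coeffs (Poly_Mapping.lookup (poly_of T)) = T"
proof -
  have "(\<Sum>m\<in>mons. Poly_Mapping.lookup (poly_of T) m * (\<Prod>v\<in>UNIV. case_sum (($) x) (($) y) v ^ Poly_Mapping.lookup m v)) = mform T x x y y" for x y
  proof -
    have "mform T x x y y = (\<Sum>m\<in>Poly_Mapping.keys (poly_of T). Poly_Mapping.lookup (poly_of T) m * (\<Prod>v\<in>UNIV. case_sum (($) x) (($) y) v ^ Poly_Mapping.lookup m v))"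
      unfolding eval2_poly_of[symmetric] eval2_def subst_poly_def by (rule refl)
    also have "\<dots> = (\<Sum>m\<in>mons. Poly_Mapping.lookup (poly_of T) m * (\<Prod>v\<in>UNIV. case_sum (($) x) (($) y) v ^ Poly_Mapping.lookup m v))"
      using poly_of_in_forms22[of T] unfolding forms22_iff
      by (intro sum.mono_neutral_left finite_mons) (auto simp: in_keys_iff)
    finally show ?thesis by simp
  qed
  then show ?thesis unfolding tensor_of_coeffs_def by (simp only: tens_mform[OF assms])
qed

lemma continuous_tensor_of_coeffs: "continuous_on UNIV tensor_of_coeffs"
  unfolding tensor_of_coeffs_def tens_def
  by (intro continuous_intros continuous_on_product_coordinates) simp_all

lemma continuous_lookup_poly_of: "continuous_on UNIV (\<lambda>T. Poly_Mapping.lookup (poly_of T))"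
proof (rule continuous_on_coordinatewise_then_product)
  fix m
  have "continuous_on UNIV (\<lambda>T :: tensor. if mon i i' j j' = m then T $ i $ i' $ j $ j' else 0)" for i i' j j'
    by (cases "mon i i' j j' = m") (auto intro!: continuous_intros)
  then show "continuous_on UNIV (\<lambda>T. Poly_Mapping.lookup (poly_of T) m)"
    unfolding lookup_poly_of by (intro continuous_on_sum)
qed

lemma closed_sym_tensor: "closed {T. sym_tensor T}"
  unfolding sym_tensor_def
  by (intro closed_Collect_all closed_Collect_conj closed_Collect_eq continuous_intros)

lemma torbit_sym: "sym_tensor T \<Longrightarrow> S \<in> torbit T \<Longrightarrow> sym_tensor S"
  by (auto simp: torbit_def sym_tact)

text \<open>Each orbit is the preimage of the other under a continuous map, cut down to a closed
  set: the symmetric tensors on one side, the coefficient functions of forms on the other.\<close>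

lemma closed_orbit_iff:
  assumes "sym_tensor T"
  shows "closed (Poly_Mapping.lookup ` orbit (poly_of T)) \<longleftrightarrow> closed (torbit T)"
proof
  let ?L = "\<lambda>T. Poly_Mapping.lookup (poly_of T)"
  have LO: "Poly_Mapping.lookup ` orbit (poly_of T) = ?L ` torbit T"
    by (simp add: orbit_poly_of image_image)
  {
    assume "closed (torbit T)"
    have "?L ` torbit T = {h. ?L (tensor_of_coeffs h) = h} \<inter> tensor_of_coeffs -` torbit T"
    proof
      show "{h. ?L (tensor_of_coeffs h) = h} \<inter> tensor_of_coeffs -` torbit T \<subseteq> ?L ` torbit T"
      proof
        fix h assume "h \<in> {h. ?L (tensor_of_coeffs h) = h} \<inter> tensor_of_coeffs -` torbit T"
        then show "h \<in> ?L ` torbit T" by (intro image_eqI[of _ _ "tensor_of_coeffs h"]) auto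
      qed
    qed (use torbit_sym[OF assms] in \<open>auto simp: tensor_of_coeffs_lookup\<close>)
    moreover have "closed {h. ?L (tensor_of_coeffs h) = h}"
      unfolding fun_eq_iff
      by (intro closed_Collect_all closed_Collect_eq continuous_on_product_coordinates
          continuous_on_compose2[OF continuous_on_product_then_coordinatewise[OF continuous_lookup_poly_of] continuous_tensor_of_coeffs]) auto
    moreover have "closed (tensor_of_coeffs -` torbit T)"
      using \<open>closed (torbit T)\<close> continuous_tensor_of_coeffs by (rule closed_vimage)
    ultimately show "closed (Poly_Mapping.lookup ` orbit (poly_of T))"
      unfolding LO by (simp add: closed_Int)
  }
  {
    assume *: "closed (Poly_Mapping.lookup ` orbit (poly_of T))"
    have "torbit T = {S. sym_tensor S} \<inter> ?L -` (?L ` torbit T)"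
    proof
      show "{S. sym_tensor S} \<inter> ?L -` (?L ` torbit T) \<subseteq> torbit T"
      proof
        fix S assume "S \<in> {S. sym_tensor S} \<inter> ?L -` (?L ` torbit T)"
        then obtain S' where "sym_tensor S" "S' \<in> torbit T" "?L S = ?L S'" by auto
        then have "S = S'" using tensor_of_coeffs_lookup torbit_sym[OF assms] by metis
        then show "S \<in> torbit T" using \<open>S' \<in> torbit T\<close> by simp
      qed
    qed (use torbit_sym[OF assms] in auto)
    moreover have "closed (?L -` (?L ` torbit T))"
      using * continuous_lookup_poly_of unfolding LO by (rule closed_vimage)
    ultimately show "closed (torbit T)" using closed_Int[OF closed_sym_tensor] by metis
  }
qed

lemma git_stable_iff:
  assumes "sym_tensor T"
  shows "git_stable (poly_of T) \<longleftrightarrow> closed (torbit T) \<and> finite (tstab T)"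
  unfolding git_stable_def closed_orbit_iff[OF assms] finite_stabilizer_iff[OF assms] ..

section \<open>The stabiliser and destabilising limits\<close>

lemma tstab_mult: "(p, q) \<in> tstab T \<Longrightarrow> (p', q') \<in> tstab T \<Longrightarrow> (p ** p', q ** q') \<in> tstab T"
  by (auto simp: tstab_def det_mul tact_tact[symmetric])

lemma tstab_inverse:
  assumes "(p, q) \<in> tstab T" "p ** p' = mat 1" "q ** q' = mat 1"
  shows "(p', q') \<in> tstab T"
proof -
  have pq: "det p = 1" "det q = 1" "tact T p q = T" using assms(1) by (auto simp: tstab_def)
  have "det (p ** p') = 1" "det (q ** q') = 1" by (simp_all add: assms)
  then have "det p' = 1" "det q' = 1" by (simp_all add: det_mul pq)
  moreover have "tact T p' q' = T"
    using tact_tact[of T p q p' q'] by (simp add: pq assms)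
  ultimately show ?thesis by (simp add: tstab_def)
qed

lemma destab_infinite_stabilizer:
  assumes "destab T" "closed (torbit T)"
  shows "infinite (tstab T)"
proof -
  obtain p q and r :: "2 \<Rightarrow> real" and s :: "3 \<Rightarrow> real" where pq: "det p \<noteq> 0" "det q \<noteq> 0" and sum0: "sum r UNIV = 0" "sum s UNIV = 0"
    and nz: "(\<exists>i. r i \<noteq> 0) \<or> (\<exists>j. s j \<noteq> 0)"
    and wt: "\<And>i i' j j'. tact T p q $ i $ i' $ j $ j' \<noteq> 0 \<Longrightarrow> r i + r i' + s j + s j' \<le> 0"
    using assms(1) unfolding destab_def by blast
  obtain pi where pi: "p ** pi = mat 1" "pi ** p = mat 1" "det p * det pi = 1"
    using mat_inverse_exists[OF pq(1)] by blast
  obtain qi where qi: "q ** qi = mat 1" "qi ** q = mat 1" "det q * det qi = 1"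
    using mat_inverse_exists[OF pq(2)] by blast
  define T' where "T' = tact T p q"
  \<comment> \<open>A sequence in the subgroup is enough: it produces the limit, and its members are
    already infinitely many.\<close>
  define D where "D n = diagm (\<lambda>i. exp (of_real (real n * r i)))" for n
  define E where "E n = diagm (\<lambda>j. exp (of_real (real n * s j)))" for n
  have det1: "det (D n) = 1" "det (E n) = 1" for n
    unfolding D_def E_def det_diagm
    by (simp_all flip: exp_sum of_real_sum sum_distrib_left add: sum0)
  have DE: "tact X (D n) (E n) $ i $ i' $ j $ j' = of_real (exp (r i + r i' + s j + s j') ^ n) * X $ i $ i' $ j $ j'" for X n i i' j j'
  proof -
    have "exp (r i + r i' + s j + s j') ^ n = exp (real n * r i) * exp (real n * r i') * exp (real n * s j) * exp (real n * s j')"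
      by (simp add: exp_of_nat_mult[symmetric] exp_add[symmetric] distrib_left)
    then show ?thesis
      unfolding D_def E_def tact_diagm exp_of_real by (simp only: of_real_mult)
  qed
  \<comment> \<open>Coefficients of positive weight are absent and those of negative weight tend to
    0, so the limit is the part of weight 0, which the subgroup fixes.\<close>
  define T0 :: tensor where "T0 = (\<chi> i i' j j'. if r i + r i' + s j + s j' = 0 then T' $ i $ i' $ j $ j' else 0)"
  have lim: "(\<lambda>n. tact T' (D n) (E n)) \<longlonglongrightarrow> T0"
  proof (intro vec_tendstoI)
    fix i i' j j'
    consider "T' $ i $ i' $ j $ j' = 0" | "r i + r i' + s j + s j' = 0" | "r i + r i' + s j + s j' < 0"
      using wt[of i i' j j'] by (fastforce simp: T'_def)
    then show "(\<lambda>n. tact T' (D n) (E n) $ i $ i' $ j $ j') \<longlonglongrightarrow> T0 $ i $ i' $ j $ j'"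
    proof cases
      case 3
      have "(\<lambda>n. exp (r i + r i' + s j + s j') ^ n) \<longlonglongrightarrow> 0"
        using 3 by (intro LIMSEQ_power_zero) simp
      then have "(\<lambda>n. complex_of_real (exp (r i + r i' + s j + s j') ^ n) * T' $ i $ i' $ j $ j') \<longlonglongrightarrow> of_real 0 * T' $ i $ i' $ j $ j'"
        by (intro tendsto_mult tendsto_of_real tendsto_const)
      then show ?thesis using 3 by (simp add: DE T0_def)
    qed (simp_all add: DE T0_def)
  qed
  define S0 where "S0 = tact T0 pi qi"
  have "(\<lambda>n. tact (tact T' (D n) (E n)) pi qi) \<longlonglongrightarrow> S0"
    unfolding S0_def by (intro tendsto_tact lim tendsto_const)
  moreover have "tact (tact T' (D n) (E n)) pi qi \<in> torbit T" for n
  proof -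
    have "tact (tact T' (D n) (E n)) pi qi = tact T (p ** D n ** pi) (q ** E n ** qi)"
      by (simp add: T'_def tact_tact)
    moreover have "det (p ** D n ** pi) = 1" "det (q ** E n ** qi) = 1"
      using pi(3) qi(3) by (simp_all add: det_mul det1)
    ultimately show ?thesis unfolding torbit_def by blast
  qed
  ultimately have "S0 \<in> torbit T"
    using closed_sequentially[OF assms(2), of "\<lambda>n. tact (tact T' (D n) (E n)) pi qi" S0] by simp
  then obtain a b where ab: "det a = 1" "det b = 1" "S0 = tact T a b" by (auto simp: torbit_def)
  obtain ai where ai: "a ** ai = mat 1" "ai ** a = mat 1" using mat_inverse_exists[of a] ab(1) by auto
  obtain bi where bi: "b ** bi = mat 1" "bi ** b = mat 1" using mat_inverse_exists[of b] ab(2) by auto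
  have T0_fixed: "tact T0 (D n) (E n) = T0" for n
    by (auto simp: vec_eq_iff DE T0_def)
  \<comment> \<open>The subgroup, conjugated from the adapted basis to the original one and then
    from the limit back to \<open>T\<close>.\<close>
  define g where "g n = (a ** p ** D n ** pi ** ai, b ** q ** E n ** qi ** bi)" for n
  have "g n \<in> tstab T" for n
  proof -
    have "det (pi) * det p = 1" "det qi * det q = 1" using pi(3) qi(3) by (simp_all add: mult.commute)
    moreover have "det (a ** ai) = 1" "det (b ** bi) = 1" by (simp_all add: ai bi)
    then have "det ai = 1" "det bi = 1" by (simp_all add: det_mul ab)
    ultimately have "det (fst (g n)) = 1" "det (snd (g n)) = 1"
      using pi(3) qi(3) by (simp_all add: g_def det_mul ab det1)
    moreover have "tact T (fst (g n)) (snd (g n)) = T"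
    proof -
      have "tact T (fst (g n)) (snd (g n)) = tact (tact (tact (tact (tact T a b) p q) (D n) (E n)) pi qi) ai bi"
        by (simp add: g_def tact_tact)
      also have "tact (tact T a b) p q = T0"
        unfolding ab(3)[symmetric] S0_def by (simp add: tact_tact pi qi)
      also have "tact (tact (tact T0 (D n) (E n)) pi qi) ai bi = tact (tact T a b) ai bi"
        unfolding T0_fixed ab(3)[symmetric] S0_def by (rule refl)
      also have "\<dots> = T" by (simp add: tact_tact ai bi)
      finally show ?thesis .
    qed
    ultimately show ?thesis by (simp add: tstab_def case_prod_beta)
  qed
  moreover have "inj g"
  proof (rule injI)
    fix n m assume "g n = g m"
    have D: "D k = pi ** (ai ** fst (g k) ** a) ** p" for k
    proof -
      have "pi ** (ai ** fst (g k) ** a) ** p = (pi ** (ai ** a) ** p) ** D k ** (pi ** (ai ** a) ** p)"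
        by (simp add: g_def matrix_mul_assoc)
      then show ?thesis by (simp add: ai pi)
    qed
    have E: "E k = qi ** (bi ** snd (g k) ** b) ** q" for k
    proof -
      have "qi ** (bi ** snd (g k) ** b) ** q = (qi ** (bi ** b) ** q) ** E k ** (qi ** (bi ** b) ** q)"
        by (simp add: g_def matrix_mul_assoc)
      then show ?thesis by (simp add: bi qi)
    qed
    have "D n = D m" "E n = E m" unfolding D[of n] D[of m] E[of n] E[of m] \<open>g n = g m\<close> by (rule refl)+
    then have "D n $ i $ i = D m $ i $ i" "E n $ j $ j = E m $ j $ j" for i j by simp_all
    \<comment> \<open>The real exponential is injective, so any nonzero weight separates the
      exponents.\<close>
    then have "real n * r i = real m * r i" "real n * s j = real m * s j" for i j
      by (simp_all add: D_def E_def diagm_def exp_of_real del: of_real_mult)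
    then show "n = m" using nz by auto
  qed
  ultimately show ?thesis
    using finite_subset[of "range g" "tstab T"] range_inj_infinite[of g] by blast
qed

section \<open>Norm estimates and properness of the orbit map\<close>

lemma vec_norm_le_sum: "norm (x :: 'a::real_normed_vector ^ 'n) \<le> (\<Sum>i\<in>UNIV. norm (x $ i))"
  by (simp add: norm_vec_def L2_set_le_sum)

lemma matrix_norm_le:
  fixes a :: "complex ^ 'n ^ 'm"
  assumes "\<And>i j. norm (a $ i $ j) \<le> C"
  shows "norm a \<le> real CARD('m) * (real CARD('n) * C)"
proof -
  have "norm (a $ i) \<le> real CARD('n) * C" for i
  proof -
    have "norm (a $ i) \<le> (\<Sum>j\<in>UNIV. norm (a $ i $ j))" by (rule vec_norm_le_sum)
    also have "\<dots> \<le> (\<Sum>j\<in>(UNIV::'n set). C)" by (intro sum_mono assms)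
    finally show ?thesis by simp
  qed
  then have "(\<Sum>i\<in>UNIV. norm (a $ i)) \<le> (\<Sum>i\<in>(UNIV::'m set). real CARD('n) * C)" by (intro sum_mono)
  then show ?thesis using vec_norm_le_sum[of a] by simp
qed

lemma matrix_vector_norm_le:
  fixes a :: "complex ^ 'n ^ 'm"
  assumes "\<And>i j. norm (a $ i $ j) \<le> C"
  shows "norm (a *v w) \<le> real CARD('m) * (real CARD('n) * C) * norm w"
proof -
  have "0 \<le> C" using order_trans[OF norm_ge_zero assms] .
  have "norm ((a *v w) $ i) \<le> real CARD('n) * C * norm w" for i
  proof -
    have "norm ((a *v w) $ i) \<le> (\<Sum>j\<in>UNIV. norm (a $ i $ j * w $ j))"
      unfolding matrix_vector_mult_def by (simp add: norm_sum)
    also have "\<dots> \<le> (\<Sum>j\<in>(UNIV::'n set). C * norm w)"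
      unfolding norm_mult using assms \<open>0 \<le> C\<close>
      by (intro sum_mono mult_mono Finite_Cartesian_Product.norm_nth_le) auto
    finally show ?thesis by simp
  qed
  then have "(\<Sum>i\<in>UNIV. norm ((a *v w) $ i)) \<le> (\<Sum>i\<in>(UNIV::'m set). real CARD('n) * C * norm w)" by (intro sum_mono)
  then show ?thesis using vec_norm_le_sum[of "a *v w"] by (simp add: mult.assoc)
qed

lemma tendsto_det:
  fixes a :: "'a \<Rightarrow> complex ^ 'n ^ 'n"
  assumes "(a \<longlongrightarrow> a0) F"
  shows "((\<lambda>n. det (a n)) \<longlongrightarrow> det a0) F"
  unfolding det_def by (intro tendsto_sum tendsto_mult tendsto_const tendsto_prod tendsto_vec_nth assms)

lemma bounded_unit_bounded: "bounded (unit_bounded :: (complex ^ 'n ^ 'n) set)"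
  unfolding bounded_iff using matrix_norm_le by (fastforce simp: unit_bounded_def)

lemma bounded_unit_cube: "bounded {v :: real ^ 'n. \<forall>i. \<bar>v $ i\<bar> \<le> 1}"
proof -
  have "norm v \<le> real CARD('n)" if "\<forall>i. \<bar>v $ i\<bar> \<le> 1" for v :: "real ^ 'n"
  proof -
    have "(\<Sum>i\<in>UNIV. norm (v $ i)) \<le> (\<Sum>i\<in>(UNIV::'n set). 1)" using that by (intro sum_mono) simp
    then show ?thesis using vec_norm_le_sum[of v] by simp
  qed
  then show ?thesis unfolding bounded_iff by blast
qed

text \<open>The factors \<open>a\<close> and \<open>b\<close> contribute norm 1 to the determinant,
  so the logarithms sum to 0. Since the entries of \<open>a\<close> and \<open>b\<close> are
  bounded, \<open>g\<close> can be large only if these logarithms are.\<close>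

lemma log_weights:
  fixes d :: "'n::finite \<Rightarrow> complex"
  assumes "det g = 1" "g = a ** diagm d ** b" "a \<in> unit_bounded" "b \<in> unit_bounded"
  shows "(\<Sum>i\<in>UNIV. ln (norm (d i))) = 0" "\<And>i. d i \<noteq> 0"
    "\<And>i j. norm (g $ i $ j) \<le> real CARD('n) * exp (\<Sum>i\<in>UNIV. \<bar>ln (norm (d i))\<bar>)"
proof -
  have "norm (det g) = norm (\<Prod>i\<in>UNIV. d i)"
    using assms(3,4) by (simp add: assms(2) det_mul det_diagm norm_mult unit_bounded_def)
  then have prod: "(\<Prod>i\<in>UNIV. norm (d i)) = 1" by (simp add: assms(1) prod_norm)
  show nz: "d i \<noteq> 0" for i
  proof
    assume "d i = 0"
    then have "(\<Prod>i\<in>UNIV. norm (d i)) = 0" by (intro prod_zero) auto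
    then show False using prod by simp
  qed
  show "(\<Sum>i\<in>UNIV. ln (norm (d i))) = 0"
    using prod nz by (simp flip: ln_prod)
  show "norm (g $ i $ j) \<le> real CARD('n) * exp (\<Sum>i\<in>UNIV. \<bar>ln (norm (d i))\<bar>)" for i j
  proof -
    have d: "norm (d k) \<le> exp (\<Sum>i\<in>UNIV. \<bar>ln (norm (d i))\<bar>)" for k
    proof -
      have "norm (d k) = exp (ln (norm (d k)))" using nz by simp
      also have "\<dots> \<le> exp (\<Sum>i\<in>UNIV. \<bar>ln (norm (d i))\<bar>)"
        using member_le_sum[of k UNIV "\<lambda>i. \<bar>ln (norm (d i))\<bar>"] by simp
      finally show ?thesis .
    qed
    have "norm (g $ i $ j) \<le> (\<Sum>k\<in>UNIV. norm (a $ i $ k * d k * b $ k $ j))"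
      unfolding assms(2) mult_diagm_mult_nth by (rule norm_sum)
    also have "\<dots> \<le> (\<Sum>k\<in>(UNIV::'n set). 1 * exp (\<Sum>i\<in>UNIV. \<bar>ln (norm (d i))\<bar>) * 1)"
      unfolding norm_mult using assms(3,4)
      by (intro sum_mono mult_mono d) (auto simp: unit_bounded_def)
    finally show ?thesis by simp
  qed
qed

text \<open>Suppose the group elements are unbounded while the transformed tensors stay bounded. The
  right bounded factors can be undone at the cost of a constant, so an entry of the tensor moved by
  the left factor is at most a constant times exp of minus its weight. Dividing the weights by their
  total size, which tends to infinity, and passing to a limit gives weights that are nonpositive
  wherever the limit tensor has a nonzero entry.\<close>

lemma orbit_map_proper:
  assumes "\<not> destab T"
  shows "\<exists>C. \<forall>p q. det p = 1 \<longrightarrow> det q = 1 \<longrightarrow> (\<forall>i i' j j'. norm (tact T p q $ i $ i' $ j $ j') \<le> B) \<longrightarrow>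
    (\<forall>i j. norm (p $ i $ j) \<le> C) \<and> (\<forall>i j. norm (q $ i $ j) \<le> C)"
proof (rule ccontr)
  assume "\<not> ?thesis"
  then have "\<forall>n::nat. \<exists>pq. det (fst pq) = 1 \<and> det (snd pq) = 1 \<and> (\<forall>i i' j j'. norm (tact T (fst pq) (snd pq) $ i $ i' $ j $ j') \<le> B) \<and>
    ((\<exists>i j. real n < norm (fst pq $ i $ j)) \<or> (\<exists>i j. real n < norm (snd pq $ i $ j)))"
    by (auto simp: not_le)
  then obtain g where g: "\<And>n. det (fst (g n)) = 1" "\<And>n. det (snd (g n)) = 1"
    "\<And>n i i' j j'. norm (tact T (fst (g n)) (snd (g n)) $ i $ i' $ j $ j') \<le> B"
    "\<And>n. (\<exists>i j. real n < norm (fst (g n) $ i $ j)) \<or> (\<exists>i j. real n < norm (snd (g n) $ i $ j))"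
    by metis
  have "\<forall>n. \<exists>z. fst z \<in> unit_bounded \<and> fst (snd z) \<in> unit_bounded \<and> fst (g n) = fst z ** diagm (snd (snd z)) ** fst (snd z)"
    using bounded_factorization2 by (metis fst_conv snd_conv)
  then obtain z1 where z1: "\<And>n. fst (z1 n) \<in> unit_bounded" "\<And>n. fst (snd (z1 n)) \<in> unit_bounded"
    "\<And>n. fst (g n) = fst (z1 n) ** diagm (snd (snd (z1 n))) ** fst (snd (z1 n))" by metis
  have "\<forall>n. \<exists>z. fst z \<in> unit_bounded \<and> fst (snd z) \<in> unit_bounded \<and> snd (g n) = fst z ** diagm (snd (snd z)) ** fst (snd z)"
    using bounded_factorization3 by (metis fst_conv snd_conv)
  then obtain z2 where z2: "\<And>n. fst (z2 n) \<in> unit_bounded" "\<And>n. fst (snd (z2 n)) \<in> unit_bounded"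
    "\<And>n. snd (g n) = fst (z2 n) ** diagm (snd (snd (z2 n))) ** fst (snd (z2 n))" by metis
  define a1 b1 d1 where "a1 n = fst (z1 n)" "b1 n = fst (snd (z1 n))" "d1 n = snd (snd (z1 n))" for n
  define a2 b2 d2 where "a2 n = fst (z2 n)" "b2 n = fst (snd (z2 n))" "d2 n = snd (snd (z2 n))" for n
  note defs = a1_b1_d1_def a2_b2_d2_def
  define \<rho> where "\<rho> n i = ln (norm (d1 n i))" for n i
  define \<sigma> where "\<sigma> n i = ln (norm (d2 n i))" for n i
  \<comment> \<open>Total size of the logarithmic weights. It controls the size of the group
    elements and hence tends to infinity.\<close>
  define N where "N n = (\<Sum>i\<in>UNIV. \<bar>\<rho> n i\<bar>) + (\<Sum>i\<in>UNIV. \<bar>\<sigma> n i\<bar>)" for n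
  note w1 = log_weights[OF g(1) z1(3) z1(1) z1(2), folded defs, folded \<rho>_def]
  note w2 = log_weights[OF g(2) z2(3) z2(1) z2(2), folded defs, folded \<sigma>_def]
  have N: "real n < 3 * exp (N n)" for n
  proof -
    have "(\<Sum>i\<in>UNIV. \<bar>\<rho> n i\<bar>) \<le> N n" "(\<Sum>i\<in>UNIV. \<bar>\<sigma> n i\<bar>) \<le> N n"
      by (simp_all add: N_def sum_nonneg)
    then have "2 * exp (\<Sum>i\<in>UNIV. \<bar>\<rho> n i\<bar>) \<le> 3 * exp (N n)" "3 * exp (\<Sum>i\<in>UNIV. \<bar>\<sigma> n i\<bar>) \<le> 3 * exp (N n)"
      by (auto intro!: mult_mono)
    moreover have "norm (fst (g n) $ i $ j) \<le> 2 * exp (\<Sum>i\<in>UNIV. \<bar>\<rho> n i\<bar>)" for i j using w1(3)[of n i j] by simp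
    moreover have "norm (snd (g n) $ i $ j) \<le> 3 * exp (\<Sum>i\<in>UNIV. \<bar>\<sigma> n i\<bar>)" for i j using w2(3)[of n i j] by simp
    ultimately show ?thesis using g(4)[of n] by (meson order_less_le_trans)
  qed
  have N_lim: "filterlim N at_top sequentially"
    unfolding filterlim_at_top
  proof
    fix K
    obtain n0 :: nat where n0: "3 * exp K < real n0" using reals_Archimedean2 by blast
    have "K \<le> N n" if "n \<ge> n0" for n
    proof -
      have "3 * exp K < 3 * exp (N n)" using N[of n] n0 that by (smt (verit) of_nat_mono)
      then show ?thesis by simp
    qed
    then show "\<forall>\<^sub>F n in sequentially. K \<le> N n" by (auto simp: eventually_sequentially)
  qed
  define X where "X n = tact T (a1 n) (a2 n)" for n
  \<comment> \<open>The inverses of the right factors have entries of norm at most 3! = 6, and each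
    of the 36 summands of the action involves four such entries.\<close>
  define B' where "B' = 36 * (B * 6 * 6 * 6 * 6)"
  have X_bound: "norm (X n $ i $ i' $ j $ j') * exp (\<rho> n i + \<rho> n i' + \<sigma> n j + \<sigma> n j') \<le> B'" for n i i' j j'
  proof -
    obtain b1i where b1i: "b1 n ** b1i = mat 1" "\<And>i j. norm (b1i $ i $ j) \<le> fact CARD(2)"
      using unit_bounded_inverse[OF z1(2)[of n]] unfolding defs by blast
    obtain b2i where b2i: "b2 n ** b2i = mat 1" "\<And>i j. norm (b2i $ i $ j) \<le> fact CARD(3)"
      using unit_bounded_inverse[OF z2(2)[of n]] unfolding defs by blast
    have 6: "fact CARD(2) \<le> (6::real)" "fact CARD(3) \<le> (6::real)" by (simp_all add: fact_numeral)
    have "tact (X n) (diagm (d1 n)) (diagm (d2 n)) = tact (tact T (fst (g n)) (snd (g n))) b1i b2i"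
    proof -
      have "tact (tact T (fst (g n)) (snd (g n))) b1i b2i =
        tact T (a1 n ** diagm (d1 n) ** (b1 n ** b1i)) (a2 n ** diagm (d2 n) ** (b2 n ** b2i))"
        unfolding z1(3)[of n] z2(3)[of n] defs tact_tact by (simp only: matrix_mul_assoc)
      then show ?thesis by (simp add: b1i b2i X_def tact_tact)
    qed
    moreover have "norm (tact (tact T (fst (g n)) (snd (g n))) b1i b2i $ i $ i' $ j $ j') \<le> B'"
      unfolding B'_def using b1i(2) b2i(2) 6 by (intro tact_bound g(3)) (meson order_trans)+
    ultimately have "norm (tact (X n) (diagm (d1 n)) (diagm (d2 n)) $ i $ i' $ j $ j') \<le> B'"
      by simp
    then have "norm (d1 n i * d1 n i' * d2 n j * d2 n j' * X n $ i $ i' $ j $ j') \<le> B'"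
      unfolding tact_diagm .
    moreover have "norm (d1 n k) = exp (\<rho> n k)" "norm (d2 n l) = exp (\<sigma> n l)" for k l
      using w1(2)[of n k] w2(2)[of n l] by (simp_all add: \<rho>_def \<sigma>_def)
    ultimately show ?thesis by (simp add: norm_mult exp_add mult_ac)
  qed
  \<comment> \<open>Group factors and normalised weights together lie in a bounded set, so one
    subsequence serves for all of them.\<close>
  define z where "z n = (a1 n, a2 n, (\<chi> i. \<rho> n i / N n) :: real ^ 2, (\<chi> j. \<sigma> n j / N n) :: real ^ 3)" for n
  have le: "\<bar>\<rho> n i\<bar> \<le> N n" "\<bar>\<sigma> n j\<bar> \<le> N n" for n i j
    using member_le_sum[of i UNIV "\<lambda>i. \<bar>\<rho> n i\<bar>"] member_le_sum[of j UNIV "\<lambda>i. \<bar>\<sigma> n i\<bar>"]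
      sum_nonneg[of UNIV "\<lambda>i. \<bar>\<rho> n i\<bar>"] sum_nonneg[of UNIV "\<lambda>i. \<bar>\<sigma> n i\<bar>"] by (auto simp: N_def)
  then have N0: "N n \<ge> 0" for n by (meson abs_ge_zero order_trans)
  have le1: "\<bar>\<rho> n i / N n\<bar> \<le> 1" "\<bar>\<sigma> n j / N n\<bar> \<le> 1" for n i j
    using le(1)[of n i] le(2)[of n j] N0[of n] by (auto simp: abs_divide divide_le_eq_1 less_le)
  have "range z \<subseteq> unit_bounded \<times> unit_bounded \<times> {v. \<forall>i. \<bar>v $ i\<bar> \<le> 1} \<times> {v. \<forall>i. \<bar>v $ i\<bar> \<le> 1}"
    using z1(1) z2(1) le1 by (auto simp: z_def defs)
  then have "bounded (range z)"
    by (rule bounded_subset[rotated]) (intro bounded_Times bounded_unit_bounded bounded_unit_cube)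
  then obtain l f where f: "strict_mono f" and l: "(z \<circ> f) \<longlonglongrightarrow> l"
    using bounded_imp_convergent_subsequence by blast
  define A1 A2 R S where "A1 = fst l" "A2 = fst (snd l)" "R = fst (snd (snd l))" "S = snd (snd (snd l))"
  have lims: "(\<lambda>n. a1 (f n)) \<longlonglongrightarrow> A1" "(\<lambda>n. a2 (f n)) \<longlonglongrightarrow> A2"
    "(\<lambda>n. (\<chi> i. \<rho> (f n) i / N (f n)) :: real ^ 2) \<longlonglongrightarrow> R" "(\<lambda>n. (\<chi> j. \<sigma> (f n) j / N (f n)) :: real ^ 3) \<longlonglongrightarrow> S"
    using tendsto_fst[OF l] tendsto_fst[OF tendsto_snd[OF l]] tendsto_fst[OF tendsto_snd[OF tendsto_snd[OF l]]]
      tendsto_snd[OF tendsto_snd[OF tendsto_snd[OF l]]]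
    by (simp_all add: z_def o_def A1_A2_R_S_def)
  have R: "(\<lambda>n. \<rho> (f n) i / N (f n)) \<longlonglongrightarrow> R $ i" for i using tendsto_vec_nth[OF lims(3), of i] by simp
  have S: "(\<lambda>n. \<sigma> (f n) i / N (f n)) \<longlonglongrightarrow> S $ i" for i using tendsto_vec_nth[OF lims(4), of i] by simp
  have Nf: "filterlim (\<lambda>n. N (f n)) at_top sequentially"
    using filterlim_compose[OF N_lim filterlim_subseq[OF f]] .
  have "norm (det A1) = 1" "norm (det A2) = 1"
  proof -
    have "(\<lambda>n. norm (det (a1 (f n)))) \<longlonglongrightarrow> norm (det A1)" "(\<lambda>n. norm (det (a2 (f n)))) \<longlonglongrightarrow> norm (det A2)"
      by (intro tendsto_norm tendsto_det lims)+
    moreover have "norm (det (a1 n)) = 1" "norm (det (a2 n)) = 1" for n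
      using z1(1)[of n] z2(1)[of n] by (simp_all add: unit_bounded_def defs)
    ultimately show "norm (det A1) = 1" "norm (det A2) = 1"
      by (simp_all add: LIMSEQ_const_iff)
  qed
  then have det: "det A1 \<noteq> 0" "det A2 \<noteq> 0" by auto
  have "(\<lambda>n. \<Sum>i\<in>UNIV. \<rho> (f n) i / N (f n)) \<longlonglongrightarrow> (\<Sum>i\<in>UNIV. R $ i)" by (intro tendsto_sum R)
  then have R0: "(\<Sum>i\<in>UNIV. R $ i) = 0"
    by (simp add: sum_divide_distrib[symmetric] w1(1) LIMSEQ_const_iff)
  have "(\<lambda>n. \<Sum>i\<in>UNIV. \<sigma> (f n) i / N (f n)) \<longlonglongrightarrow> (\<Sum>i\<in>UNIV. S $ i)" by (intro tendsto_sum S)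
  then have S0: "(\<Sum>i\<in>UNIV. S $ i) = 0"
    by (simp add: sum_divide_distrib[symmetric] w2(1) LIMSEQ_const_iff)
  have pos: "\<forall>\<^sub>F n in sequentially. N (f n) > 0"
    using Nf by (simp add: filterlim_at_top_dense)
  \<comment> \<open>The absolute values of the normalised weights sum to 1, and this persists in the
    limit.\<close>
  have nz: "(\<exists>i. R $ i \<noteq> 0) \<or> (\<exists>j. S $ j \<noteq> 0)"
  proof -
    have "(\<lambda>n. (\<Sum>i\<in>UNIV. \<bar>\<rho> (f n) i / N (f n)\<bar>) + (\<Sum>i\<in>UNIV. \<bar>\<sigma> (f n) i / N (f n)\<bar>)) \<longlonglongrightarrow> (\<Sum>i\<in>UNIV. \<bar>R $ i\<bar>) + (\<Sum>i\<in>UNIV. \<bar>S $ i\<bar>)"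
      by (intro tendsto_add tendsto_sum tendsto_rabs R S)
    moreover have "\<forall>\<^sub>F n in sequentially. (\<Sum>i\<in>UNIV. \<bar>\<rho> (f n) i / N (f n)\<bar>) + (\<Sum>i\<in>UNIV. \<bar>\<sigma> (f n) i / N (f n)\<bar>) = 1"
      using pos
    proof eventually_elim
      case (elim n)
      then have "(\<Sum>i\<in>UNIV. \<bar>\<rho> (f n) i / N (f n)\<bar>) + (\<Sum>i\<in>UNIV. \<bar>\<sigma> (f n) i / N (f n)\<bar>) = N (f n) / N (f n)"
      proof -
        have "(\<Sum>i\<in>UNIV. \<bar>\<rho> (f n) i / N (f n)\<bar>) = (\<Sum>i\<in>UNIV. \<bar>\<rho> (f n) i\<bar>) / N (f n)"
          "(\<Sum>i\<in>UNIV. \<bar>\<sigma> (f n) i / N (f n)\<bar>) = (\<Sum>i\<in>UNIV. \<bar>\<sigma> (f n) i\<bar>) / N (f n)"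
          using elim by (simp_all add: abs_divide sum_divide_distrib)
        then show ?thesis by (simp only: add_divide_distrib[symmetric] N_def[symmetric])
      qed
      then show ?case using elim by simp
    qed
    ultimately have "(\<lambda>n. 1::real) \<longlonglongrightarrow> (\<Sum>i\<in>UNIV. \<bar>R $ i\<bar>) + (\<Sum>i\<in>UNIV. \<bar>S $ i\<bar>)"
      by (rule Lim_transform_eventually)
    then have "(\<Sum>i\<in>UNIV. \<bar>R $ i\<bar>) + (\<Sum>i\<in>UNIV. \<bar>S $ i\<bar>) = 1" by (simp add: LIMSEQ_const_iff)
    then show ?thesis by (rule contrapos_pp) simp
  qed
  have "R $ i + R $ i' + S $ j + S $ j' \<le> 0" if "tact T A1 A2 $ i $ i' $ j $ j' \<noteq> 0" for i i' j j'
  proof -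
    define \<epsilon> where "\<epsilon> = norm (tact T A1 A2 $ i $ i' $ j $ j') / 2"
    have \<epsilon>: "\<epsilon> > 0" using that by (simp add: \<epsilon>_def)
    have "(\<lambda>n. norm (X (f n) $ i $ i' $ j $ j')) \<longlonglongrightarrow> norm (tact T A1 A2 $ i $ i' $ j $ j')"
      unfolding X_def by (intro tendsto_norm tendsto_vec_nth tendsto_tact tendsto_const lims)
    then have ev: "\<forall>\<^sub>F n in sequentially. \<epsilon> < norm (X (f n) $ i $ i' $ j $ j')"
      by (rule order_tendstoD) (use that in \<open>simp add: \<epsilon>_def\<close>)
    \<comment> \<open>Where the entry stays away from 0 its weight is bounded above, so after
      division by \<open>N\<close> the limit is at most 0.\<close>
    define w where "w n = \<rho> n i + \<rho> n i' + \<sigma> n j + \<sigma> n j'" for n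
    have "\<forall>\<^sub>F n in sequentially. w (f n) / N (f n) \<le> \<bar>ln (B' / \<epsilon>)\<bar> / N (f n)"
      using ev pos
    proof eventually_elim
      case (elim n)
      have "\<epsilon> * exp (w (f n)) \<le> norm (X (f n) $ i $ i' $ j $ j') * exp (w (f n))"
        using elim(1) by (intro mult_right_mono) auto
      also have "\<dots> \<le> B'" unfolding w_def by (rule X_bound)
      finally have exp_le: "exp (w (f n)) \<le> B' / \<epsilon>"
        using \<epsilon> by (simp add: pos_le_divide_eq mult.commute)
      then have "w (f n) \<le> ln (B' / \<epsilon>)"
        using ln_ge_iff[OF order_less_le_trans[OF exp_gt_zero exp_le]] by simp
      then have "w (f n) \<le> \<bar>ln (B' / \<epsilon>)\<bar>" by linarith
      then show ?case using elim(2) by (intro divide_right_mono) simp_all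
    qed
    note ev_le = this
    have lim_w: "(\<lambda>n. w (f n) / N (f n)) \<longlonglongrightarrow> R $ i + R $ i' + S $ j + S $ j'"
      unfolding w_def add_divide_distrib by (intro tendsto_add R S)
    have "(\<lambda>n. \<bar>ln (B' / \<epsilon>)\<bar> / N (f n)) \<longlonglongrightarrow> 0"
      by (rule real_tendsto_divide_at_top[OF tendsto_const Nf])
    then show ?thesis
      by (rule tendsto_le[OF trivial_limit_sequentially _ lim_w ev_le])
  qed
  then have "destab T"
    unfolding destab_def using det R0 S0 nz by (intro exI[of _ A1] exI[of _ A2] exI[of _ "($) R"] exI[of _ "($) S"]) blast
  then show False using assms by simp
qed

section \<open>Closed orbits\<close>

lemma tensor_comp_le: "norm (T $ i $ i' $ j $ j') \<le> norm (T :: tensor)"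
proof -
  have "norm (T $ i $ i' $ j $ j') \<le> norm (T $ i $ i' $ j)" by (rule Finite_Cartesian_Product.norm_nth_le)
  also have "\<dots> \<le> norm (T $ i $ i')" by (rule Finite_Cartesian_Product.norm_nth_le)
  also have "\<dots> \<le> norm (T $ i)" by (rule Finite_Cartesian_Product.norm_nth_le)
  also have "\<dots> \<le> norm T" by (rule Finite_Cartesian_Product.norm_nth_le)
  finally show ?thesis .
qed

text \<open>A convergent sequence in the orbit is bounded, so properness bounds the group elements,
  and a subsequence of them converges to elements of determinant 1.\<close>

lemma closed_torbit:
  assumes "\<not> destab T"
  shows "closed (torbit T)"
  unfolding closed_sequential_limits
proof (intro allI impI, elim conjE)
  fix x l assume x: "\<forall>n. x n \<in> torbit T" and l: "x \<longlonglongrightarrow> l"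
  have "\<forall>n. \<exists>g. x n = tact T (fst g) (snd g) \<and> det (fst g) = 1 \<and> det (snd g) = 1"
    using x unfolding torbit_def by fastforce
  then obtain g where g: "\<And>n. x n = tact T (fst (g n)) (snd (g n))" "\<And>n. det (fst (g n)) = 1" "\<And>n. det (snd (g n)) = 1"
    by metis
  obtain B where B: "\<And>n. norm (x n) \<le> B"
    using convergent_imp_bounded[OF l] unfolding bounded_iff by auto
  obtain C where C: "\<And>p q. det p = 1 \<Longrightarrow> det q = 1 \<Longrightarrow> (\<forall>i i' j j'. norm (tact T p q $ i $ i' $ j $ j') \<le> B) \<Longrightarrow>
    (\<forall>i j. norm (p $ i $ j) \<le> C) \<and> (\<forall>i j. norm (q $ i $ j) \<le> C)"
    using orbit_map_proper[OF assms] by blast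
  have entries: "(\<forall>i j. norm (fst (g n) $ i $ j) \<le> C) \<and> (\<forall>i j. norm (snd (g n) $ i $ j) \<le> C)" for n
    using order_trans[OF tensor_comp_le B]
    by (intro C g(2,3)) (simp add: g(1)[symmetric])
  have "norm (g n) \<le> 2 * (2 * C) + 3 * (3 * C)" for n
    using norm_Pair_le[of "fst (g n)" "snd (g n)"] matrix_norm_le[of "fst (g n)" C] matrix_norm_le[of "snd (g n)" C] entries[of n]
    by simp
  then have "bounded (range g)" unfolding bounded_iff by auto
  then obtain l' f where f: "strict_mono f" "(g \<circ> f) \<longlonglongrightarrow> l'"
    using bounded_imp_convergent_subsequence by blast
  have l1: "(\<lambda>n. fst (g (f n))) \<longlonglongrightarrow> fst l'" and l2: "(\<lambda>n. snd (g (f n))) \<longlonglongrightarrow> snd l'"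
    using tendsto_fst[OF f(2)] tendsto_snd[OF f(2)] by (simp_all add: o_def)
  have "(\<lambda>n. x (f n)) \<longlonglongrightarrow> tact T (fst l') (snd l')"
    unfolding g(1) by (intro tendsto_tact tendsto_const l1 l2)
  moreover have "(\<lambda>n. x (f n)) \<longlonglongrightarrow> l"
    using LIMSEQ_subseq_LIMSEQ[OF l f(1)] by (simp add: o_def)
  ultimately have "l = tact T (fst l') (snd l')" by (rule LIMSEQ_unique[rotated])
  moreover have "det (fst l') = 1" "det (snd l') = 1"
    using tendsto_det[OF l1] tendsto_det[OF l2] by (simp_all add: g LIMSEQ_const_iff)
  ultimately show "l \<in> torbit T" unfolding torbit_def by blast
qed

section \<open>Finiteness of the stabiliser\<close>

lemma mult_axis: "a *v axis k (1::complex) = column k a"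
proof -
  have "(\<Sum>j\<in>UNIV. a $ i $ j * axis k 1 $ j) = (\<Sum>j\<in>UNIV. if j = k then a $ i $ j else 0)" for i
    by (intro sum.cong) (auto simp: axis_def)
  then show ?thesis by (simp add: vec_eq_iff matrix_vector_mult_def column_def)
qed

text \<open>A column of \<open>P\<close> is an eigenvector that h - 1 multiplies by d k - 1, and the
  entries of h - 1 bound this factor.\<close>

lemma eigenvalue_near_1:
  fixes h :: "complex ^ 'n ^ 'n"
  assumes "det P \<noteq> 0" "h ** P = P ** diagm d" "\<And>i j. norm ((h - mat 1) $ i $ j) \<le> \<epsilon>"
  shows "norm (d k - 1) \<le> real CARD('n) * (real CARD('n) * \<epsilon>)"
proof -
  define v where "v = column k P"
  have "v \<noteq> 0"
  proof
    assume "v = 0"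
    then have "P *v axis k 1 = 0" by (simp add: v_def mult_axis)
    then have "axis k 1 = (0 :: complex ^ 'n)"
      using mat_inverse_exists[OF assms(1)] by (metis matrix_vector_mul_assoc matrix_vector_mul_lid matrix_vector_mult_0_right)
    then show False by (simp add: axis_eq_0_iff)
  qed
  have "h *v v = d k *s v"
  proof -
    have "h *v v = h *v (P *v axis k 1)" by (simp only: mult_axis v_def)
    also have "\<dots> = (h ** P) *v axis k 1" by (rule matrix_vector_mul_assoc)
    also have "\<dots> = (P ** diagm d) *v axis k 1" by (simp only: assms(2))
    also have "\<dots> = P *v (diagm d *v axis k 1)" by (rule matrix_vector_mul_assoc[symmetric])
    also have "\<dots> = d k *s (P *v axis k 1)" by (simp only: mult_axis[of "diagm d"] column_diagm vector_scalar_commute)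
    also have "\<dots> = d k *s v" by (simp only: mult_axis v_def)
    finally show ?thesis .
  qed
  then have eq: "(h - mat 1) *v v = (d k - 1) *s v"
    by (simp add: matrix_vector_mult_diff_rdistrib vec.scale_left_diff_distrib)
  have "norm (d k - 1) * norm v \<le> real CARD('n) * (real CARD('n) * \<epsilon>) * norm v"
    using matrix_vector_norm_le[OF assms(3), of v] unfolding eq scalar_vec_norm .
  then show ?thesis using \<open>v \<noteq> 0\<close> by simp
qed

text \<open>The kernel of the exponential map consists of the integral multiples of 2 pi i, and 2 pi
  exceeds 1.\<close>

lemma exp_small_eq_1:
  fixes z :: complex
  assumes "exp z = 1" "norm z \<le> 1"
  shows "z = 0"
proof -
  obtain n :: int where n: "Re z = 0" "Im z = of_int (2 * n) * pi"
    using assms(1) unfolding exp_eq_1 by blast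
  have "\<bar>Im z\<bar> \<le> 1" using abs_Im_le_cmod[of z] assms(2) by linarith
  have "n = 0"
  proof (rule ccontr)
    assume "n \<noteq> 0"
    then have "1 \<le> \<bar>real_of_int n\<bar>" by linarith
    then have "pi \<le> \<bar>real_of_int n\<bar> * pi" by simp
    then have "2 * pi \<le> \<bar>Im z\<bar>" by (simp add: n(2) abs_mult)
    then show False using \<open>\<bar>Im z\<bar> \<le> 1\<close> pi_gt3 by linarith
  qed
  then show ?thesis using n by (simp add: complex_eq_iff)
qed

text \<open>Eigenvalues near 1 have small logarithms, for which the multiplicative relations
  (determinant 1, invariance of the coefficients) become additive. Every monomial that occurs then
  has complex weight 0, so the real parts and the imaginary parts are both real weights with the
  same property.\<close>

lemma stabilizer_near_identity:
  assumes "(h1, h2) \<in> tstab T" "(h1, h2) \<noteq> (mat 1, mat 1)"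
    and d1: "det P1 \<noteq> 0" "h1 ** P1 = P1 ** diagm m1" and d2: "det P2 \<noteq> 0" "h2 ** P2 = P2 ** diagm m2"
    and small: "\<And>i. norm (m1 i - 1) \<le> 1 / 8" "\<And>j. norm (m2 j - 1) \<le> 1 / 8"
  shows "destab T"
proof -
  have h: "det h1 = 1" "det h2 = 1" "tact T h1 h2 = T" using assms(1) by (auto simp: tstab_def)
  \<comment> \<open>At most four logarithms are added, so norm 1/4 for each keeps the sum in the
    range of \<open>exp_small_eq_1\<close>.\<close>
  have Ln: "exp (Ln m) = m \<and> norm (Ln m) \<le> 1 / 4" if "norm (m - 1) \<le> 1 / 8" for m
  proof -
    have "m \<noteq> 0" using that by auto
    moreover have "norm (Ln (1 + (m - 1))) \<le> 2 * norm (m - 1)" using that by (intro norm_Ln_le) auto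
    ultimately show ?thesis using that by auto
  qed
  define z where "z i = Ln (m1 i)" for i
  define w where "w j = Ln (m2 j)" for j
  have z: "exp (z i) = m1 i" "norm (z i) \<le> 1 / 4" for i using Ln[OF small(1)] by (auto simp: z_def)
  have w: "exp (w j) = m2 j" "norm (w j) \<le> 1 / 4" for j using Ln[OF small(2)] by (auto simp: w_def)
  have sz: "sum z UNIV = 0"
  proof (rule exp_small_eq_1)
    have "det (h1 ** P1) = det (P1 ** diagm m1)" by (simp only: d1)
    then show "exp (sum z UNIV) = 1" using d1(1) by (simp add: det_mul h det_diagm exp_sum z)
    show "norm (sum z UNIV) \<le> 1" using z(2)[of 1] z(2)[of 2] norm_triangle_ineq[of "z 1" "z 2"] by (simp add: sum_2)
  qed
  have sw: "sum w UNIV = 0"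
  proof (rule exp_small_eq_1)
    have "det (h2 ** P2) = det (P2 ** diagm m2)" by (simp only: d2)
    then show "exp (sum w UNIV) = 1" using d2(1) by (simp add: det_mul h det_diagm exp_sum w)
    show "norm (sum w UNIV) \<le> 1" using w(2)[of 1] w(2)[of 2] w(2)[of 3] norm_triangle_ineq[of "w 1 + w 2" "w 3"] norm_triangle_ineq[of "w 1" "w 2"]
      by (simp add: sum_3)
  qed
  define T' where "T' = tact T P1 P2"
  have "tact T' (diagm m1) (diagm m2) = T'"
    unfolding T'_def tact_tact d1(2)[symmetric] d2(2)[symmetric] by (simp add: h flip: tact_tact)
  then have eq: "m1 i * m1 i' * m2 j * m2 j' * T' $ i $ i' $ j $ j' = T' $ i $ i' $ j $ j'" for i i' j j'
    by (metis tact_diagm)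
  have weight: "z i + z i' + w j + w j' = 0" if "T' $ i $ i' $ j $ j' \<noteq> 0" for i i' j j'
  proof (rule exp_small_eq_1)
    show "exp (z i + z i' + w j + w j') = 1" using eq[of i i' j j'] that by (simp add: exp_add z w)
    show "norm (z i + z i' + w j + w j') \<le> 1"
      using z(2)[of i] z(2)[of i'] w(2)[of j] w(2)[of j'] norm_triangle_ineq[of "z i + z i' + w j" "w j'"]
        norm_triangle_ineq[of "z i + z i'" "w j"] norm_triangle_ineq[of "z i" "z i'"] by linarith
  qed
  have eq_1: "h = mat 1" if "det P \<noteq> 0" "h ** P = P ** diagm m" "\<And>i. m i = 1" for h P :: "complex ^ 'n ^ 'n" and m
  proof -
    have "m = (\<lambda>i. 1)" using that(3) by auto
    then have "diagm m = mat 1" by (simp only: diagm_1)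
    then have "h ** P = P" using that(2) by simp
    then show ?thesis using mat_inverse_exists[OF that(1)] by (metis matrix_mul_assoc matrix_mul_rid)
  qed
  have nz: "(\<exists>i. z i \<noteq> 0) \<or> (\<exists>j. w j \<noteq> 0)"
  proof (rule ccontr)
    assume "\<not> ?thesis"
    then have "m1 i = 1" "m2 j = 1" for i j using z(1)[of i] w(1)[of j] by auto
    then show False using eq_1[OF d1] eq_1[OF d2] assms(2) by blast
  qed
  \<comment> \<open>Any additive \<open>F\<close> gives weights. It will be the real part, unless
    all real parts vanish; then some imaginary part does not.\<close>
  have "destab T" if "\<And>x y. F (x + y) = F x + F y" "F 0 = (0::real)" "(\<exists>i. F (z i) \<noteq> 0) \<or> (\<exists>j. F (w j) \<noteq> 0)" for F
    unfolding destab_def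
  proof (intro exI conjI allI impI)
    show "det P1 \<noteq> 0" "det P2 \<noteq> 0" by fact+
    show "(\<Sum>i\<in>UNIV. F (z i)) = 0" using sz that(1,2) by (simp add: sum_2) (metis that(1,2))
    show "(\<Sum>j\<in>UNIV. F (w j)) = 0" using sw that(1,2) by (simp add: sum_3) (metis that(1,2))
    show "(\<exists>i. F (z i) \<noteq> 0) \<or> (\<exists>j. F (w j) \<noteq> 0)" by fact
    fix i i' j j' assume "tact T P1 P2 $ i $ i' $ j $ j' \<noteq> 0"
    then have "z i + z i' + w j + w j' = 0" using weight by (simp add: T'_def)
    then show "F (z i) + F (z i') + F (w j) + F (w j') \<le> 0" by (metis that(1,2) order_refl)
  qed
  note D = this
  show ?thesis
  proof (cases "(\<exists>i. Re (z i) \<noteq> 0) \<or> (\<exists>j. Re (w j) \<noteq> 0)")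
    case True
    then show ?thesis using D[of Re] by simp
  next
    case False
    then have "(\<exists>i. Im (z i) \<noteq> 0) \<or> (\<exists>j. Im (w j) \<noteq> 0)" using nz by (metis complex_eq_iff zero_complex.sel)
    then show ?thesis using D[of Im] by simp
  qed
qed

lemma matrix_diff_left: "a ** (b - c) = a ** b - a ** (c :: complex ^ 'n ^ 'm)"
  by (simp add: matrix_matrix_mult_def vec_eq_iff sum_subtractf right_diff_distrib)

lemma finite_tstab:
  assumes "\<not> destab T"
  shows "finite (tstab T)"
proof (rule ccontr)
  assume inf: "infinite (tstab T)"
  obtain C where C: "\<And>p q. det p = 1 \<Longrightarrow> det q = 1 \<Longrightarrow> (\<forall>i i' j j'. norm (tact T p q $ i $ i' $ j $ j') \<le> norm T) \<Longrightarrow>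
    (\<forall>i j. norm (p $ i $ j) \<le> C) \<and> (\<forall>i j. norm (q $ i $ j) \<le> C)"
    using orbit_map_proper[OF assms] by blast
  have entries: "norm (p $ i $ j) \<le> C" "norm (q $ k $ l) \<le> C" if "(p, q) \<in> tstab T" for p q i j k l
    using that C[of p q] tensor_comp_le[of T] by (auto simp: tstab_def)
  have C0: "C > 0"
  proof -
    obtain p q where pq: "(p, q) \<in> tstab T" using inf by (metis finite.emptyI ex_in_conv surj_pair)
    show ?thesis
    proof (rule ccontr)
      assume "\<not> C > 0"
      then have "p $ i $ j = 0" for i j using entries(1)[OF pq, of i j] by (smt (verit) norm_le_zero_iff)
      then have "det p = 0" by (simp add: det_2)
      then show False using pq by (simp add: tstab_def)
    qed
  qed
  have "norm g \<le> 2 * (2 * C) + 3 * (3 * C)" if "g \<in> tstab T" for g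
    using that norm_Pair_le[of "fst g" "snd g"] matrix_norm_le[of "fst g" C] matrix_norm_le[of "snd g" C] entries[of "fst g" "snd g"]
    by simp
  then have "bounded (tstab T)" unfolding bounded_iff by blast
  then have "compact (closure (tstab T))" by (simp add: compact_eq_bounded_closed bounded_closure)
  then obtain x where x: "x islimpt tstab T"
    using inf closure_subset unfolding compact_eq_Bolzano_Weierstrass by blast
  \<comment> \<open>The quotient of two elements at distance \<delta> then differs from 1 by at most
    3 C \<delta> = 1/72 in each entry, and \<open>eigenvalue_near_1\<close> loses a factor of at
    most 9, which leaves 1/8.\<close>
  define \<delta> where "\<delta> = 1 / (216 * C)"
  have "\<delta> > 0" using C0 by (simp add: \<delta>_def)
  \<comment> \<open>The limit point need not belong to the stabiliser. Hence two elements near it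
    are compared; the second is closer to it than the first, so they are distinct.\<close>
  then obtain g where g: "g \<in> tstab T" "g \<noteq> x" "dist g x < \<delta> / 2"
    using x unfolding islimpt_approachable by (meson half_gt_zero)
  then obtain g' where g': "g' \<in> tstab T" "dist g' x < dist g x"
    using x unfolding islimpt_approachable by (meson zero_less_dist_iff)
  then have "g' \<noteq> g" "dist g' g < \<delta>"
    using g dist_triangle2[of g' g x] by (auto simp: dist_commute)
  obtain p q p' q' where pq: "g = (p, q)" "g' = (p', q')" by (metis surj_pair)
  have det: "det p = 1" "det q = 1" using g(1) by (auto simp: pq tstab_def)
  obtain pi qi where pi: "p ** pi = mat 1" "pi ** p = mat 1" and qi: "q ** qi = mat 1" "qi ** q = mat 1"
    using mat_inverse_exists[of p] mat_inverse_exists[of q] det by auto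
  have inv: "(pi, qi) \<in> tstab T" using tstab_inverse[OF g(1)[unfolded pq] pi(1) qi(1)] .
  define h1 h2 where "h1 = pi ** p'" "h2 = qi ** q'"
  have h: "(h1, h2) \<in> tstab T" unfolding h1_h2_def using tstab_mult[OF inv g'(1)[unfolded pq]] .
  have h_ne: "(h1, h2) \<noteq> (mat 1, mat 1)"
  proof
    assume "(h1, h2) = (mat 1, mat 1)"
    then have "p ** (pi ** p') = p" "q ** (qi ** q') = q" by (simp_all add: h1_h2_def)
    then have "p' = p" "q' = q" by (simp_all add: matrix_mul_assoc pi qi)
    then show False using \<open>g' \<noteq> g\<close> by (simp add: pq)
  qed
  have close: "norm ((p' - p) $ i $ j) \<le> \<delta>" "norm ((q' - q) $ k $ l) \<le> \<delta>" for i j k l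
  proof -
    have "dist p' p < \<delta>" "dist q' q < \<delta>"
      using \<open>dist g' g < \<delta>\<close> dist_fst_le[of g' g] dist_snd_le[of g' g] by (auto simp: pq)
    then have "norm (p' - p) < \<delta>" "norm (q' - q) < \<delta>" by (simp_all only: dist_norm)
    then show "norm ((p' - p) $ i $ j) \<le> \<delta>" "norm ((q' - q) $ k $ l) \<le> \<delta>"
      using Finite_Cartesian_Product.norm_nth_le[of "p' - p" i] Finite_Cartesian_Product.norm_nth_le[of "(p' - p) $ i" j]
        Finite_Cartesian_Product.norm_nth_le[of "q' - q" k] Finite_Cartesian_Product.norm_nth_le[of "(q' - q) $ k" l]
      by linarith+
  qed
  have near: "norm ((a ** b) $ i $ j) \<le> 3 * (C * \<delta>)"
    if "\<And>i j. norm (a $ i $ j) \<le> C" "\<And>i j. norm (b $ i $ j) \<le> \<delta>" "CARD('n) \<le> 3" for a b :: "complex ^ 'n ^ 'n" and i j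
  proof -
    have "norm ((a ** b) $ i $ j) \<le> (\<Sum>k\<in>UNIV. norm (a $ i $ k * b $ k $ j))"
      by (simp add: matrix_matrix_mult_def norm_sum)
    also have "\<dots> \<le> (\<Sum>k\<in>(UNIV::'n set). C * \<delta>)"
      unfolding norm_mult using C0 by (intro sum_mono mult_mono that) auto
    also have "\<dots> = real CARD('n) * (C * \<delta>)" by simp
    also have "\<dots> \<le> 3 * (C * \<delta>)" using that(3) C0 \<open>\<delta> > 0\<close> by (intro mult_right_mono) auto
    finally show ?thesis .
  qed
  have "3 * (C * \<delta>) = 1 / 72" using C0 by (simp add: \<delta>_def)
  have h1: "norm ((h1 - mat 1) $ i $ j) \<le> 1 / 72" for i j
  proof -
    have "h1 - mat 1 = pi ** (p' - p)" by (simp add: h1_h2_def pi(2)[symmetric] matrix_diff_left)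
    then show ?thesis using near[of pi "p' - p" i j] entries(1)[OF inv] close(1) \<open>3 * (C * \<delta>) = 1 / 72\<close> by simp
  qed
  have h2: "norm ((h2 - mat 1) $ i $ j) \<le> 1 / 72" for i j
  proof -
    have "h2 - mat 1 = qi ** (q' - q)" by (simp add: h1_h2_def qi(2)[symmetric] matrix_diff_left)
    then show ?thesis using near[of qi "q' - q" i j] entries(2)[OF inv] close(2) \<open>3 * (C * \<delta>) = 1 / 72\<close> by simp
  qed
  \<comment> \<open>Powers stay in the stabiliser, whose entries are bounded.\<close>
  have power: "power_bounded k1 \<and> power_bounded k2" if "(k1, k2) \<in> tstab T" for k1 k2
  proof -
    have pw: "(mpow n k1, mpow n k2) \<in> tstab T" for n
      by (induction n) (use that in \<open>auto simp: tstab_mult\<close>, simp add: tstab_def)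
    show ?thesis
      unfolding power_bounded_def
      using matrix_vector_norm_le[OF entries(1)[OF pw]] matrix_vector_norm_le[OF entries(2)[OF pw]] by blast
  qed
  have dh: "det h1 = 1" "det h2 = 1" using h by (auto simp: tstab_def)
  obtain h1' h2' where h1': "h1 ** h1' = mat 1" "h1' ** h1 = mat 1" and h2': "h2 ** h2' = mat 1" "h2' ** h2 = mat 1"
    using mat_inverse_exists[of h1] mat_inverse_exists[of h2] dh by auto
  have h': "(h1', h2') \<in> tstab T" using tstab_inverse[OF h h1'(1) h2'(1)] .
  obtain P1 m1 where P1: "det P1 \<noteq> 0" "h1 ** P1 = P1 ** diagm m1"
    using power_bounded_diagonalisable[of h1 h1'] power[OF h] power[OF h'] h1'(2) by blast
  obtain P2 m2 where P2: "det P2 \<noteq> 0" "h2 ** P2 = P2 ** diagm m2"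
    using power_bounded_diagonalisable[of h2 h2'] power[OF h] power[OF h'] h2'(2) by blast
  have "norm (m1 i - 1) \<le> 1 / 8" for i using eigenvalue_near_1[OF P1 h1, of i] by simp
  moreover have "norm (m2 i - 1) \<le> 1 / 8" for i using eigenvalue_near_1[OF P2 h2, of i] by simp
  ultimately have "destab T" using stabilizer_near_identity[OF h h_ne P1 P2] by blast
  then show False using assms by simp
qed

theorem hilbert_mumford:
  assumes "sym_tensor T"
  shows "git_stable (poly_of T) \<longleftrightarrow> \<not> destab T"
  unfolding git_stable_iff[OF assms]
  using destab_infinite_stabilizer[of T] closed_torbit[of T] finite_tstab[of T]
  by (cases "destab T") simp_all

section \<open>Power series in three variables\<close>

interpretation const3: coeff_hom const3
  by standard (simp_all add: const3_def fps_const_1_eq_1)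

definition mk3 :: "(nat \<Rightarrow> nat \<Rightarrow> nat \<Rightarrow> complex) \<Rightarrow> cfps3" where
  "mk3 f = Abs_fps (\<lambda>k. Abs_fps (\<lambda>j. Abs_fps (\<lambda>i. f i j k)))"

lemma coeff3_mk3 [simp]: "coeff3 (mk3 f) i j k = f i j k"
  by (simp add: coeff3_def mk3_def)

lemma coeff3_eqI:
  assumes "\<And>i j k. coeff3 g i j k = coeff3 h i j k"
  shows "g = h"
  using assms by (simp add: coeff3_def fps_eq_iff)

lemma coeff3_linear [simp]:
  "coeff3 0 i j k = 0" "coeff3 (g + h) i j k = coeff3 g i j k + coeff3 h i j k"
  "coeff3 (g - h) i j k = coeff3 g i j k - coeff3 h i j k" "coeff3 (- g) i j k = - coeff3 g i j k"
  by (simp_all add: coeff3_def)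

lemma coeff3_sum: "coeff3 (sum f A) i j k = (\<Sum>x\<in>A. coeff3 (f x) i j k)"
  by (simp add: coeff3_def fps_sum_nth)

lemma coeff3_const3_mult [simp]: "coeff3 (const3 c * g) i j k = c * coeff3 g i j k"
  by (simp add: coeff3_def const3_def)

lemma coeff3_const3: "coeff3 (const3 c) i j k = (if i = 0 \<and> j = 0 \<and> k = 0 then c else 0)"
  by (simp add: coeff3_def const3_def)

lemma coeff3_1: "coeff3 1 i j k = (if i = 0 \<and> j = 0 \<and> k = 0 then 1 else 0)"
  using coeff3_const3[of 1 i j k] by (simp add: const3.hom_1)

lemma coeff3_shift [simp]:
  "coeff3 (fps_u * g) i j k = (if i = 0 then 0 else coeff3 g (i - 1) j k)"
  "coeff3 (fps_v * g) i j k = (if j = 0 then 0 else coeff3 g i (j - 1) k)"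
  "coeff3 (fps_w * g) i j k = (if k = 0 then 0 else coeff3 g i j (k - 1))"
  by (simp_all add: coeff3_def fps_u_def fps_v_def fps_w_def)

lemma coeff3_mult: "coeff3 (g * h) i j k =
  (\<Sum>k'=0..k. \<Sum>j'=0..j. \<Sum>i'=0..i. coeff3 g i' j' k' * coeff3 h (i - i') (j - j') (k - k'))"
  by (simp add: coeff3_def fps_mult_nth fps_sum_nth)

text \<open>The n-th power of the maximal ideal: the series of order at least n.\<close>

definition fil :: "nat \<Rightarrow> cfps3 set" where
  "fil n = {g. \<forall>i j k. i + j + k < n \<longrightarrow> coeff3 g i j k = 0}"

lemma fil_0 [simp]: "g \<in> fil 0"
  by (simp add: fil_def)

lemma fil_zero [simp]: "0 \<in> fil n"
  by (simp add: fil_def)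

lemma fil_add: "g \<in> fil n \<Longrightarrow> h \<in> fil n \<Longrightarrow> g + h \<in> fil n"
  and fil_diff: "g \<in> fil n \<Longrightarrow> h \<in> fil n \<Longrightarrow> g - h \<in> fil n"
  and fil_minus: "g \<in> fil n \<Longrightarrow> - g \<in> fil n"
  by (simp_all add: fil_def)

lemma fil_mono: "g \<in> fil n \<Longrightarrow> m \<le> n \<Longrightarrow> g \<in> fil m"
  by (simp add: fil_def)

lemma fil_sum: "(\<And>x. x \<in> A \<Longrightarrow> f x \<in> fil n) \<Longrightarrow> sum f A \<in> fil n"
  by (simp add: fil_def coeff3_sum)

lemma fil_mult:
  assumes "g \<in> fil m" "h \<in> fil n"
  shows "g * h \<in> fil (m + n)"
  unfolding fil_def
proof (intro CollectI allI impI)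
  fix i j k :: nat assume lt: "i + j + k < m + n"
  have "coeff3 g i' j' k' * coeff3 h (i - i') (j - j') (k - k') = 0" if "i' \<le> i" "j' \<le> j" "k' \<le> k" for i' j' k'
  proof (cases "i' + j' + k' < m")
    case False
    then have "(i - i') + (j - j') + (k - k') < n" using lt that by linarith
    then show ?thesis using assms(2) by (simp add: fil_def)
  qed (use assms(1) in \<open>simp add: fil_def\<close>)
  then show "coeff3 (g * h) i j k = 0"
    unfolding coeff3_mult by (intro sum.neutral ballI) auto
qed

lemma fil_mult_right: "h \<in> fil n \<Longrightarrow> g * h \<in> fil n"
  using fil_mult[of g 0 h n] by simp

lemma fil_mult_left: "g \<in> fil n \<Longrightarrow> g * h \<in> fil n"
  using fil_mult[of g n h 0] by simp

lemma fil_power: "g \<in> fil 1 \<Longrightarrow> g ^ n \<in> fil n"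
proof (induction n)
  case (Suc n)
  then show ?case using fil_mult[of g 1 "g ^ n" n] by simp
qed simp

text \<open>The filtration is separated, which reduces equations between power series to congruences
  modulo every order.\<close>

lemma fil_zeroI: "(\<And>n. g \<in> fil n) \<Longrightarrow> g = 0"
  by (rule coeff3_eqI) (fastforce simp: fil_def)

lemma fil_1_iff: "g \<in> fil 1 \<longleftrightarrow> coeff3 g 0 0 0 = 0"
  by (auto simp: fil_def)

lemma fil_2_iff: "g \<in> fil 2 \<longleftrightarrow> coeff3 g 0 0 0 = 0 \<and> coeff3 g 1 0 0 = 0 \<and> coeff3 g 0 1 0 = 0 \<and> coeff3 g 0 0 1 = 0"
proof -
  have "i + j + k < 2 \<longleftrightarrow> (i = 0 \<and> j = 0 \<and> k = 0) \<or> (i = 1 \<and> j = 0 \<and> k = 0) \<or> (i = 0 \<and> j = 1 \<and> k = 0) \<or> (i = 0 \<and> j = 0 \<and> k = 1)" for i j k :: nat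
    by arith
  then show ?thesis unfolding fil_def by auto
qed

text \<open>Each monomial is assigned to w if w divides it, otherwise to v if v divides it, and
  otherwise to u.\<close>

lemma fil_Suc_decompose:
  assumes "g \<in> fil (Suc n)"
  obtains a b c where "a \<in> fil n" "b \<in> fil n" "c \<in> fil n" "g = fps_u * a + fps_v * b + fps_w * c"
proof
  let ?a = "mk3 (\<lambda>i j k. if j = 0 \<and> k = 0 then coeff3 g (Suc i) 0 0 else 0)"
  let ?b = "mk3 (\<lambda>i j k. if k = 0 then coeff3 g i (Suc j) 0 else 0)"
  let ?c = "mk3 (\<lambda>i j k. coeff3 g i j (Suc k))"
  show "?a \<in> fil n" "?b \<in> fil n" "?c \<in> fil n"
    using assms by (auto simp: fil_def)
  have g0: "coeff3 g 0 0 0 = 0" using assms by (simp add: fil_def)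
  show "g = fps_u * ?a + fps_v * ?b + fps_w * ?c"
    by (rule coeff3_eqI) (auto simp: g0)
qed

lemma fps_uvw_fil: "fps_u \<in> fil 1" "fps_v \<in> fil 1" "fps_w \<in> fil 1"
  using coeff3_shift(1)[of 1 0 0 0] coeff3_shift(2)[of 1 0 0 0] coeff3_shift(3)[of 1 0 0 0]
  unfolding fil_1_iff by simp_all

declare fps_uvw_fil [unfolded One_nat_def, simp]

section \<open>Substitution of power series\<close>

definition monom3 :: "cfps3 \<Rightarrow> cfps3 \<Rightarrow> cfps3 \<Rightarrow> nat \<times> nat \<times> nat \<Rightarrow> cfps3" where
  "monom3 U V W = (\<lambda>(i, j, k). U ^ i * V ^ j * W ^ k)"

lemma coeff3_monom3: "coeff3 (monom3 fps_u fps_v fps_w (i, j, k)) a b c = (if a = i \<and> b = j \<and> c = k then 1 else 0)"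
proof -
  have W: "coeff3 (fps_w ^ k) a b c = (if a = 0 \<and> b = 0 \<and> c = k then 1 else 0)" for a b c
    by (induction k arbitrary: c) (auto simp: coeff3_1)
  have V: "coeff3 (fps_v ^ j * fps_w ^ k) a b c = (if a = 0 \<and> b = j \<and> c = k then 1 else 0)" for a b c
    by (induction j arbitrary: b) (auto simp: W mult.assoc)
  have "coeff3 (fps_u ^ i * (fps_v ^ j * fps_w ^ k)) a b c = (if a = i \<and> b = j \<and> c = k then 1 else 0)" for a b c
    by (induction i arbitrary: a) (auto simp: V mult.assoc)
  then show ?thesis by (simp add: monom3_def mult.assoc)
qed

lemma monom3_mult: "monom3 U V W (i, j, k) * monom3 U V W (i', j', k') = monom3 U V W (i + i', j + j', k + k')"
  by (simp add: monom3_def power_add algebra_simps)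

definition idx :: "nat \<Rightarrow> (nat \<times> nat \<times> nat) set" where
  "idx n = {(i, j, k). i + j + k < n}"

lemma finite_idx [simp]: "finite (idx n)"
  by (rule finite_subset[of _ "{..n} \<times> {..n} \<times> {..n}"]) (auto simp: idx_def)

definition cf :: "cfps3 \<Rightarrow> nat \<times> nat \<times> nat \<Rightarrow> complex" where
  "cf h = (\<lambda>(i, j, k). coeff3 h i j k)"

text \<open>Substitution into the truncation of \<open>h\<close> below total degree n, a finite sum
  for which no convergence question arises.\<close>

definition psub :: "cfps3 \<Rightarrow> cfps3 \<Rightarrow> cfps3 \<Rightarrow> nat \<Rightarrow> cfps3 \<Rightarrow> cfps3" where
  "psub U V W n h = (\<Sum>x\<in>idx n. const3 (cf h x) * monom3 U V W x)"

text \<open>Substitution of power series without constant term, defined coefficient by coefficient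
  from the substitution into truncations.\<close>

definition sub :: "cfps3 \<Rightarrow> cfps3 \<Rightarrow> cfps3 \<Rightarrow> cfps3 \<Rightarrow> cfps3" where
  "sub U V W h = mk3 (\<lambda>a b c. coeff3 (psub U V W (Suc (a + b + c)) h) a b c)"

lemma psub_uvw: "h - psub fps_u fps_v fps_w n h \<in> fil n"
  unfolding fil_def
proof (intro CollectI allI impI)
  fix i j k :: nat assume lt: "i + j + k < n"
  have "coeff3 (psub fps_u fps_v fps_w n h) i j k = (\<Sum>x\<in>idx n. if x = (i, j, k) then cf h x else 0)"
    unfolding psub_def coeff3_sum by (intro sum.cong) (auto simp: coeff3_monom3 split: if_splits)
  also have "\<dots> = coeff3 h i j k"
  proof -
    have "(i, j, k) \<in> idx n" using lt by (simp add: idx_def)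
    then show ?thesis by (simp add: cf_def)
  qed
  finally show "coeff3 (h - psub fps_u fps_v fps_w n h) i j k = 0" by simp
qed

locale fps_subst =
  fixes U V W :: cfps3
  assumes UVW: "U \<in> fil 1" "V \<in> fil 1" "W \<in> fil 1"
begin

lemma monom3_fil: "i + j + k \<ge> n \<Longrightarrow> monom3 U V W (i, j, k) \<in> fil n"
  unfolding monom3_def
  using fil_mult[OF fil_mult[OF fil_power[OF UVW(1), of i] fil_power[OF UVW(2), of j]] fil_power[OF UVW(3), of k]]
  by (auto intro: fil_mono)

lemma psub_diff_fil:
  assumes "m \<le> n"
  shows "psub U V W n h - psub U V W m h \<in> fil m"
proof -
  have "psub U V W n h - psub U V W m h = (\<Sum>x\<in>idx n - idx m. const3 (cf h x) * monom3 U V W x)"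
  proof -
    have "idx m \<subseteq> idx n" using assms by (auto simp: idx_def)
    then show ?thesis unfolding psub_def by (simp add: sum_diff)
  qed
  also have "\<dots> \<in> fil m"
  proof (intro fil_sum fil_mult_right)
    fix x assume "x \<in> idx n - idx m"
    then show "monom3 U V W x \<in> fil m" by (cases x) (auto simp: idx_def intro: monom3_fil)
  qed
  finally show ?thesis .
qed

text \<open>Since \<open>U\<close>, \<open>V\<close>, \<open>W\<close> have no constant term, longer
  truncations do not affect coefficients of degree below n.\<close>

lemma sub_psub: "sub U V W h - psub U V W n h \<in> fil n"
  unfolding fil_def
proof (intro CollectI allI impI)
  fix i j k :: nat assume "i + j + k < n"
  then have "psub U V W n h - psub U V W (Suc (i + j + k)) h \<in> fil (Suc (i + j + k))" by (intro psub_diff_fil) simp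
  then have "coeff3 (psub U V W n h - psub U V W (Suc (i + j + k)) h) i j k = 0" unfolding fil_def by blast
  then show "coeff3 (sub U V W h - psub U V W n h) i j k = 0" by (simp add: sub_def)
qed

lemma sub_add: "sub U V W (g + h) = sub U V W g + sub U V W h"
  by (rule coeff3_eqI)
    (simp add: sub_def psub_def cf_def case_prod_unfold const3.hom_add distrib_right sum.distrib)

lemma sub_const3_mult: "sub U V W (const3 c * h) = const3 c * sub U V W h"
  by (rule coeff3_eqI)
    (simp add: sub_def psub_def cf_def case_prod_unfold const3.hom_mult mult.assoc flip: sum_distrib_left)

lemma sub_0 [simp]: "sub U V W 0 = 0"
  using sub_add[of 0 0] by simp

lemma sub_minus: "sub U V W (- h) = - sub U V W h"
  using sub_add[of h "- h"] by (simp add: eq_neg_iff_add_eq_0 add.commute)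

lemma sub_diff: "sub U V W (g - h) = sub U V W g - sub U V W h"
  using sub_add[of g "- h"] by (simp add: sub_minus)

lemma sub_sum: "sub U V W (sum f A) = (\<Sum>x\<in>A. sub U V W (f x))"
  by (induction A rule: infinite_finite_induct) (simp_all add: sub_add)

lemma sub_fil:
  assumes "h \<in> fil n"
  shows "sub U V W h \<in> fil n"
proof -
  have "psub U V W n h = 0"
    unfolding psub_def using assms
    by (intro sum.neutral) (auto simp: idx_def cf_def fil_def const3.hom_0)
  then show ?thesis using sub_psub[of h n] by simp
qed

lemma sub_monom3: "sub U V W (monom3 fps_u fps_v fps_w x) = monom3 U V W x"
proof -
  obtain i j k where x: "x = (i, j, k)" by (cases x)
  have "sub U V W (monom3 fps_u fps_v fps_w x) - monom3 U V W x \<in> fil n" for n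
  proof -
    define m where "m = n + Suc (i + j + k)"
    have "psub U V W m (monom3 fps_u fps_v fps_w x) = (\<Sum>y\<in>idx m. if y = x then monom3 U V W y else 0)"
      unfolding psub_def
      by (intro sum.cong) (auto simp: cf_def x coeff3_monom3 const3.hom_0 const3.hom_1 split: if_splits)
    also have "\<dots> = monom3 U V W x"
    proof -
      have "x \<in> idx m" by (simp add: idx_def m_def x)
      then show ?thesis by simp
    qed
    finally have "sub U V W (monom3 fps_u fps_v fps_w x) - monom3 U V W x \<in> fil m"
      using sub_psub[of "monom3 fps_u fps_v fps_w x" m] by simp
    then show ?thesis by (rule fil_mono) (simp add: m_def)
  qed
  then show ?thesis using fil_zeroI by (metis eq_iff_diff_eq_0)
qed

lemma sub_poly: "sub U V W (psub fps_u fps_v fps_w n h) = psub U V W n h"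
  by (simp add: psub_def sub_sum sub_const3_mult sub_monom3)

text \<open>Modulo order n both factors may be replaced by polynomials, for which multiplicativity
  reduces to monomials.\<close>

lemma sub_mult: "sub U V W (g * h) = sub U V W g * sub U V W h"
proof -
  have "sub U V W (g * h) - sub U V W g * sub U V W h \<in> fil n" for n
  proof -
    define p where "p = psub fps_u fps_v fps_w n g"
    define q where "q = psub fps_u fps_v fps_w n h"
    have pq: "sub U V W (p * q) = sub U V W p * sub U V W q"
    proof -
      have "sub U V W (p * q) = (\<Sum>x\<in>idx n. \<Sum>y\<in>idx n. sub U V W (const3 (cf g x * cf h y) * (monom3 fps_u fps_v fps_w x * monom3 fps_u fps_v fps_w y)))"
        unfolding p_def q_def psub_def sum_product sub_sum
        by (intro sum.cong refl) (simp add: const3.hom_mult mult_ac)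
      also have "\<dots> = (\<Sum>x\<in>idx n. \<Sum>y\<in>idx n. const3 (cf g x * cf h y) * (monom3 U V W x * monom3 U V W y))"
      proof (intro sum.cong refl)
        fix x y :: "nat \<times> nat \<times> nat"
        show "sub U V W (const3 (cf g x * cf h y) * (monom3 fps_u fps_v fps_w x * monom3 fps_u fps_v fps_w y)) =
          const3 (cf g x * cf h y) * (monom3 U V W x * monom3 U V W y)"
          by (cases x; cases y) (simp only: monom3_mult sub_const3_mult sub_monom3)
      qed
      also have "\<dots> = psub U V W n g * psub U V W n h"
        unfolding psub_def sum_product
        by (intro sum.cong refl) (simp add: const3.hom_mult mult_ac)
      finally show ?thesis by (simp add: p_def q_def sub_poly)
    qed
    have "(g - p) * h + p * (h - q) \<in> fil n"
      unfolding p_def q_def by (intro fil_add fil_mult_left fil_mult_right psub_uvw)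
    then have 1: "sub U V W (g * h) - sub U V W (p * q) \<in> fil n"
      using sub_fil[of "g * h - p * q" n] by (simp add: algebra_simps sub_diff[symmetric])
    have "(sub U V W g - sub U V W p) * sub U V W h + sub U V W p * (sub U V W h - sub U V W q) \<in> fil n"
      unfolding p_def q_def sub_diff[symmetric] by (intro fil_add fil_mult_left fil_mult_right sub_fil psub_uvw)
    then have 2: "sub U V W g * sub U V W h - sub U V W p * sub U V W q \<in> fil n"
      by (simp add: algebra_simps)
    show ?thesis using fil_diff[OF 1 2] by (simp add: pq)
  qed
  then show ?thesis using fil_zeroI by (metis eq_iff_diff_eq_0)
qed

lemma sub_uvw [simp]: "sub U V W fps_u = U" "sub U V W fps_v = V" "sub U V W fps_w = W"
  using sub_monom3[of "(1, 0, 0)"] sub_monom3[of "(0, 1, 0)"] sub_monom3[of "(0, 0, 1)"] by (simp_all add: monom3_def)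

lemma sub_1 [simp]: "sub U V W 1 = 1"
  using sub_monom3[of "(0, 0, 0)"] by (simp add: monom3_def)

lemma sub_const3 [simp]: "sub U V W (const3 c) = const3 c"
  using sub_const3_mult[of c 1] by simp

lemma sub_power: "sub U V W (g ^ n) = sub U V W g ^ n"
  by (induction n) (simp_all add: sub_mult)

text \<open>A homomorphism that respects the filtration agrees with substitution on truncations, and
  the remaining error has arbitrarily high order. The composition law of substitutions is a
  consequence.\<close>

lemma sub_unique:
  assumes add: "\<And>g h. H (g + h) = H g + H h" and mult: "\<And>g h. H (g * h) = H g * H h"
    and const: "\<And>c. H (const3 c) = const3 c" and fil: "\<And>g n. g \<in> fil n \<Longrightarrow> H g \<in> fil n"
    and uvw: "H fps_u = U" "H fps_v = V" "H fps_w = W"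
  shows "H h = sub U V W h"
proof -
  have H0: "H 0 = 0" using add[of 0 0] by simp
  have minus: "H (g - h) = H g - H h" for g h using add[of "g - h" h] by simp
  have sum: "H (sum f A) = (\<Sum>x\<in>A. H (f x))" for f :: "nat \<times> nat \<times> nat \<Rightarrow> cfps3" and A
    by (induction A rule: infinite_finite_induct) (simp_all add: add H0)
  have one: "H 1 = 1" using const[of 1] by (simp add: const3.hom_1)
  have pow: "H (g ^ n) = H g ^ n" for g n by (induction n) (simp_all add: one mult)
  have mon: "H (monom3 fps_u fps_v fps_w x) = monom3 U V W x" for x
    by (cases x) (simp add: monom3_def mult pow uvw)
  have "H h - sub U V W h \<in> fil n" for n
  proof -
    have "H (psub fps_u fps_v fps_w n h) = psub U V W n h"
      by (simp add: psub_def sum mult const mon)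
    then have "H h - psub U V W n h \<in> fil n" using fil[OF psub_uvw[of h n]] by (simp add: minus)
    then show ?thesis using fil_diff[OF _ sub_psub[of h n]] by fastforce
  qed
  then show ?thesis using fil_zeroI by (metis eq_iff_diff_eq_0)
qed

end

lemma sub_id: "sub fps_u fps_v fps_w h = h"
proof -
  interpret fps_subst fps_u fps_v fps_w by standard simp_all
  show ?thesis using sub_unique[of "\<lambda>h. h" h] by simp
qed

lemma sub_comp:
  assumes "fps_subst U V W" "fps_subst U' V' W'"
  shows "sub U' V' W' (sub U V W h) = sub (sub U' V' W' U) (sub U' V' W' V) (sub U' V' W' W) h"
proof -
  note s1 = fps_subst.sub_add[OF assms(1)] fps_subst.sub_mult[OF assms(1)] fps_subst.sub_const3[OF assms(1)] fps_subst.sub_uvw[OF assms(1)]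
  note s2 = fps_subst.sub_add[OF assms(2)] fps_subst.sub_mult[OF assms(2)] fps_subst.sub_const3[OF assms(2)]
  have "fps_subst (sub U' V' W' U) (sub U' V' W' V) (sub U' V' W' W)"
    using fps_subst.UVW[OF assms(1)] by (intro fps_subst.intro fps_subst.sub_fil[OF assms(2)])
  then show ?thesis
    by (rule fps_subst.sub_unique) (simp_all add: s1 s2 fps_subst.sub_fil[OF assms(1)] fps_subst.sub_fil[OF assms(2)])
qed

section \<open>Substitutions tangent to the identity\<close>

lemma fil_mult_cong:
  assumes "x - x' \<in> fil (Suc a)" "y - y' \<in> fil (Suc b)" "x' \<in> fil a" "y \<in> fil b"
  shows "x * y - x' * y' \<in> fil (Suc (a + b))"
proof -
  have "(x - x') * y + x' * (y - y') \<in> fil (Suc (a + b))"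
    using fil_mult[OF assms(1,4)] fil_mult[OF assms(3,2)] by (intro fil_add) simp_all
  then show ?thesis by (simp add: algebra_simps)
qed

lemma fil_power_cong:
  assumes "x - x' \<in> fil 2" "x \<in> fil 1" "x' \<in> fil 1"
  shows "x ^ n - x' ^ n \<in> fil (Suc n)"
proof (induction n)
  case (Suc n)
  show ?case
    using fil_mult_cong[of x x' 1 "x ^ n" "x' ^ n" n] assms Suc fil_power by (simp add: numeral_2_eq_2)
qed simp

text \<open>A series of order n is changed only by terms of higher order. This gives injectivity
  order by order and surjectivity by successive approximation.\<close>

lemma sub_near_identity_bij:
  assumes "U - fps_u \<in> fil 2" "V - fps_v \<in> fil 2" "W - fps_w \<in> fil 2"
  shows "fps_subst U V W" "bij (sub U V W)"
proof -
  have UVW: "U \<in> fil 1" "V \<in> fil 1" "W \<in> fil 1"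
    using fil_add[OF fil_mono[OF assms(1), of 1] fps_uvw_fil(1)] fil_add[OF fil_mono[OF assms(2), of 1] fps_uvw_fil(2)]
      fil_add[OF fil_mono[OF assms(3), of 1] fps_uvw_fil(3)] by simp_all
  then show "fps_subst U V W" by (simp add: fps_subst_def)
  interpret fps_subst U V W by standard (fact UVW)+
  let ?p = "sub U V W"
  have near: "?p h - h \<in> fil (Suc n)" if h: "h \<in> fil n" for h n
  proof -
    define p where "p = psub fps_u fps_v fps_w (Suc n) h"
    have hp: "h - p \<in> fil (Suc n)" unfolding p_def by (rule psub_uvw)
    have "psub U V W (Suc n) h - p = (\<Sum>x\<in>idx (Suc n). const3 (cf h x) * (monom3 U V W x - monom3 fps_u fps_v fps_w x))"
      by (simp add: p_def psub_def sum_subtractf right_diff_distrib)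
    also have "\<dots> \<in> fil (Suc n)"
    proof (intro fil_sum)
      fix x assume "x \<in> idx (Suc n)"
      obtain i j k where x: "x = (i, j, k)" by (cases x)
      show "const3 (cf h x) * (monom3 U V W x - monom3 fps_u fps_v fps_w x) \<in> fil (Suc n)"
      proof (cases "i + j + k < n")
        case True
        then have "cf h x = 0" using h by (simp add: x cf_def fil_def)
        then show ?thesis by (simp add: const3.hom_0)
      next
        case False
        then have n: "n = i + j + k" using \<open>x \<in> idx (Suc n)\<close> by (simp add: x idx_def)
        have "monom3 U V W x - monom3 fps_u fps_v fps_w x \<in> fil (Suc (i + j + k))"
          unfolding monom3_def x prod.case
          by (intro fil_mult_cong fil_power_cong fil_power fil_mult assms UVW fps_uvw_fil)
        then show ?thesis unfolding n by (rule fil_mult_right)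
      qed
    qed
    finally have "psub U V W (Suc n) h - p \<in> fil (Suc n)" .
    then have "?p h - p \<in> fil (Suc n)" using fil_add[OF sub_psub[of h "Suc n"]] by fastforce
    then show ?thesis using fil_diff[OF _ hp] by fastforce
  qed
  show "bij ?p"
    unfolding bij_def
  proof
    show "inj ?p"
    proof (rule injI)
      fix g h assume "?p g = ?p h"
      then have 0: "?p (g - h) = 0" by (simp add: sub_diff)
      have "g - h \<in> fil n" for n
      proof (induction n)
        case (Suc n)
        then show ?case using near[OF Suc] fil_minus by (fastforce simp: 0)
      qed simp
      then show "g = h" using fil_zeroI by (metis eq_iff_diff_eq_0)
    qed
    show "surj ?p"
    proof (rule surjI)
      fix k
      \<comment> \<open>Adding the current error to the approximation raises the order of the error
        by one.\<close>
      define s where "s = rec_nat 0 (\<lambda>n h. h + (k - ?p h))"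
      have s: "s (Suc n) = s n + (k - ?p (s n))" for n by (simp add: s_def)
      have r: "k - ?p (s n) \<in> fil n" for n
      proof (induction n)
        case (Suc n)
        have eq: "k - ?p (s (Suc n)) = - (?p (k - ?p (s n)) - (k - ?p (s n)))"
          unfolding s sub_add by simp
        show ?case unfolding eq by (rule fil_minus[OF near[OF Suc]])
      qed simp
      have sd: "m \<le> n \<Longrightarrow> s n - s m \<in> fil m" for m n
      proof (induction n)
        case (Suc n)
        show ?case
        proof (cases "m = Suc n")
          case False
          then have "m \<le> n" using Suc.prems by simp
          then have "s n - s m + (k - ?p (s n)) \<in> fil m" using Suc.IH r[of n] by (intro fil_add) (auto intro: fil_mono)
          then show ?thesis by (simp add: s algebra_simps)
        qed simp
      qed simp
      \<comment> \<open>Coefficients of degree d no longer change from stage d + 1 on, so the limit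
        is read off there.\<close>
      define t where "t = mk3 (\<lambda>a b c. coeff3 (s (Suc (a + b + c))) a b c)"
      have ts: "t - s n \<in> fil n" for n
        unfolding fil_def
      proof (intro CollectI allI impI)
        fix a b c :: nat assume "a + b + c < n"
        then have "s n - s (Suc (a + b + c)) \<in> fil (Suc (a + b + c))" by (intro sd) simp
        then have "coeff3 (s n - s (Suc (a + b + c))) a b c = 0" unfolding fil_def by blast
        then show "coeff3 (t - s n) a b c = 0" by (simp add: t_def)
      qed
      have "k - ?p t \<in> fil n" for n
        using fil_diff[OF r[of n] sub_fil[OF ts[of n]]] by (simp add: sub_diff)
      then have "?p t = k" using fil_zeroI by (metis eq_iff_diff_eq_0)
      then have "\<exists>t. ?p t = k" ..
      then show "?p (SOME t. ?p t = k) = k" by (rule someI_ex)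
    qed
  qed
qed

text \<open>The series \<open>(1 + x) powr (- 1 / 2)\<close> evaluated at \<open>m - 1\<close>.\<close>

lemma inverse_sqrt_unit:
  assumes "m - 1 \<in> fil 1"
  obtains s where "s\<^sup>2 * m = 1" "s - 1 \<in> fil 1"
proof
  interpret fps_subst "m - 1" 0 0 by standard (use assms in simp_all)
  define e :: "complex fps \<Rightarrow> cfps3" where "e f = fps_const (fps_const f)" for f
  define I where "I = fps_binomial (- 1 / 2 :: complex)"
  have "I * I * fps_binomial 1 = fps_binomial (- 1 / 2 + - 1 / 2 + 1 :: complex)"
    unfolding I_def by (simp only: fps_binomial_add_mult)
  then have I: "I * I * (1 + fps_X) = 1" by (simp add: fps_binomial_1)
  have "e I * e I * (1 + fps_u) = e (I * I * (1 + fps_X))"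
    by (simp add: e_def fps_u_def distrib_left flip: fps_const_1_eq_1 fps_const_add)
  also have "\<dots> = 1" unfolding I by (simp add: e_def)
  finally have eI: "e I * e I * (1 + fps_u) = 1" .
  have "sub (m - 1) 0 0 (e I * e I * (1 + fps_u)) = sub (m - 1) 0 0 (e I) * sub (m - 1) 0 0 (e I) * m"
    by (simp add: sub_mult sub_add)
  then show "(sub (m - 1) 0 0 (e I))\<^sup>2 * m = 1" by (simp add: eI power2_eq_square)
  have "e I - 1 \<in> fil 1" unfolding fil_1_iff by (simp add: coeff3_def e_def I_def)
  then have "sub (m - 1) 0 0 (e I - 1) \<in> fil 1" by (rule sub_fil)
  then show "sub (m - 1) 0 0 (e I) - 1 \<in> fil 1" by (simp add: sub_diff)
qed

text \<open>The six coefficients are power series, so g is exactly a quadratic form in the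
  coordinates over the power series ring; their constant terms are the quadratic part of g.\<close>

lemma fil_2_decompose:
  assumes "g \<in> fil 2"
  obtains a b c d e f where
    "g = fps_u * fps_u * a + fps_u * fps_v * b + fps_u * fps_w * c + fps_v * fps_v * d + fps_v * fps_w * e + fps_w * fps_w * f"
    "coeff3 a 0 0 0 = coeff3 g 2 0 0" "coeff3 b 0 0 0 = coeff3 g 1 1 0" "coeff3 c 0 0 0 = coeff3 g 1 0 1"
    "coeff3 d 0 0 0 = coeff3 g 0 2 0" "coeff3 e 0 0 0 = coeff3 g 0 1 1" "coeff3 f 0 0 0 = coeff3 g 0 0 2"
proof -
  obtain a b c where abc: "a \<in> fil 1" "b \<in> fil 1" "c \<in> fil 1" "g = fps_u * a + fps_v * b + fps_w * c"
    using fil_Suc_decompose[of g 1] assms by (auto simp: numeral_2_eq_2)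
  obtain a1 a2 a3 where a: "a = fps_u * a1 + fps_v * a2 + fps_w * a3" using fil_Suc_decompose[of a 0] abc(1) by auto
  obtain b1 b2 b3 where b: "b = fps_u * b1 + fps_v * b2 + fps_w * b3" using fil_Suc_decompose[of b 0] abc(2) by auto
  obtain c1 c2 c3 where c: "c = fps_u * c1 + fps_v * c2 + fps_w * c3" using fil_Suc_decompose[of c 0] abc(3) by auto
  have "g = fps_u * fps_u * a1 + fps_u * fps_v * (a2 + b1) + fps_u * fps_w * (a3 + c1) + fps_v * fps_v * b2 + fps_v * fps_w * (b3 + c2) + fps_w * fps_w * c3"
    unfolding abc(4) a b c by (simp add: algebra_simps)
  then show ?thesis
    by (rule that) (simp_all add: abc(4) a b c)
qed

text \<open>Completing the square, with s as an inverse square root of m: the left side is the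
  square of sqrt(m) x + y / sqrt(m).\<close>

lemma lagrange_reduction:
  fixes x x' y :: cfps3
  assumes "s\<^sup>2 * m = 1"
  shows "(s * (m * x + y))\<^sup>2 = m * x\<^sup>2 + 2 * x * y + s\<^sup>2 * y\<^sup>2"
proof -
  have "(s * (m * x + y))\<^sup>2 = (s\<^sup>2 * m) * m * x\<^sup>2 + 2 * (s\<^sup>2 * m) * x * y + s\<^sup>2 * y\<^sup>2"
    by (simp add: power2_eq_square algebra_simps)
  then show ?thesis by (simp add: assms)
qed

text \<open>Morse lemma by completing squares.\<close>

lemma morse_normalised:
  assumes "g \<in> fil 2" "coeff3 g 2 0 0 = 1" "coeff3 g 0 2 0 = 1" "coeff3 g 0 0 2 = 1"
    "coeff3 g 1 1 0 = 0" "coeff3 g 1 0 1 = 0" "coeff3 g 0 1 1 = 0"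
  obtains U V W where "U - fps_u \<in> fil 2" "V - fps_v \<in> fil 2" "W - fps_w \<in> fil 2" "g = U\<^sup>2 + V\<^sup>2 + W\<^sup>2"
proof -
  obtain a b c d e f where
    g: "g = fps_u * fps_u * a + fps_u * fps_v * b + fps_u * fps_w * c + fps_v * fps_v * d + fps_v * fps_w * e + fps_w * fps_w * f"
    and c0: "coeff3 a 0 0 0 = 1" "coeff3 b 0 0 0 = 0" "coeff3 c 0 0 0 = 0"
    "coeff3 d 0 0 0 = 1" "coeff3 e 0 0 0 = 0" "coeff3 f 0 0 0 = 1"
    using fil_2_decompose[OF assms(1)] assms(2-) by metis
  have half: "const3 (1/2) + const3 (1/2) = 1" using const3.hom_add[of "1/2" "1/2"] by (simp add: const3.hom_1)
  have fil1: "b \<in> fil 1" "c \<in> fil 1" "e \<in> fil 1" "a - 1 \<in> fil 1" "d - 1 \<in> fil 1" "f - 1 \<in> fil 1"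
    unfolding fil_1_iff by (simp_all add: c0 coeff3_1)
  have twice: "2 * (const3 (1/2) * x) = x" for x
    using half by (metis distrib_right mult_1 mult_2)
  define B C E where "B = const3 (1/2) * b" "C = const3 (1/2) * c" "E = const3 (1/2) * e"
  have BCE: "b = 2 * B" "c = 2 * C" "e = 2 * E" by (simp_all only: B_C_E_def twice)
  have BCE1: "B \<in> fil 1" "C \<in> fil 1" "E \<in> fil 1" unfolding B_C_E_def by (intro fil_mult_right fil1)+
  obtain s where s: "s\<^sup>2 * a = 1" "s - 1 \<in> fil 1" using inverse_sqrt_unit[OF fil1(4)] .
  define y where "y = B * fps_v + C * fps_w"
  define U where "U = s * (a * fps_u + y)"
  define d' where "d' = d - s\<^sup>2 * B\<^sup>2"
  define E' where "E' = E - s\<^sup>2 * (B * C)"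
  define f' where "f' = f - s\<^sup>2 * C\<^sup>2"
  have sq: "x\<^sup>2 \<in> fil 1" "x * z \<in> fil 1" if "x \<in> fil 1" for x z using that fil_mult_left[of x 1] by (simp_all add: power2_eq_square)
  have "d' - 1 = (d - 1) - s\<^sup>2 * B\<^sup>2" by (simp add: d'_def)
  then have d'1: "d' - 1 \<in> fil 1" by (simp only: fil_diff[OF fil1(5) fil_mult_right[OF sq(1)[OF BCE1(1)]]])
  have E'1: "E' \<in> fil 1" unfolding E'_def by (intro fil_diff fil_mult_right sq BCE1)
  obtain t where t: "t\<^sup>2 * d' = 1" "t - 1 \<in> fil 1" using inverse_sqrt_unit[OF d'1] .
  define V where "V = t * (d' * fps_v + E' * fps_w)"
  define f'' where "f'' = f' - t\<^sup>2 * E'\<^sup>2"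
  have "f'' - 1 = (f - 1) - s\<^sup>2 * C\<^sup>2 - t\<^sup>2 * E'\<^sup>2" by (simp add: f''_def f'_def)
  then have f''1: "f'' - 1 \<in> fil 1" by (simp only: fil_diff[OF fil_diff[OF fil1(6) fil_mult_right[OF sq(1)[OF BCE1(2)]]] fil_mult_right[OF sq(1)[OF E'1]]])
  obtain r where r: "r\<^sup>2 * f'' = 1" "r - 1 \<in> fil 1" using inverse_sqrt_unit[OF f''1] .
  define W where "W = r * (f'' * fps_w + 0)"
  have U2: "U\<^sup>2 = a * fps_u\<^sup>2 + 2 * fps_u * y + s\<^sup>2 * y\<^sup>2" unfolding U_def by (rule lagrange_reduction[OF s(1)])
  have V2: "V\<^sup>2 = d' * fps_v\<^sup>2 + 2 * fps_v * (E' * fps_w) + t\<^sup>2 * (E' * fps_w)\<^sup>2" unfolding V_def by (rule lagrange_reduction[OF t(1)])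
  have W2: "W\<^sup>2 = f'' * fps_w\<^sup>2" unfolding W_def using lagrange_reduction[OF r(1), of fps_w 0] by simp
  have "g = U\<^sup>2 + V\<^sup>2 + W\<^sup>2"
    unfolding U2 V2 W2 g BCE y_def d'_def f''_def f'_def E'_def
    by (simp add: power2_eq_square algebra_simps)
  have prod1: "x * z - 1 \<in> fil 1" if "x - 1 \<in> fil 1" "z - 1 \<in> fil 1" for x z
  proof -
    have "(x - 1) * z + (z - 1) \<in> fil 1" using that by (intro fil_add fil_mult_left)
    then show ?thesis by (simp add: algebra_simps)
  qed
  have lin: "(x - 1) * z \<in> fil 2" if "x - 1 \<in> fil 1" "z \<in> fil 1" for x z
    using fil_mult[OF that] by (simp add: numeral_2_eq_2)
  have lin': "x * z \<in> fil 2" if "x \<in> fil 1" "z \<in> fil 1" for x z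
    using fil_mult[OF that] by (simp add: numeral_2_eq_2)
  have "(s * a - 1) * fps_u + s * (B * fps_v + C * fps_w) \<in> fil 2"
    by (intro fil_add fil_mult_right lin lin' prod1 s fil1 BCE1 fps_uvw_fil)
  then have "U - fps_u \<in> fil 2" by (simp add: U_def y_def algebra_simps)
  moreover have "(t * d' - 1) * fps_v + t * (E' * fps_w) \<in> fil 2"
    by (intro fil_add fil_mult_right lin lin' prod1 t d'1 E'1 fps_uvw_fil)
  then have "V - fps_v \<in> fil 2" by (simp add: V_def algebra_simps)
  moreover have "(r * f'' - 1) * fps_w \<in> fil 2"
    by (intro lin prod1 r f''1 fps_uvw_fil)
  then have "W - fps_w \<in> fil 2" by (simp add: W_def algebra_simps)
  ultimately show ?thesis using that \<open>g = U\<^sup>2 + V\<^sup>2 + W\<^sup>2\<close> by blast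
qed

subsection \<open>Quotients by a principal ideal\<close>

text \<open>The residue class of \<open>x\<close> modulo \<open>g\<close> as an explicit set. With
  \<open>coset3_eq_iff\<close>, computations in the quotient ring become questions of
  divisibility.\<close>

definition coset3 :: "cfps3 \<Rightarrow> cfps3 \<Rightarrow> cfps3 set" where
  "coset3 g x = range (\<lambda>k. k * g + x)"

lemma PIdl_coset: "PIdl\<^bsub>cfps3_ring\<^esub> g +>\<^bsub>cfps3_ring\<^esub> x = coset3 g x"
  by (auto simp: cgenideal_def a_r_coset_def' cfps3_ring_def coset3_def)

lemma coset3_eq_iff: "coset3 g x = coset3 g y \<longleftrightarrow> g dvd x - y"
proof
  assume "coset3 g x = coset3 g y"
  moreover have "x \<in> coset3 g x" unfolding coset3_def by (rule range_eqI[of _ _ 0]) simp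
  ultimately obtain k where "x = k * g + y" by (auto simp: coset3_def)
  then show "g dvd x - y" by simp
next
  have sub: "coset3 g x \<subseteq> coset3 g y" if "g dvd x - y" for x y
  proof
    fix z assume "z \<in> coset3 g x"
    then obtain k where k: "z = k * g + x" by (auto simp: coset3_def)
    obtain l where "x - y = g * l" using \<open>g dvd x - y\<close> by (rule dvdE)
    then have "z = (k + l) * g + y" by (simp add: k algebra_simps)
    then show "z \<in> coset3 g y" unfolding coset3_def by blast
  qed
  assume "g dvd x - y"
  moreover from this have "g dvd y - x" using dvd_minus_iff[of g "x - y"] by simp
  ultimately show "coset3 g x = coset3 g y" using sub by blast
qed

lemma coset3_self: "x \<in> coset3 g x"
  unfolding coset3_def by (rule range_eqI[of _ _ 0]) simp

lemma hypersurface_ring_simps: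
  "carrier (hypersurface_ring g) = range (coset3 g)"
  "coset3 g x \<otimes>\<^bsub>hypersurface_ring g\<^esub> coset3 g y = coset3 g (x * y)"
  "coset3 g x \<oplus>\<^bsub>hypersurface_ring g\<^esub> coset3 g y = coset3 g (x + y)"
  "\<one>\<^bsub>hypersurface_ring g\<^esub> = coset3 g 1"
proof -
  show "carrier (hypersurface_ring g) = range (coset3 g)"
    by (auto simp: hypersurface_ring_def FactRing_def A_RCOSETS_def' PIdl_coset) (auto simp: cfps3_ring_def)
  show "\<one>\<^bsub>hypersurface_ring g\<^esub> = coset3 g 1"
    by (simp add: hypersurface_ring_def FactRing_def PIdl_coset) (simp add: cfps3_ring_def)
  have "(\<Union>a\<in>coset3 g x. \<Union>b\<in>coset3 g y. coset3 g (a * b)) = coset3 g (x * y)"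
  proof -
    have "coset3 g (a * b) = coset3 g (x * y)" if ab: "a \<in> coset3 g x" "b \<in> coset3 g y" for a b
    proof -
      obtain k l where kl: "a = k * g + x" "b = l * g + y" using ab by (auto simp: coset3_def)
      have "a * b - x * y = g * (k * l * g + k * y + l * x)" unfolding kl by (simp add: algebra_simps)
      then show ?thesis unfolding coset3_eq_iff by simp
    qed
    then show ?thesis using coset3_self by blast
  qed
  then show "coset3 g x \<otimes>\<^bsub>hypersurface_ring g\<^esub> coset3 g y = coset3 g (x * y)"
    by (simp add: hypersurface_ring_def FactRing_def rcoset_mult_def PIdl_coset) (simp add: cfps3_ring_def)
  have "(\<Union>a\<in>coset3 g x. \<Union>b\<in>coset3 g y. {a + b}) = coset3 g (x + y)"
  proof
    show "(\<Union>a\<in>coset3 g x. \<Union>b\<in>coset3 g y. {a + b}) \<subseteq> coset3 g (x + y)"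
    proof
      fix z assume "z \<in> (\<Union>a\<in>coset3 g x. \<Union>b\<in>coset3 g y. {a + b})"
      then obtain k l where "z = (k * g + x) + (l * g + y)" by (auto simp: coset3_def)
      then have "z = (k + l) * g + (x + y)" by (simp add: algebra_simps)
      then show "z \<in> coset3 g (x + y)" unfolding coset3_def by blast
    qed
    show "coset3 g (x + y) \<subseteq> (\<Union>a\<in>coset3 g x. \<Union>b\<in>coset3 g y. {a + b})"
    proof
      fix z assume "z \<in> coset3 g (x + y)"
      then obtain k where "z = (k * g + x) + y" by (auto simp: coset3_def add.assoc)
      moreover have "k * g + x \<in> coset3 g x" unfolding coset3_def by (rule rangeI)
      ultimately show "z \<in> (\<Union>a\<in>coset3 g x. \<Union>b\<in>coset3 g y. {a + b})" using coset3_self by blast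
    qed
  qed
  then show "coset3 g x \<oplus>\<^bsub>hypersurface_ring g\<^esub> coset3 g y = coset3 g (x + y)"
    by (simp add: hypersurface_ring_def FactRing_def set_add_def' ) (simp add: cfps3_ring_def)
qed

text \<open>The inverse of the substitution sends \<open>g\<close> to \<open>q\<close>, hence the
  ideal of \<open>g\<close> onto that of \<open>q\<close>, and it acts on cosets by taking
  images.\<close>

lemma hypersurface_iso_sub:
  assumes "fps_subst U V W" "bij (sub U V W)" "sub U V W q = g"
  shows "hypersurface_iso g q"
proof -
  interpret fps_subst U V W by fact
  define \<theta> where "\<theta> = inv_into UNIV (sub U V W)"
  have \<theta>: "sub U V W (\<theta> x) = x" "\<theta> (sub U V W x) = x" for x
    using assms(2) by (simp_all add: \<theta>_def bij_is_surj surj_f_inv_f bij_is_inj)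
  have inj: "x = y" if "sub U V W x = sub U V W y" for x y using that \<theta>(2) by metis
  have add: "\<theta> (x + y) = \<theta> x + \<theta> y" for x y by (rule inj) (simp add: sub_add \<theta>)
  have mult: "\<theta> (x * y) = \<theta> x * \<theta> y" for x y by (rule inj) (simp add: sub_mult \<theta>)
  have const: "\<theta> (const3 c) = const3 c" for c by (rule inj) (simp add: \<theta>)
  have one: "\<theta> 1 = 1" by (rule inj) (simp add: \<theta>)
  have g: "\<theta> g = q" using \<theta>(2)[of q] assms(3) by simp
  have img: "\<theta> ` coset3 g x = coset3 q (\<theta> x)" for x
  proof
    show "\<theta> ` coset3 g x \<subseteq> coset3 q (\<theta> x)" by (auto simp: coset3_def add mult g)
    show "coset3 q (\<theta> x) \<subseteq> \<theta> ` coset3 g x"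
    proof
      fix z assume "z \<in> coset3 q (\<theta> x)"
      then obtain k where "z = k * q + \<theta> x" by (auto simp: coset3_def)
      then have "z = \<theta> (sub U V W k * g + x)" by (simp add: add mult g \<theta>)
      then show "z \<in> \<theta> ` coset3 g x" unfolding coset3_def by blast
    qed
  qed
  have dvd: "g dvd x - y" if qd: "q dvd \<theta> x - \<theta> y" for x y
  proof -
    obtain k where "\<theta> x - \<theta> y = q * k" using qd by (rule dvdE)
    then have "\<theta> x = \<theta> (g * sub U V W k + y)" by (simp add: add mult g \<theta> algebra_simps)
    then have "x = g * sub U V W k + y" using \<theta>(1) by metis
    then show ?thesis by simp
  qed
  have "image \<theta> \<in> ring_hom (hypersurface_ring g) (hypersurface_ring q)"
  proof (rule ring_hom_memI)
    show "\<theta> ` \<one>\<^bsub>hypersurface_ring g\<^esub> = \<one>\<^bsub>hypersurface_ring q\<^esub>"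
      by (simp add: hypersurface_ring_simps img one)
    show "\<theta> ` A \<in> carrier (hypersurface_ring q)" if "A \<in> carrier (hypersurface_ring g)" for A
      using that by (auto simp: hypersurface_ring_simps img)
    fix A B assume "A \<in> carrier (hypersurface_ring g)" "B \<in> carrier (hypersurface_ring g)"
    then obtain x y where AB: "A = coset3 g x" "B = coset3 g y" by (auto simp: hypersurface_ring_simps)
    show "\<theta> ` (A \<otimes>\<^bsub>hypersurface_ring g\<^esub> B) = \<theta> ` A \<otimes>\<^bsub>hypersurface_ring q\<^esub> \<theta> ` B"
      by (simp only: AB hypersurface_ring_simps img mult)
    show "\<theta> ` (A \<oplus>\<^bsub>hypersurface_ring g\<^esub> B) = \<theta> ` A \<oplus>\<^bsub>hypersurface_ring q\<^esub> \<theta> ` B"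
      by (simp only: AB hypersurface_ring_simps img add)
  qed
  moreover
    have "bij_betw (image \<theta>) (carrier (hypersurface_ring g)) (carrier (hypersurface_ring q))"
      unfolding bij_betw_def hypersurface_ring_simps
    proof
      show "inj_on (image \<theta>) (range (coset3 g))"
        by (auto simp: inj_on_def img coset3_eq_iff dvd)
      show "image \<theta> ` range (coset3 g) = range (coset3 q)"
      proof
        show "range (coset3 q) \<subseteq> image \<theta> ` range (coset3 g)"
        proof
          fix z assume "z \<in> range (coset3 q)"
          then obtain x where "z = coset3 q x" by blast
          then have "z = \<theta> ` coset3 g (sub U V W x)" by (simp add: img \<theta>)
          then show "z \<in> image \<theta> ` range (coset3 g)" by blast
        qed
      qed (auto simp: img)
    qed
  ultimately have "image \<theta> \<in> ring_iso (hypersurface_ring g) (hypersurface_ring q)"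
    unfolding ring_iso_def by blast
  then show ?thesis
    unfolding hypersurface_iso_def PIdl_coset by (intro bexI[of _ "image \<theta>"]) (simp_all add: img const)
qed

section \<open>Linear and quadratic parts at the origin\<close>

definition lin :: "cfps3 \<Rightarrow> complex ^ 3" where
  "lin x = vector [coeff3 x 1 0 0, coeff3 x 0 1 0, coeff3 x 0 0 1]"

text \<open>The matrix of second derivatives at the origin, whence the factor 2 on the
  diagonal.\<close>

definition hess :: "cfps3 \<Rightarrow> complex ^ 3 ^ 3" where
  "hess x = vector [vector [2 * coeff3 x 2 0 0, coeff3 x 1 1 0, coeff3 x 1 0 1],
    vector [coeff3 x 1 1 0, 2 * coeff3 x 0 2 0, coeff3 x 0 1 1],
    vector [coeff3 x 1 0 1, coeff3 x 0 1 1, 2 * coeff3 x 0 0 2]]"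

lemma lin_add: "lin (x + y) = lin x + lin y"
  by (simp add: lin_def vec_eq_iff forall_3)

lemma lin_const3_mult: "lin (const3 c * x) = c *s lin x"
  by (simp add: lin_def vec_eq_iff forall_3)

lemma lin_uvw: "lin fps_u = vector [1, 0, 0]" "lin fps_v = vector [0, 1, 0]" "lin fps_w = vector [0, 0, 1]"
  using coeff3_shift(1)[of 1] coeff3_shift(2)[of 1] coeff3_shift(3)[of 1]
  by (simp_all add: lin_def vec_eq_iff forall_3 coeff3_1)

lemma hess_add: "hess (x + y) = hess x + hess y"
  by (simp add: hess_def vec_eq_iff forall_3 algebra_simps)

lemma hess_sym: "hess x $ a $ b = hess x $ b $ a"
  using exhaust_3[of a] exhaust_3[of b] by (auto simp: hess_def)

lemma hess_mult1:
  assumes "x \<in> fil 1" "y \<in> fil 1"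
  shows "hess (x * y) $ a $ b = lin x $ a * lin y $ b + lin x $ b * lin y $ a"
proof -
  have 0: "coeff3 x 0 0 0 = 0" "coeff3 y 0 0 0 = 0" using assms by (simp_all only: fil_1_iff)
  have s: "sum F {0..2::nat} = F 0 + F 1 + F 2" "sum F {0..1::nat} = F 0 + F 1" for F :: "nat \<Rightarrow> complex"
    by (simp_all add: numeral_2_eq_2)
  have "\<forall>a b. hess (x * y) $ a $ b = lin x $ a * lin y $ b + lin x $ b * lin y $ a"
    unfolding forall_3 hess_def lin_def vector_3 coeff3_mult s
    by (simp add: 0)
  then show ?thesis by blast
qed

lemma hess_mult0:
  assumes "y \<in> fil 2"
  shows "hess (x * y) $ a $ b = coeff3 x 0 0 0 * hess y $ a $ b"
proof -
  have 0: "coeff3 y 0 0 0 = 0" "coeff3 y 1 0 0 = 0" "coeff3 y 0 1 0 = 0" "coeff3 y 0 0 1 = 0"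
    using assms by (simp_all only: fil_2_iff)
  have s: "sum F {0..2::nat} = F 0 + F 1 + F 2" "sum F {0..1::nat} = F 0 + F 1" for F :: "nat \<Rightarrow> complex"
    by (simp_all add: numeral_2_eq_2)
  have "\<forall>a b. hess (x * y) $ a $ b = coeff3 x 0 0 0 * hess y $ a $ b"
    unfolding forall_3 hess_def vector_3 coeff3_mult s
    using 0 by simp
  then show ?thesis by blast
qed

lemma coeff3_0_mult: "coeff3 (x * y) 0 0 0 = coeff3 x 0 0 0 * coeff3 y 0 0 0"
  by (simp add: coeff3_mult)

lemma fil_2_lin: "x \<in> fil 2 \<longleftrightarrow> x \<in> fil 1 \<and> lin x = 0"
  by (simp only: fil_2_iff fil_1_iff lin_def) (simp add: vec_eq_iff forall_3)

lemma det_zero_ker: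
  fixes A :: "complex ^ 'n ^ 'n"
  shows "det A = 0 \<longleftrightarrow> (\<exists>z. z \<noteq> 0 \<and> A *v z = 0)"
  using matrix_left_invertible_ker[of A] invertible_left_inverse[of A] invertible_det_nz[of A] by blast

subsection \<open>Linear changes of coordinates\<close>

definition linsub :: "complex ^ 3 ^ 3 \<Rightarrow> 3 \<Rightarrow> cfps3" where
  "linsub P i = const3 (P $ i $ 1) * fps_u + const3 (P $ i $ 2) * fps_v + const3 (P $ i $ 3) * fps_w"

lemma linsub_fil: "linsub P i \<in> fil 1"
  unfolding linsub_def by (intro fil_add fil_mult_right fps_uvw_fil)

lemma linsub_subst: "fps_subst (linsub P 1) (linsub P 2) (linsub P 3)"
  by (intro fps_subst.intro linsub_fil)

abbreviation lsub :: "complex ^ 3 ^ 3 \<Rightarrow> cfps3 \<Rightarrow> cfps3" where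
  "lsub P \<equiv> sub (linsub P 1) (linsub P 2) (linsub P 3)"

lemma lin_linsub: "lin (linsub P i) $ c = P $ i $ c"
  using exhaust_3[of c] by (auto simp: linsub_def lin_add lin_const3_mult lin_uvw)

lemma lsub_lsub:
  assumes "Q ** P = mat 1"
  shows "lsub P (lsub Q h) = h"
proof -
  have q: "(\<Sum>k\<in>UNIV. Q $ i $ k * P $ k $ j) = (if i = j then 1 else 0)" for i j
    using assms by (simp add: matrix_matrix_mult_def mat_def vec_eq_iff)
  have q': "Q $ i $ 1 * P $ 1 $ j + Q $ i $ 2 * P $ 2 $ j + Q $ i $ 3 * P $ 3 $ j = (if i = j then 1 else 0)" for i j
    using q[of i j] by (simp add: sum_3)
  interpret fps_subst "linsub P 1" "linsub P 2" "linsub P 3" by (rule linsub_subst)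
  have "lsub P (linsub Q i) = const3 (Q $ i $ 1 * P $ 1 $ 1 + Q $ i $ 2 * P $ 2 $ 1 + Q $ i $ 3 * P $ 3 $ 1) * fps_u
     + const3 (Q $ i $ 1 * P $ 1 $ 2 + Q $ i $ 2 * P $ 2 $ 2 + Q $ i $ 3 * P $ 3 $ 2) * fps_v
     + const3 (Q $ i $ 1 * P $ 1 $ 3 + Q $ i $ 2 * P $ 2 $ 3 + Q $ i $ 3 * P $ 3 $ 3) * fps_w" for i
    unfolding linsub_def[of Q] sub_add sub_const3_mult sub_uvw
    by (simp add: linsub_def const3.hom_add const3.hom_mult algebra_simps)
  then have e: "lsub P (linsub Q 1) = fps_u" "lsub P (linsub Q 2) = fps_v" "lsub P (linsub Q 3) = fps_w"
    unfolding q' by (simp_all add: const3.hom_0 const3.hom_1)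
  show ?thesis
    unfolding sub_comp[OF linsub_subst linsub_subst] e by (rule sub_id)
qed

text \<open>In the presentation of g as a quadratic form with power series coefficients only the
  constant terms of these coefficients matter, and substitution preserves them. What remains is the
  congruence rule for quadratic forms.\<close>

lemma hess_lsub:
  assumes "g \<in> fil 2"
  shows "hess (lsub P g) = transpose P ** hess g ** P"
proof -
  interpret fps_subst "linsub P 1" "linsub P 2" "linsub P 3" by (rule linsub_subst)
  obtain a b c d e f where
    g: "g = fps_u * fps_u * a + fps_u * fps_v * b + fps_u * fps_w * c + fps_v * fps_v * d + fps_v * fps_w * e + fps_w * fps_w * f"
    and c0: "coeff3 a 0 0 0 = coeff3 g 2 0 0" "coeff3 b 0 0 0 = coeff3 g 1 1 0" "coeff3 c 0 0 0 = coeff3 g 1 0 1"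
    "coeff3 d 0 0 0 = coeff3 g 0 2 0" "coeff3 e 0 0 0 = coeff3 g 0 1 1" "coeff3 f 0 0 0 = coeff3 g 0 0 2"
    using fil_2_decompose[OF assms] by metis
  have c0': "coeff3 (lsub P x) 0 0 0 = coeff3 x 0 0 0" for x
  proof -
    have "x - const3 (coeff3 x 0 0 0) \<in> fil 1" unfolding fil_1_iff by (simp add: coeff3_const3)
    then have "lsub P (x - const3 (coeff3 x 0 0 0)) \<in> fil 1" by (rule sub_fil)
    then show ?thesis unfolding fil_1_iff by (simp add: sub_diff coeff3_const3)
  qed
  have h: "hess (x * y * z) $ k $ l = coeff3 z 0 0 0 * (lin x $ k * lin y $ l + lin x $ l * lin y $ k)"
    if "x \<in> fil 1" "y \<in> fil 1" for x y z k l
  proof -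
    have "x * y \<in> fil 2" using fil_mult[OF that] by (simp add: numeral_2_eq_2)
    then have "hess (z * (x * y)) $ k $ l = coeff3 z 0 0 0 * hess (x * y) $ k $ l" by (rule hess_mult0)
    then show ?thesis by (simp add: hess_mult1[OF that] mult.commute)
  qed
  have "hess (lsub P g) $ k $ l = (transpose P ** hess g ** P) $ k $ l" for k l
  proof -
    have "hess (lsub P g) $ k $ l =
      coeff3 g 2 0 0 * (P $ 1 $ k * P $ 1 $ l + P $ 1 $ l * P $ 1 $ k)
      + coeff3 g 1 1 0 * (P $ 1 $ k * P $ 2 $ l + P $ 1 $ l * P $ 2 $ k)
      + coeff3 g 1 0 1 * (P $ 1 $ k * P $ 3 $ l + P $ 1 $ l * P $ 3 $ k)
      + coeff3 g 0 2 0 * (P $ 2 $ k * P $ 2 $ l + P $ 2 $ l * P $ 2 $ k)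
      + coeff3 g 0 1 1 * (P $ 2 $ k * P $ 3 $ l + P $ 2 $ l * P $ 3 $ k)
      + coeff3 g 0 0 2 * (P $ 3 $ k * P $ 3 $ l + P $ 3 $ l * P $ 3 $ k)"
      by (subst g) (simp only: sub_add sub_mult sub_uvw hess_add vector_add_component h[OF linsub_fil linsub_fil] lin_linsub c0' c0)
    also have "\<dots> = (transpose P ** hess g ** P) $ k $ l"
      by (simp add: matrix_matrix_mult_def transpose_def sum_3 hess_def algebra_simps)
    finally show ?thesis .
  qed
  then show ?thesis by (simp add: vec_eq_iff)
qed

text \<open>If every vector of \<open>W\<close> were isotropic, x, y and x + y would force B(x,y) =
  0. A nonisotropic vector is normalised with a complex square root.\<close>

lemma symmetric_unit_vector:
  fixes B :: "complex ^ 'n \<Rightarrow> complex ^ 'n \<Rightarrow> complex"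
  assumes B_add: "\<And>x y z. B (x + y) z = B x z + B y z" "\<And>x y z. B z (x + y) = B z x + B z y"
    and B_scale: "\<And>c x z. B (c *s x) z = c * B x z" "\<And>c x z. B z (c *s x) = c * B z x"
    and B_sym: "\<And>x y. B x y = B y x"
    and xy: "x \<in> W" "y \<in> W" "B x y \<noteq> 0"
    and W: "\<And>x y. x \<in> W \<Longrightarrow> y \<in> W \<Longrightarrow> x + y \<in> W" "\<And>c x. x \<in> W \<Longrightarrow> c *s x \<in> W"
  shows "\<exists>v\<in>W. B v v = 1"
proof -
  have "\<exists>v\<in>W. B v v \<noteq> 0"
  proof (rule ccontr)
    assume "\<not> ?thesis"
    then have "B x x = 0" "B y y = 0" "B (x + y) (x + y) = 0" using xy W(1) by blast+
    then have "2 * B x y = 0" unfolding B_add by (simp add: B_sym[of y x])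
    then show False using xy(3) by simp
  qed
  then obtain v where v: "v \<in> W" "B v v \<noteq> 0" by blast
  have "B ((1 / csqrt (B v v)) *s v) ((1 / csqrt (B v v)) *s v) = B v v / (csqrt (B v v))\<^sup>2"
    unfolding B_scale by (simp add: power2_eq_square)
  then have "B ((1 / csqrt (B v v)) *s v) ((1 / csqrt (B v v)) *s v) = 1" using v(2) by simp
  then show ?thesis using W(2)[OF v(1)] by blast
qed

text \<open>Gram-Schmidt for a nondegenerate complex symmetric form.\<close>

lemma symmetric_orthonormal:
  fixes S :: "complex ^ 3 ^ 3"
  assumes sym: "\<And>a b. S $ a $ b = S $ b $ a" and det: "det S \<noteq> 0"
  shows "\<exists>P :: complex ^ 3 ^ 3. transpose P ** S ** P = mat 1"
proof -
  define B where "B x y = (\<Sum>a\<in>UNIV. \<Sum>b\<in>UNIV. x $ a * S $ a $ b * y $ b)" for x y :: "complex ^ 3"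
  have B_add: "B (x + y) z = B x z + B y z" "B z (x + y) = B z x + B z y" for x y z
    by (simp_all add: B_def algebra_simps sum.distrib)
  have B_scale: "B (c *s x) z = c * B x z" "B z (c *s x) = c * B z x" for c x z
    by (simp_all add: B_def algebra_simps sum_distrib_left)
  have B_diff: "B (x - y) z = B x z - B y z" "B z (x - y) = B z x - B z y" for x y z
    by (simp_all add: B_def algebra_simps sum_subtractf)
  have B_sym: "B x y = B y x" for x y
    unfolding B_def by (rule trans[OF sum.swap]) (simp add: sym[of _ "_"] mult_ac)
  have S_B: "S $ a $ b = B (axis a 1) (axis b 1)" for a b
  proof -
    have "B (axis a 1) (axis b 1) = (\<Sum>k\<in>UNIV. \<Sum>l\<in>UNIV. if l = b then (if k = a then S $ k $ l else 0) else 0)"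
      unfolding B_def by (intro sum.cong refl) (auto simp: axis_def)
    then show ?thesis by simp
  qed
  note unit = symmetric_unit_vector[of B, OF B_add B_scale B_sym]
  have "\<exists>x y. B x y \<noteq> 0"
  proof (rule ccontr)
    assume "\<not> ?thesis"
    then have "S = 0" by (simp add: vec_eq_iff S_B)
    then show False using det by (simp add: det_3)
  qed
  then obtain v1 where v1: "B v1 v1 = 1" using unit[of _ UNIV] by blast
  define W1 where "W1 = {x. B v1 x = 0}"
  have "\<exists>x\<in>W1. \<exists>y\<in>W1. B x y \<noteq> 0"
  proof (rule ccontr)
    assume no: "\<not> ?thesis"
    have "S $ a $ b = B v1 (axis a 1) * B v1 (axis b 1)" for a b
    proof -
      define x y where "x = (axis a 1 :: complex ^ 3)" "y = (axis b 1 :: complex ^ 3)"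
      have "x - B v1 x *s v1 \<in> W1" "y - B v1 y *s v1 \<in> W1" by (simp_all add: W1_def B_diff B_scale v1)
      then have "B (x - B v1 x *s v1) (y - B v1 y *s v1) = 0" using no by blast
      then show ?thesis unfolding B_diff B_scale S_B x_y_def[symmetric] by (simp add: v1 B_sym[of x v1] algebra_simps)
    qed
    then have "det S = 0" unfolding det_3 by (simp add: algebra_simps)
    then show False using det by simp
  qed
  then obtain v2 where v2: "B v1 v2 = 0" "B v2 v2 = 1"
    using unit[of _ W1] unfolding W1_def by (auto simp: B_add B_scale)
  define W2 where "W2 = {x. B v1 x = 0 \<and> B v2 x = 0}"
  have "\<exists>x\<in>W2. \<exists>y\<in>W2. B x y \<noteq> 0"
  proof (rule ccontr)
    assume no: "\<not> ?thesis"
    have "S $ a $ b = B v1 (axis a 1) * B v1 (axis b 1) + B v2 (axis a 1) * B v2 (axis b 1)" for a b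
    proof -
      define x y where "x = (axis a 1 :: complex ^ 3)" "y = (axis b 1 :: complex ^ 3)"
      have "x - B v1 x *s v1 - B v2 x *s v2 \<in> W2" "y - B v1 y *s v1 - B v2 y *s v2 \<in> W2"
        by (simp_all add: W2_def B_diff B_scale v1 v2 B_sym[of v2 v1])
      then have "B (x - B v1 x *s v1 - B v2 x *s v2) (y - B v1 y *s v1 - B v2 y *s v2) = 0" using no by blast
      then show ?thesis unfolding B_diff B_scale S_B x_y_def[symmetric]
        by (simp add: v1 v2 B_sym[of x v1] B_sym[of x v2] B_sym[of v2 v1] algebra_simps)
    qed
    then have "det S = 0" unfolding det_3 by (simp add: algebra_simps)
    then show False using det by simp
  qed
  then obtain v3 where v3: "B v1 v3 = 0" "B v2 v3 = 0" "B v3 v3 = 1"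
    using unit[of _ W2] unfolding W2_def by (auto simp: B_add B_scale)
  define P :: "complex ^ 3 ^ 3" where "P = (\<chi> i j. if j = 1 then v1 $ i else if j = 2 then v2 $ i else v3 $ i)"
  have col: "column 1 P = v1" "column 2 P = v2" "column 3 P = v3" by (simp_all add: P_def column_def vec_eq_iff)
  have "(transpose P ** S ** P) $ k $ l = B (column k P) (column l P)" for k l
    unfolding B_def matrix_matrix_mult_def transpose_def column_def vec_lambda_beta sum_distrib_right
    by (rule trans[OF sum.swap]) (rule refl)
  moreover have "B (column k P) (column l P) = (if k = l then 1 else 0)" for k l
    using exhaust_3[of k] exhaust_3[of l] by (auto simp: col v1 v2 v3 B_sym[of v2 v1] B_sym[of v3 v1] B_sym[of v3 v2])
  ultimately have "transpose P ** S ** P = mat 1" by (simp add: vec_eq_iff mat_def)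
  then show ?thesis by blast
qed

text \<open>A linear change of coordinates normalises the Hessian, the Morse lemma then writes the
  series as a sum of squares, and the two substitutions compose to a bijective one.\<close>

lemma A1_of_nondegenerate:
  assumes g: "g \<in> fil 2" and det: "det (hess g) \<noteq> 0"
  shows "hypersurface_iso g (fps_u\<^sup>2 + fps_v\<^sup>2 + fps_w\<^sup>2)"
proof -
  obtain P0 :: "complex ^ 3 ^ 3" where P0: "transpose P0 ** hess g ** P0 = mat 1"
    using symmetric_orthonormal[of "hess g"] hess_sym det by blast
  \<comment> \<open>The sum of three squares has twice the identity as Hessian, so the orthonormal
    basis is stretched by the square root of 2.\<close>
  define P :: "complex ^ 3 ^ 3" where "P = (\<chi> i j. csqrt 2 * P0 $ i $ j)"
  have "(transpose P ** hess g ** P) $ k $ l = (csqrt 2 * csqrt 2) * (transpose P0 ** hess g ** P0) $ k $ l" for k l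
    by (simp add: matrix_matrix_mult_def transpose_def P_def sum_3 algebra_simps)
  moreover have "csqrt 2 * csqrt 2 = 2" by (metis power2_csqrt power2_eq_square)
  ultimately have hP: "(transpose P ** hess g ** P) $ k $ l = (if k = l then 2 else 0)" for k l
    by (simp add: P0 mat_def)
  then have "det (transpose P ** hess g ** P) = 8" by (simp add: det_3)
  then have "det P \<noteq> 0" by (auto simp: det_mul)
  then obtain Q where Q: "P ** Q = mat 1" using invertible_det_nz invertible_right_inverse by blast
  define g' where "g' = lsub P g"
  interpret P: fps_subst "linsub P 1" "linsub P 2" "linsub P 3" by (rule linsub_subst)
  have g': "g' \<in> fil 2" unfolding g'_def by (rule P.sub_fil[OF g])
  have hg': "hess g' $ k $ l = (if k = l then 2 else 0)" for k l
    unfolding g'_def hess_lsub[OF g] by (rule hP)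
  obtain U V W where UVW: "U - fps_u \<in> fil 2" "V - fps_v \<in> fil 2" "W - fps_w \<in> fil 2" "g' = U\<^sup>2 + V\<^sup>2 + W\<^sup>2"
    using morse_normalised[OF g'] hg'[of 1 1] hg'[of 1 2] hg'[of 1 3] hg'[of 2 2] hg'[of 2 3] hg'[of 3 3]
    by (auto simp: hess_def)
  have near: "fps_subst U V W" "bij (sub U V W)" using sub_near_identity_bij[OF UVW(1-3)] by auto
  interpret U: fps_subst U V W by (rule near(1))
  interpret Q: fps_subst "linsub Q 1" "linsub Q 2" "linsub Q 3" by (rule linsub_subst)
  have comp: "lsub Q (sub U V W h) = sub (lsub Q U) (lsub Q V) (lsub Q W) h" for h
    by (rule sub_comp[OF near(1) linsub_subst])
  have "bij (lsub Q)"
    by (rule o_bij[of "lsub P"]) (use lsub_lsub[OF Q] lsub_lsub[of Q P] Q matrix_left_right_inverse[of P Q] in \<open>auto simp: fun_eq_iff\<close>)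
  then have "bij (lsub Q \<circ> sub U V W)" using near(2) by (rule bij_comp[rotated])
  moreover have "lsub Q \<circ> sub U V W = sub (lsub Q U) (lsub Q V) (lsub Q W)" using comp by (simp add: fun_eq_iff)
  ultimately have bij: "bij (sub (lsub Q U) (lsub Q V) (lsub Q W))" by simp
  have subst: "fps_subst (lsub Q U) (lsub Q V) (lsub Q W)"
    by (intro fps_subst.intro Q.sub_fil U.UVW)
  have "sub (lsub Q U) (lsub Q V) (lsub Q W) (fps_u\<^sup>2 + fps_v\<^sup>2 + fps_w\<^sup>2) = lsub Q g'"
    unfolding comp[symmetric] UVW(4) by (simp add: U.sub_add U.sub_power)
  also have "\<dots> = g" unfolding g'_def by (rule lsub_lsub[OF Q])
  finally show ?thesis using hypersurface_iso_sub[OF subst bij] by blast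
qed

text \<open>Up to the constant factor -c the element is 1 - x/c, and
  \<open>inverse_sqrt_unit\<close> yields an inverse of that.\<close>

lemma unit3:
  assumes "coeff3 x 0 0 0 = 0" "c \<noteq> 0"
  shows "x - const3 c dvd 1"
proof -
  have "const3 (- (1 / c)) * x \<in> fil 1" unfolding fil_1_iff using assms by simp
  then have "(1 + const3 (- (1 / c)) * x) - 1 \<in> fil 1" by simp
  then obtain s where s: "s\<^sup>2 * (1 + const3 (- (1 / c)) * x) = 1" using inverse_sqrt_unit by blast
  have "const3 c * const3 (- (1 / c)) = - 1" using assms(2) by (simp flip: const3.hom_mult add: const3.hom_minus const3.hom_1)
  then have "- const3 c * (1 + const3 (- (1 / c)) * x) = x - const3 c"
    by (simp add: algebra_simps)
  moreover have "(- const3 c * (1 + const3 (- (1 / c)) * x)) * (s\<^sup>2 * const3 (- (1 / c))) = - (const3 c * const3 (- (1 / c))) * (s\<^sup>2 * (1 + const3 (- (1 / c)) * x))"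
    by (simp add: algebra_simps)
  ultimately have "(x - const3 c) * (s\<^sup>2 * const3 (- (1 / c))) = 1"
    using s \<open>const3 c * const3 (- (1 / c)) = - 1\<close> by simp
  then show ?thesis by (metis dvd_triv_left)
qed

text \<open>An isomorphism of the quotient rings transports the maximal ideal, hence the linear parts of
  lifts of the coordinates form an invertible matrix; comparing quadratic parts then shows that
  both Hessians have the same rank.\<close>

lemma degenerate_not_A1:
  assumes g: "g \<in> fil 2" and det: "det (hess g) = 0"
  shows "\<not> hypersurface_iso g (fps_u\<^sup>2 + fps_v\<^sup>2 + fps_w\<^sup>2)"
proof
  define q where "q = fps_u\<^sup>2 + fps_v\<^sup>2 + fps_w\<^sup>2"
  assume "hypersurface_iso g (fps_u\<^sup>2 + fps_v\<^sup>2 + fps_w\<^sup>2)"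
  then obtain h where h: "h \<in> ring_iso (hypersurface_ring g) (hypersurface_ring q)"
    and hc: "\<And>c. h (coset3 g (const3 c)) = coset3 q (const3 c)"
    unfolding hypersurface_iso_def PIdl_coset q_def by blast
  have two: "x * y \<in> fil 2" if "x \<in> fil 1" "y \<in> fil 1" for x y
    using fil_mult[OF that] by (simp add: numeral_2_eq_2)
  have q: "q \<in> fil 2"
    unfolding q_def power2_eq_square by (intro fil_add two fps_uvw_fil)
  \<comment> \<open>A relation between representatives replaces the isomorphism, so that no system
    of lifts has to be chosen.\<close>
  define R where "R x y \<longleftrightarrow> h (coset3 g x) = coset3 q y" for x y
  have R_const: "R (const3 c) (const3 c)" for c by (simp add: R_def hc)
  have R_add: "R (x + x') (y + y')" and R_mult: "R (x * x') (y * y')" if "R x y" "R x' y'" for x y x' y'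
  proof -
    have c: "coset3 g x \<in> carrier (hypersurface_ring g)" "coset3 g x' \<in> carrier (hypersurface_ring g)"
      by (simp_all add: hypersurface_ring_simps)
    show "R (x + x') (y + y')" "R (x * x') (y * y')"
      using ring_iso_memE(2)[OF h c] ring_iso_memE(3)[OF h c] that
      by (simp_all add: R_def hypersurface_ring_simps)
  qed
  have bij: "bij_betw h (range (coset3 g)) (range (coset3 q))"
    using ring_iso_memE(5)[OF h] by (simp add: hypersurface_ring_simps)
  have R_total: "\<exists>y. R x y" for x
  proof -
    have "h (coset3 g x) \<in> range (coset3 q)" using bij unfolding bij_betw_def by blast
    then show ?thesis unfolding R_def by blast
  qed
  have R_surj: "\<exists>x. R x y" for y
  proof -
    have "coset3 q y \<in> h ` range (coset3 g)" using bij unfolding bij_betw_def by blast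
    then obtain x where "coset3 q y = h (coset3 g x)" by blast
    then show ?thesis unfolding R_def by (intro exI[of _ x]) simp
  qed
  have R_iff: "g dvd x - x' \<longleftrightarrow> q dvd y - y'" if "R x y" "R x' y'" for x y x' y'
  proof -
    have "coset3 g x = coset3 g x' \<longleftrightarrow> coset3 q y = coset3 q y'"
      using bij that inj_on_eq_iff[of h "range (coset3 g)" "coset3 g x" "coset3 g x'"] unfolding bij_betw_def R_def by simp
    then show ?thesis by (simp only: coset3_eq_iff)
  qed
  have not_dvd: "\<not> p dvd x * y - 1" if "p \<in> fil 2" "x \<in> fil 1" for p x y :: cfps3
  proof
    assume "p dvd x * y - 1"
    then obtain k where "x * y - 1 = p * k" by (rule dvdE)
    then have "coeff3 (x * y - 1) 0 0 0 = coeff3 (p * k) 0 0 0" by simp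
    moreover have "coeff3 x 0 0 0 = 0" "coeff3 p 0 0 0 = 0" using that by (simp_all only: fil_1_iff fil_2_iff)
    ultimately show False by (simp add: coeff3_0_mult coeff3_1)
  qed
  have shift: "x - const3 (coeff3 x 0 0 0) \<in> fil 1" for x unfolding fil_1_iff by (simp add: coeff3_const3)
  have minus: "const3 (- c) = - const3 c" for c by (simp add: const3.hom_minus)
  \<comment> \<open>If x had a nonzero constant term c, then y - c would be a unit and x - c
    invertible modulo g. But x - c has no constant term, and neither has g.\<close>
  have max1: "x \<in> fil 1" if xy: "R x y" "y \<in> fil 1" for x y
  proof (rule ccontr)
    assume "x \<notin> fil 1"
    then have c: "coeff3 x 0 0 0 \<noteq> 0" by (simp only: fil_1_iff not_False_eq_True)
    obtain r where r: "(y - const3 (coeff3 x 0 0 0)) * r = 1"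
      using unit3[of y, OF _ c] xy(2) unfolding fil_1_iff by (metis dvdE)
    obtain r' where r': "R r' r" using R_surj by blast
    have "R ((x + const3 (- coeff3 x 0 0 0)) * r') ((y + const3 (- coeff3 x 0 0 0)) * r)"
      by (intro R_mult R_add R_const xy r')
    then have "R ((x - const3 (coeff3 x 0 0 0)) * r') 1" by (simp add: minus r)
    then have "g dvd (x - const3 (coeff3 x 0 0 0)) * r' - 1"
      using R_iff[OF _ R_const[of 1]] by (simp add: const3.hom_1)
    then show False using not_dvd[OF g shift] by blast
  qed
  have max2: "y \<in> fil 1" if xy: "R x y" "x \<in> fil 1" for x y
  proof (rule ccontr)
    assume "y \<notin> fil 1"
    then have c: "coeff3 y 0 0 0 \<noteq> 0" by (simp only: fil_1_iff not_False_eq_True)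
    obtain r where r: "(x - const3 (coeff3 y 0 0 0)) * r = 1"
      using unit3[of x, OF _ c] xy(2) unfolding fil_1_iff by (metis dvdE)
    obtain r' where r': "R r r'" using R_total by blast
    have "R ((x + const3 (- coeff3 y 0 0 0)) * r) ((y + const3 (- coeff3 y 0 0 0)) * r')"
      by (intro R_mult R_add R_const xy r')
    then have "R 1 ((y - const3 (coeff3 y 0 0 0)) * r')" by (simp add: minus r)
    then have "g dvd 1 - const3 1 \<longleftrightarrow> q dvd (y - const3 (coeff3 y 0 0 0)) * r' - const3 1"
      by (rule R_iff) (rule R_const)
    then have "q dvd (y - const3 (coeff3 y 0 0 0)) * r' - 1" by (simp add: const3.hom_1)
    then show False using not_dvd[OF q shift] by blast
  qed
  obtain U V W where UVW: "R U fps_u" "R V fps_v" "R W fps_w" using R_surj by metis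
  have UVW1: "U \<in> fil 1" "V \<in> fil 1" "W \<in> fil 1" using UVW max1 fps_uvw_fil by blast+
  have "R (U\<^sup>2 + V\<^sup>2 + W\<^sup>2) q" unfolding q_def power2_eq_square by (intro R_add R_mult UVW)
  then have "g dvd (U\<^sup>2 + V\<^sup>2 + W\<^sup>2) - const3 0" using R_iff[OF _ R_const[of 0]] by (simp add: const3.hom_0)
  then obtain k where "U\<^sup>2 + V\<^sup>2 + W\<^sup>2 - const3 0 = g * k" by (rule dvdE)
  then have k: "U\<^sup>2 + V\<^sup>2 + W\<^sup>2 = k * g" by (simp add: const3.hom_0 mult.commute)
  define \<Lambda> :: "complex ^ 3 ^ 3" where "\<Lambda> = vector [lin U, lin V, lin W]"
  have \<Lambda>: "\<Lambda> $ 1 = lin U" "\<Lambda> $ 2 = lin V" "\<Lambda> $ 3 = lin W" by (simp_all add: \<Lambda>_def)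
  have hk: "2 * (\<Lambda> $ 1 $ a * \<Lambda> $ 1 $ b + \<Lambda> $ 2 $ a * \<Lambda> $ 2 $ b + \<Lambda> $ 3 $ a * \<Lambda> $ 3 $ b) = coeff3 k 0 0 0 * hess g $ a $ b" for a b
  proof -
    have "hess (U\<^sup>2 + V\<^sup>2 + W\<^sup>2) $ a $ b = coeff3 k 0 0 0 * hess g $ a $ b"
      unfolding k by (rule hess_mult0[OF g])
    moreover have "hess (U\<^sup>2 + V\<^sup>2 + W\<^sup>2) $ a $ b = 2 * (\<Lambda> $ 1 $ a * \<Lambda> $ 1 $ b + \<Lambda> $ 2 $ a * \<Lambda> $ 2 $ b + \<Lambda> $ 3 $ a * \<Lambda> $ 3 $ b)"
      unfolding power2_eq_square \<Lambda> by (simp only: hess_add vector_add_component hess_mult1[OF UVW1(1) UVW1(1)] hess_mult1[OF UVW1(2) UVW1(2)] hess_mult1[OF UVW1(3) UVW1(3)]) (simp add: algebra_simps)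
    ultimately show ?thesis by simp
  qed
  obtain z where z: "z \<noteq> 0" "hess g *v z = 0" using det det_zero_ker by blast
  have "transpose \<Lambda> *v (\<Lambda> *v z) = 0"
  proof -
    have "2 * (transpose \<Lambda> *v (\<Lambda> *v z)) $ a = coeff3 k 0 0 0 * (hess g *v z) $ a" for a
    proof -
      have "2 * (transpose \<Lambda> *v (\<Lambda> *v z)) $ a =
        (2 * (\<Lambda> $ 1 $ a * \<Lambda> $ 1 $ 1 + \<Lambda> $ 2 $ a * \<Lambda> $ 2 $ 1 + \<Lambda> $ 3 $ a * \<Lambda> $ 3 $ 1)) * z $ 1
        + (2 * (\<Lambda> $ 1 $ a * \<Lambda> $ 1 $ 2 + \<Lambda> $ 2 $ a * \<Lambda> $ 2 $ 2 + \<Lambda> $ 3 $ a * \<Lambda> $ 3 $ 2)) * z $ 2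
        + (2 * (\<Lambda> $ 1 $ a * \<Lambda> $ 1 $ 3 + \<Lambda> $ 2 $ a * \<Lambda> $ 2 $ 3 + \<Lambda> $ 3 $ a * \<Lambda> $ 3 $ 3)) * z $ 3"
        by (simp add: matrix_vector_mult_def transpose_def sum_3 algebra_simps)
      also have "\<dots> = coeff3 k 0 0 0 * (hess g *v z) $ a"
        unfolding hk by (simp add: matrix_vector_mult_def sum_3 algebra_simps)
      finally show ?thesis .
    qed
    then show ?thesis by (simp add: z(2) vec_eq_iff)
  qed
  \<comment> \<open>If \<Lambda> does not kill z, then \<Lambda> z is a kernel vector of the
    transpose; if it does, \<Lambda> is singular and so is its transpose.\<close>
  then obtain c where c: "c \<noteq> 0" "transpose \<Lambda> *v c = 0"
  proof (cases "\<Lambda> *v z = 0")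
    case True
    then have "det \<Lambda> = 0" using z(1) det_zero_ker by blast
    then have "det (transpose \<Lambda>) = 0" by (simp add: det_transpose)
    then show ?thesis using det_zero_ker that by blast
  qed (use that in blast)
  \<comment> \<open>\<open>e\<close> has no linear part, yet it corresponds to the nonzero linear
    form \<open>l\<close>. Since the maximal ideals correspond, so do their squares, up to multiples
    of g and q, which have order 2 themselves.\<close>
  define e where "e = const3 (c $ 1) * U + const3 (c $ 2) * V + const3 (c $ 3) * W"
  define l where "l = const3 (c $ 1) * fps_u + const3 (c $ 2) * fps_v + const3 (c $ 3) * fps_w"
  have Re: "R e l" unfolding e_def l_def by (intro R_add R_mult R_const UVW)
  have "lin e $ a = (transpose \<Lambda> *v c) $ a" for a
    unfolding e_def lin_add lin_const3_mult
    by (simp add: matrix_vector_mult_def transpose_def sum_3 \<Lambda> mult.commute)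
  then have "lin e = transpose \<Lambda> *v c" unfolding vec_eq_iff by blast
  then have "lin e = 0" by (simp only: c(2))
  moreover have "e \<in> fil 1" unfolding e_def by (intro fil_add fil_mult_right UVW1)
  ultimately have "e \<in> fil (Suc 1)" using fil_2_lin[of e] by (simp add: numeral_2_eq_2)
  then obtain x1 x2 x3 where x: "x1 \<in> fil 1" "x2 \<in> fil 1" "x3 \<in> fil 1" "e = fps_u * x1 + fps_v * x2 + fps_w * x3"
    using fil_Suc_decompose by blast
  obtain A B C where ABC: "R fps_u A" "R fps_v B" "R fps_w C" using R_total by metis
  obtain y1 y2 y3 where y: "R x1 y1" "R x2 y2" "R x3 y3" using R_total by metis
  have "R e (A * y1 + B * y2 + C * y3)" unfolding x(4) by (intro R_add R_mult ABC y)
  then have "g dvd e - e \<longleftrightarrow> q dvd l - (A * y1 + B * y2 + C * y3)" by (rule R_iff[OF Re])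
  then have "q dvd l - (A * y1 + B * y2 + C * y3)" by simp
  then obtain k' where k': "l - (A * y1 + B * y2 + C * y3) = q * k'" by (rule dvdE)
  have "A * y1 + B * y2 + C * y3 \<in> fil 2"
    using ABC y x fps_uvw_fil by (intro fil_add two) (blast intro: max2)+
  then have "l \<in> fil 2"
    using fil_add[OF fil_mult_left[OF q, of k'] \<open>A * y1 + B * y2 + C * y3 \<in> fil 2\<close>] unfolding k'[symmetric] by simp
  then have "lin l = 0" using fil_2_lin by blast
  moreover have "lin l = c"
    by (simp add: l_def lin_add lin_const3_mult lin_uvw vec_eq_iff forall_3)
  ultimately show False using c(1) by simp
qed

theorem A1_iff_nondegenerate:
  assumes "g \<in> fil 2"
  shows "hypersurface_iso g (fps_u ^ 2 + fps_v ^ 2 + fps_w ^ (1 + 1)) \<longleftrightarrow> det (hess g) \<noteq> 0"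
  using A1_of_nondegenerate[OF assms] degenerate_not_A1[OF assms] by (auto simp: numeral_2_eq_2)

section \<open>Local equations\<close>

text \<open>f and all its first derivatives vanish at (a, b), up to the factor 2 of polarisation.
  The condition is stated on the affine cones, so no chart is involved.\<close>

definition singt :: "tensor \<Rightarrow> complex ^ 2 \<Rightarrow> complex ^ 3 \<Rightarrow> bool" where
  "singt T a b \<longleftrightarrow> mform T a a b b = 0 \<and> (\<forall>x. mform T a x b b = 0) \<and> (\<forall>y. mform T a a b y = 0)"

text \<open>The Hessian of $f(a + x, b + y)$ at the origin has a kernel vector that is not accounted for
  by Euler's relation.\<close>

definition degent :: "tensor \<Rightarrow> complex ^ 2 \<Rightarrow> complex ^ 3 \<Rightarrow> bool" where
  "degent T a b \<longleftrightarrow> (\<exists>x y. \<not> (\<exists>\<alpha> \<beta>. x = \<alpha> *s a \<and> y = \<beta> *s b) \<and>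
     (\<forall>x'. mform T x x' b b + 2 * mform T a x' b y = 0) \<and>
     (\<forall>y'. 2 * mform T a x b y' + mform T a a y y' = 0))"

lemma singt_scale:
  assumes "c \<noteq> 0" "d \<noteq> 0"
  shows "singt T (c *s a) (d *s b) \<longleftrightarrow> singt T a b"
  unfolding singt_def using assms by (simp only: mform_scale) simp

lemma degent_scale_imp:
  assumes "c \<noteq> 0" "d \<noteq> 0" "degent T a b"
  shows "degent T (c *s a) (d *s b)"
proof -
  obtain x y where xy: "\<not> (\<exists>\<alpha> \<beta>. x = \<alpha> *s a \<and> y = \<beta> *s b)"
    "\<And>x'. mform T x x' b b + 2 * mform T a x' b y = 0" "\<And>y'. 2 * mform T a x b y' + mform T a a y y' = 0"
    using assms(3) unfolding degent_def by blast
  have "\<not> (\<exists>\<alpha> \<beta>. c *s x = \<alpha> *s (c *s a) \<and> d *s y = \<beta> *s (d *s b))"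
  proof
    assume "\<exists>\<alpha> \<beta>. c *s x = \<alpha> *s (c *s a) \<and> d *s y = \<beta> *s (d *s b)"
    then obtain \<alpha> \<beta> where "c *s x = c *s (\<alpha> *s a)" "d *s y = d *s (\<beta> *s b)"
      by (auto simp: vector_smult_assoc mult.commute)
    then have "x = \<alpha> *s a" "y = \<beta> *s b" using assms(1,2) by (simp_all add: vec_eq_iff)
    then show False using xy(1) by blast
  qed
  moreover have "mform T (c *s x) x' (d *s b) (d *s b) + 2 * mform T (c *s a) x' (d *s b) (d *s y) = 0" for x'
  proof -
    have "mform T (c *s x) x' (d *s b) (d *s b) + 2 * mform T (c *s a) x' (d *s b) (d *s y)
      = c * d * d * (mform T x x' b b + 2 * mform T a x' b y)" by (simp only: mform_scale) (simp add: algebra_simps)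
    then show ?thesis by (simp add: xy)
  qed
  moreover have "2 * mform T (c *s a) (c *s x) (d *s b) y' + mform T (c *s a) (c *s a) (d *s y) y' = 0" for y'
  proof -
    have "2 * mform T (c *s a) (c *s x) (d *s b) y' + mform T (c *s a) (c *s a) (d *s y) y'
      = c * c * d * (2 * mform T a x b y' + mform T a a y y')" by (simp only: mform_scale) (simp add: algebra_simps)
    then show ?thesis by (simp add: xy)
  qed
  ultimately show ?thesis unfolding degent_def by blast
qed

lemma degent_scale:
  assumes "c \<noteq> 0" "d \<noteq> 0"
  shows "degent T (c *s a) (d *s b) \<longleftrightarrow> degent T a b"
proof
  assume "degent T (c *s a) (d *s b)"
  then have "degent T (inverse c *s (c *s a)) (inverse d *s (d *s b))"
    using degent_scale_imp[of "inverse c" "inverse d" T "c *s a" "d *s b"] assms by simp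
  then show "degent T a b" using assms by (simp add: vector_smult_assoc)
qed (rule degent_scale_imp[OF assms])

section \<open>Expansion in affine charts\<close>

lemma gform_eq_mform_const3:
  "gform const3 T (\<lambda>i. const3 (x $ i)) (\<lambda>i. const3 (x' $ i)) (\<lambda>j. const3 (y $ j)) (\<lambda>j. const3 (y' $ j)) = const3 (mform T x x' y y')"
  by (rule const3.gform_hom)

text \<open>The Taylor expansion of f at (a, b) in three given directions. With general directions
  its coefficients are plain values of the tensor; a chart is a choice of coordinate vectors as
  directions.\<close>

definition loc :: "tensor \<Rightarrow> complex ^ 2 \<Rightarrow> complex ^ 3 \<Rightarrow> complex ^ 2 \<Rightarrow> complex ^ 3 \<Rightarrow> complex ^ 3 \<Rightarrow> cfps3" where
  "loc T a b \<xi> \<eta> \<zeta> = gform const3 T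
     (\<lambda>k. const3 (a $ k) + fps_u * const3 (\<xi> $ k)) (\<lambda>k. const3 (a $ k) + fps_u * const3 (\<xi> $ k))
     (\<lambda>k. const3 (b $ k) + fps_v * const3 (\<eta> $ k) + fps_w * const3 (\<zeta> $ k))
     (\<lambda>k. const3 (b $ k) + fps_v * const3 (\<eta> $ k) + fps_w * const3 (\<zeta> $ k))"

lemma loc_coeffs:
  assumes "sym_tensor T"
  shows "coeff3 (loc T a b \<xi> \<eta> \<zeta>) 0 0 0 = mform T a a b b"
    "coeff3 (loc T a b \<xi> \<eta> \<zeta>) 1 0 0 = 2 * mform T a \<xi> b b"
    "coeff3 (loc T a b \<xi> \<eta> \<zeta>) 0 1 0 = 2 * mform T a a b \<eta>"
    "coeff3 (loc T a b \<xi> \<eta> \<zeta>) 0 0 1 = 2 * mform T a a b \<zeta>"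
    "coeff3 (loc T a b \<xi> \<eta> \<zeta>) 2 0 0 = mform T \<xi> \<xi> b b"
    "coeff3 (loc T a b \<xi> \<eta> \<zeta>) 1 1 0 = 4 * mform T a \<xi> b \<eta>"
    "coeff3 (loc T a b \<xi> \<eta> \<zeta>) 1 0 1 = 4 * mform T a \<xi> b \<zeta>"
    "coeff3 (loc T a b \<xi> \<eta> \<zeta>) 0 2 0 = mform T a a \<eta> \<eta>"
    "coeff3 (loc T a b \<xi> \<eta> \<zeta>) 0 1 1 = 2 * mform T a a \<eta> \<zeta>"
    "coeff3 (loc T a b \<xi> \<eta> \<zeta>) 0 0 2 = mform T a a \<zeta> \<zeta>"
  unfolding loc_def gform_add gform_scale gform_eq_mform_const3 coeff3_linear coeff3_shift coeff3_const3
  by (simp_all add: gform_commute(1)[OF assms, of _ "($) \<xi>" "($) a"] gform_commute(2)[OF assms, of _ _ _ "($) \<eta>" "($) b"]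
      gform_commute(2)[OF assms, of _ _ _ "($) \<zeta>" "($) b"] gform_commute(2)[OF assms, of _ _ _ "($) \<zeta>" "($) \<eta>"])

lemma local_equation_iff:
  "local_equation (poly_of T) P g \<longleftrightarrow> (\<exists>i j. \<exists>a\<in>fst P. \<exists>b\<in>snd P. a $ i = 1 \<and> b $ j = 1 \<and>
     g = loc T a b (axis (i + 1) 1) (axis (j + 1) 1) (axis (j + 2) 1))"
proof -
  have ne: "j + 1 \<noteq> j + 2" for j :: 3 using exhaust_3[of j] by auto
  have "case_sum (\<lambda>k. const3 (a $ k) + (if k = i + 1 then fps_u else 0))
      (\<lambda>k. const3 (b $ k) + (if k = j + 1 then fps_v else if k = j + 2 then fps_w else 0)) \<circ> Inl =
    (\<lambda>k. const3 (a $ k) + fps_u * const3 (axis (i + 1) 1 $ k))" for a :: "complex ^ 2" and b :: "complex ^ 3" and i j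
    by (auto simp: fun_eq_iff axis_def const3.hom_0 const3.hom_1)
  moreover have "case_sum (\<lambda>k. const3 (a $ k) + (if k = i + 1 then fps_u else 0))
      (\<lambda>k. const3 (b $ k) + (if k = j + 1 then fps_v else if k = j + 2 then fps_w else 0)) \<circ> Inr =
    (\<lambda>k. const3 (b $ k) + fps_v * const3 (axis (j + 1) 1 $ k) + fps_w * const3 (axis (j + 2) 1 $ k))" for a :: "complex ^ 2" and b :: "complex ^ 3" and i j
    using ne[of j] by (auto simp: fun_eq_iff axis_def const3.hom_0 const3.hom_1)
  ultimately show ?thesis
    unfolding local_equation_def const3.subst_poly_of loc_def by simp
qed

text \<open>The vector \<open>a\<close> and the other coordinate vector form a basis, so a condition
  that holds along \<open>a\<close> by homogeneity only needs to be tested in the direction of the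
  chart.\<close>

lemma chart2:
  fixes a :: "complex ^ 2"
  assumes "a $ i = 1"
  shows "x = (x $ i) *s a + (x $ (i + 1) - x $ i * a $ (i + 1)) *s axis (i + 1) 1"
proof -
  have k: "k = i \<or> k = i + 1" for k using exhaust_2[of i] exhaust_2[of k] by auto
  have ne: "i \<noteq> i + 1" using exhaust_2[of i] by auto
  show ?thesis
    unfolding vec_eq_iff
  proof
    fix l
    show "x $ l = ((x $ i) *s a + (x $ (i + 1) - x $ i * a $ (i + 1)) *s axis (i + 1) 1) $ l"
      using k[of l] ne assms by (elim disjE) (simp_all add: axis_def)
  qed
qed

lemma chart3:
  fixes b :: "complex ^ 3"
  assumes "b $ j = 1"
  shows "y = (y $ j) *s b + (y $ (j + 1) - y $ j * b $ (j + 1)) *s axis (j + 1) 1 + (y $ (j + 2) - y $ j * b $ (j + 2)) *s axis (j + 2) 1"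
proof -
  have k: "k = j \<or> k = j + 1 \<or> k = j + 2" for k using exhaust_3[of j] exhaust_3[of k] by auto
  have ne: "j \<noteq> j + 1" "j \<noteq> j + 2" "j + 1 \<noteq> j + 2" using exhaust_3[of j] by auto
  show ?thesis
    unfolding vec_eq_iff
  proof
    fix l
    show "y $ l = ((y $ j) *s b + (y $ (j + 1) - y $ j * b $ (j + 1)) *s axis (j + 1) 1 + (y $ (j + 2) - y $ j * b $ (j + 2)) *s axis (j + 2) 1) $ l"
      using k[of l] ne assms by (elim disjE) (simp_all add: axis_def)
  qed
qed

lemma loc_fil_2:
  assumes T: "sym_tensor T" and a: "a $ i = 1" and b: "b $ j = 1"
  shows "loc T a b (axis (i + 1) 1) (axis (j + 1) 1) (axis (j + 2) 1) \<in> fil 2 \<longleftrightarrow> singt T a b"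
proof
  assume "loc T a b (axis (i + 1) 1) (axis (j + 1) 1) (axis (j + 2) 1) \<in> fil 2"
  then have 0: "mform T a a b b = 0" "mform T a (axis (i + 1) 1) b b = 0" "mform T a a b (axis (j + 1) 1) = 0" "mform T a a b (axis (j + 2) 1) = 0"
    unfolding fil_2_iff loc_coeffs[OF T] by simp_all
  have "mform T a x b b = 0" for x
    by (subst chart2[OF a, of x]) (simp only: mform_add mform_scale 0, simp)
  moreover have "mform T a a b y = 0" for y
    by (subst chart3[OF b, of y]) (simp only: mform_add mform_scale 0, simp)
  ultimately show "singt T a b" unfolding singt_def using 0(1) by blast
next
  assume "singt T a b"
  then show "loc T a b (axis (i + 1) 1) (axis (j + 1) 1) (axis (j + 2) 1) \<in> fil 2"
    unfolding fil_2_iff loc_coeffs[OF T] singt_def by simp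
qed

text \<open>At a singular point the equations of \<open>degent\<close> do not change if multiples of
  a and b are added to x and y, and they hold trivially for x' = a and y' = b. Only the directions
  of the chart remain, and for these the equations say that the Hessian kills a vector.\<close>

lemma loc_hess:
  assumes T: "sym_tensor T" and a: "a $ i = 1" and b: "b $ j = 1" and s: "singt T a b"
  shows "det (hess (loc T a b (axis (i + 1) 1) (axis (j + 1) 1) (axis (j + 2) 1))) = 0 \<longleftrightarrow> degent T a b"
proof -
  define \<xi> \<eta> \<zeta> where "\<xi> = (axis (i + 1) 1 :: complex ^ 2)" "\<eta> = (axis (j + 1) 1 :: complex ^ 3)" "\<zeta> = (axis (j + 2) 1 :: complex ^ 3)"
  define H where "H = hess (loc T a b \<xi> \<eta> \<zeta>)"
  define Q1 where "Q1 x y x' = mform T x x' b b + 2 * mform T a x' b y" for x y x'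
  define Q2 where "Q2 x y y' = 2 * mform T a x b y' + mform T a a y y'" for x y y'
  have s0: "mform T a x b b = 0" "mform T x a b b = 0" "mform T a a b y = 0" "mform T a a y b = 0" for x y
    using s gform_commute[OF T] unfolding singt_def by metis+
  have commute: "mform T \<xi> x b b = mform T x \<xi> b b" "mform T a a \<zeta> \<eta> = mform T a a \<eta> \<zeta>" for x
    by (rule gform_commute[OF T])+
  have Q_lin: "Q1 x y (c *s a + d *s \<xi>) = d * Q1 x y \<xi>" for x y c d
    unfolding Q1_def mform_add mform_scale s0 by (simp add: algebra_simps)
  have Q2_lin: "Q2 x y (c *s b + d *s \<eta> + e *s \<zeta>) = d * Q2 x y \<eta> + e * Q2 x y \<zeta>" for x y c d e
    unfolding Q2_def mform_add mform_scale s0 by (simp add: algebra_simps)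
  have Hz: "(H *v z) $ 1 = 2 * Q1 (z $ 1 *s \<xi>) (z $ 2 *s \<eta> + z $ 3 *s \<zeta>) \<xi>"
    "(H *v z) $ 2 = 2 * Q2 (z $ 1 *s \<xi>) (z $ 2 *s \<eta> + z $ 3 *s \<zeta>) \<eta>"
    "(H *v z) $ 3 = 2 * Q2 (z $ 1 *s \<xi>) (z $ 2 *s \<eta> + z $ 3 *s \<zeta>) \<zeta>" for z
    unfolding Q1_def Q2_def mform_add mform_scale H_def matrix_vector_mult_def sum_3 hess_def vec_lambda_beta vector_3 loc_coeffs[OF T] commute(2)
    by (simp_all add: algebra_simps)
  have ne: "k \<noteq> k + 1" for k :: 2 using exhaust_2[of k] by auto
  have ne3: "k \<noteq> k + 1" "k \<noteq> k + 2" "k + 1 \<noteq> k + 2" "k + 2 \<noteq> k + 1" "k + 1 \<noteq> k" "k + 2 \<noteq> k" for k :: 3 using exhaust_3[of k] by auto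
  have "det H = 0 \<longleftrightarrow> degent T a b"
  proof
    assume "det H = 0"
    then obtain z where z: "z \<noteq> 0" "H *v z = 0" using det_zero_ker by blast
    define x where "x = z $ 1 *s \<xi>"
    define y where "y = z $ 2 *s \<eta> + z $ 3 *s \<zeta>"
    have Q0: "Q1 x y \<xi> = 0" "Q2 x y \<eta> = 0" "Q2 x y \<zeta> = 0"
      using Hz[of z] z(2) by (simp_all add: x_def y_def)
    have "\<not> (\<exists>\<alpha> \<beta>. x = \<alpha> *s a \<and> y = \<beta> *s b)"
    proof
      assume "\<exists>\<alpha> \<beta>. x = \<alpha> *s a \<and> y = \<beta> *s b"
      then obtain \<alpha> \<beta> where ab: "x = \<alpha> *s a" "y = \<beta> *s b" by blast
      have "x $ i = 0" "y $ j = 0" by (simp_all add: x_def y_def \<xi>_\<eta>_\<zeta>_def axis_def ne ne3)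
      then have "\<alpha> = 0" "\<beta> = 0" using ab a b by auto
      then have "x $ (i + 1) = 0" "y $ (j + 1) = 0" "y $ (j + 2) = 0" using ab by auto
      then have "z $ 1 = 0" "z $ 2 = 0" "z $ 3 = 0"
        by (auto simp: x_def y_def \<xi>_\<eta>_\<zeta>_def axis_def ne3)
      then show False using z(1) by (simp add: vec_eq_iff forall_3)
    qed
    moreover have "Q1 x y x' = 0" for x'
      using Q_lin[of x y "x' $ i" "x' $ (i + 1) - x' $ i * a $ (i + 1)"] chart2[OF a, of x'] Q0 by (simp add: \<xi>_\<eta>_\<zeta>_def)
    moreover have "Q2 x y y' = 0" for y'
      using Q2_lin[of x y "y' $ j" "y' $ (j + 1) - y' $ j * b $ (j + 1)" "y' $ (j + 2) - y' $ j * b $ (j + 2)"] chart3[OF b, of y'] Q0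
      by (simp add: \<xi>_\<eta>_\<zeta>_def)
    ultimately show "degent T a b" unfolding degent_def Q1_def Q2_def by blast
  next
    assume "degent T a b"
    then obtain x y where xy: "\<not> (\<exists>\<alpha> \<beta>. x = \<alpha> *s a \<and> y = \<beta> *s b)" "\<And>x'. Q1 x y x' = 0" "\<And>y'. Q2 x y y' = 0"
      unfolding degent_def Q1_def Q2_def by blast
    define z :: "complex ^ 3" where "z = vector [x $ (i + 1) - x $ i * a $ (i + 1), y $ (j + 1) - y $ j * b $ (j + 1), y $ (j + 2) - y $ j * b $ (j + 2)]"
    have x: "x = x $ i *s a + z $ 1 *s \<xi>" using chart2[OF a, of x] by (simp add: z_def \<xi>_\<eta>_\<zeta>_def)
    have y: "y = y $ j *s b + (z $ 2 *s \<eta> + z $ 3 *s \<zeta>)" using chart3[OF b, of y] by (simp add: z_def \<xi>_\<eta>_\<zeta>_def add.assoc)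
    have "z \<noteq> 0"
    proof
      assume "z = 0"
      then have "x = x $ i *s a" "y = y $ j *s b" using x y by simp_all
      then show False using xy(1) by blast
    qed
    moreover have "Q1 (\<alpha> *s a + x0) (\<beta> *s b + y0) x' = Q1 x0 y0 x'" for \<alpha> \<beta> x0 y0 x'
      unfolding Q1_def mform_add mform_scale s0 by simp
    then have "Q1 (z $ 1 *s \<xi>) (z $ 2 *s \<eta> + z $ 3 *s \<zeta>) x' = 0" for x' using xy(2)[of x'] x y by metis
    moreover have "Q2 (\<alpha> *s a + x0) (\<beta> *s b + y0) y' = Q2 x0 y0 y'" for \<alpha> \<beta> x0 y0 y'
      unfolding Q2_def mform_add mform_scale s0 by simp
    then have "Q2 (z $ 1 *s \<xi>) (z $ 2 *s \<eta> + z $ 3 *s \<zeta>) y' = 0" for y' using xy(3)[of y'] x y by metis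
    ultimately have "H *v z = 0" by (simp add: vec_eq_iff forall_3 Hz)
    then show "det H = 0" using \<open>z \<noteq> 0\<close> det_zero_ker by blast
  qed
  then show ?thesis by (simp only: H_def \<xi>_\<eta>_\<zeta>_def)
qed

section \<open>Points of the surface as spans of vectors\<close>

lemma span_unit:
  fixes a :: "complex ^ 'n"
  assumes "a \<noteq> 0"
  obtains a' c i where "a' \<in> vec.span {a}" "a' $ i = 1" "a' = c *s a" "c \<noteq> 0"
proof -
  obtain i where i: "a $ i \<noteq> 0" using assms by (auto simp: vec_eq_iff)
  show ?thesis
  proof (rule that[of "inverse (a $ i) *s a" i "inverse (a $ i)"])
    show "inverse (a $ i) *s a \<in> vec.span {a}" by (intro vec.span_scale vec.span_base) simp
  qed (use i in simp_all)
qed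

lemma span_singleton_scale:
  fixes a :: "complex ^ 'n"
  assumes "a' \<in> vec.span {a}" "a' \<noteq> 0"
  obtains c where "a' = c *s a" "c \<noteq> 0"
  using assms by (auto simp: vec.span_singleton)

lemma span_in_proj_space: "a \<noteq> 0 \<Longrightarrow> vec.span {a} \<in> proj_space"
  by (auto simp: proj_space_def)

lemma surface_iff:
  assumes "a \<noteq> 0" "b \<noteq> 0"
  shows "(vec.span {a}, vec.span {b}) \<in> surface (poly_of T) \<longleftrightarrow> mform T a a b b = 0"
proof
  assume "(vec.span {a}, vec.span {b}) \<in> surface (poly_of T)"
  moreover have "a \<in> vec.span {a}" "b \<in> vec.span {b}" by (simp_all add: vec.span_base)
  ultimately show "mform T a a b b = 0" unfolding surface_def eval2_poly_of by auto
next
  assume "mform T a a b b = 0"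
  then have "mform T (c *s a) (c *s a) (d *s b) (d *s b) = 0" for c d by (simp only: mform_scale) simp
  then show "(vec.span {a}, vec.span {b}) \<in> surface (poly_of T)"
    unfolding surface_def eval2_poly_of using span_in_proj_space[OF assms(1)] span_in_proj_space[OF assms(2)] by (auto simp: vec.span_singleton)
qed

lemma chart_elem:
  fixes a :: "complex ^ 'n"
  assumes "a' \<in> vec.span {a}" "a' $ i = 1"
  obtains c where "a' = c *s a" "c \<noteq> 0"
proof -
  have "a' \<noteq> 0" using assms(2) by auto
  then show ?thesis using span_singleton_scale[OF assms(1)] that by blast
qed

text \<open>\<open>singt\<close> is invariant under rescaling of the representatives, so it does not
  matter which chart is used.\<close>

lemma sing_locus_iff:
  assumes T: "sym_tensor T" and ab: "a \<noteq> 0" "b \<noteq> 0"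
  shows "(vec.span {a}, vec.span {b}) \<in> sing_locus (poly_of T) \<longleftrightarrow> singt T a b"
proof
  assume *: "(vec.span {a}, vec.span {b}) \<in> sing_locus (poly_of T)"
  then obtain i j a' b' where a': "a' \<in> vec.span {a}" "a' $ i = 1" and b': "b' \<in> vec.span {b}" "b' $ j = 1"
    and c: "coeff3 (loc T a' b' (axis (i + 1) 1) (axis (j + 1) 1) (axis (j + 2) 1)) 1 0 0 = 0"
      "coeff3 (loc T a' b' (axis (i + 1) 1) (axis (j + 1) 1) (axis (j + 2) 1)) 0 1 0 = 0"
      "coeff3 (loc T a' b' (axis (i + 1) 1) (axis (j + 1) 1) (axis (j + 2) 1)) 0 0 1 = 0"
    unfolding sing_locus_def local_equation_iff by auto
  obtain c where cc: "a' = c *s a" "c \<noteq> 0" using chart_elem[OF a'] .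
  obtain d where d: "b' = d *s b" "d \<noteq> 0" using chart_elem[OF b'] .
  have "mform T a a b b = 0" using * surface_iff[OF ab] by (simp add: sing_locus_def)
  then have "mform T a' a' b' b' = 0" unfolding cc d by (simp only: mform_scale) simp
  then have "singt T a' b'"
    using c unfolding loc_fil_2[OF T a'(2) b'(2), symmetric] fil_2_iff by (simp add: loc_coeffs(1)[OF T])
  then show "singt T a b" using singt_scale cc d by blast
next
  assume s: "singt T a b"
  obtain a' c i where a': "a' \<in> vec.span {a}" "a' $ i = 1" "a' = c *s a" "c \<noteq> 0" using span_unit[OF ab(1)] .
  obtain b' d j where b': "b' \<in> vec.span {b}" "b' $ j = 1" "b' = d *s b" "d \<noteq> 0" using span_unit[OF ab(2)] .
  have "singt T a' b'" using s singt_scale a' b' by blast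
  then have "loc T a' b' (axis (i + 1) 1) (axis (j + 1) 1) (axis (j + 2) 1) \<in> fil 2"
    using loc_fil_2[OF T a'(2) b'(2)] by blast
  moreover have "local_equation (poly_of T) (vec.span {a}, vec.span {b}) (loc T a' b' (axis (i + 1) 1) (axis (j + 1) 1) (axis (j + 2) 1))"
    unfolding local_equation_iff fst_conv snd_conv
    by (intro exI[of _ i] exI[of _ j] bexI[of _ a'] bexI[of _ b'] conjI refl a'(1,2) b'(1,2))
  moreover have "(vec.span {a}, vec.span {b}) \<in> surface (poly_of T)"
    using s surface_iff[OF ab] by (simp add: singt_def)
  ultimately show "(vec.span {a}, vec.span {b}) \<in> sing_locus (poly_of T)"
    unfolding sing_locus_def fil_2_iff by blast
qed

text \<open>Chart independence again: \<open>singt\<close> and \<open>degent\<close> are both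
  invariant under rescaling, so the power series criterion may be applied in any chart.\<close>

lemma A1_iff:
  assumes T: "sym_tensor T" and ab: "a \<noteq> 0" "b \<noteq> 0" and s: "singt T a b"
  shows "A_type 1 (poly_of T) (vec.span {a}, vec.span {b}) \<longleftrightarrow> \<not> degent T a b"
proof -
  have key: "hypersurface_iso (loc T a' b' (axis (i + 1) 1) (axis (j + 1) 1) (axis (j + 2) 1)) (fps_u ^ 2 + fps_v ^ 2 + fps_w ^ (1 + 1))
      \<longleftrightarrow> \<not> degent T a b"
    if "a' $ i = 1" "a' = c *s a" "c \<noteq> 0" "b' $ j = 1" "b' = d *s b" "d \<noteq> 0" for a' b' c d i j
  proof -
    have s': "singt T a' b'" using s singt_scale that by blast
    then have fil: "loc T a' b' (axis (i + 1) 1) (axis (j + 1) 1) (axis (j + 2) 1) \<in> fil 2"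
      using loc_fil_2[OF T that(1,4)] by blast
    have "hypersurface_iso (loc T a' b' (axis (i + 1) 1) (axis (j + 1) 1) (axis (j + 2) 1)) (fps_u ^ 2 + fps_v ^ 2 + fps_w ^ (1 + 1)) \<longleftrightarrow> \<not> degent T a' b'"
      using A1_iff_nondegenerate[OF fil] loc_hess[OF T that(1,4) s'] by simp
    then show ?thesis using degent_scale that by blast
  qed
  have surf: "(vec.span {a}, vec.span {b}) \<in> surface (poly_of T)"
    using s surface_iff[OF ab] by (simp add: singt_def)
  show ?thesis
  proof
    assume "A_type 1 (poly_of T) (vec.span {a}, vec.span {b})"
    then obtain i j a' b' where a': "a' \<in> vec.span {a}" "a' $ i = 1" and b': "b' \<in> vec.span {b}" "b' $ j = 1"
      and iso: "hypersurface_iso (loc T a' b' (axis (i + 1) 1) (axis (j + 1) 1) (axis (j + 2) 1)) (fps_u ^ 2 + fps_v ^ 2 + fps_w ^ (1 + 1))"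
      unfolding A_type_def local_equation_iff by auto
    obtain c where c: "a' = c *s a" "c \<noteq> 0" using chart_elem[OF a'] .
    obtain d where d: "b' = d *s b" "d \<noteq> 0" using chart_elem[OF b'] .
    show "\<not> degent T a b" using key[OF a'(2) c b'(2) d] iso by blast
  next
    assume nd: "\<not> degent T a b"
    obtain a' c i where a': "a' \<in> vec.span {a}" "a' $ i = 1" "a' = c *s a" "c \<noteq> 0" using span_unit[OF ab(1)] .
    obtain b' d j where b': "b' \<in> vec.span {b}" "b' $ j = 1" "b' = d *s b" "d \<noteq> 0" using span_unit[OF ab(2)] .
    have "local_equation (poly_of T) (vec.span {a}, vec.span {b}) (loc T a' b' (axis (i + 1) 1) (axis (j + 1) 1) (axis (j + 2) 1))"
      unfolding local_equation_iff fst_conv snd_conv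
    by (intro exI[of _ i] exI[of _ j] bexI[of _ a'] bexI[of _ b'] conjI refl a'(1,2) b'(1,2))
    then show "A_type 1 (poly_of T) (vec.span {a}, vec.span {b})"
      unfolding A_type_def using surf key[OF a'(2-4) b'(2-4)] nd by blast
  qed
qed

section \<open>Reduced fibres\<close>

lemma cpoly_induct [case_names Const Var add mult]:
  fixes p :: "'v::finite cpoly"
  assumes C: "\<And>c. P (Const c)" and V: "\<And>v. P (Var v)"
    and add: "\<And>p q. P p \<Longrightarrow> P q \<Longrightarrow> P (p + q)" and mult: "\<And>p q. P p \<Longrightarrow> P q \<Longrightarrow> P (p * q)"
  shows "P p"
proof -
  have 0: "P 0" and 1: "P 1" using C[of 0] C[of 1] by (simp_all add: Const_def)
  have pow: "P (q ^ n)" if "P q" for q n by (induction n) (simp_all add: 1 mult that)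
  have prod: "P (prod h A)" if "\<And>v. P (h v)" for h and A :: "'v set"
    by (induction A rule: infinite_finite_induct) (simp_all add: 1 mult that)
  have sum: "P (sum h A)" if "\<And>m. P (h m)" for h and A :: "('v \<Rightarrow>\<^sub>0 nat) set"
    by (induction A rule: infinite_finite_induct) (simp_all add: 0 add that)
  have "p = subst_poly Const Var p"
    by (rule eval_inject) (simp add: eval_def id.subst_subst)
  then have "p = (\<Sum>m\<in>Poly_Mapping.keys p. Const (Poly_Mapping.lookup p m) * (\<Prod>v\<in>UNIV. Var v ^ Poly_Mapping.lookup m v))"
    unfolding subst_poly_def .
  moreover have "P (\<Sum>m\<in>Poly_Mapping.keys p. Const (Poly_Mapping.lookup p m) * (\<Prod>v\<in>UNIV. Var v ^ Poly_Mapping.lookup m v))"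
    by (intro sum mult C prod pow V)
  ultimately show ?thesis by simp
qed

lemma continuous_eval:
  "continuous_on UNIV (eval p)"
  by (induction p rule: cpoly_induct) (simp_all add: continuous_intros)

text \<open>Continuity along a line, used to carry identities from generic points to special
  ones.\<close>

lemma tendsto_eval_line:
  fixes e :: "complex ^ 'v::finite"
  shows "(\<lambda>t. eval p (y + t *s e)) \<midarrow>0\<rightarrow> eval p y"
proof -
  have "continuous_on UNIV (\<lambda>t. \<chi> i. y $ i + t * e $ i)"
    by (intro continuous_on_vec_lambda continuous_intros)
  moreover have "(\<chi> i. y $ i + t * e $ i) = y + t *s e" for t by (simp add: vec_eq_iff)
  ultimately have "continuous_on UNIV (\<lambda>t. y + t *s e)" by simp
  then have "continuous_on UNIV (\<lambda>t. eval p (y + t *s e))"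
    by (rule continuous_on_compose2[OF continuous_eval]) simp
  then have "isCont (\<lambda>t. eval p (y + t *s e)) 0" by (simp add: continuous_on_eq_continuous_at)
  then show ?thesis by (simp add: isCont_def)
qed

section \<open>Divisibility by linear forms\<close>

definition linpoly :: "('v::finite \<Rightarrow> complex) \<Rightarrow> 'v cpoly" where
  "linpoly l = (\<Sum>v\<in>UNIV. Const (l v) * Var v)"

lemma eval_linpoly: "eval (linpoly l) y = (\<Sum>v\<in>UNIV. l v * y $ v)"
  by (simp add: linpoly_def eval_sum)

text \<open>Induction on the construction of p; for products the quotient follows a Leibniz rule
  with a correction term. If l(c) = 1, then y - l(y) c is the projection of y to the hyperplane l =
  0, and the remainder depends only on the restriction of p to it.\<close>

lemma division_by_linear:
  fixes p :: "'v::finite cpoly"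
  shows "\<exists>k. \<forall>y. eval p y = eval p (y - eval (linpoly l) y *s c) + eval (linpoly l) y * eval k y"
proof (induction p rule: cpoly_induct)
  case (Const r)
  show ?case by (intro exI[of _ 0]) simp
next
  case (Var v)
  show ?case by (intro exI[of _ "Const (c $ v)"]) simp
next
  case (add p q)
  then obtain k k' where "\<And>y. eval p y = eval p (y - eval (linpoly l) y *s c) + eval (linpoly l) y * eval k y"
    "\<And>y. eval q y = eval q (y - eval (linpoly l) y *s c) + eval (linpoly l) y * eval k' y" by blast
  note k = this
  have alg: "(P + L * A) + (Q + L * B) = (P + Q) + L * (A + B)" for P Q L A B :: complex
    by (simp add: algebra_simps)
  have "eval (p + q) y = eval (p + q) (y - eval (linpoly l) y *s c) + eval (linpoly l) y * eval (k + k') y" for y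
    using alg[of "eval p (y - eval (linpoly l) y *s c)" "eval (linpoly l) y" "eval k y" "eval q (y - eval (linpoly l) y *s c)" "eval k' y"]
    by (simp only: k(1)[of y, symmetric] k(2)[of y, symmetric] eval_simps)
  then show ?case by blast
next
  case (mult p q)
  then obtain k k' where k: "\<And>y. eval p y = eval p (y - eval (linpoly l) y *s c) + eval (linpoly l) y * eval k y"
    "\<And>y. eval q y = eval q (y - eval (linpoly l) y *s c) + eval (linpoly l) y * eval k' y" by blast
  have alg: "(P + L * A) * (Q + L * B) = P * Q + L * ((P + L * A) * B + A * (Q + L * B) - L * A * B)" for P Q L A B :: complex
    by (simp add: algebra_simps)
  have "eval (p * q) y = eval (p * q) (y - eval (linpoly l) y *s c) + eval (linpoly l) y * eval (p * k' + k * q - linpoly l * k * k') y" for y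
    using alg[of "eval p (y - eval (linpoly l) y *s c)" "eval (linpoly l) y" "eval k y" "eval q (y - eval (linpoly l) y *s c)" "eval k' y"]
    by (simp only: k(1)[of y, symmetric] k(2)[of y, symmetric] eval_simps)
  then show ?case by blast
qed

lemma divisible_by_linear:
  assumes "eval (linpoly l) c = 1" "\<And>y. eval (linpoly l) y = 0 \<Longrightarrow> eval p y = 0"
  shows "\<exists>k. p = linpoly l * k"
proof -
  obtain k where k: "\<And>y. eval p y = eval p (y - eval (linpoly l) y *s c) + eval (linpoly l) y * eval k y"
    using division_by_linear by blast
  have "eval (linpoly l) (y - r *s c) = eval (linpoly l) y - r * eval (linpoly l) c" for y r
    by (simp add: eval_linpoly algebra_simps sum_subtractf sum_distrib_left)
  then have "eval p (y - eval (linpoly l) y *s c) = 0" for y by (intro assms(2)) (simp add: assms(1))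
  then have "eval p y = eval (linpoly l * k) y" for y using k[of y] by simp
  then show ?thesis using eval_inject by blast
qed

lemma eval_linpoly_add: "eval (linpoly l) (x + y) = eval (linpoly l) x + eval (linpoly l) y"
  by (simp add: eval_linpoly algebra_simps sum.distrib)

lemma eval_linpoly_scale: "eval (linpoly l) (r *s y) = r * eval (linpoly l) y"
  by (simp add: eval_linpoly algebra_simps sum_distrib_left)

text \<open>The witnesses \<open>c\<close> and \<open>d\<close> express that l and m are not
  proportional. h vanishes on both hyperplanes; after division by l the vanishing on m = 0 is clear
  off l = 0 and follows on the intersection by continuity.\<close>

lemma linear_product_radical:
  fixes l m :: "'v::finite \<Rightarrow> complex"
  assumes c: "eval (linpoly l) c = 1" and d: "eval (linpoly l) d = 0" "eval (linpoly m) d = 1"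
    and h: "linpoly l * linpoly m dvd h ^ n"
  shows "linpoly l * linpoly m dvd h"
proof -
  obtain g where g: "h ^ n = linpoly l * linpoly m * g" using h by (rule dvdE)
  have zero: "eval h y = 0" if "eval (linpoly l) y = 0 \<or> eval (linpoly m) y = 0" for y
  proof -
    have "eval (h ^ n) y = 0" unfolding g using that by auto
    then show ?thesis by simp
  qed
  obtain k where k: "h = linpoly l * k" using divisible_by_linear[OF c] zero by blast
  have kz: "eval k y = 0" if my: "eval (linpoly m) y = 0" for y
  proof (cases "eval (linpoly l) y = 0")
    case False
    then show ?thesis using zero[of y] my k by simp
  next
    case True
    \<comment> \<open>A direction inside m = 0 that leaves l = 0.\<close>
    define e where "e = c - eval (linpoly m) c *s d"
    have le: "eval (linpoly l) e = 1" and me: "eval (linpoly m) e = 0"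
      unfolding e_def using eval_linpoly_add[of l c "- (eval (linpoly m) c *s d)"] eval_linpoly_add[of m c "- (eval (linpoly m) c *s d)"]
        eval_linpoly_scale[of l "- eval (linpoly m) c" d] eval_linpoly_scale[of m "- eval (linpoly m) c" d] c d
      by (simp_all add: vector_smult_lneg)
    have nz: "eval k (y + t *s e) = 0" if "t \<noteq> 0" for t
    proof -
      have "eval (linpoly l) (y + t *s e) = t" "eval (linpoly m) (y + t *s e) = 0"
        by (simp_all add: eval_linpoly_add eval_linpoly_scale le me my True)
      then show ?thesis using zero[of "y + t *s e"] k that by simp
    qed
    have "(\<lambda>t. eval k (y + t *s e)) \<midarrow>0\<rightarrow> eval k y" by (rule tendsto_eval_line)
    moreover have "(\<lambda>t. eval k (y + t *s e)) \<midarrow>0\<rightarrow> 0"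
      by (rule tendsto_eventually) (simp add: eventually_at_filter nz)
    ultimately show ?thesis by (rule LIM_unique)
  qed
  obtain k' where "k = linpoly m * k'" using divisible_by_linear[OF d(2)] kz by blast
  then have "h = linpoly l * linpoly m * k'" using k by (simp add: mult.assoc)
  then show ?thesis by simp
qed

section \<open>Singular conics and reducedness\<close>

definition form_of :: "(complex ^ 3 \<Rightarrow> complex) \<Rightarrow> 3 \<Rightarrow> complex" where
  "form_of F = (\<lambda>v. F (axis v 1))"

lemma eval_form_of:
  assumes "\<And>x y. F (x + y) = F x + F y" "\<And>c x. F (c *s x) = c * F x"
  shows "eval (linpoly (form_of F)) y = F y"
proof -
  have 0: "F 0 = 0" using assms(2)[of 0 0] by simp
  have s: "F (sum g A) = (\<Sum>v\<in>A. F (g v))" for g and A :: "3 set"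
    by (induction A rule: infinite_finite_induct) (simp_all add: assms 0)
  have "F y = F (\<Sum>v\<in>UNIV. y $ v *s axis v 1)" by (simp only: basis_expansion)
  also have "\<dots> = (\<Sum>v\<in>UNIV. y $ v * F (axis v 1))" unfolding s assms(2) by (rule refl)
  finally show ?thesis by (simp add: eval_linpoly form_of_def mult.commute)
qed

lemma span3_coordinates:
  fixes b c d :: "complex ^ 3"
  assumes "\<And>\<alpha> \<beta> \<gamma>. \<alpha> *s b + \<beta> *s c + \<gamma> *s d = 0 \<Longrightarrow> \<alpha> = 0 \<and> \<beta> = 0 \<and> \<gamma> = 0"
  shows "\<exists>\<alpha> \<beta> \<gamma>. y = \<alpha> *s b + \<beta> *s c + \<gamma> *s d"
proof -
  define P :: "complex ^ 3 ^ 3" where "P = (\<chi> i j. if j = 1 then b $ i else if j = 2 then c $ i else d $ i)"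
  have P: "P *v z = z $ 1 *s b + z $ 2 *s c + z $ 3 *s d" for z
    by (simp add: vec_eq_iff matrix_vector_mult_def sum_3 P_def mult.commute)
  have "z = 0" if "P *v z = 0" for z
    using assms[of "z $ 1" "z $ 2" "z $ 3"] that unfolding P by (simp add: vec_eq_iff forall_3)
  then obtain Q where "P ** Q = mat 1"
    using matrix_left_invertible_ker[of P] matrix_left_right_inverse by blast
  then have "y = P *v (Q *v y)" by (simp add: matrix_vector_mul_assoc)
  then show ?thesis unfolding P by blast
qed

text \<open>If the radical of the conic were only the line of b, the conic would have rank 2 and
  split into two nonproportional linear forms, hence be reduced.\<close>

lemma nonreduced_radical:
  assumes T: "sym_tensor T" and b: "b \<noteq> 0" and rad: "\<And>y. mform T a a b y = 0" and nz: "\<not> (\<forall>y y'. mform T a a y y' = 0)"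
    and nr: "\<not> p1_fibre_reduced (poly_of T) (vec.span {a})"
  shows "\<exists>b'. (\<forall>y. mform T a a b' y = 0) \<and> b' \<notin> vec.span {b}"
proof (rule ccontr)
  assume "\<not> ?thesis"
  then have only: "b' \<in> vec.span {b}" if "\<And>y. mform T a a b' y = 0" for b' using that by blast
  define B where "B y y' = mform T a a y y'" for y y'
  have B: "B (x + y) z = B x z + B y z" "B z (x + y) = B z x + B z y" "B (c *s x) z = c * B x z" "B z (c *s x) = c * B z x" "B x y = B y x" for x y z c
    unfolding B_def by (simp_all only: mform_add mform_scale) (rule gform_commute[OF T])
  have B_diff: "B (x - y) z = B x z - B y z" "B z (x - y) = B z x - B z y" for x y z
    unfolding B_def by (simp_all only: mform_diff)
  note unit = symmetric_unit_vector[of B, OF B]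
  have B0: "B 0 z = 0" "B z 0 = 0" for z using B(3)[of 0 0 z] B(4)[of z 0 0] by simp_all
  have bB: "B b y = 0" "B y b = 0" for y using rad[of y] B(5)[of b y] by (simp_all add: B_def)
  obtain v1 where v1: "B v1 v1 = 1" using nz unit[of _ UNIV] unfolding B_def[symmetric] by blast
  define W where "W = {x. B v1 x = 0}"
  \<comment> \<open>If the form vanished on the orthogonal complement of v1, that complement would
    lie in the radical, so v1 and b would span the whole space.\<close>
  have "\<exists>x\<in>W. \<exists>y\<in>W. B x y \<noteq> 0"
  proof (rule ccontr)
    assume no: "\<not> ?thesis"
    have Wsub: "W \<subseteq> vec.span {b}"
    proof
      fix w assume w: "w \<in> W"
      have "B w y = 0" for y
      proof -
        have "y - B v1 y *s v1 \<in> W" by (simp add: W_def B_diff B v1)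
        then have "B w (y - B v1 y *s v1) = 0" using no w by blast
        then show ?thesis using w unfolding B_diff B(4) W_def by (simp add: B(5)[of w v1])
      qed
      then show "w \<in> vec.span {b}" using only unfolding B_def by blast
    qed
    have "\<exists>\<alpha> \<beta>. y = \<alpha> *s v1 + \<beta> *s b" for y
    proof -
      have "y - B v1 y *s v1 \<in> W" by (simp add: W_def B_diff B v1)
      then obtain \<beta> where "y - B v1 y *s v1 = \<beta> *s b" using Wsub by (auto simp: vec.span_singleton)
      then have "y = B v1 y *s v1 + \<beta> *s b" by (simp add: algebra_simps)
      then show ?thesis by blast
    qed
    then have "UNIV \<subseteq> vec.span {v1, b}"
      by (auto simp: vec.span_insert vec.span_singleton algebra_simps)
    then have "vec.dim (UNIV :: (complex ^ 3) set) \<le> card {v1, b}"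
      by (intro vec.dim_le_card) auto
    also have "\<dots> \<le> 2" by (simp add: card_insert_if)
    finally show False unfolding vec_dim_card by simp
  qed
  then obtain v2 where v2: "B v1 v2 = 0" "B v2 v2 = 1"
    using unit[of _ W] unfolding W_def by (auto simp: B)
  have ind: "\<alpha> = 0 \<and> \<beta> = 0 \<and> \<gamma> = 0" if z: "\<alpha> *s b + \<beta> *s v1 + \<gamma> *s v2 = 0" for \<alpha> \<beta> \<gamma>
  proof -
    have "B v1 (\<alpha> *s b + \<beta> *s v1 + \<gamma> *s v2) = 0" "B v2 (\<alpha> *s b + \<beta> *s v1 + \<gamma> *s v2) = 0" unfolding z by (simp_all only: B0)
    then have "\<beta> = 0" "\<gamma> = 0" by (simp_all add: B bB v1 v2 B(5)[of v2 v1])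
    then show ?thesis using z b by simp
  qed
  \<comment> \<open>A sum of two squares factors over the complex numbers.\<close>
  define lp where "lp y = B v1 y + \<i> * B v2 y" for y
  define lm where "lm y = B v1 y - \<i> * B v2 y" for y
  have quad: "B y y = lp y * lm y" for y
  proof -
    obtain \<alpha> \<beta> \<gamma> where y: "y = \<alpha> *s b + \<beta> *s v1 + \<gamma> *s v2" using span3_coordinates[OF ind] by blast
    have "B v1 y = \<beta>" "B v2 y = \<gamma>" unfolding y by (simp_all add: B bB v1 v2 B(5)[of v2 v1])
    moreover have "B y y = \<beta> * \<beta> + \<gamma> * \<gamma>" unfolding y by (simp add: B bB v1 v2 B(5)[of v2 v1])
    ultimately show ?thesis by (simp add: lp_def lm_def algebra_simps)
  qed
  have lin: "lp (x + y) = lp x + lp y" "lp (c *s x) = c * lp x" "lm (x + y) = lm x + lm y" "lm (c *s x) = c * lm x" for x y c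
    by (simp_all add: lp_def lm_def B algebra_simps)
  have ev: "eval (linpoly (form_of lp)) y = lp y" "eval (linpoly (form_of lm)) y = lm y" for y
    by (rule eval_form_of; rule lin)+
  have lv: "lp v1 = 1" "lp (v1 + \<i> *s v2) = 0" "lm (v1 + \<i> *s v2) = 2"
    by (simp_all add: lp_def lm_def B v1 v2 B(5)[of v2 v1])
  have red: "linpoly (form_of lp) * linpoly (form_of lm) dvd h" if "linpoly (form_of lp) * linpoly (form_of lm) dvd h ^ n" for h n
  proof (rule linear_product_radical[OF _ _ _ that])
    show "eval (linpoly (form_of lp)) v1 = 1" by (simp add: ev lv)
    show "eval (linpoly (form_of lp)) ((1/2) *s (v1 + \<i> *s v2)) = 0" by (simp only: ev lin(2) lv) simp
    show "eval (linpoly (form_of lm)) ((1/2) *s (v1 + \<i> *s v2)) = 1" by (simp only: ev lin(4) lv) simp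
  qed
  have "p1_fibre_reduced (poly_of T) (vec.span {a})"
    unfolding p1_fibre_reduced_def
  proof (intro ballI allI impI)
    fix a' h n assume a': "a' \<in> vec.span {a} - {0}" and h: "fibre_form (poly_of T) a' dvd h ^ n"
    obtain c where c: "a' = c *s a" "c \<noteq> 0" using span_singleton_scale[of a' a] a' by blast
    have F: "fibre_form (poly_of T) a' = Const (c * c) * (linpoly (form_of lp) * linpoly (form_of lm))"
    proof (rule eval_inject)
      fix y
      have "eval (fibre_form (poly_of T) a') y = c * c * B y y"
        unfolding eval_fibre_form eval2_poly_of c(1) B_def by (simp only: mform_scale mult.assoc)
      then show "eval (fibre_form (poly_of T) a') y = eval (Const (c * c) * (linpoly (form_of lp) * linpoly (form_of lm))) y"
        by (simp add: ev quad)
    qed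
    have "linpoly (form_of lp) * linpoly (form_of lm) dvd h ^ n"
      using h unfolding F by (rule dvd_mult_right)
    then have "linpoly (form_of lp) * linpoly (form_of lm) dvd h" by (rule red)
    then obtain g where g: "h = linpoly (form_of lp) * linpoly (form_of lm) * g" by (rule dvdE)
    have "Const (c * c) * Const (1 / (c * c)) = (1 :: 3 cpoly)"
      by (rule eval_inject) (use c(2) in simp)
    then have "h = Const (c * c) * (linpoly (form_of lp) * linpoly (form_of lm)) * (Const (1 / (c * c)) * g)"
    proof -
      have "Const (c * c) * (linpoly (form_of lp) * linpoly (form_of lm)) * (Const (1 / (c * c)) * g)
        = (Const (c * c) * Const (1 / (c * c))) * (linpoly (form_of lp) * linpoly (form_of lm) * g)"
        by (simp only: mult_ac)
      then show ?thesis unfolding g \<open>Const (c * c) * Const (1 / (c * c)) = 1\<close> by simp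
    qed
    then show "fibre_form (poly_of T) a' dvd h" unfolding F by (rule dvdI)
  qed
  then show False using nr by contradiction
qed

text \<open>The form l is nilpotent modulo \<gamma> l^2. Were it a multiple k \<gamma> l^2, then 1 =
  \<gamma> t k(t d) for all nonzero t, but the right side tends to 0 with t.\<close>

lemma double_line_not_reduced:
  assumes a: "a \<noteq> 0" and l: "\<And>x y. l (x + y) = l x + l y" "\<And>c x. l (c *s x) = c * l x" "l d = 1"
    and F: "\<And>y. mform T a a y y = \<gamma> * l y * l y" and "\<gamma> \<noteq> 0"
  shows "\<not> p1_fibre_reduced (poly_of T) (vec.span {a})"
proof
  assume red: "p1_fibre_reduced (poly_of T) (vec.span {a})"
  define h where "h = linpoly (form_of l)"
  have ev: "eval h y = l y" for y unfolding h_def by (rule eval_form_of; rule l)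
  have Feq: "eval (fibre_form (poly_of T) a) y = \<gamma> * l y * l y" for y
    unfolding eval_fibre_form eval2_poly_of by (rule F)
  have "h ^ 2 = fibre_form (poly_of T) a * Const (1 / \<gamma>)"
    by (rule eval_inject) (use \<open>\<gamma> \<noteq> 0\<close> in \<open>simp add: Feq ev power2_eq_square\<close>)
  then have "fibre_form (poly_of T) a dvd h ^ 2" by simp
  moreover have "a \<in> vec.span {a} - {0}" using a by (simp add: vec.span_base)
  ultimately have "fibre_form (poly_of T) a dvd h" using red unfolding p1_fibre_reduced_def by blast
  then obtain k where "h = fibre_form (poly_of T) a * k" by (rule dvdE)
  then have eq: "l y = \<gamma> * l y * l y * eval k y" for y using ev[of y] Feq[of y] by simp
  have nz: "\<gamma> * t * eval k (t *s d) = 1" if "t \<noteq> 0" for t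
    using eq[of "t *s d"] that by (simp add: l mult.assoc)
  have "(\<lambda>t. \<gamma> * t * eval k (0 + t *s d)) \<midarrow>0\<rightarrow> \<gamma> * 0 * eval k 0"
    by (intro tendsto_mult tendsto_const tendsto_ident_at tendsto_eval_line)
  then have "(\<lambda>t. \<gamma> * t * eval k (t *s d)) \<midarrow>0\<rightarrow> 0" by simp
  moreover have "(\<lambda>t. \<gamma> * t * eval k (t *s d)) \<midarrow>0\<rightarrow> 1"
    by (rule tendsto_eventually) (simp add: eventually_at_filter nz)
  ultimately have "0 = (1::complex)" by (rule LIM_unique)
  then show False by simp
qed

section \<open>Contracted sections and tangent directions\<close>

definition indep2 :: "complex ^ 2 \<Rightarrow> complex ^ 2 \<Rightarrow> bool" where
  "indep2 a b \<longleftrightarrow> (\<forall>\<alpha> \<beta>. \<alpha> *s a + \<beta> *s b = 0 \<longrightarrow> \<alpha> = 0 \<and> \<beta> = 0)"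

definition indep3 :: "complex ^ 3 \<Rightarrow> complex ^ 3 \<Rightarrow> complex ^ 3 \<Rightarrow> bool" where
  "indep3 b c d \<longleftrightarrow> (\<forall>\<alpha> \<beta> \<gamma>. \<alpha> *s b + \<beta> *s c + \<gamma> *s d = 0 \<longrightarrow> \<alpha> = 0 \<and> \<beta> = 0 \<and> \<gamma> = 0)"

lemma indep2_nz: "indep2 a b \<Longrightarrow> a \<noteq> 0" "indep2 a b \<Longrightarrow> b \<noteq> 0"
proof -
  assume i: "indep2 a b"
  show "a \<noteq> 0"
  proof
    assume "a = 0"
    then have "1 *s a + 0 *s b = 0" by simp
    then show False using i unfolding indep2_def by (metis zero_neq_one)
  qed
  show "b \<noteq> 0"
  proof
    assume "b = 0"
    then have "0 *s a + 1 *s b = 0" by simp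
    then show False using i unfolding indep2_def by (metis zero_neq_one)
  qed
qed

lemma complement2:
  assumes "a \<noteq> 0"
  shows "\<exists>b. indep2 a b"
proof -
  obtain i where i: "a $ i \<noteq> 0" using assms by (auto simp: vec_eq_iff)
  have ne: "i \<noteq> i + 1" using exhaust_2[of i] by auto
  have "indep2 a (axis (i + 1) 1)"
    unfolding indep2_def
  proof (intro allI impI)
    fix \<alpha> \<beta> assume z: "\<alpha> *s a + \<beta> *s axis (i + 1) 1 = 0"
    have "(\<alpha> *s a + \<beta> *s axis (i + 1) 1) $ i = 0" "(\<alpha> *s a + \<beta> *s axis (i + 1) 1) $ (i + 1) = 0" unfolding z by simp_all
    then show "\<alpha> = 0 \<and> \<beta> = 0" using i ne by (simp add: axis_def)
  qed
  then show ?thesis ..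
qed

lemma complement3:
  assumes "b \<noteq> 0"
  shows "\<exists>c d. indep3 b c d"
proof -
  obtain j where j: "b $ j \<noteq> 0" using assms by (auto simp: vec_eq_iff)
  have ne: "j \<noteq> j + 1" "j \<noteq> j + 2" "j + 1 \<noteq> j + 2" "j + 2 \<noteq> j + 1" using exhaust_3[of j] by auto
  have "indep3 b (axis (j + 1) 1) (axis (j + 2) 1)"
    unfolding indep3_def
  proof (intro allI impI)
    fix \<alpha> \<beta> \<gamma> assume z: "\<alpha> *s b + \<beta> *s axis (j + 1) 1 + \<gamma> *s axis (j + 2) 1 = 0"
    have "(\<alpha> *s b + \<beta> *s axis (j + 1) 1 + \<gamma> *s axis (j + 2) 1) $ j = 0"
      "(\<alpha> *s b + \<beta> *s axis (j + 1) 1 + \<gamma> *s axis (j + 2) 1) $ (j + 1) = 0"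
      "(\<alpha> *s b + \<beta> *s axis (j + 1) 1 + \<gamma> *s axis (j + 2) 1) $ (j + 2) = 0" unfolding z by simp_all
    then show "\<alpha> = 0 \<and> \<beta> = 0 \<and> \<gamma> = 0" using j ne by (simp add: axis_def)
  qed
  then show ?thesis by blast
qed

text \<open>\<open>Q\<close> inverts the matrix with columns \<open>a\<close> and \<open>b\<close>,
  so its rows are the dual coordinates.\<close>

lemma dual2:
  assumes "indep2 a b"
  shows "\<exists>Q :: complex ^ 2 ^ 2. (\<forall>\<alpha> \<beta>. (Q *v (\<alpha> *s a + \<beta> *s b)) $ 1 = \<alpha> \<and> (Q *v (\<alpha> *s a + \<beta> *s b)) $ 2 = \<beta>) \<and>
    (\<forall>x. x = (Q *v x) $ 1 *s a + (Q *v x) $ 2 *s b)"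
proof -
  define P :: "complex ^ 2 ^ 2" where "P = (\<chi> i j. if j = 1 then a $ i else b $ i)"
  have P: "P *v z = z $ 1 *s a + z $ 2 *s b" for z
    by (simp add: vec_eq_iff matrix_vector_mult_def sum_2 P_def mult.commute)
  have "z = 0" if "P *v z = 0" for z
  proof -
    have "z $ 1 = 0 \<and> z $ 2 = 0" using assms that unfolding P indep2_def by blast
    then show ?thesis by (simp add: vec_eq_iff forall_2)
  qed
  then obtain Q where Q: "Q ** P = mat 1" using matrix_left_invertible_ker[of P] by blast
  then have Q': "P ** Q = mat 1" using matrix_left_right_inverse by blast
  have "Q *v (\<alpha> *s a + \<beta> *s b) = vector [\<alpha>, \<beta>]" for \<alpha> \<beta>
  proof -
    have "\<alpha> *s a + \<beta> *s b = P *v vector [\<alpha>, \<beta>]" unfolding P by simp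
    then show ?thesis by (simp add: matrix_vector_mul_assoc Q)
  qed
  moreover have "x = (Q *v x) $ 1 *s a + (Q *v x) $ 2 *s b" for x
    unfolding P[symmetric] by (simp add: matrix_vector_mul_assoc Q')
  ultimately show ?thesis by (intro exI[of _ Q]) simp
qed

lemma dual3:
  assumes "indep3 b c d"
  shows "\<exists>Q :: complex ^ 3 ^ 3. (\<forall>\<alpha> \<beta> \<gamma>. (Q *v (\<alpha> *s b + \<beta> *s c + \<gamma> *s d)) $ 1 = \<alpha> \<and>
      (Q *v (\<alpha> *s b + \<beta> *s c + \<gamma> *s d)) $ 2 = \<beta> \<and> (Q *v (\<alpha> *s b + \<beta> *s c + \<gamma> *s d)) $ 3 = \<gamma>) \<and>
    (\<forall>y. y = (Q *v y) $ 1 *s b + (Q *v y) $ 2 *s c + (Q *v y) $ 3 *s d)"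
proof -
  define P :: "complex ^ 3 ^ 3" where "P = (\<chi> i j. if j = 1 then b $ i else if j = 2 then c $ i else d $ i)"
  have P: "P *v z = z $ 1 *s b + z $ 2 *s c + z $ 3 *s d" for z
    by (simp add: vec_eq_iff matrix_vector_mult_def sum_3 P_def mult.commute)
  have "z = 0" if "P *v z = 0" for z
  proof -
    have "z $ 1 = 0 \<and> z $ 2 = 0 \<and> z $ 3 = 0" using assms that unfolding P indep3_def by blast
    then show ?thesis by (simp add: vec_eq_iff forall_3)
  qed
  then obtain Q where Q: "Q ** P = mat 1" using matrix_left_invertible_ker[of P] by blast
  then have Q': "P ** Q = mat 1" using matrix_left_right_inverse by blast
  have "Q *v (\<alpha> *s b + \<beta> *s c + \<gamma> *s d) = vector [\<alpha>, \<beta>, \<gamma>]" for \<alpha> \<beta> \<gamma>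
  proof -
    have "\<alpha> *s b + \<beta> *s c + \<gamma> *s d = P *v vector [\<alpha>, \<beta>, \<gamma>]" unfolding P by simp
    then show ?thesis by (simp add: matrix_vector_mul_assoc Q)
  qed
  moreover have "y = (Q *v y) $ 1 *s b + (Q *v y) $ 2 *s c + (Q *v y) $ 3 *s d" for y
    unfolding P[symmetric] by (simp add: matrix_vector_mul_assoc Q')
  ultimately show ?thesis by (intro exI[of _ Q]) simp
qed

lemma indep2_span: "indep2 a b \<Longrightarrow> \<exists>\<alpha> \<beta>. x = \<alpha> *s a + \<beta> *s b"
  using dual2 by blast

lemma indep3_span: "indep3 b c d \<Longrightarrow> \<exists>\<alpha> \<beta> \<gamma>. y = \<alpha> *s b + \<beta> *s c + \<gamma> *s d"
  using dual3 by blast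

lemma complement3':
  assumes b: "b \<noteq> 0" and c: "c \<notin> vec.span {b}"
  shows "\<exists>d. indep3 b c d"
proof -
  have "vec.span {b, c} \<noteq> UNIV"
  proof
    assume "vec.span {b, c} = UNIV"
    then have "vec.dim (UNIV :: (complex ^ 3) set) \<le> card {b, c}" by (intro vec.dim_le_card) auto
    also have "\<dots> \<le> 2" by (simp add: card_insert_if)
    finally show False unfolding vec_dim_card by simp
  qed
  then obtain d where d: "d \<notin> vec.span {b, c}" by blast
  have "indep3 b c d"
    unfolding indep3_def
  proof (intro allI impI)
    fix \<alpha> \<beta> \<gamma> assume z: "\<alpha> *s b + \<beta> *s c + \<gamma> *s d = 0"
    have g: "\<gamma> = 0"
    proof (rule ccontr)
      assume "\<gamma> \<noteq> 0"
      have "\<gamma> *s d = (\<alpha> *s b + \<beta> *s c + \<gamma> *s d) - \<alpha> *s b - \<beta> *s c"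
        by (simp add: vec_eq_iff)
      then have "\<gamma> *s d = (- \<alpha>) *s b + (- \<beta>) *s c"
        unfolding z by (simp add: vec_eq_iff)
      then have "inverse \<gamma> *s (\<gamma> *s d) \<in> vec.span {b, c}"
        by (simp only:) (intro vec.span_scale vec.span_add vec.span_base; simp)
      then show False using d \<open>\<gamma> \<noteq> 0\<close> by (simp add: vector_smult_assoc)
    qed
    have bb: "\<beta> = 0"
    proof (rule ccontr)
      assume "\<beta> \<noteq> 0"
      have "\<beta> *s c = (- \<alpha>) *s b"
        using z g by (simp add: vec_eq_iff add_eq_0_iff)
      then have "inverse \<beta> *s (\<beta> *s c) \<in> vec.span {b}"
        by (simp only:) (intro vec.span_scale vec.span_base; simp)
      then show False using c \<open>\<beta> \<noteq> 0\<close> by (simp add: vector_smult_assoc)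
    qed
    show "\<alpha> = 0 \<and> \<beta> = 0 \<and> \<gamma> = 0" using z g bb b by simp
  qed
  then show ?thesis ..
qed

lemma indep3_not_in_span: "indep3 b c d \<Longrightarrow> \<beta> \<noteq> 0 \<or> \<gamma> \<noteq> 0 \<Longrightarrow> \<beta> *s c + \<gamma> *s d \<notin> vec.span {b}"
proof
  assume i: "indep3 b c d" and nz: "\<beta> \<noteq> 0 \<or> \<gamma> \<noteq> 0" and "\<beta> *s c + \<gamma> *s d \<in> vec.span {b}"
  then obtain k where "\<beta> *s c + \<gamma> *s d = k *s b" by (auto simp: vec.span_singleton)
  then have "(- k) *s b + \<beta> *s c + \<gamma> *s d = 0" by (simp add: vec_eq_iff algebra_simps)
  then show False using i nz unfolding indep3_def by blast
qed

lemma span_line_inj: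
  assumes "indep2 e w"
  shows "inj (\<lambda>t. vec.span {e + t *s w})"
proof (rule injI)
  fix s t assume "vec.span {e + s *s w} = vec.span {e + t *s w}"
  then have "e + s *s w \<in> vec.span {e + t *s w}" by (metis vec.span_base singletonI)
  then obtain k where "e + s *s w = k *s (e + t *s w)" by (auto simp: vec.span_singleton)
  then have "(1 - k) *s e + (s - k * t) *s w = 0" by (simp add: vec_eq_iff algebra_simps)
  then have "1 - k = 0 \<and> s - k * t = 0" using assms unfolding indep2_def by blast
  then show "s = t" by simp
qed

lemma indep2_line_nz: "indep2 e w \<Longrightarrow> e + t *s w \<noteq> 0"
proof
  assume i: "indep2 e w" and "e + t *s w = 0"
  then have "1 *s e + t *s w = 0" by simp
  then show False using i unfolding indep2_def by (metis zero_neq_one)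
qed

lemma span_scale_eq:
  fixes a :: "complex ^ 'n"
  assumes "c \<noteq> 0"
  shows "vec.span {c *s a} = vec.span {a}"
proof
  show "vec.span {c *s a} \<subseteq> vec.span {a}"
    by (intro vec.span_minimal vec.subspace_span) (simp add: vec.span_scale vec.span_base)
  have "inverse c *s (c *s a) \<in> vec.span {c *s a}" by (intro vec.span_scale vec.span_base) simp
  then have "a \<in> vec.span {c *s a}" using assms by (simp add: vector_smult_assoc)
  then show "vec.span {a} \<subseteq> vec.span {c *s a}" by (intro vec.span_minimal vec.subspace_span) simp
qed

text \<open>All conics of the family pass through b; equivalently, the fibre of the second
  projection over b is a whole projective line.\<close>

definition contr :: "tensor \<Rightarrow> complex ^ 3 \<Rightarrow> bool" where
  "contr T b \<longleftrightarrow> (\<forall>x. mform T x x b b = 0)"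

lemma mform_x_polar:
  assumes T: "sym_tensor T" and "\<And>x. mform T x x b c = 0"
  shows "mform T x x' b c = 0"
proof -
  have "mform T (x + x') (x + x') b c = 0" by (rule assms(2))
  then have "2 * mform T x x' b c = 0"
    unfolding mform_add assms(2) gform_commute(1)[OF T, of _ "($) x'" "($) x"] by simp
  then show ?thesis by simp
qed

section \<open>Fibres of the second projection\<close>

lemma infinite_proj_space: "infinite (proj_space :: (complex ^ 2) set set)"
proof
  assume fin: "finite (proj_space :: (complex ^ 2) set set)"
  obtain w where w: "indep2 (axis 1 1) w" using complement2[of "axis 1 1"] by (auto simp: axis_eq_0_iff)
  have "range (\<lambda>t. vec.span {axis 1 1 + t *s w}) \<subseteq> proj_space"
    using span_in_proj_space indep2_line_nz[OF w] by blast
  then have "finite (range (\<lambda>t. vec.span {axis 1 1 + t *s w}))" using fin finite_subset by blast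
  then have "finite (UNIV :: complex set)" using span_line_inj[OF w] by (rule finite_imageD)
  then show False using infinite_UNIV_char_0 by blast
qed

text \<open>For fixed b, f(x, b) is a binary quadratic form: it vanishes identically or has finitely
  many zeros on the projective line.\<close>

lemma p2_finite_iff: "p2_finite (poly_of T) \<longleftrightarrow> (\<forall>b. b \<noteq> 0 \<longrightarrow> \<not> contr T b)"
proof
  assume fin: "p2_finite (poly_of T)"
  show "\<forall>b. b \<noteq> 0 \<longrightarrow> \<not> contr T b"
  proof (intro allI impI notI)
    fix b assume b: "b \<noteq> 0" "contr T b"
    have "(\<lambda>Q. (Q, vec.span {b})) ` proj_space \<subseteq> {P \<in> surface (poly_of T). snd P = vec.span {b}}"
    proof
      fix P assume "P \<in> (\<lambda>Q. (Q, vec.span {b})) ` (proj_space :: (complex ^ 2) set set)"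
      then obtain a where a: "a \<noteq> 0" "P = (vec.span {a}, vec.span {b})" by (auto simp: proj_space_def)
      then show "P \<in> {P \<in> surface (poly_of T). snd P = vec.span {b}}"
        using surface_iff[OF a(1) b(1)] b(2) by (simp add: contr_def)
    qed
    moreover have "finite {P \<in> surface (poly_of T). snd P = vec.span {b}}"
      using fin span_in_proj_space[OF b(1)] unfolding p2_finite_def by blast
    ultimately have "finite ((\<lambda>Q. (Q, vec.span {b})) ` (proj_space :: (complex ^ 2) set set))" using finite_subset by blast
    then have "finite (proj_space :: (complex ^ 2) set set)" by (rule finite_imageD) (auto simp: inj_on_def)
    then show False using infinite_proj_space by blast
  qed
next
  assume nc: "\<forall>b. b \<noteq> 0 \<longrightarrow> \<not> contr T b"
  show "p2_finite (poly_of T)"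
    unfolding p2_finite_def
  proof
    fix M :: "(complex ^ 3) set" assume "M \<in> proj_space"
    then obtain b where b: "b \<noteq> 0" "M = vec.span {b}" by (auto simp: proj_space_def)
    obtain x where x: "mform T x x b b \<noteq> 0" using nc b(1) by (auto simp: contr_def)
    then have "x \<noteq> 0" by auto
    then obtain e where e: "indep2 x e" using complement2 by blast
    \<comment> \<open>A point x that is not a zero is moved to infinity. The polynomial then has a
      nonzero leading coefficient, and its roots miss no point of the fibre.\<close>
    define p where "p = [:mform T e e b b, mform T x e b b + mform T e x b b, mform T x x b b:]"
    have p: "mform T (e + t *s x) (e + t *s x) b b = poly p t" for t
      unfolding p_def mform_add mform_scale by (simp add: algebra_simps)
    have "{P \<in> surface (poly_of T). snd P = M} \<subseteq> (\<lambda>t. (vec.span {e + t *s x}, M)) ` {t. poly p t = 0}"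
    proof
      fix P assume P: "P \<in> {P \<in> surface (poly_of T). snd P = M}"
      then have "fst P \<in> proj_space" by (auto simp: surface_def)
      then obtain a where a: "a \<noteq> 0" "fst P = vec.span {a}" by (auto simp: proj_space_def)
      then have "P = (vec.span {a}, vec.span {b})" using P b by (cases P) auto
      then have z: "mform T a a b b = 0" using P surface_iff[OF a(1) b(1)] by simp
      obtain \<alpha> \<beta> where ab: "a = \<alpha> *s x + \<beta> *s e" using indep2_span[OF e] by blast
      have "\<beta> \<noteq> 0"
      proof
        assume "\<beta> = 0"
        then have "a = \<alpha> *s x" using ab by simp
        then have "\<alpha> * (\<alpha> * mform T x x b b) = 0" using z by (simp only: mform_scale)
        then show False using x a(1) \<open>a = \<alpha> *s x\<close> by auto
      qed
      then have a': "a = \<beta> *s (e + (\<alpha> / \<beta>) *s x)" using ab by (simp add: vec_eq_iff algebra_simps)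
      have "\<beta> * (\<beta> * mform T (e + (\<alpha> / \<beta>) *s x) (e + (\<alpha> / \<beta>) *s x) b b) = 0"
        using z unfolding a' by (simp only: mform_scale)
      then have "poly p (\<alpha> / \<beta>) = 0" using \<open>\<beta> \<noteq> 0\<close> by (simp add: p)
      moreover have "vec.span {a} = vec.span {e + (\<alpha> / \<beta>) *s x}"
        by (subst a') (rule span_scale_eq[OF \<open>\<beta> \<noteq> 0\<close>])
      ultimately show "P \<in> (\<lambda>t. (vec.span {e + t *s x}, M)) ` {t. poly p t = 0}"
        using \<open>P = (vec.span {a}, vec.span {b})\<close> b(2) by blast
    qed
    moreover have "p \<noteq> 0" using x by (simp add: p_def)
    ultimately show "finite {P \<in> surface (poly_of T). snd P = M}"
      using poly_roots_finite finite_surj by blast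
  qed
qed

lemma contracted_section_iff:
  "contracted_section (poly_of T) \<sigma> M \<longleftrightarrow> (\<exists>b. b \<noteq> 0 \<and> M = vec.span {b} \<and> contr T b \<and> (\<forall>Q\<in>proj_space. \<sigma> Q = (Q, M)))"
proof
  assume cs: "contracted_section (poly_of T) \<sigma> M"
  then have \<sigma>: "\<sigma> Q = (Q, M)" "(Q, M) \<in> surface (poly_of T)" if "Q \<in> proj_space" for Q
    using that unfolding contracted_section_def by (metis prod.collapse)+
  have "vec.span {axis 1 1 :: complex ^ 2} \<in> proj_space" by (rule span_in_proj_space) (simp add: axis_eq_0_iff)
  then have "M \<in> proj_space" using \<sigma>(2) by (auto simp: surface_def)
  then obtain b where b: "b \<noteq> 0" "M = vec.span {b}" by (auto simp: proj_space_def)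
  have "mform T x x b b = 0" for x
  proof (cases "x = 0")
    case False
    then show ?thesis using \<sigma>(2)[OF span_in_proj_space[OF False]] surface_iff[OF False b(1)] b(2) by simp
  qed simp
  then show "\<exists>b. b \<noteq> 0 \<and> M = vec.span {b} \<and> contr T b \<and> (\<forall>Q\<in>proj_space. \<sigma> Q = (Q, M))"
    using b \<sigma>(1) unfolding contr_def by blast
next
  assume "\<exists>b. b \<noteq> 0 \<and> M = vec.span {b} \<and> contr T b \<and> (\<forall>Q\<in>proj_space. \<sigma> Q = (Q, M))"
  then obtain b where b: "b \<noteq> 0" "M = vec.span {b}" "contr T b" "\<And>Q. Q \<in> proj_space \<Longrightarrow> \<sigma> Q = (Q, M)" by blast
  show "contracted_section (poly_of T) \<sigma> M"
    unfolding contracted_section_def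
  proof
    fix Q :: "(complex ^ 2) set" assume Q: "Q \<in> proj_space"
    then obtain a where "a \<noteq> 0" "Q = vec.span {a}" by (auto simp: proj_space_def)
    then have "(Q, M) \<in> surface (poly_of T)" using surface_iff[of a b T] b by (simp add: contr_def)
    then show "\<sigma> Q \<in> surface (poly_of T) \<and> fst (\<sigma> Q) = Q \<and> snd (\<sigma> Q) = M" using b(4)[OF Q] by simp
  qed
qed

section \<open>Tangent lines of the conics\<close>

lemma dir_deriv_fibre:
  assumes T: "sym_tensor T"
  shows "dir_deriv (fibre_form (poly_of T) a) b y = 2 * mform T a a b y"
proof -
  have "eval (fibre_form (poly_of T) a) (b + t *s y) = mform T a a b b + 2 * mform T a a b y * t + mform T a a y y * t\<^sup>2" for t
    unfolding eval_fibre_form eval2_poly_of mform_add mform_scale gform_commute(2)[OF T, of _ _ _ "($) y" "($) b"]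
    by (simp add: algebra_simps power2_eq_square)
  moreover have "((\<lambda>t. mform T a a b b + 2 * mform T a a b y * t + mform T a a y y * t\<^sup>2) has_field_derivative 2 * mform T a a b y) (at 0)"
    by (auto intro!: derivative_eq_intros)
  ultimately show ?thesis unfolding dir_deriv_def using DERIV_imp_deriv by simp
qed

lemma smooth_at_fibre:
  assumes T: "sym_tensor T"
  shows "smooth_at (fibre_form (poly_of T) a) b \<longleftrightarrow> mform T a a b b = 0 \<and> (\<exists>y. mform T a a b y \<noteq> 0)"
  unfolding smooth_at_def dir_deriv_fibre[OF T] eval_fibre_form eval2_poly_of by simp

lemma tangent_line_fibre:
  assumes T: "sym_tensor T"
  shows "tangent_line (fibre_form (poly_of T) a) b = {y. mform T a a b y = 0}"
  unfolding tangent_line_def dir_deriv_fibre[OF T] by simp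

lemma homogeneous_add: "homogeneous d p \<Longrightarrow> homogeneous d q \<Longrightarrow> homogeneous d (p + q)"
  unfolding homogeneous_def using keys_add[of p q] by blast

lemma homogeneous_0: "homogeneous d 0"
  by (simp add: homogeneous_def)

lemma homogeneous_sum: "(\<And>x. x \<in> A \<Longrightarrow> homogeneous d (h x)) \<Longrightarrow> homogeneous d (sum h A)"
  by (induction A rule: infinite_finite_induct) (simp_all add: homogeneous_0 homogeneous_add)

lemma homogeneous_mult: "homogeneous d p \<Longrightarrow> homogeneous e q \<Longrightarrow> homogeneous (d + e) (p * q)"
  unfolding homogeneous_def
proof
  fix m assume d: "\<forall>m\<in>Poly_Mapping.keys p. (\<Sum>v\<in>UNIV. Poly_Mapping.lookup m v) = d"
    and e: "\<forall>m\<in>Poly_Mapping.keys q. (\<Sum>v\<in>UNIV. Poly_Mapping.lookup m v) = e" and "m \<in> Poly_Mapping.keys (p * q)"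
  then obtain k l where "k \<in> Poly_Mapping.keys p" "l \<in> Poly_Mapping.keys q" "m = k + l" using keys_mult[of p q] by blast
  then show "(\<Sum>v\<in>UNIV. Poly_Mapping.lookup m v) = d + e" using d e by (simp add: lookup_add sum.distrib)
qed

lemma homogeneous_Const: "homogeneous 0 (Const c)"
  by (cases "c = 0") (simp_all add: homogeneous_def Const_def)

lemma homogeneous_Var: "homogeneous 1 (Var v)"
  by (simp add: homogeneous_def Var_def lookup_single when_def)

lemma homogeneous_Const_mult: "homogeneous d p \<Longrightarrow> homogeneous d (Const c * p)"
  using homogeneous_mult[OF homogeneous_Const, of d p c] by simp

lemma eval_homogeneous:
  assumes "homogeneous d p"
  shows "eval p (s *s a) = s ^ d * eval p a"
proof -
  have "Poly_Mapping.lookup p m * (\<Prod>v\<in>UNIV. (s * a $ v) ^ Poly_Mapping.lookup m v) =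
    s ^ d * (Poly_Mapping.lookup p m * (\<Prod>v\<in>UNIV. (a $ v) ^ Poly_Mapping.lookup m v))" if "m \<in> Poly_Mapping.keys p" for m
  proof -
    have "(\<Prod>v\<in>UNIV. s ^ Poly_Mapping.lookup m v) = s ^ d"
      using assms that unfolding homogeneous_def by (simp flip: power_sum)
    then show ?thesis by (simp add: power_mult_distrib prod.distrib)
  qed
  then show ?thesis
    unfolding eval_def subst_poly_def sum_distrib_left vector_smult_component by (intro sum.cong refl)
qed

lemma span_insert_line:
  fixes v b :: "complex ^ 'n"
  shows "y \<in> vec.span (insert v (vec.span {b})) \<longleftrightarrow> (\<exists>k m. y = k *s v + m *s b)"
proof -
  have "y \<in> vec.span (insert v (vec.span {b})) \<longleftrightarrow> (\<exists>k. y - k *s v \<in> vec.span {b})"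
    unfolding vec.span_breakdown_eq vec.span_span ..
  also have "\<dots> \<longleftrightarrow> (\<exists>k m. y = k *s v + m *s b)"
    by (auto simp: vec.span_singleton image_iff algebra_simps)
  finally show ?thesis .
qed

text \<open>On a dense set of lines the value of \<open>\<phi>\<close> is the plane spanned by \<open>b0\<close> and \<open>b1\<close>, hence
  everywhere.\<close>

lemma phi_constant:
  assumes T: "sym_tensor T" and b0: "b0 \<noteq> 0" and b1: "b1 \<notin> vec.span {b0}" and "contr T b0"
    and z: "\<And>x. mform T x x b0 b1 = 0" and phi: "is_phi (poly_of T) (vec.span {b0}) \<phi>"
  shows "\<exists>N. \<forall>Q\<in>proj_space. \<phi> Q = N"
proof -
  obtain d where ind: "indep3 b0 b1 d" using complement3'[OF b0 b1] by blast
  obtain R :: "complex ^ 3 ^ 3" where R: "\<And>\<alpha> \<beta> \<gamma>. (R *v (\<alpha> *s b0 + \<beta> *s b1 + \<gamma> *s d)) $ 3 = \<gamma>"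
    "\<And>y. y = (R *v y) $ 1 *s b0 + (R *v y) $ 2 *s b1 + (R *v y) $ 3 *s d"
    using dual3[OF ind] by metis
  define N where "N = {y. (R *v y) $ 3 = 0}"
  obtain deg and v :: "3 \<Rightarrow> 2 cpoly" where
    v: "\<And>a. a \<noteq> 0 \<Longrightarrow> (\<chi> k. eval (v k) a) \<notin> vec.span {b0}"
      "\<And>a. a \<noteq> 0 \<Longrightarrow> \<phi> (vec.span {a}) = vec.span (insert (\<chi> k. eval (v k) a) (vec.span {b0}))"
    using phi unfolding is_phi_def pencil_morphism_def by blast
  define V where "V a = (\<chi> k. eval (v k) a)" for a
  define Exc where "Exc = {Q \<in> proj_space. \<not> (\<forall>a\<in>Q - {0}. \<forall>b\<in>vec.span {b0} - {0}.
        smooth_at (fibre_form (poly_of T) a) b \<and> \<phi> Q = tangent_line (fibre_form (poly_of T) a) b)}"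
  have finE: "finite Exc" using phi unfolding is_phi_def Exc_def by blast
  have good: "(R *v V a) $ 3 = 0" if a: "a \<noteq> 0" "vec.span {a} \<notin> Exc" for a
  proof -
    have "a \<in> vec.span {a} - {0}" "b0 \<in> vec.span {b0} - {0}" using a(1) b0 by (simp_all add: vec.span_base)
    then have sm: "smooth_at (fibre_form (poly_of T) a) b0" "\<phi> (vec.span {a}) = tangent_line (fibre_form (poly_of T) a) b0"
      using a span_in_proj_space[OF a(1)] unfolding Exc_def by blast+
    obtain y where y: "mform T a a b0 y \<noteq> 0" using sm(1) unfolding smooth_at_fibre[OF T] by blast
    have lin: "mform T a a b0 (\<alpha> *s b0 + \<beta> *s b1 + \<gamma> *s d) = \<gamma> * mform T a a b0 d" for \<alpha> \<beta> \<gamma>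
      using assms(4) by (simp only: mform_add mform_scale z contr_def) simp
    have lin': "mform T a a b0 y = (R *v y) $ 3 * mform T a a b0 d" for y
      by (subst R(2)[of y]) (rule lin)
    have d: "mform T a a b0 d \<noteq> 0" using y lin'[of y] by auto
    have "V a \<in> \<phi> (vec.span {a})" unfolding v(2)[OF a(1)] V_def by (intro vec.span_base) simp
    then have "mform T a a b0 (V a) = 0" unfolding sm(2) tangent_line_fibre[OF T] by simp
    then show ?thesis using lin'[of "V a"] d by simp
  qed
  define p where "p = (\<Sum>k\<in>UNIV. Const (R $ 3 $ k) * v k)"
  have p: "eval p a = (R *v V a) $ 3" for a
    by (simp add: p_def eval_sum matrix_vector_mult_def V_def)
  have all: "(R *v V a) $ 3 = 0" if a: "a \<noteq> 0" for a
  proof -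
    obtain w where w: "indep2 a w" using complement2[OF a] by blast
    \<comment> \<open>The parameter 0 is taken out so that the complement of this finite set is a
      neighbourhood of 0.\<close>
    define B where "B = (\<lambda>t. vec.span {a + t *s w}) -` Exc - {0}"
    have "finite B" unfolding B_def using finite_vimageI[OF finE span_line_inj[OF w]] by simp
    then have "open (- B)" by (simp add: finite_imp_closed open_Compl)
    moreover have "0 \<in> - B" by (simp add: B_def)
    ultimately have "\<forall>\<^sub>F t in at 0. t \<in> - B" by (metis eventually_at_topological)
    moreover have "\<forall>\<^sub>F t in at 0. t \<noteq> (0 :: complex)" by (simp add: eventually_at_filter)
    ultimately have "\<forall>\<^sub>F t in at 0. eval p (a + t *s w) = 0"
    proof eventually_elim
      case (elim t)
      then have "vec.span {a + t *s w} \<notin> Exc" by (simp add: B_def)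
      then show ?case unfolding p using good indep2_line_nz[OF w] by blast
    qed
    then have "(\<lambda>t. eval p (a + t *s w)) \<midarrow>0\<rightarrow> 0" by (rule tendsto_eventually)
    then have "eval p a = 0" using tendsto_eval_line LIM_unique by metis
    then show ?thesis by (simp add: p)
  qed
  have "\<phi> Q = N" if Q: "Q \<in> proj_space" for Q
  proof -
    obtain a where a: "a \<noteq> 0" "Q = vec.span {a}" using Q by (auto simp: proj_space_def)
    have "(R *v V a) $ 3 = 0" using all[OF a(1)] .
    then obtain \<alpha> \<beta> where V: "V a = \<alpha> *s b0 + \<beta> *s b1" using R(2)[of "V a"] by (metis add.right_neutral vec.scale_zero_left)
    have "\<beta> \<noteq> 0"
    proof
      assume "\<beta> = 0"
      then have "V a \<in> vec.span {b0}" unfolding V by (simp add: vec.span_scale vec.span_base)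
      then show False using v(1)[OF a(1)] by (simp add: V_def)
    qed
    have "y \<in> \<phi> Q \<longleftrightarrow> y \<in> N" for y
    proof -
      have "y \<in> \<phi> Q \<longleftrightarrow> (\<exists>k m. y = k *s V a + m *s b0)"
        unfolding a(2) v(2)[OF a(1)] V_def[symmetric] span_insert_line ..
      also have "\<dots> \<longleftrightarrow> (R *v y) $ 3 = 0"
      proof
        assume "\<exists>k m. y = k *s V a + m *s b0"
        then obtain k m where "y = k *s V a + m *s b0" by blast
        then have "y = (k * \<alpha> + m) *s b0 + (k * \<beta>) *s b1 + 0 *s d"
          unfolding V by (simp add: vec_eq_iff algebra_simps)
        then show "(R *v y) $ 3 = 0" by (simp only: R(1))
      next
        assume "(R *v y) $ 3 = 0"
        then obtain \<alpha>' \<beta>' where "y = \<alpha>' *s b0 + \<beta>' *s b1" using R(2)[of y] by (metis add.right_neutral vec.scale_zero_left)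
        then have "y = (\<beta>' / \<beta>) *s V a + (\<alpha>' - \<beta>' / \<beta> * \<alpha>) *s b0"
          unfolding V using \<open>\<beta> \<noteq> 0\<close> by (simp add: vec_eq_iff algebra_simps)
        then show "\<exists>k m. y = k *s V a + m *s b0" by blast
      qed
      finally show ?thesis by (simp add: N_def)
    qed
    then show ?thesis by blast
  qed
  then show ?thesis by blast
qed

text \<open>In the basis b, c, d the tangent line over x has the equation T(x,x,b,c) \<beta> +
  T(x,x,b,d) \<gamma> = 0. Cancelling the common factor g leaves forms without common zero, so the
  direction p2 c - p1 d is defined everywhere. A constant direction would be a linear relation
  between the two original forms.\<close>

lemma phi_from_forms:
  fixes p1 p2 :: "2 cpoly"
  assumes T: "sym_tensor T" and ind: "indep3 b c d" and contr: "contr T b"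
    and hom: "homogeneous deg p1" "homogeneous deg p2"
    and nz: "\<And>x. x \<noteq> 0 \<Longrightarrow> eval p1 x \<noteq> 0 \<or> eval p2 x \<noteq> 0"
    and g: "\<And>x. mform T x x b c = g x * eval p1 x" "\<And>x. mform T x x b d = g x * eval p2 x"
    and fin: "finite {Q \<in> proj_space. \<exists>a\<in>Q - {0}. g a = 0}"
    and li: "\<And>k l. (\<And>x. k * mform T x x b c + l * mform T x x b d = 0) \<Longrightarrow> k = 0 \<and> l = 0"
  shows "\<exists>\<phi>. is_phi (poly_of T) (vec.span {b}) \<phi> \<and> \<not> (\<exists>N. \<forall>Q\<in>proj_space. \<phi> Q = N)"
proof -
  define v where "v k = Const (c $ k) * p2 + Const (- d $ k) * p1" for k
  define V where "V a = (\<chi> k. eval (v k) a)" for a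
  have V: "V a = eval p2 a *s c + (- eval p1 a) *s d" for a
    by (simp add: V_def v_def vec_eq_iff)
  have homv: "homogeneous deg (v k)" for k
    unfolding v_def by (intro homogeneous_add homogeneous_Const_mult hom)
  have V_scale: "V (s *s a) = s ^ deg *s V a" for s a
    by (simp add: V_def vec_eq_iff eval_homogeneous[OF homv])
  define M where "M = vec.span {b}"
  \<comment> \<open>Taking the span over all of \<open>Q\<close> avoids choosing a representative;
    by homogeneity a single nonzero vector of \<open>Q\<close> already generates it modulo
    \<open>M\<close>.\<close>
  define \<phi> where "\<phi> Q = vec.span (V ` Q \<union> M)" for Q
  have phi: "\<phi> (vec.span {a}) = vec.span (insert (V a) M)" for a
  proof
    show "\<phi> (vec.span {a}) \<subseteq> vec.span (insert (V a) M)"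
      unfolding \<phi>_def
    proof (intro vec.span_minimal vec.subspace_span subsetI)
      fix y assume "y \<in> V ` vec.span {a} \<union> M"
      then show "y \<in> vec.span (insert (V a) M)"
      proof
        assume "y \<in> V ` vec.span {a}"
        then obtain s where "y = V (s *s a)" by (auto simp: vec.span_singleton)
        then show ?thesis unfolding V_scale by (simp add: vec.span_scale vec.span_base)
      qed (simp add: vec.span_base)
    qed
    have "V a \<in> V ` vec.span {a}" by (simp add: vec.span_base)
    then show "vec.span (insert (V a) M) \<subseteq> \<phi> (vec.span {a})"
      unfolding \<phi>_def by (intro vec.span_mono) blast
  qed
  have phi_mem: "y \<in> \<phi> (vec.span {a}) \<longleftrightarrow> (\<exists>k m. y = k *s V a + m *s b)" for y a
    unfolding phi M_def span_insert_line ..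
  have "pencil_morphism M \<phi>"
    unfolding pencil_morphism_def
  proof (intro exI conjI allI impI)
    show "homogeneous deg (v k)" for k by (rule homv)
    fix a :: "complex ^ 2" assume a: "a \<noteq> 0"
    show "(\<chi> k. eval (v k) a) \<notin> M"
      unfolding V_def[symmetric] V M_def using indep3_not_in_span[OF ind, of "eval p2 a" "- eval p1 a"] nz[OF a] by auto
    show "\<phi> (vec.span {a}) = vec.span (insert (\<chi> k. eval (v k) a) M)"
      unfolding phi V_def by (rule refl)
  qed
  moreover have "finite {Q \<in> proj_space. \<not> (\<forall>a\<in>Q - {0}. \<forall>b'\<in>M - {0}.
        smooth_at (fibre_form (poly_of T) a) b' \<and> \<phi> Q = tangent_line (fibre_form (poly_of T) a) b')}"
  proof (rule finite_subset[OF _ fin], rule subsetI)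
    fix Q assume Q: "Q \<in> {Q \<in> proj_space. \<not> (\<forall>a\<in>Q - {0}. \<forall>b'\<in>M - {0}.
        smooth_at (fibre_form (poly_of T) a) b' \<and> \<phi> Q = tangent_line (fibre_form (poly_of T) a) b')}"
    have "smooth_at (fibre_form (poly_of T) a) b' \<and> \<phi> Q = tangent_line (fibre_form (poly_of T) a) b'"
      if a: "a \<in> Q - {0}" and b': "b' \<in> M - {0}" and ga: "g a \<noteq> 0" for a b'
    proof
      have "Q \<in> proj_space" using Q by simp
      then obtain a0 where a0: "Q = vec.span {a0}" by (auto simp: proj_space_def)
      obtain s where s: "a = s *s a0" "s \<noteq> 0" using span_singleton_scale[of a a0] a a0 by blast
      have Qa: "Q = vec.span {a}" unfolding a0 s(1) by (rule span_scale_eq[OF s(2), symmetric])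
      obtain r where r: "b' = r *s b" "r \<noteq> 0" using span_singleton_scale[of b' b] b' by (auto simp: M_def)
      have an: "a \<noteq> 0" using a by simp
      have tau: "mform T a a b' (\<alpha> *s b + \<beta> *s c + \<gamma> *s d) = r * g a * (\<beta> * eval p1 a + \<gamma> * eval p2 a)" for \<alpha> \<beta> \<gamma>
        unfolding r(1) using contr by (simp only: mform_add mform_scale g contr_def) (simp add: algebra_simps)
      have "mform T a a b' b' = 0" unfolding r(1) using contr by (simp only: mform_scale contr_def) simp
      moreover have "\<exists>y. mform T a a b' y \<noteq> 0"
        using tau[of 0 1 0] tau[of 0 0 1] nz[OF an] ga r(2) by (metis mult_eq_0_iff mult_zero_left mult_1 add_0 add.right_neutral)
      ultimately show "smooth_at (fibre_form (poly_of T) a) b'" unfolding smooth_at_fibre[OF T] by blast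
      have "y \<in> \<phi> Q \<longleftrightarrow> mform T a a b' y = 0" for y
      proof -
        obtain \<alpha> \<beta> \<gamma> where y: "y = \<alpha> *s b + \<beta> *s c + \<gamma> *s d" using indep3_span[OF ind] by blast
        have "mform T a a b' y = 0 \<longleftrightarrow> \<beta> * eval p1 a + \<gamma> * eval p2 a = 0"
          unfolding y tau using ga r(2) by simp
        also have "\<dots> \<longleftrightarrow> (\<exists>k m. y = k *s V a + m *s b)"
        proof
          assume "\<exists>k m. y = k *s V a + m *s b"
          then obtain k m where "y = k *s V a + m *s b" by blast
          then have "(\<alpha> - m) *s b + (\<beta> - k * eval p2 a) *s c + (\<gamma> + k * eval p1 a) *s d = 0"
            unfolding y V by (simp add: vec_eq_iff algebra_simps)
          then have "\<beta> - k * eval p2 a = 0" "\<gamma> + k * eval p1 a = 0" using ind unfolding indep3_def by blast+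
          then have "\<beta> = k * eval p2 a" "\<gamma> = - (k * eval p1 a)" by (simp_all add: eq_neg_iff_add_eq_0)
          then show "\<beta> * eval p1 a + \<gamma> * eval p2 a = 0" by simp
        next
          assume eq: "\<beta> * eval p1 a + \<gamma> * eval p2 a = 0"
          have "\<exists>k. \<beta> = k * eval p2 a \<and> \<gamma> = - k * eval p1 a"
          proof (cases "eval p2 a = 0")
            case True
            then have "eval p1 a \<noteq> 0" "\<beta> = 0" using nz[OF an] eq by auto
            then show ?thesis using True by (intro exI[of _ "- \<gamma> / eval p1 a"]) simp
          next
            case False
            then have "\<gamma> = - (\<beta> / eval p2 a) * eval p1 a" using eq by (simp add: field_simps add_eq_0_iff2)
            then show ?thesis using False by (intro exI[of _ "\<beta> / eval p2 a"]) simp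
          qed
          then obtain k where "\<beta> = k * eval p2 a" "\<gamma> = - k * eval p1 a" by blast
          then have "y = k *s V a + \<alpha> *s b" unfolding y V by (simp add: vec_eq_iff algebra_simps)
          then show "\<exists>k m. y = k *s V a + m *s b" by blast
        qed
        finally show ?thesis unfolding Qa phi_mem by blast
      qed
      then show "\<phi> Q = tangent_line (fibre_form (poly_of T) a) b'" unfolding tangent_line_fibre[OF T] by blast
    qed
    then show "Q \<in> {Q \<in> proj_space. \<exists>a\<in>Q - {0}. g a = 0}" using Q by blast
  qed
  ultimately have "is_phi (poly_of T) (vec.span {b}) \<phi>" unfolding is_phi_def M_def by blast
  moreover have "\<not> (\<exists>N. \<forall>Q\<in>proj_space. \<phi> Q = N)"
  proof
    assume "\<exists>N. \<forall>Q\<in>proj_space. \<phi> Q = N"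
    then obtain N where N: "\<And>Q. Q \<in> proj_space \<Longrightarrow> \<phi> Q = N" by blast
    define a0 :: "complex ^ 2" where "a0 = axis 1 1"
    have a0: "a0 \<noteq> 0" by (simp add: a0_def axis_eq_0_iff)
    have "eval p2 a0 * mform T x x b c + (- eval p1 a0) * mform T x x b d = 0" for x
    proof (cases "x = 0")
      case False
      have "V x \<in> \<phi> (vec.span {x})" unfolding phi_mem by (intro exI[of _ 1] exI[of _ 0]) simp
      then have "V x \<in> \<phi> (vec.span {a0})" using N span_in_proj_space[OF False] span_in_proj_space[OF a0] by metis
      then obtain k m where "V x = k *s V a0 + m *s b" unfolding phi_mem by blast
      then have "(- m) *s b + (eval p2 x - k * eval p2 a0) *s c + (k * eval p1 a0 - eval p1 x) *s d = 0"
        unfolding V by (simp add: vec_eq_iff algebra_simps)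
      then have "eval p2 x - k * eval p2 a0 = 0" "k * eval p1 a0 - eval p1 x = 0" using ind unfolding indep3_def by blast+
      then have "eval p2 x = k * eval p2 a0" "eval p1 x = k * eval p1 a0" by simp_all
      then show ?thesis unfolding g by simp
    qed simp
    then have "eval p2 a0 = 0 \<and> - eval p1 a0 = 0" by (rule li)
    then show False using nz[OF a0] by simp
  qed
  ultimately show ?thesis by blast
qed

lemma quadratic_poly:
  "\<exists>p :: 2 cpoly. homogeneous 2 p \<and> (\<forall>x. eval p x = mform T x x b c)"
proof -
  define p :: "2 cpoly" where "p = (\<Sum>i\<in>UNIV. \<Sum>i'\<in>UNIV. Const (mform T (axis i 1) (axis i' 1) b c) * (Var i * Var i'))"
  have "homogeneous (1 + 1) p"
    unfolding p_def by (intro homogeneous_sum homogeneous_Const_mult homogeneous_mult homogeneous_Var)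
  then have "homogeneous 2 p" by (simp add: numeral_2_eq_2)
  moreover have "eval p x = mform T x x b c" for x
  proof -
    have x: "(\<Sum>i\<in>UNIV. x $ i *s axis i 1) = x" by (rule basis_expansion)
    have "mform T x x b c = mform T (\<Sum>i\<in>UNIV. x $ i *s axis i 1) (\<Sum>i\<in>UNIV. x $ i *s axis i 1) b c" by (simp only: x)
    also have "\<dots> = (\<Sum>i'\<in>UNIV. \<Sum>i\<in>UNIV. x $ i' * (x $ i * mform T (axis i 1) (axis i' 1) b c))"
      by (simp only: mform_sum mform_scale sum_distrib_left)
    also have "\<dots> = eval p x"
      unfolding p_def eval_sum eval_simps by (rule trans[OF sum.swap]) (intro sum.cong refl, simp only: mult_ac)
    finally show ?thesis by simp
  qed
  ultimately show ?thesis by blast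
qed

lemma homogeneous_linpoly: "homogeneous 1 (linpoly l)"
  unfolding linpoly_def by (intro homogeneous_sum homogeneous_Const_mult homogeneous_Var)

text \<open>By assumption the binary quadratic forms T(x,x,b,c) and T(x,x,b,d) are linearly
  independent. Without a common zero they define the morphism directly. Otherwise they share a
  linear factor, and the quotients are independent linear forms, which have no common zero.\<close>

lemma phi_exists:
  assumes T: "sym_tensor T" and b: "b \<noteq> 0" and contr: "contr T b"
    and no: "\<And>b1. b1 \<notin> vec.span {b} \<Longrightarrow> \<exists>x. mform T x x b b1 \<noteq> 0"
  shows "\<exists>\<phi>. is_phi (poly_of T) (vec.span {b}) \<phi> \<and> \<not> (\<exists>N. \<forall>Q\<in>proj_space. \<phi> Q = N)"
proof -
  obtain c d where ind: "indep3 b c d" using complement3[OF b] by blast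
  have li: "k = 0 \<and> l = 0" if "\<And>x. k * mform T x x b c + l * mform T x x b d = 0" for k l
  proof (rule ccontr)
    assume "\<not> (k = 0 \<and> l = 0)"
    then have "k *s c + l *s d \<notin> vec.span {b}" using indep3_not_in_span[OF ind] by blast
    then obtain x where "mform T x x b (k *s c + l *s d) \<noteq> 0" using no by blast
    then show False using that by (simp only: mform_add mform_scale)
  qed
  show ?thesis
  proof (cases "\<exists>e. e \<noteq> 0 \<and> mform T e e b c = 0 \<and> mform T e e b d = 0")
    case False
    obtain p1 :: "2 cpoly" where p1: "homogeneous 2 p1" "\<And>x. eval p1 x = mform T x x b c" using quadratic_poly by blast
    obtain p2 :: "2 cpoly" where p2: "homogeneous 2 p2" "\<And>x. eval p2 x = mform T x x b d" using quadratic_poly by blast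
    show ?thesis
    proof (rule phi_from_forms[OF T ind contr p1(1) p2(1), of "\<lambda>x. 1"])
      show "eval p1 x \<noteq> 0 \<or> eval p2 x \<noteq> 0" if "x \<noteq> 0" for x using False that unfolding p1(2) p2(2) by blast
      show "mform T x x b c = 1 * eval p1 x" "mform T x x b d = 1 * eval p2 x" for x unfolding p1(2) p2(2) by simp_all
      show "finite {Q \<in> proj_space. \<exists>a::complex^2\<in>Q - {0}. (1::complex) = 0}" by simp
      show "k = 0 \<and> l = 0" if "\<And>x. k * mform T x x b c + l * mform T x x b d = 0" for k l
        using that by (rule li)
    qed
  next
    case True
    then obtain e where e: "e \<noteq> 0" "mform T e e b c = 0" "mform T e e b d = 0" by blast
    obtain w where w: "indep2 e w" using complement2[OF e(1)] by blast
    obtain R :: "complex ^ 2 ^ 2" where R: "\<And>\<alpha> \<beta>. (R *v (\<alpha> *s e + \<beta> *s w)) $ 1 = \<alpha>" "\<And>\<alpha> \<beta>. (R *v (\<alpha> *s e + \<beta> *s w)) $ 2 = \<beta>"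
      "\<And>x. x = (R *v x) $ 1 *s e + (R *v x) $ 2 *s w" using dual2[OF w] by metis
    \<comment> \<open>Coefficients of the quotient by the linear form that vanishes at e; the factor
      2 is that of the mixed term.\<close>
    define m n where "m y = 2 * mform T e w b y" "n y = mform T w w b y" for y
    define p where "p y = linpoly (\<lambda>i. R $ 1 $ i * m y + R $ 2 $ i * n y)" for y
    have p: "eval (p y) x = (R *v x) $ 1 * m y + (R *v x) $ 2 * n y" for x y
      by (simp add: p_def eval_linpoly matrix_vector_mult_def sum_2 algebra_simps)
    have t: "mform T x x b y = (R *v x) $ 2 * eval (p y) x" if "mform T e e b y = 0" for x y
    proof -
      have "mform T x x b y = mform T ((R *v x) $ 1 *s e + (R *v x) $ 2 *s w) ((R *v x) $ 1 *s e + (R *v x) $ 2 *s w) b y"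
        by (simp only: R(3)[symmetric])
      also have "\<dots> = (R *v x) $ 2 * ((R *v x) $ 1 * m y + (R *v x) $ 2 * n y)"
        unfolding mform_add mform_scale that gform_commute(1)[OF T, of _ "($) w" "($) e"] m_n_def by (simp add: algebra_simps)
      finally show ?thesis by (simp add: p)
    qed
    show ?thesis
    proof (rule phi_from_forms[OF T ind contr, of 1 "p c" "p d" "\<lambda>x. (R *v x) $ 2"])
      show "homogeneous 1 (p c)" "homogeneous 1 (p d)" unfolding p_def by (rule homogeneous_linpoly)+
      show "mform T x x b c = (R *v x) $ 2 * eval (p c) x" "mform T x x b d = (R *v x) $ 2 * eval (p d) x" for x
        using t e by blast+
      show "k = 0 \<and> l = 0" if "\<And>x. k * mform T x x b c + l * mform T x x b d = 0" for k l
        using that by (rule li)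
      have "{Q \<in> proj_space. \<exists>a\<in>Q - {0}. (R *v a) $ 2 = 0} \<subseteq> {vec.span {e}}"
      proof
        fix Q assume "Q \<in> {Q \<in> proj_space. \<exists>a\<in>Q - {0}. (R *v a) $ 2 = 0}"
        then obtain a a0 where a: "a \<in> Q" "a \<noteq> 0" "(R *v a) $ 2 = 0" "Q = vec.span {a0}" by (auto simp: proj_space_def)
        obtain s where s: "a = s *s a0" "s \<noteq> 0" using span_singleton_scale[of a a0] a by blast
        have "a = (R *v a) $ 1 *s e" using R(3)[of a] a(3) by simp
        moreover from this have "(R *v a) $ 1 \<noteq> 0" using a(2) by auto
        ultimately have "vec.span {a} = vec.span {e}" using span_scale_eq by metis
        then show "Q \<in> {vec.span {e}}" using a(4) s span_scale_eq[OF s(2), of a0] by simp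
      qed
      then show "finite {Q \<in> proj_space. \<exists>a\<in>Q - {0}. (R *v a) $ 2 = 0}" using finite_subset by blast
      fix x :: "complex ^ 2" assume x: "x \<noteq> 0"
      show "eval (p c) x \<noteq> 0 \<or> eval (p d) x \<noteq> 0"
      proof (rule ccontr)
        assume no: "\<not> (eval (p c) x \<noteq> 0 \<or> eval (p d) x \<noteq> 0)"
        define \<alpha> \<beta> where "\<alpha> = (R *v x) $ 1" "\<beta> = (R *v x) $ 2"
        have z: "\<alpha> * m c + \<beta> * n c = 0" "\<alpha> * m d + \<beta> * n d = 0"
          using no by (simp_all add: p \<alpha>_\<beta>_def)
        have nz: "\<alpha> \<noteq> 0 \<or> \<beta> \<noteq> 0" using R(3)[of x] x by (auto simp: \<alpha>_\<beta>_def)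
        have det: "m c * n d = m d * n c"
        proof -
          have "\<alpha> * (m c * n d - m d * n c) = (\<alpha> * m c + \<beta> * n c) * n d - (\<alpha> * m d + \<beta> * n d) * n c"
            "\<beta> * (m c * n d - m d * n c) = (\<alpha> * m d + \<beta> * n d) * m c - (\<alpha> * m c + \<beta> * n c) * m d"
            by (simp_all add: algebra_simps)
          then show ?thesis using nz z by auto
        qed
        \<comment> \<open>The vanishing determinant makes the two linear forms dependent, and the
          relation passes back to the quadratic forms.\<close>
        have "\<exists>k l. (k \<noteq> 0 \<or> l \<noteq> 0) \<and> k * m c + l * m d = 0 \<and> k * n c + l * n d = 0"
        proof (cases "m c = 0 \<and> m d = 0")
          case True
          show ?thesis
          proof (cases "n c = 0 \<and> n d = 0")
            case True
            then show ?thesis using \<open>m c = 0 \<and> m d = 0\<close> by (intro exI[of _ 1] exI[of _ 0]) simp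
          next
            case False
            then show ?thesis using \<open>m c = 0 \<and> m d = 0\<close> by (intro exI[of _ "n d"] exI[of _ "- n c"]) auto
          qed
        next
          case False
          then show ?thesis using det by (intro exI[of _ "m d"] exI[of _ "- m c"]) (auto simp: algebra_simps)
        qed
        then obtain k l where kl: "k \<noteq> 0 \<or> l \<noteq> 0" "k * m c + l * m d = 0" "k * n c + l * n d = 0" by blast
        have "k * mform T y y b c + l * mform T y y b d = 0" for y
        proof -
          have "k * mform T y y b c + l * mform T y y b d = (R *v y) $ 2 * ((R *v y) $ 1 * (k * m c + l * m d) + (R *v y) $ 2 * (k * n c + l * n d))"
            unfolding t[OF e(2)] t[OF e(3)] p by (simp add: algebra_simps)
          then show ?thesis by (simp add: kl)
        qed
        then show False using li kl(1) by blast
      qed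
    qed
  qed
qed

section \<open>Destabilising weights\<close>

lemma det_indep2: "det p \<noteq> 0 \<longleftrightarrow> indep2 (column 1 p) (column 2 p)"
proof -
  have P: "p *v z = z $ 1 *s column 1 p + z $ 2 *s column 2 p" for z
    by (simp add: matrix_mult_sum sum_2)
  have "det p = 0 \<longleftrightarrow> (\<exists>z. z \<noteq> 0 \<and> p *v z = 0)" by (rule det_zero_ker)
  also have "\<dots> \<longleftrightarrow> \<not> indep2 (column 1 p) (column 2 p)"
  proof
    assume "\<exists>z. z \<noteq> 0 \<and> p *v z = 0"
    then obtain z :: "complex ^ 2" where z: "z \<noteq> 0" "z $ 1 *s column 1 p + z $ 2 *s column 2 p = 0" unfolding P by blast
    from z(1) have "\<not> (z $ 1 = 0 \<and> z $ 2 = 0)" by (simp add: vec_eq_iff forall_2)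
    then show "\<not> indep2 (column 1 p) (column 2 p)" using z(2) unfolding indep2_def by blast
  next
    assume "\<not> indep2 (column 1 p) (column 2 p)"
    then obtain \<alpha> \<beta> where ab: "\<alpha> *s column 1 p + \<beta> *s column 2 p = 0" "\<not> (\<alpha> = 0 \<and> \<beta> = 0)"
      unfolding indep2_def by blast
    have "vector [\<alpha>, \<beta>] \<noteq> (0 :: complex ^ 2)" using ab(2) by (simp add: vec_eq_iff forall_2)
    moreover have "p *v vector [\<alpha>, \<beta>] = 0" unfolding P vector_2 by (rule ab(1))
    ultimately show "\<exists>z. z \<noteq> 0 \<and> p *v z = 0" by blast
  qed
  finally show ?thesis by blast
qed

lemma det_indep3: "det q \<noteq> 0 \<longleftrightarrow> indep3 (column 1 q) (column 2 q) (column 3 q)"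
proof -
  have P: "q *v z = z $ 1 *s column 1 q + z $ 2 *s column 2 q + z $ 3 *s column 3 q" for z
    by (simp add: matrix_mult_sum sum_3)
  have "det q = 0 \<longleftrightarrow> (\<exists>z. z \<noteq> 0 \<and> q *v z = 0)" by (rule det_zero_ker)
  also have "\<dots> \<longleftrightarrow> \<not> indep3 (column 1 q) (column 2 q) (column 3 q)"
  proof
    assume "\<exists>z. z \<noteq> 0 \<and> q *v z = 0"
    then obtain z :: "complex ^ 3" where z: "z \<noteq> 0" "z $ 1 *s column 1 q + z $ 2 *s column 2 q + z $ 3 *s column 3 q = 0" unfolding P by blast
    from z(1) have "\<not> (z $ 1 = 0 \<and> z $ 2 = 0 \<and> z $ 3 = 0)" by (simp add: vec_eq_iff forall_3)
    then show "\<not> indep3 (column 1 q) (column 2 q) (column 3 q)" using z(2) unfolding indep3_def by blast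
  next
    assume "\<not> indep3 (column 1 q) (column 2 q) (column 3 q)"
    then obtain \<alpha> \<beta> \<gamma> where ab: "\<alpha> *s column 1 q + \<beta> *s column 2 q + \<gamma> *s column 3 q = 0" "\<not> (\<alpha> = 0 \<and> \<beta> = 0 \<and> \<gamma> = 0)"
      unfolding indep3_def by blast
    have "vector [\<alpha>, \<beta>, \<gamma>] \<noteq> (0 :: complex ^ 3)" using ab(2) by (simp add: vec_eq_iff forall_3)
    moreover have "q *v vector [\<alpha>, \<beta>, \<gamma>] = 0" unfolding P vector_3 by (rule ab(1))
    ultimately show "\<exists>z. z \<noteq> 0 \<and> q *v z = 0" by blast
  qed
  finally show ?thesis by blast
qed

text \<open>\<open>w\<close> is the weight of the pair a, a' alone. By symmetry six of the nine
  products of basis vectors suffice.\<close>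

definition weights3 where
  "weights3 T a a' w b0 b1 b2 s0 s1 (s2 :: real) \<longleftrightarrow>
     (mform T a a' b0 b0 \<noteq> 0 \<longrightarrow> w + s0 + s0 \<le> 0) \<and> (mform T a a' b0 b1 \<noteq> 0 \<longrightarrow> w + s0 + s1 \<le> 0) \<and>
     (mform T a a' b0 b2 \<noteq> 0 \<longrightarrow> w + s0 + s2 \<le> 0) \<and> (mform T a a' b1 b1 \<noteq> 0 \<longrightarrow> w + s1 + s1 \<le> 0) \<and>
     (mform T a a' b1 b2 \<noteq> 0 \<longrightarrow> w + s1 + s2 \<le> 0) \<and> (mform T a a' b2 b2 \<noteq> 0 \<longrightarrow> w + s2 + s2 \<le> 0)"

text \<open>\<open>destab\<close> spelled out on basis vectors in place of matrix columns, with
  weights \<rho> and -\<rho> for a0 and a1.\<close>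

definition weights where
  "weights T a0 a1 \<rho> b0 b1 b2 s0 s1 s2 \<longleftrightarrow> indep2 a0 a1 \<and> indep3 b0 b1 b2 \<and>
     s0 + s1 + s2 = 0 \<and> (\<rho> \<noteq> 0 \<or> s0 \<noteq> 0 \<or> s1 \<noteq> 0 \<or> s2 \<noteq> 0) \<and>
     weights3 T a0 a0 (2 * \<rho>) b0 b1 b2 s0 s1 s2 \<and> weights3 T a0 a1 0 b0 b1 b2 s0 s1 s2 \<and>
     weights3 T a1 a1 (- 2 * \<rho>) b0 b1 b2 s0 s1 s2"

lemma weights3_swap:
  assumes T: "sym_tensor T"
  shows "weights3 T a a' w b0 b1 b2 s0 s1 s2 \<Longrightarrow> weights3 T a a' w b1 b0 b2 s1 s0 s2"
    and "weights3 T a a' w b0 b1 b2 s0 s1 s2 \<Longrightarrow> weights3 T a a' w b0 b2 b1 s0 s2 s1"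
  unfolding weights3_def
  using gform_commute(2)[OF T, of _ "($) a" "($) a'" "($) b0" "($) b1"] gform_commute(2)[OF T, of _ "($) a" "($) a'" "($) b2" "($) b1"]
  by (simp_all add: add_ac)

lemma weights_swap_b:
  assumes T: "sym_tensor T" and w: "weights T a0 a1 \<rho> b0 b1 b2 s0 s1 s2"
  shows "weights T a0 a1 \<rho> b1 b0 b2 s1 s0 s2" and "weights T a0 a1 \<rho> b0 b2 b1 s0 s2 s1"
proof -
  have e: "\<alpha> *s b1 + \<beta> *s b0 + \<gamma> *s b2 = \<beta> *s b0 + \<alpha> *s b1 + \<gamma> *s b2"
      "\<alpha> *s b0 + \<beta> *s b2 + \<gamma> *s b1 = \<alpha> *s b0 + \<gamma> *s b1 + \<beta> *s b2" for \<alpha> \<beta> \<gamma>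
    by (simp_all add: add_ac)
  have i: "indep2 a0 a1" "indep3 b0 b1 b2" and s: "s0 + s1 + s2 = 0" "\<rho> \<noteq> 0 \<or> s0 \<noteq> 0 \<or> s1 \<noteq> 0 \<or> s2 \<noteq> 0"
    and w3: "weights3 T a0 a0 (2 * \<rho>) b0 b1 b2 s0 s1 s2" "weights3 T a0 a1 0 b0 b1 b2 s0 s1 s2"
      "weights3 T a1 a1 (- 2 * \<rho>) b0 b1 b2 s0 s1 s2"
    using w unfolding weights_def by blast+
  have "indep3 b1 b0 b2" unfolding indep3_def e(1) using i(2) unfolding indep3_def by blast
  moreover have "s1 + s0 + s2 = 0" "\<rho> \<noteq> 0 \<or> s1 \<noteq> 0 \<or> s0 \<noteq> 0 \<or> s2 \<noteq> 0" using s by (linarith, blast)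
  ultimately show "weights T a0 a1 \<rho> b1 b0 b2 s1 s0 s2"
    unfolding weights_def using i w3[THEN weights3_swap(1)[OF T]] by (intro conjI)
  have "indep3 b0 b2 b1" unfolding indep3_def e(2) using i(2) unfolding indep3_def by blast
  moreover have "s0 + s2 + s1 = 0" "\<rho> \<noteq> 0 \<or> s0 \<noteq> 0 \<or> s2 \<noteq> 0 \<or> s1 \<noteq> 0" using s by (linarith, blast)
  ultimately show "weights T a0 a1 \<rho> b0 b2 b1 s0 s2 s1"
    unfolding weights_def using i w3[THEN weights3_swap(2)[OF T]] by (intro conjI)
qed

lemma weights_swap_a:
  assumes T: "sym_tensor T" and w: "weights T a0 a1 \<rho> b0 b1 b2 s0 s1 s2"
  shows "weights T a1 a0 (- \<rho>) b0 b1 b2 s0 s1 s2"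
proof -
  have e: "\<alpha> *s a1 + \<beta> *s a0 = \<beta> *s a0 + \<alpha> *s a1" for \<alpha> \<beta> by (rule add.commute)
  have i: "indep2 a0 a1" "indep3 b0 b1 b2" and s: "s0 + s1 + s2 = 0" "\<rho> \<noteq> 0 \<or> s0 \<noteq> 0 \<or> s1 \<noteq> 0 \<or> s2 \<noteq> 0"
    and w3: "weights3 T a0 a0 (2 * \<rho>) b0 b1 b2 s0 s1 s2" "weights3 T a0 a1 0 b0 b1 b2 s0 s1 s2"
      "weights3 T a1 a1 (- 2 * \<rho>) b0 b1 b2 s0 s1 s2"
    using w unfolding weights_def by blast+
  have "indep2 a1 a0" unfolding indep2_def e using i(1) unfolding indep2_def by blast
  moreover have "weights3 T a1 a0 0 b0 b1 b2 s0 s1 s2"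
    using w3(2) unfolding weights3_def gform_commute(1)[OF T, of _ "($) a1" "($) a0"] .
  moreover have "- \<rho> \<noteq> 0 \<or> s0 \<noteq> 0 \<or> s1 \<noteq> 0 \<or> s2 \<noteq> 0" using s(2) by simp
  moreover have "2 * - \<rho> = - 2 * \<rho>" "- 2 * - \<rho> = 2 * \<rho>" by simp_all
  ultimately show ?thesis unfolding weights_def using i s(1) w3 by metis
qed

lemma weights_imp_destab:
  assumes T: "sym_tensor T" and w: "weights T a0 a1 \<rho> b0 b1 b2 s0 s1 s2"
  shows "destab T"
proof -
  define p :: "complex ^ 2 ^ 2" where "p = (\<chi> i j. if j = 1 then a0 $ i else a1 $ i)"
  define q :: "complex ^ 3 ^ 3" where "q = (\<chi> i j. if j = 1 then b0 $ i else if j = 2 then b1 $ i else b2 $ i)"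
  define r :: "2 \<Rightarrow> real" where "r i = (if i = 1 then \<rho> else - \<rho>)" for i
  define s :: "3 \<Rightarrow> real" where "s j = (if j = 1 then s0 else if j = 2 then s1 else s2)" for j
  have col: "column 1 p = a0" "column 2 p = a1" "column 1 q = b0" "column 2 q = b1" "column 3 q = b2"
    by (simp_all add: p_def q_def column_def vec_eq_iff)
  have rs: "r 1 = \<rho>" "r 2 = - \<rho>" "s 1 = s0" "s 2 = s1" "s 3 = s2" by (simp_all add: r_def s_def)
  have det: "det p \<noteq> 0" "det q \<noteq> 0" using w unfolding weights_def det_indep2 det_indep3 col by blast+
  have sum0: "sum r UNIV = 0" "sum s UNIV = 0" using w by (simp_all add: sum_2 sum_3 rs weights_def)
  have nz: "(\<exists>i. r i \<noteq> 0) \<or> (\<exists>j. s j \<noteq> 0)" using w rs unfolding weights_def by metis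
  have w3: "weights3 T a0 a0 (2 * \<rho>) b0 b1 b2 s0 s1 s2" "weights3 T a0 a1 0 b0 b1 b2 s0 s1 s2"
      "weights3 T a1 a1 (- 2 * \<rho>) b0 b1 b2 s0 s1 s2"
    using w unfolding weights_def by blast+
  have sc: "mform T a1 a0 y y' = mform T a0 a1 y y'" for y y' by (rule gform_commute(1)[OF T])
  have sc': "mform T x x' b1 b0 = mform T x x' b0 b1" "mform T x x' b2 b0 = mform T x x' b0 b2" "mform T x x' b2 b1 = mform T x x' b1 b2" for x x'
    by (rule gform_commute(2)[OF T])+
  have "\<forall>i i' j j'. tact T p q $ i $ i' $ j $ j' \<noteq> 0 \<longrightarrow> r i + r i' + s j + s j' \<le> 0"
    unfolding tact_def vec_lambda_beta forall_2 forall_3 col rs sc sc'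
    using w3 unfolding weights3_def by (simp add: algebra_simps)
  then show ?thesis unfolding destab_def using det sum0 nz by blast
qed

text \<open>Exchanging basis vectors permutes the weights, so they can be sorted.\<close>

lemma destab_imp_weights:
  assumes T: "sym_tensor T" and "destab T"
  shows "\<exists>a0 a1 \<rho> b0 b1 b2 s0 s1 s2. weights T a0 a1 \<rho> b0 b1 b2 s0 s1 s2 \<and> \<rho> \<ge> 0 \<and> s0 \<ge> s1 \<and> s1 \<ge> s2"
proof -
  obtain p q and r :: "2 \<Rightarrow> real" and s :: "3 \<Rightarrow> real" where det: "det p \<noteq> 0" "det q \<noteq> 0"
    and sum0: "sum r UNIV = 0" "sum s UNIV = 0" and nz: "(\<exists>i. r i \<noteq> 0) \<or> (\<exists>j. s j \<noteq> 0)"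
    and le: "\<And>i i' j j'. tact T p q $ i $ i' $ j $ j' \<noteq> 0 \<Longrightarrow> r i + r i' + s j + s j' \<le> 0"
    using assms(2) unfolding destab_def by blast
  have r2: "r 2 = - r 1" using sum0(1) by (simp add: sum_2 add_eq_0_iff)
  have "weights T (column 1 p) (column 2 p) (r 1) (column 1 q) (column 2 q) (column 3 q) (s 1) (s 2) (s 3)"
    unfolding weights_def
  proof (intro conjI)
    show "indep2 (column 1 p) (column 2 p)" "indep3 (column 1 q) (column 2 q) (column 3 q)"
      using det det_indep2 det_indep3 by blast+
    show "s 1 + s 2 + s 3 = 0" using sum0(2) by (simp add: sum_3)
    show "r 1 \<noteq> 0 \<or> s 1 \<noteq> 0 \<or> s 2 \<noteq> 0 \<or> s 3 \<noteq> 0"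
      using nz unfolding not_all[symmetric] forall_2 forall_3 by (auto simp: r2)
    have w: "weights3 T (column i p) (column i' p) (r i + r i') (column 1 q) (column 2 q) (column 3 q) (s 1) (s 2) (s 3)" for i i'
      unfolding weights3_def using le[of i i'] unfolding tact_def vec_lambda_beta by blast
    show "weights3 T (column 1 p) (column 1 p) (2 * r 1) (column 1 q) (column 2 q) (column 3 q) (s 1) (s 2) (s 3)"
      using w[of 1 1] by simp
    show "weights3 T (column 1 p) (column 2 p) 0 (column 1 q) (column 2 q) (column 3 q) (s 1) (s 2) (s 3)"
      using w[of 1 2] by (simp add: r2)
    show "weights3 T (column 2 p) (column 2 p) (- 2 * r 1) (column 1 q) (column 2 q) (column 3 q) (s 1) (s 2) (s 3)"
      using w[of 2 2] by (simp add: r2)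
  qed
  then obtain a0 a1 \<rho> b0 b1 b2 s0 s1 s2 where w: "weights T a0 a1 \<rho> b0 b1 b2 s0 s1 s2" and "\<rho> \<ge> 0"
    using weights_swap_a[OF T] by (metis neg_0_le_iff_le linear)
  note sw = weights_swap_b[OF T]
  consider "s0 \<ge> s1 \<and> s1 \<ge> s2" | "s0 \<ge> s2 \<and> s2 \<ge> s1" | "s1 \<ge> s0 \<and> s0 \<ge> s2" | "s1 \<ge> s2 \<and> s2 \<ge> s0" | "s2 \<ge> s0 \<and> s0 \<ge> s1" | "s2 \<ge> s1 \<and> s1 \<ge> s0"
    by linarith
  then show ?thesis
    using w sw(2)[OF w] sw(1)[OF w] sw(2)[OF sw(1)[OF w]] sw(1)[OF sw(2)[OF w]] sw(1)[OF sw(2)[OF sw(1)[OF w]]] \<open>\<rho> \<ge> 0\<close>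
    by cases blast+
qed

section \<open>From weights to geometry\<close>

lemma contrI:
  assumes T: "sym_tensor T" and i: "indep2 a0 a1"
    and "mform T a0 a0 b c = 0" "mform T a0 a1 b c = 0" "mform T a1 a1 b c = 0"
  shows "mform T x x b c = 0"
proof -
  obtain \<alpha> \<beta> where x: "x = \<alpha> *s a0 + \<beta> *s a1" using indep2_span[OF i] by blast
  show ?thesis unfolding x mform_add mform_scale gform_commute(1)[OF T, of _ "($) a1" "($) a0"] assms(3-5) by simp
qed

lemma zero_on_basis3:
  assumes i: "indep3 b0 b1 b2" and "mform T a a' b b0 = 0" "mform T a a' b b1 = 0" "mform T a a' b b2 = 0"
  shows "mform T a a' b y = 0"
proof -
  obtain \<alpha> \<beta> \<gamma> where y: "y = \<alpha> *s b0 + \<beta> *s b1 + \<gamma> *s b2" using indep3_span[OF i] by blast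
  show ?thesis unfolding y mform_add mform_scale assms(2-4) by simp
qed

lemma form_zero_on_basis3:
  assumes T: "sym_tensor T" and i: "indep3 b0 b1 b2" and z: "mform T a a' b0 b0 = 0" "mform T a a' b0 b1 = 0"
    "mform T a a' b0 b2 = 0" "mform T a a' b1 b1 = 0" "mform T a a' b1 b2 = 0" "mform T a a' b2 b2 = 0"
  shows "mform T a a' y y' = 0"
proof -
  have sy: "mform T a a' b1 b0 = mform T a a' b0 b1" "mform T a a' b2 b0 = mform T a a' b0 b2" "mform T a a' b2 b1 = mform T a a' b1 b2"
    by (rule gform_commute(2)[OF T])+
  obtain \<alpha> \<beta> \<gamma> where y: "y = \<alpha> *s b0 + \<beta> *s b1 + \<gamma> *s b2" using indep3_span[OF i] by blast
  obtain \<alpha>' \<beta>' \<gamma>' where y': "y' = \<alpha>' *s b0 + \<beta>' *s b1 + \<gamma>' *s b2" using indep3_span[OF i] by blast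
  show ?thesis unfolding y y' mform_add mform_scale sy z by simp
qed

lemma not_Euler:
  assumes "indep2 a0 a1" "indep3 b0 b1 b2" and "x1 \<noteq> 0 \<or> y1 \<noteq> 0"
  shows "\<not> (\<exists>\<alpha> \<beta>. x1 *s a1 = \<alpha> *s a0 \<and> y1 *s b1 = \<beta> *s b0)"
proof
  assume "\<exists>\<alpha> \<beta>. x1 *s a1 = \<alpha> *s a0 \<and> y1 *s b1 = \<beta> *s b0"
  then obtain \<alpha> \<beta> where "x1 *s a1 = \<alpha> *s a0" "y1 *s b1 = \<beta> *s b0" by blast
  then have "(- \<alpha>) *s a0 + x1 *s a1 = 0" "(- \<beta>) *s b0 + y1 *s b1 + 0 *s b2 = 0" by (simp_all add: vec_eq_iff)
  then have "x1 = 0" "y1 = 0" using assms(1,2) unfolding indep2_def indep3_def by blast+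
  then show False using assms(3) by blast
qed

lemma weights3D:
  assumes "weights3 T a a' w b0 b1 b2 s0 s1 s2"
  shows "w + s0 + s0 > 0 \<Longrightarrow> mform T a a' b0 b0 = 0" "w + s0 + s1 > 0 \<Longrightarrow> mform T a a' b0 b1 = 0"
    "w + s0 + s2 > 0 \<Longrightarrow> mform T a a' b0 b2 = 0" "w + s1 + s1 > 0 \<Longrightarrow> mform T a a' b1 b1 = 0"
    "w + s1 + s2 > 0 \<Longrightarrow> mform T a a' b1 b2 = 0" "w + s2 + s2 > 0 \<Longrightarrow> mform T a a' b2 b2 = 0"
  using assms unfolding weights3_def by (meson not_le)+

text \<open>Coefficients of positive weight vanish, and s0 > 0 > s2, since otherwise the conic over
  a0 would be zero. The split is by the weight 2 s0 - 2 \<rho> of a1 a1 b0 b0. If it is positive,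
  all conics pass through b0. If not, \<rho> is so large that over a0 only the coefficient of b2 b2
  survives, and the conic there is a double line.\<close>

lemma weights_cases:
  assumes T: "sym_tensor T" and w: "weights T a0 a1 \<rho> b0 b1 b2 s0 s1 s2" and "\<rho> \<ge> 0" "s0 \<ge> s1" "s1 \<ge> s2"
    and nz: "\<not> (\<forall>y y'. mform T a0 a0 y y' = 0)"
  shows "contr T b0 \<and> (\<forall>x. mform T x x b0 b1 = 0) \<or>
    contr T b0 \<and> singt T a0 b0 \<and> degent T a0 b0 \<or>
    singt T a0 b0 \<and> degent T a0 b0 \<and> \<not> p1_fibre_reduced (poly_of T) (vec.span {a0})"
proof -
  have i2: "indep2 a0 a1" and i3: "indep3 b0 b1 b2" and s: "s0 + s1 + s2 = 0"
    and nz0: "\<rho> \<noteq> 0 \<or> s0 \<noteq> 0 \<or> s1 \<noteq> 0 \<or> s2 \<noteq> 0" using w unfolding weights_def by blast+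
  have w3: "weights3 T a0 a0 (2 * \<rho>) b0 b1 b2 s0 s1 s2" "weights3 T a0 a1 0 b0 b1 b2 s0 s1 s2"
      "weights3 T a1 a1 (- 2 * \<rho>) b0 b1 b2 s0 s1 s2"
    using w unfolding weights_def by blast+
  have A: "2 * \<rho> + s0 + s0 > 0 \<Longrightarrow> mform T a0 a0 b0 b0 = 0" "2 * \<rho> + s0 + s1 > 0 \<Longrightarrow> mform T a0 a0 b0 b1 = 0"
    "2 * \<rho> + s0 + s2 > 0 \<Longrightarrow> mform T a0 a0 b0 b2 = 0" "2 * \<rho> + s1 + s1 > 0 \<Longrightarrow> mform T a0 a0 b1 b1 = 0"
    "2 * \<rho> + s1 + s2 > 0 \<Longrightarrow> mform T a0 a0 b1 b2 = 0" "2 * \<rho> + s2 + s2 > 0 \<Longrightarrow> mform T a0 a0 b2 b2 = 0"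
    and B: "s0 + s0 > 0 \<Longrightarrow> mform T a0 a1 b0 b0 = 0" "s0 + s1 > 0 \<Longrightarrow> mform T a0 a1 b0 b1 = 0" "s0 + s2 > 0 \<Longrightarrow> mform T a0 a1 b0 b2 = 0"
    and C: "- 2 * \<rho> + s0 + s0 > 0 \<Longrightarrow> mform T a1 a1 b0 b0 = 0" "- 2 * \<rho> + s0 + s1 > 0 \<Longrightarrow> mform T a1 a1 b0 b1 = 0"
    using w3[THEN weights3D(1)] w3[THEN weights3D(2)] w3[THEN weights3D(3)] w3(1)[THEN weights3D(4)] w3(1)[THEN weights3D(5)]
      w3(1)[THEN weights3D(6)] by simp_all
  have sy: "mform T x x' b1 b0 = mform T x x' b0 b1" "mform T x x' b2 b0 = mform T x x' b0 b2" "mform T x x' b2 b1 = mform T x x' b1 b2" for x x'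
    by (rule gform_commute(2)[OF T])+
  have Az: "mform T a0 a0 b2 b2 \<noteq> 0" if "mform T a0 a0 b0 b0 = 0" "mform T a0 a0 b0 b1 = 0" "mform T a0 a0 b0 b2 = 0"
    "mform T a0 a0 b1 b1 = 0" "mform T a0 a0 b1 b2 = 0"
  proof
    assume 22: "mform T a0 a0 b2 b2 = 0"
    have "mform T a0 a0 y y' = 0" for y y' by (rule form_zero_on_basis3[OF T i3 that 22])
    then show False using nz by blast
  qed
  have s0pos: "s0 > 0"
  proof (rule ccontr)
    assume "\<not> s0 > 0"
    then have "s0 = 0" "s1 = 0" "s2 = 0" using s \<open>s0 \<ge> s1\<close> \<open>s1 \<ge> s2\<close> by linarith+
    then have "\<rho> > 0" using nz0 \<open>\<rho> \<ge> 0\<close> by simp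
    then show False using A Az \<open>s0 = 0\<close> \<open>s1 = 0\<close> \<open>s2 = 0\<close> by simp
  qed
  have s2neg: "s2 < 0" using s s0pos \<open>s0 \<ge> s1\<close> \<open>s1 \<ge> s2\<close> by linarith
  have AB: "mform T a0 a0 b0 b0 = 0" "mform T a0 a0 b0 b1 = 0" "mform T a0 a1 b0 b0 = 0" "mform T a0 a1 b0 b1 = 0"
    using A(1,2) B(1,2) s s0pos s2neg \<open>\<rho> \<ge> 0\<close> by simp_all
  show ?thesis
  proof (cases "\<rho> = 0 \<or> s0 > \<rho>")
    case True
    then have C00: "mform T a1 a1 b0 b0 = 0" using C(1) s0pos by auto
    have c: "contr T b0" unfolding contr_def using contrI[OF T i2 AB(1,3) C00] by blast
    show ?thesis
    proof (cases "mform T a1 a1 b0 b1 = 0")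
      case True
      then show ?thesis using c contrI[OF T i2 AB(2,4) True] by blast
    next
      case False
      \<comment> \<open>The coefficient of a1 a1 b0 b1 is nonzero, so its weight s0 + s1 - 2 \<rho>,
        which is - s2 - 2 \<rho>, is not positive.\<close>
      then have "- s2 \<le> 2 * \<rho>" using C(2) s by linarith
      then have rs: "\<rho> > 0" "s0 > \<rho>" using True s2neg \<open>\<rho> \<ge> 0\<close> by auto
      then have A02: "mform T a0 a0 b0 b2 = 0" using A(3) s \<open>- s2 \<le> 2 * \<rho>\<close> s0pos by linarith
      have A0: "mform T a0 a0 b0 y = 0" for y by (rule zero_on_basis3[OF i3 AB(1,2) A02])
      have sing: "singt T a0 b0" unfolding singt_def using A0 c mform_x_polar[OF T] unfolding contr_def by blast
      \<comment> \<open>A kernel vector of the Hessian in the directions a1 and b1. If the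
        coefficient of a0 a1 b0 b2 vanishes, a1 alone will do. Otherwise s1 is nonnegative, the
        coefficient of b1 b1 vanishes, and one equation in two unknowns is left.\<close>
      have "\<exists>x1 y1. (x1 \<noteq> 0 \<or> y1 \<noteq> 0) \<and> y1 * mform T a0 a0 b1 b1 = 0 \<and> 2 * x1 * mform T a0 a1 b0 b2 + y1 * mform T a0 a0 b1 b2 = 0"
      proof (cases "mform T a0 a1 b0 b2 = 0")
        case True
        then show ?thesis by (intro exI[of _ 1] exI[of _ 0]) simp
      next
        case False
        then have "s0 + s2 \<le> 0" using B(3) by linarith
        then have "mform T a0 a0 b1 b1 = 0" using A(4) s rs by linarith
        then show ?thesis using False by (intro exI[of _ "mform T a0 a0 b1 b2"] exI[of _ "- 2 * mform T a0 a1 b0 b2"]) simp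
      qed
      then obtain x1 y1 where xy: "x1 \<noteq> 0 \<or> y1 \<noteq> 0" "y1 * mform T a0 a0 b1 b1 = 0"
        "2 * x1 * mform T a0 a1 b0 b2 + y1 * mform T a0 a0 b1 b2 = 0" by blast
      have "degent T a0 b0"
        unfolding degent_def
      proof (intro exI conjI allI)
        show "\<not> (\<exists>\<alpha> \<beta>. x1 *s a1 = \<alpha> *s a0 \<and> y1 *s b1 = \<beta> *s b0)" by (rule not_Euler[OF i2 i3 xy(1)])
        fix x'
        obtain \<alpha> \<beta> where x': "x' = \<alpha> *s a0 + \<beta> *s a1" using indep2_span[OF i2] by blast
        have "mform T (x1 *s a1) x' b0 b0 = 0" using mform_x_polar[OF T] c unfolding contr_def by blast
        moreover have "mform T a0 x' b0 (y1 *s b1) = 0" unfolding x' mform_add mform_scale AB by simp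
        ultimately show "mform T (x1 *s a1) x' b0 b0 + 2 * mform T a0 x' b0 (y1 *s b1) = 0" by simp
      next
        fix y'
        obtain \<alpha> \<beta> \<gamma> where y': "y' = \<alpha> *s b0 + \<beta> *s b1 + \<gamma> *s b2" using indep3_span[OF i3] by blast
        have "2 * mform T a0 (x1 *s a1) b0 y' + mform T a0 a0 (y1 *s b1) y' =
          \<beta> * (y1 * mform T a0 a0 b1 b1) + \<gamma> * (2 * x1 * mform T a0 a1 b0 b2 + y1 * mform T a0 a0 b1 b2)"
          unfolding y' mform_add mform_scale sy AB by (simp add: algebra_simps)
        then show "2 * mform T a0 (x1 *s a1) b0 y' + mform T a0 a0 (y1 *s b1) y' = 0" unfolding xy by simp
      qed
      then show ?thesis using c sing by blast
    qed
  next
    case False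
    then have rs: "\<rho> > 0" "s0 \<le> \<rho>" using \<open>\<rho> \<ge> 0\<close> by auto
    \<comment> \<open>The order and the zero sum give s1 at least -s0/2 and s2 at least -2 s0; as
      \<rho> is at least s0, all three weights are positive.\<close>
    have A': "mform T a0 a0 b0 b2 = 0" "mform T a0 a0 b1 b1 = 0" "mform T a0 a0 b1 b2 = 0"
      using A(3,4,5) rs s s0pos \<open>s0 \<ge> s1\<close> \<open>s1 \<ge> s2\<close> by linarith+
    have A0: "mform T a0 a0 b0 y = 0" for y by (rule zero_on_basis3[OF i3 AB(1,2) A'(1)])
    have A1: "mform T a0 a0 b1 y = 0" for y by (rule zero_on_basis3[OF i3 _ A'(2,3)]) (simp only: sy AB)
    have Bx: "mform T a0 x b0 b0 = 0" "mform T a0 x b0 b1 = 0" for x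
    proof -
      obtain \<alpha> \<beta> where x: "x = \<alpha> *s a0 + \<beta> *s a1" using indep2_span[OF i2] by blast
      show "mform T a0 x b0 b0 = 0" "mform T a0 x b0 b1 = 0" unfolding x mform_add mform_scale AB by simp_all
    qed
    have sing: "singt T a0 b0" unfolding singt_def using A0 Bx by blast
    \<comment> \<open>The direction b1 lies in the radical of the conic over a0 and has no mixed
      term with b0, so it is a kernel vector of the Hessian.\<close>
    have "degent T a0 b0"
      unfolding degent_def
    proof (intro exI conjI allI)
      show "\<not> (\<exists>\<alpha> \<beta>. 0 *s a1 = \<alpha> *s a0 \<and> 1 *s b1 = \<beta> *s b0)" by (rule not_Euler[OF i2 i3]) simp
      show "mform T (0 *s a1) x' b0 b0 + 2 * mform T a0 x' b0 (1 *s b1) = 0" for x' unfolding mform_scale Bx by simp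
      show "2 * mform T a0 (0 *s a1) b0 y' + mform T a0 a0 (1 *s b1) y' = 0" for y' unfolding mform_scale A1 by simp
    qed
    moreover have "\<not> p1_fibre_reduced (poly_of T) (vec.span {a0})"
    proof -
      obtain R :: "complex ^ 3 ^ 3" where R: "\<And>\<alpha> \<beta> \<gamma>. (R *v (\<alpha> *s b0 + \<beta> *s b1 + \<gamma> *s b2)) $ 3 = \<gamma>"
        "\<And>y. y = (R *v y) $ 1 *s b0 + (R *v y) $ 2 *s b1 + (R *v y) $ 3 *s b2"
        using dual3[OF i3] by metis
      show ?thesis
      proof (rule double_line_not_reduced[where l = "\<lambda>y. (R *v y) $ 3" and d = b2 and \<gamma> = "mform T a0 a0 b2 b2"])
        show "a0 \<noteq> 0" by (rule indep2_nz[OF i2])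
        show "(R *v (x + y)) $ 3 = (R *v x) $ 3 + (R *v y) $ 3" for x y by (simp add: matrix_vector_right_distrib)
        show "(R *v (c *s x)) $ 3 = c * (R *v x) $ 3" for c x by (simp add: matrix_vector_mult_def sum_distrib_left mult_ac)
        show "(R *v b2) $ 3 = 1" using R(1)[of 0 0 1] by simp
        show "mform T a0 a0 b2 b2 \<noteq> 0" using Az AB A' by blast
        fix y
        obtain \<alpha> \<beta> \<gamma> where y: "y = \<alpha> *s b0 + \<beta> *s b1 + \<gamma> *s b2" using indep3_span[OF i3] by blast
        have "mform T a0 a0 y y = mform T a0 a0 b2 b2 * \<gamma> * \<gamma>"
          unfolding y mform_add mform_scale sy AB A' by (simp add: algebra_simps)
        then show "mform T a0 a0 y y = mform T a0 a0 b2 b2 * (R *v y) $ 3 * (R *v y) $ 3" unfolding y R(1) .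
      qed
    qed
    ultimately show ?thesis using sing by blast
  qed
qed

text \<open>The alternative in property (i) becomes a single implication over the points b, vacuous
  when the second projection is finite.\<close>

definition section_condition :: "tensor \<Rightarrow> bool" where
  "section_condition T \<longleftrightarrow> (\<forall>b. b \<noteq> 0 \<longrightarrow> contr T b \<longrightarrow>
     (\<forall>a. a \<noteq> 0 \<longrightarrow> singt T a b \<longrightarrow> \<not> degent T a b) \<and>
     (\<exists>\<phi>. is_phi (poly_of T) (vec.span {b}) \<phi> \<and> \<not> (\<exists>N. \<forall>Q\<in>proj_space. \<phi> Q = N)))"

definition fibre_condition :: "tensor \<Rightarrow> bool" where
  "fibre_condition T \<longleftrightarrow> (\<forall>a b. a \<noteq> 0 \<longrightarrow> b \<noteq> 0 \<longrightarrow> singt T a b \<longrightarrow> degent T a b \<longrightarrow> p1_fibre_reduced (poly_of T) (vec.span {a}))"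

lemma indep3_nz: "indep3 b c d \<Longrightarrow> b \<noteq> 0"
proof
  assume i: "indep3 b c d" and "b = 0"
  then have "1 *s b + 0 *s c + 0 *s d = 0" by simp
  then show False using i unfolding indep3_def by (metis zero_neq_one)
qed

section \<open>Destabilising weights against the geometric properties\<close>

lemma destab_imp_violation:
  assumes T: "sym_tensor T" and nz: "\<And>a. a \<noteq> 0 \<Longrightarrow> \<not> (\<forall>y y'. mform T a a y y' = 0)" and "destab T"
  shows "\<not> (section_condition T \<and> fibre_condition T)"
proof
  assume c: "section_condition T \<and> fibre_condition T"
  obtain a0 a1 \<rho> b0 b1 b2 s0 s1 s2 where w: "weights T a0 a1 \<rho> b0 b1 b2 s0 s1 s2" and o: "\<rho> \<ge> 0" "s0 \<ge> s1" "s1 \<ge> s2"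
    using destab_imp_weights[OF T \<open>destab T\<close>] by blast
  have i: "indep2 a0 a1" "indep3 b0 b1 b2" using w unfolding weights_def by blast+
  have a0: "a0 \<noteq> 0" and b0: "b0 \<noteq> 0" using indep2_nz[OF i(1)] indep3_nz[OF i(2)] by blast+
  have b1: "b1 \<notin> vec.span {b0}" using indep3_not_in_span[OF i(2), of 1 0] by simp
  have phi: "\<exists>\<phi>. is_phi (poly_of T) (vec.span {b0}) \<phi> \<and> \<not> (\<exists>N. \<forall>Q\<in>proj_space. \<phi> Q = N)"
    and nd: "singt T a0 b0 \<Longrightarrow> \<not> degent T a0 b0" if "contr T b0"
    using c b0 a0 that unfolding section_condition_def by blast+
  consider "contr T b0" "\<And>x. mform T x x b0 b1 = 0" | "contr T b0" "singt T a0 b0" "degent T a0 b0"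
    | "singt T a0 b0" "degent T a0 b0" "\<not> p1_fibre_reduced (poly_of T) (vec.span {a0})"
    using weights_cases[OF T w o nz[OF a0]] by blast
  then show False
  proof cases
    case 1
    then show False using phi phi_constant[OF T b0 b1 1] by blast
  next
    case 2
    then show False using nd by blast
  next
    case 3
    then show False using c a0 b0 unfolding fibre_condition_def by blast
  qed
qed

text \<open>At a singular point the components of a kernel vector along a and b contribute nothing,
  so only three equations for the other coordinates remain.\<close>

lemma degent_coordinates:
  assumes T: "sym_tensor T" and i: "indep2 a a1" "indep3 b b1 b2" and s: "singt T a b" and d: "degent T a b"
  shows "\<exists>x1 y1 y2. (x1 \<noteq> 0 \<or> y1 \<noteq> 0 \<or> y2 \<noteq> 0) \<and>
    x1 * mform T a1 a1 b b + 2 * (y1 * mform T a a1 b b1 + y2 * mform T a a1 b b2) = 0 \<and>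
    2 * x1 * mform T a a1 b b1 + y1 * mform T a a b1 b1 + y2 * mform T a a b1 b2 = 0 \<and>
    2 * x1 * mform T a a1 b b2 + y1 * mform T a a b1 b2 + y2 * mform T a a b2 b2 = 0"
proof -
  obtain x y where xy: "\<not> (\<exists>\<alpha> \<beta>. x = \<alpha> *s a \<and> y = \<beta> *s b)"
    "\<And>x'. mform T x x' b b + 2 * mform T a x' b y = 0" "\<And>y'. 2 * mform T a x b y' + mform T a a y y' = 0"
    using d unfolding degent_def by blast
  obtain x0 x1 where x: "x = x0 *s a + x1 *s a1" using indep2_span[OF i(1)] by blast
  obtain y0 y1 y2 where y: "y = y0 *s b + y1 *s b1 + y2 *s b2" using indep3_span[OF i(2)] by blast
  have s': "mform T a z b b = 0" "mform T a a b z' = 0" for z z' using s unfolding singt_def by blast+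
  have sy: "mform T a a b2 b1 = mform T a a b1 b2" by (rule gform_commute(2)[OF T])
  show ?thesis
  proof (intro exI conjI)
    show "x1 \<noteq> 0 \<or> y1 \<noteq> 0 \<or> y2 \<noteq> 0"
    proof (rule ccontr)
      assume "\<not> (x1 \<noteq> 0 \<or> y1 \<noteq> 0 \<or> y2 \<noteq> 0)"
      then have "x = x0 *s a" "y = y0 *s b" using x y by simp_all
      then show False using xy(1) by blast
    qed
    show "x1 * mform T a1 a1 b b + 2 * (y1 * mform T a a1 b b1 + y2 * mform T a a1 b b2) = 0"
      using xy(2)[of a1] unfolding x y mform_add mform_scale s' by (simp add: algebra_simps)
    show "2 * x1 * mform T a a1 b b1 + y1 * mform T a a b1 b1 + y2 * mform T a a b1 b2 = 0"
      using xy(3)[of b1] unfolding x y mform_add mform_scale s' sy by (simp add: algebra_simps)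
    show "2 * x1 * mform T a a1 b b2 + y1 * mform T a a b1 b2 + y2 * mform T a a b2 b2 = 0"
      using xy(3)[of b2] unfolding x y mform_add mform_scale s' by (simp add: algebra_simps)
  qed
qed

text \<open>A non-reduced fibre is a double line: b1 can be taken in its radical, and over a only
  the coefficient of b2 b2 survives. The equations for the kernel vector then make the coefficient
  of a a1 b b1 vanish: directly if x1 is nonzero, and otherwise because y2 = 0 and y1 is
  nonzero.\<close>

lemma fibre_violation_imp_destab:
  assumes T: "sym_tensor T" and nz: "\<And>a. a \<noteq> 0 \<Longrightarrow> \<not> (\<forall>y y'. mform T a a y y' = 0)" and "\<not> fibre_condition T"
  shows "destab T"
proof -
  obtain a b where ab: "a \<noteq> 0" "b \<noteq> 0" "singt T a b" "degent T a b" "\<not> p1_fibre_reduced (poly_of T) (vec.span {a})"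
    using assms(3) unfolding fibre_condition_def by blast
  have s: "mform T a z b b = 0" "mform T a a b z' = 0" for z z' using ab(3) unfolding singt_def by blast+
  obtain b1 where b1: "\<And>y. mform T a a b1 y = 0" "b1 \<notin> vec.span {b}"
    using nonreduced_radical[OF T ab(2) s(2) nz[OF ab(1)] ab(5)] by blast
  obtain b2 where i3: "indep3 b b1 b2" using complement3'[OF ab(2) b1(2)] by blast
  obtain a1 where i2: "indep2 a a1" using complement2[OF ab(1)] by blast
  have A22: "mform T a a b2 b2 \<noteq> 0"
  proof
    assume "mform T a a b2 b2 = 0"
    then have "mform T a a y y' = 0" for y y' by (rule form_zero_on_basis3[OF T i3 s(2) s(2) s(2) b1(1) b1(1)])
    then show False using nz[OF ab(1)] by blast
  qed
  obtain x1 y1 y2 where xy: "x1 \<noteq> 0 \<or> y1 \<noteq> 0 \<or> y2 \<noteq> 0"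
    "x1 * mform T a1 a1 b b + 2 * (y1 * mform T a a1 b b1 + y2 * mform T a a1 b b2) = 0"
    "2 * x1 * mform T a a1 b b1 = 0" "2 * x1 * mform T a a1 b b2 + y2 * mform T a a b2 b2 = 0"
    using degent_coordinates[OF T i2 i3 ab(3,4)] unfolding b1 by auto
  have "mform T a a1 b b1 = 0"
  proof (cases "x1 = 0")
    case True
    then have "y2 = 0" using xy(4) A22 by simp
    then show ?thesis using xy(1,2) True by simp
  qed (use xy(3) in simp)
  \<comment> \<open>The monomials of positive weight are those over a a other than b2 b2, and over a
    a1 only b b and b b1.\<close>
  then have "weights T a a1 1 b b1 b2 1 0 (- 1)"
    unfolding weights_def weights3_def using i2 i3 by (simp add: s b1)
  then show ?thesis by (rule weights_imp_destab[OF T])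
qed

text \<open>Either T(x,x,b,b1) vanishes for all x and some further direction b1, so that the tangent
  direction is constant or undefined, or \<open>phi_exists\<close> supplies the map and the
  violation is a bad point of the section.\<close>

lemma section_violation_imp_destab:
  assumes T: "sym_tensor T" and "\<not> section_condition T"
  shows "destab T"
proof -
  obtain b where b: "b \<noteq> 0" "contr T b" and v: "(\<exists>\<phi>. is_phi (poly_of T) (vec.span {b}) \<phi> \<and> \<not> (\<exists>N. \<forall>Q\<in>proj_space. \<phi> Q = N)) \<Longrightarrow>
      \<exists>a. a \<noteq> 0 \<and> singt T a b \<and> degent T a b"
    using assms(2) unfolding section_condition_def by blast
  have cc: "mform T x x' b b = 0" for x x' using mform_x_polar[OF T] b(2) unfolding contr_def by blast
  show ?thesis
  proof (cases "\<exists>b1. b1 \<notin> vec.span {b} \<and> (\<forall>x. mform T x x b b1 = 0)")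
    case True
    then obtain b1 where b1: "b1 \<notin> vec.span {b}" "\<And>x. mform T x x b b1 = 0" by blast
    have c1: "mform T x x' b b1 = 0" for x x' using mform_x_polar[OF T b1(2)] .
    obtain b2 where i3: "indep3 b b1 b2" using complement3'[OF b(1) b1(1)] by blast
    obtain a1 where i2: "indep2 (axis 1 1) a1" using complement2[of "axis 1 1"] by (auto simp: axis_eq_0_iff)
    \<comment> \<open>Positive weight belongs to b b and b b1, whatever the x part; hence any basis
      of the first factor will do.\<close>
    have "weights T (axis 1 1) a1 0 b b1 b2 1 0 (- 1)"
      unfolding weights_def weights3_def using i2 i3 by (simp add: cc c1)
    then show ?thesis by (rule weights_imp_destab[OF T])
  next
    case False
    then have "\<exists>x. mform T x x b b1 \<noteq> 0" if "b1 \<notin> vec.span {b}" for b1 using that by blast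
    then obtain a where a: "a \<noteq> 0" "singt T a b" "degent T a b"
      using v[OF phi_exists[OF T b]] by blast
    have s: "mform T a a b z' = 0" for z' using a(2) unfolding singt_def by blast
    obtain a1 where i2: "indep2 a a1" using complement2[OF a(1)] by blast
    obtain c d where cd: "indep3 b c d" using complement3[OF b(1)] by blast
    \<comment> \<open>The linear form T(a,a1,b,y) in y has a nonzero zero on the plane spanned by c
      and d; this becomes b1.\<close>
    have "\<exists>k l. (k \<noteq> 0 \<or> l \<noteq> 0) \<and> k * mform T a a1 b c + l * mform T a a1 b d = 0"
    proof (cases "mform T a a1 b c = 0")
      case True
      then show ?thesis by (intro exI[of _ 1] exI[of _ 0]) simp
    next
      case False
      then show ?thesis by (intro exI[of _ "mform T a a1 b d"] exI[of _ "- mform T a a1 b c"]) simp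
    qed
    then obtain k l where kl: "k \<noteq> 0 \<or> l \<noteq> 0" "k * mform T a a1 b c + l * mform T a a1 b d = 0" by blast
    define b1 where "b1 = k *s c + l *s d"
    have b1: "b1 \<notin> vec.span {b}" unfolding b1_def by (rule indep3_not_in_span[OF cd kl(1)])
    have B01: "mform T a a1 b b1 = 0" unfolding b1_def mform_add mform_scale by (rule kl(2))
    obtain b2 where i3: "indep3 b b1 b2" using complement3'[OF b(1) b1] by blast
    obtain x1 y1 y2 where xy: "x1 \<noteq> 0 \<or> y1 \<noteq> 0 \<or> y2 \<noteq> 0" "y2 * mform T a a1 b b2 = 0"
      "y1 * mform T a a b1 b1 + y2 * mform T a a b1 b2 = 0"
      "2 * x1 * mform T a a1 b b2 + y1 * mform T a a b1 b2 + y2 * mform T a a b2 b2 = 0"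
      using degent_coordinates[OF T i2 i3 a(2,3)] unfolding B01 cc by auto
    show ?thesis
    proof (cases "mform T a a1 b b2 = 0")
      case True
      \<comment> \<open>Now T(a,a1,b,y) vanishes for all y, so b1 and b2 can share the weight
        -1.\<close>
      then have "weights T a a1 1 b b1 b2 2 (- 1) (- 1)"
        unfolding weights_def weights3_def using i2 i3 by (simp add: s cc B01)
      then show ?thesis by (rule weights_imp_destab[OF T])
    next
      case False
      then have "y2 = 0" using xy(2) by simp
      \<comment> \<open>With y2 = 0 and the coefficient of a a1 b b2 nonzero, y1 = 0 would force x1
        = 0 as well. So y1 is nonzero, and the second equation gives the claim.\<close>
      then have "mform T a a b1 b1 = 0" using xy False by auto
      then have "weights T a a1 1 b b1 b2 2 0 (- 2)"
        unfolding weights_def weights3_def using i2 i3 by (simp add: s cc B01)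
      then show ?thesis by (rule weights_imp_destab[OF T])
    qed
  qed
qed

section \<open>Irreducibility and translation back to the surface\<close>

lemma bilinear_poly: "\<exists>p :: xy_poly. \<forall>x y. eval2 p x y = mform T a a' y y"
proof -
  define p :: xy_poly where "p = (\<Sum>j\<in>UNIV. \<Sum>j'\<in>UNIV. Const (mform T a a' (axis j 1) (axis j' 1)) * (Var (Inr j) * Var (Inr j')))"
  have "eval2 p x y = mform T a a' y y" for x y
  proof -
    have y: "(\<Sum>j\<in>UNIV. y $ j *s axis j 1) = y" by (rule basis_expansion)
    have "mform T a a' y y = mform T a a' (\<Sum>j\<in>UNIV. y $ j *s axis j 1) (\<Sum>j\<in>UNIV. y $ j *s axis j 1)" by (simp only: y)
    also have "\<dots> = (\<Sum>j'\<in>UNIV. \<Sum>j\<in>UNIV. y $ j' * (y $ j * mform T a a' (axis j 1) (axis j' 1)))"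
      by (simp only: mform_sum mform_scale sum_distrib_left)
    also have "\<dots> = eval2 p x y"
      unfolding p_def eval2_sum eval2_simps by (rule trans[OF sum.swap]) (intro sum.cong refl, simp only: mult_ac)
    finally show ?thesis by simp
  qed
  then show ?thesis by blast
qed

text \<open>If the fibre form over \<open>a\<close> vanishes, then \<open>f\<close> is divisible by the linear form in \<open>x\<close> that
  vanishes at \<open>a\<close>.\<close>

lemma irreducible_imp_fibre_nonzero:
  assumes T: "sym_tensor T" and irr: "irreducible (poly_of T)" and a: "a \<noteq> 0"
  shows "\<not> (\<forall>y y'. mform T a a y y' = 0)"
proof
  assume z: "\<forall>y y'. mform T a a y y' = 0"
  obtain a1 where i: "indep2 a a1" using complement2[OF a] by blast
  obtain Q :: "complex ^ 2 ^ 2" where Q: "\<And>x. x = (Q *v x) $ 1 *s a + (Q *v x) $ 2 *s a1" using dual2[OF i] by blast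
  obtain B :: xy_poly where B: "\<And>x y. eval2 B x y = mform T a a1 y y" using bilinear_poly by blast
  obtain C :: xy_poly where C: "\<And>x y. eval2 C x y = mform T a1 a1 y y" using bilinear_poly by blast
  define L where "L k = (\<Sum>i\<in>UNIV. Const (Q $ k $ i) * Var (Inl i) :: xy_poly)" for k
  have L: "eval2 (L k) x y = (Q *v x) $ k" for k x y by (simp add: L_def eval2_sum matrix_vector_mult_def)
  define G where "G = Const 2 * L 1 * B + L 2 * C"
  have "poly_of T = L 2 * G"
  proof (rule eval2_inject)
    fix x y
    have "mform T x x y y = mform T ((Q *v x) $ 1 *s a + (Q *v x) $ 2 *s a1) ((Q *v x) $ 1 *s a + (Q *v x) $ 2 *s a1) y y"
      by (simp only: Q[symmetric])
    also have "\<dots> = eval2 (L 2 * G) x y"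
      unfolding mform_add mform_scale z[rule_format] gform_commute(1)[OF T, of _ "($) a1" "($) a"]
      by (simp add: G_def L B C algebra_simps)
    finally show "eval2 (poly_of T) x y = eval2 (L 2 * G) x y" by (simp add: eval2_poly_of)
  qed
  \<comment> \<open>Both factors vanish at the origin, so neither is a unit.\<close>
  then have "L 2 dvd 1 \<or> G dvd 1" using irr by (rule irreducibleD[rotated])
  then show False
  proof
    assume "L 2 dvd 1"
    then obtain r where "1 = L 2 * r" by (auto elim: dvdE)
    then have "eval2 1 0 0 = eval2 (L 2 * r) 0 0" by simp
    then show False by (simp add: L)
  next
    assume "G dvd 1"
    then obtain r where "1 = G * r" by (auto elim: dvdE)
    then have "eval2 1 0 0 = eval2 (G * r) 0 0" by simp
    then show False by (simp add: G_def L)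
  qed
qed

text \<open>A contracted section is determined on points by its image b under the second projection,
  and every b with \<open>contr\<close> yields one, so quantifying over sections is quantifying over
  b.\<close>

lemma section_condition_iff:
  assumes T: "sym_tensor T"
  shows "section_condition T \<longleftrightarrow> p2_finite (poly_of T) \<or>
       (\<exists>\<sigma> M. contracted_section (poly_of T) \<sigma> M) \<and>
       (\<forall>\<sigma> M. contracted_section (poly_of T) \<sigma> M \<longrightarrow>
          (\<forall>P \<in> \<sigma> ` proj_space. P \<in> sing_locus (poly_of T) \<longrightarrow> A_type 1 (poly_of T) P) \<and>
          (\<exists>\<phi>. is_phi (poly_of T) M \<phi> \<and> \<not> (\<exists>N. \<forall>Q\<in>proj_space. \<phi> Q = N)))"
    (is "_ \<longleftrightarrow> _ \<or> _ \<and> ?sec")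
proof -
  have sec: "contracted_section (poly_of T) (\<lambda>Q. (Q, vec.span {b})) (vec.span {b})" if "b \<noteq> 0" "contr T b" for b
    unfolding contracted_section_iff using that by blast
  have ex: "p2_finite (poly_of T) \<or> (\<exists>\<sigma> M. contracted_section (poly_of T) \<sigma> M)"
    unfolding p2_finite_iff using sec by blast
  have "?sec" if c: "section_condition T"
  proof (intro allI impI)
    fix \<sigma> M assume "contracted_section (poly_of T) \<sigma> M"
    then obtain b where b: "b \<noteq> 0" "M = vec.span {b}" "contr T b" "\<And>Q. Q \<in> proj_space \<Longrightarrow> \<sigma> Q = (Q, M)"
      unfolding contracted_section_iff by blast
    have "A_type 1 (poly_of T) P" if P: "P \<in> \<sigma> ` proj_space" "P \<in> sing_locus (poly_of T)" for P
    proof -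
      obtain a where a: "a \<noteq> 0" "P = (vec.span {a}, vec.span {b})" using P(1) b(2,4) by (auto simp: proj_space_def)
      have s: "singt T a b" using P(2) unfolding a(2) sing_locus_iff[OF T a(1) b(1)] .
      then have "\<not> degent T a b" using c a(1) b unfolding section_condition_def by blast
      then show ?thesis unfolding a(2) A1_iff[OF T a(1) b(1) s] .
    qed
    moreover have "\<exists>\<phi>. is_phi (poly_of T) M \<phi> \<and> \<not> (\<exists>N. \<forall>Q\<in>proj_space. \<phi> Q = N)"
      using c b(1,3) unfolding section_condition_def b(2) by blast
    ultimately show "(\<forall>P \<in> \<sigma> ` proj_space. P \<in> sing_locus (poly_of T) \<longrightarrow> A_type 1 (poly_of T) P) \<and>
          (\<exists>\<phi>. is_phi (poly_of T) M \<phi> \<and> \<not> (\<exists>N. \<forall>Q\<in>proj_space. \<phi> Q = N))" by blast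
  qed
  moreover have "section_condition T" if "p2_finite (poly_of T)"
    using that unfolding p2_finite_iff section_condition_def by blast
  moreover have "section_condition T" if s: "?sec"
    unfolding section_condition_def
  proof (intro allI impI conjI)
    fix b assume b: "b \<noteq> 0" "contr T b"
    have s': "(\<forall>P \<in> (\<lambda>Q. (Q, vec.span {b})) ` proj_space. P \<in> sing_locus (poly_of T) \<longrightarrow> A_type 1 (poly_of T) P) \<and>
          (\<exists>\<phi>. is_phi (poly_of T) (vec.span {b}) \<phi> \<and> \<not> (\<exists>N. \<forall>Q\<in>proj_space. \<phi> Q = N))"
      by (rule s[rule_format, OF sec[OF b]])
    then show "\<exists>\<phi>. is_phi (poly_of T) (vec.span {b}) \<phi> \<and> \<not> (\<exists>N. \<forall>Q\<in>proj_space. \<phi> Q = N)" by blast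
    fix a assume a: "a \<noteq> 0" "singt T a b"
    have "(vec.span {a}, vec.span {b}) \<in> (\<lambda>Q. (Q, vec.span {b})) ` proj_space" using span_in_proj_space[OF a(1)] by blast
    then have "A_type 1 (poly_of T) (vec.span {a}, vec.span {b})"
      using s' sing_locus_iff[OF T a(1) b(1)] a(2) by blast
    then show "\<not> degent T a b" unfolding A1_iff[OF T a(1) b(1) a(2)] .
  qed
  ultimately show ?thesis using ex by blast
qed

lemma fibre_condition_iff:
  assumes T: "sym_tensor T"
  shows "fibre_condition T \<longleftrightarrow>
    (\<forall>P. P \<in> sing_locus (poly_of T) \<and> \<not> A_type 1 (poly_of T) P \<longrightarrow> p1_fibre_reduced (poly_of T) (fst P))"
proof
  assume c: "fibre_condition T"
  show "\<forall>P. P \<in> sing_locus (poly_of T) \<and> \<not> A_type 1 (poly_of T) P \<longrightarrow> p1_fibre_reduced (poly_of T) (fst P)"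
  proof (intro allI impI)
    fix P assume P: "P \<in> sing_locus (poly_of T) \<and> \<not> A_type 1 (poly_of T) P"
    then have "P \<in> proj_space \<times> proj_space" unfolding sing_locus_def surface_def by blast
    then obtain a b where ab: "a \<noteq> 0" "b \<noteq> 0" "P = (vec.span {a}, vec.span {b})" by (auto simp: proj_space_def)
    then have s: "singt T a b" using P sing_locus_iff[OF T ab(1,2)] by blast
    then have "degent T a b" using P A1_iff[OF T ab(1,2) s] ab(3) by blast
    then show "p1_fibre_reduced (poly_of T) (fst P)" using c s ab unfolding fibre_condition_def by simp
  qed
next
  assume c: "\<forall>P. P \<in> sing_locus (poly_of T) \<and> \<not> A_type 1 (poly_of T) P \<longrightarrow> p1_fibre_reduced (poly_of T) (fst P)"
  show "fibre_condition T"
    unfolding fibre_condition_def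
  proof (intro allI impI)
    fix a b assume ab: "a \<noteq> 0" "b \<noteq> 0" "singt T a b" "degent T a b"
    then show "p1_fibre_reduced (poly_of T) (vec.span {a})"
      using c[rule_format, of "(vec.span {a}, vec.span {b})"] sing_locus_iff[OF T ab(1,2)] A1_iff[OF T ab(1,2,3)] by simp
  qed
qed

theorem theorem1p2:
  fixes f :: xy_poly
  assumes "f \<in> forms22" and "f \<noteq> 0" and "irreducible f" and "git_semistable f"
  shows "git_stable f \<longleftrightarrow>
    (p2_finite f \<or>
       (\<exists>\<sigma> M. contracted_section f \<sigma> M) \<and>
       (\<forall>\<sigma> M. contracted_section f \<sigma> M \<longrightarrow>
          (\<forall>P \<in> \<sigma> ` proj_space. P \<in> sing_locus f \<longrightarrow> A_type 1 f P) \<and>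
          (\<exists>\<phi>. is_phi f M \<phi> \<and> \<not> (\<exists>N. \<forall>Q\<in>proj_space. \<phi> Q = N)))) \<and>
    (\<forall>P. P \<in> sing_locus f \<and> \<not> A_type 1 f P \<longrightarrow> p1_fibre_reduced f (fst P))"
proof -
  obtain T where T: "sym_tensor T" and f: "f = poly_of T" using forms22_eq_poly_of[OF assms(1)] by blast
  have nz: "\<not> (\<forall>y y'. mform T a a y y' = 0)" if "a \<noteq> 0" for a
    using irreducible_imp_fibre_nonzero[OF T _ that] assms(3) unfolding f by blast
  have "destab T \<longleftrightarrow> \<not> (section_condition T \<and> fibre_condition T)"
    using destab_imp_violation[OF T nz] section_violation_imp_destab[OF T] fibre_violation_imp_destab[OF T nz] by blast
  then show ?thesis
    unfolding f hilbert_mumford[OF T] section_condition_iff[OF T, symmetric] fibre_condition_iff[OF T, symmetric] by blast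
qed

end
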